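(* Let $n$ be a positive integer and let $d$ be a balanced dimension vector of $\Gamma$ with $d_0=n$. Let $M$ be an $n$-dimensional representation of $A$ such that $F(M)$ has dimension vector $d$, that is, $d_{ij}=\dim_{\mathbb{K}}(E_{ij}M)/w_{ij}$ for all $i,j$. (1) The dimension vector $d$ is $\theta$-stable if and only if one of the following holds: (a) $d$ is the minimal nonzero integral vector on the ray spanned by some real extremal vector $\delta_u$; (b) $d$ is special isotropic and indivisible; (c) $d$ is not special isotropic and $$\sum_{i=1}^m\max\left(\frac{d_{i1}}{w_{i1}},\ldots,\frac{d_{ir_i}}{w_{ir_i}}\right)\le (m-1)n.$$ (2) If $M$ is simple, then $d$ is $\theta$-stable, hence satisfies one of the conditions (a), (b), (c) of (1). (3) If $d$ is $\theta$-stable, then the space $\mathcal{C}_d$ of $n$-dimensional representations $M$ of $A$ with $F(M)$ having dimension vector $d$ has a Zariski-dense and open subset of simple representations.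
   Context: Setup. $\mathbb{K}$ is an algebraically closed field, $m\ge 1$, and $A=A_1*\cdots*A_m$ is the free product (coproduct in associative unital $\mathbb{K}$-algebras) of finite dimensional semisimple $\mathbb{K}$-algebras $A_i$, none of which is one-dimensional. Write $A_i=A_{i1}\times\cdots\times A_{ir_i}$ with $A_{ij}=\mathrm{Mat}_{w_{ij}}(\mathbb{K})$; the integers $w_{ij}$ are called weights, and a weight is trivial if it equals $1$. Let $e_{ij}^{pq}\in A_{ij}$ be the matrix units ($1\le p,q\le w_{ij}$) and $E_{ij}$ the identity of $A_{ij}$. $\mathrm{rep}(A)$ is the category of finite dimensional left $A$-modules (representations of $A$). Quiver. $\Gamma=\Gamma_A$ has one sink $v_0$, a source $v_{ij}$ for each $1\le i\le m$, $1\le j\le r_i$, and $w_{ij}$ arrows $\alpha_{ij}^1,\dots,\alpha_{ij}^{w_{ij}}$ from $v_{ij}$ to $v_0$. The set $\{v_{i1},\dots,v_{ir_i}\}$ is the $i$-th cluster. A dimension vector is $d\in\mathbb{Z}_{\ge0}^{\Gamma_0}$, with entries $d_0=d_{v_0}$, $d_{ij}=d_{v_{ij}}$. It is balanced if $\sum_{j=1}^{r_i}w_{ij}d_{ij}=d_0$ for every $i$. Functor. $F:\mathrm{rep}(A)\to\mathrm{rep}(\Gamma)$ (finite dimensional representations of $\Gamma$) sends $M$ to the representation with $F(M)_0=M$ at $v_0$, $F(M)_{ij}=e_{ij}^{11}M$ at $v_{ij}$, and $F(M)(\alpha_{ij}^k):e_{ij}^{11}M\to M$ equal to left multiplication by $e_{ij}^{k1}$;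 on morphisms it is given by $f$ and its restrictions. A representation $X$ of $\Gamma$ is balanced if for each $i$ the map $\bigoplus_{j=1}^{r_i}\bigoplus_{k=1}^{w_{ij}}X(\alpha_{ij}^k):\bigoplus_{j}\bigoplus_{k}X_{ij}\to X_0$ is invertible. $F$ is an equivalence from $\mathrm{rep}(A)$ to the full subcategory $\mathcal{C}$ of balanced representations. $\mathrm{rep}(\Gamma,d)$ is the affine space $\bigoplus_{\alpha:u\to v}\mathrm{Mat}_{d_v\times d_u}(\mathbb{K})$ of representations of dimension vector $d$, and $\mathcal{C}_d=\mathcal{C}\cap\mathrm{rep}(\Gamma,d)$, a Zariski-open subset of it; via $F$, points of $\mathcal{C}_d$ are identified with the $A$-modules $M$ with $F(M)$ of dimension vector $d$. Stability. $\theta\in\mathbb{Z}^{\Gamma_0}$ has $\theta_0=-m$, $\theta_{ij}=w_{ij}$, and $\theta(d)=\sum_v\theta_vd_v$. A nonzero representation $X$ of $\Gamma$ is $\theta$-stable if $\theta(\dim X)=0$ and $\theta(\dim X')<0$ for every nonzero proper subrepresentation $X'$. A dimension vector is $\theta$-stable if it is the dimension vector of some $\theta$-stable representation. Extremal vectors. For $u=(u_1,\dots,u_m)$ with $1\le u_i\le r_i$, $\delta_u\in\mathbb{Q}_{\ge0}^{\Gamma_0}$ has $(\delta_u)_0=1$, $(\delta_u)_{iu_i}=1/w_{iu_i}$ and $(\delta_u)_{ij}=0$ for $j\ne u_i$. It is called real if at most one of the weights $w_{1u_1},\dots,w_{mu_m}$ is non-trivial. A balanced dimension vector $d$ with $d_0=n\ge2$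 is special isotropic if it has exactly $4$ entries $d_{ij}$ with $0<d_{ij}<n$, and these four entries are all equal to $n/2$ with trivial corresponding weights. A dimension vector is divisible if its entries share a non-trivial common factor, and indivisible otherwise. *)

theory Defs
  imports
    "Jordan_Normal_Form.VS_Connect"
    "Graph_Theory.Digraph"
    "HOL-Algebra.QuotRing"
    "HOL-Analysis.Abstract_Topology"
begin

text \<open>The ground field is a type \<open>'k\<close>, used as the HOL-Algebra field \<open>class_ring :: 'k ring\<close>.
  Vector spaces over it, and associative unital algebras over it, are both records of type
  \<open>('k, 'a) module\<close>; for mere vector spaces the fields \<open>mult\<close> and \<open>one\<close> carry no meaning.\<close>

section \<open>Finite products of algebras, free algebras and coproducts\<close>

definition prod_algebra :: "'i set \<Rightarrow> ('i \<Rightarrow> ('k, 'a) module) \<Rightarrow> ('k, 'i \<Rightarrow> 'a) module" where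
  "prod_algebra J B =
    \<lparr> carrier = (\<Pi>\<^sub>E j\<in>J. carrier (B j)),
      mult = (\<lambda>x y. \<lambda>j\<in>J. x j \<otimes>\<^bsub>B j\<^esub> y j),
      one = (\<lambda>j\<in>J. \<one>\<^bsub>B j\<^esub>),
      zero = (\<lambda>j\<in>J. \<zero>\<^bsub>B j\<^esub>),
      add = (\<lambda>x y. \<lambda>j\<in>J. x j \<oplus>\<^bsub>B j\<^esub> y j),
      smult = (\<lambda>c x. \<lambda>j\<in>J. c \<odot>\<^bsub>B j\<^esub> x j) \<rparr>"

text \<open>The free associative algebra on \<open>X\<close>: finitely supported functions on the words over \<open>X\<close>,
  multiplied by extending concatenation of words bilinearly.\<close>
definition free_algebra :: "'x set \<Rightarrow> ('k::field, 'x list \<Rightarrow> 'k) module" where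
  "free_algebra X =
    \<lparr> carrier = {f. finite {xs. f xs \<noteq> 0} \<and> {xs. f xs \<noteq> 0} \<subseteq> lists X},
      mult = (\<lambda>f g xs. \<Sum>k\<le>length xs. f (take k xs) * g (drop k xs)),
      one = (\<lambda>xs. if xs = [] then 1 else 0),
      zero = (\<lambda>xs. 0),
      add = (\<lambda>f g xs. f xs + g xs),
      smult = (\<lambda>c f xs. c * f xs) \<rparr>"

lemma sum_triangle: "(\<Sum>k\<le>n. \<Sum>l\<le>k. a l k) = (\<Sum>l\<le>n. \<Sum>k\<le>n-l. a l (l+k))" for a :: "nat \<Rightarrow> nat \<Rightarrow> 'b::comm_monoid_add"
proof -
  have "(\<Sum>k\<le>n. \<Sum>l\<le>k. a l k) = (\<Sum>(k,l)\<in>(SIGMA k:{..n}. {..k}). a l k)" by (simp add: sum.Sigma)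
  also have "\<dots> = (\<Sum>(l,k)\<in>(SIGMA l:{..n}. {..n-l}). a l (l+k))"
    by (rule sum.reindex_bij_witness[of _ "\<lambda>(l,k). (l+k,l)" "\<lambda>(k,l). (l,k-l)"]) auto
  also have "\<dots> = (\<Sum>l\<le>n. \<Sum>k\<le>n-l. a l (l+k))" by (simp add: sum.Sigma)
  finally show ?thesis .
qed

text \<open>In particular \<open>genideal (free_algebra X)\<close> gives the generated two-sided ideal.\<close>
lemma ring_free_algebra: "ring (free_algebra X :: ('k::field, 'x list \<Rightarrow> 'k) module)"
proof -
  let ?R = "free_algebra X :: ('k, 'x list \<Rightarrow> 'k) module"
  have supp: "finite {xs. f xs \<noteq> 0} \<and> {xs. f xs \<noteq> 0} \<subseteq> lists X \<longleftrightarrow> f \<in> carrier ?R" for f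
    by (simp add: free_algebra_def)
  have mc: "f \<otimes>\<^bsub>?R\<^esub> g \<in> carrier ?R" if f: "f \<in> carrier ?R" and g: "g \<in> carrier ?R" for f g
  proof -
    let ?h = "f \<otimes>\<^bsub>?R\<^esub> g" let ?S = "{u @ v | u v. f u \<noteq> 0 \<and> g v \<noteq> 0}"
    have fg: "finite {u. f u \<noteq> 0}" "finite {u. g u \<noteq> 0}" "{u. f u \<noteq> 0} \<subseteq> lists X" "{u. g u \<noteq> 0} \<subseteq> lists X"
      using f g by (simp_all add: free_algebra_def)
    have "{xs. ?h xs \<noteq> 0} \<subseteq> ?S"
    proof
      fix xs assume "xs \<in> {xs. ?h xs \<noteq> 0}"
      then have "(\<Sum>k\<le>length xs. f (take k xs) * g (drop k xs)) \<noteq> 0" by (simp add: free_algebra_def)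
      then obtain k where "f (take k xs) * g (drop k xs) \<noteq> 0"
        by (rule sum.not_neutral_contains_not_neutral)
      then have "xs = take k xs @ drop k xs \<and> f (take k xs) \<noteq> 0 \<and> g (drop k xs) \<noteq> 0" by simp
      then show "xs \<in> ?S" by blast
    qed
    moreover have "finite ?S" by (rule finite_image_set2[OF fg(1,2)])
    moreover have "?S \<subseteq> lists X"
    proof
      fix xs assume "xs \<in> ?S"
      then obtain u v where "xs = u @ v" "u \<in> lists X" "v \<in> lists X" using fg(3,4) by blast
      then show "xs \<in> lists X" by simp
    qed
    ultimately show ?thesis unfolding supp[symmetric] using finite_subset[of "{xs. ?h xs \<noteq> 0}" ?S] subset_trans[of "{xs. ?h xs \<noteq> 0}" ?S] by blast
  qed
  have ac: "f \<oplus>\<^bsub>?R\<^esub> g \<in> carrier ?R" if f: "f \<in> carrier ?R" and g: "g \<in> carrier ?R" for f g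
  proof -
    have "{xs. (f \<oplus>\<^bsub>?R\<^esub> g) xs \<noteq> 0} \<subseteq> {xs. f xs \<noteq> 0} \<union> {xs. g xs \<noteq> 0}" by (auto simp: free_algebra_def)
    then show ?thesis using f[folded supp] g[folded supp] supp[of "f \<oplus>\<^bsub>?R\<^esub> g"]
      by (metis (no_types, lifting) Un_least finite_Un finite_subset subset_trans)
  qed
  show ?thesis
  proof (rule ringI)
    show "abelian_group ?R"
    proof (rule abelian_groupI)
      fix f assume f: "f \<in> carrier ?R"
      show "\<exists>g\<in>carrier ?R. g \<oplus>\<^bsub>?R\<^esub> f = \<zero>\<^bsub>?R\<^esub>"
        by (rule bexI[of _ "\<lambda>xs. - f xs"]) (use f in \<open>auto simp: free_algebra_def\<close>)
    next
      show "\<zero>\<^bsub>?R\<^esub> \<in> carrier ?R" by (simp add: free_algebra_def)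
    qed (erule (1) ac | simp add: free_algebra_def add_ac)+
    show "Group.monoid ?R"
    proof (rule monoidI)
      show "\<one>\<^bsub>?R\<^esub> \<in> carrier ?R" by (auto simp: free_algebra_def)
      fix f g h assume f: "f \<in> carrier ?R"
      show "f \<otimes>\<^bsub>?R\<^esub> g \<otimes>\<^bsub>?R\<^esub> h = f \<otimes>\<^bsub>?R\<^esub> (g \<otimes>\<^bsub>?R\<^esub> h)"
      proof
        fix xs :: "'x list"
        have "(f \<otimes>\<^bsub>?R\<^esub> g \<otimes>\<^bsub>?R\<^esub> h) xs = (\<Sum>k\<le>length xs. \<Sum>l\<le>k. f (take l xs) * g (drop l (take k xs)) * h (drop k xs))"
          by (auto simp: free_algebra_def sum_distrib_right min_def intro!: sum.cong)
        also have "\<dots> = (\<Sum>l\<le>length xs. \<Sum>k\<le>length xs - l. f (take l xs) * g (drop l (take (l+k) xs)) * h (drop (l+k) xs))"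
          by (rule sum_triangle)
        also have "\<dots> = (f \<otimes>\<^bsub>?R\<^esub> (g \<otimes>\<^bsub>?R\<^esub> h)) xs"
          by (auto simp: free_algebra_def sum_distrib_left drop_take mult.assoc add.commute intro!: sum.cong)
        finally show "(f \<otimes>\<^bsub>?R\<^esub> g \<otimes>\<^bsub>?R\<^esub> h) xs = (f \<otimes>\<^bsub>?R\<^esub> (g \<otimes>\<^bsub>?R\<^esub> h)) xs" .
      qed
      show "\<one>\<^bsub>?R\<^esub> \<otimes>\<^bsub>?R\<^esub> f = f"
      proof
        fix xs :: "'x list"
        have "(\<one>\<^bsub>?R\<^esub> \<otimes>\<^bsub>?R\<^esub> f) xs = (\<Sum>k\<le>length xs. if k = 0 then f xs else 0)"
          unfolding free_algebra_def module.simps monoid.simps by (intro sum.cong) auto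
        then show "(\<one>\<^bsub>?R\<^esub> \<otimes>\<^bsub>?R\<^esub> f) xs = f xs" by simp
      qed
      show "f \<otimes>\<^bsub>?R\<^esub> \<one>\<^bsub>?R\<^esub> = f"
      proof
        fix xs :: "'x list"
        have "(f \<otimes>\<^bsub>?R\<^esub> \<one>\<^bsub>?R\<^esub>) xs = (\<Sum>k\<le>length xs. if k = length xs then f xs else 0)"
          unfolding free_algebra_def module.simps monoid.simps by (intro sum.cong) auto
        then show "(f \<otimes>\<^bsub>?R\<^esub> \<one>\<^bsub>?R\<^esub>) xs = f xs" by simp
      qed
    qed (rule mc)
  next
    fix f g h assume "f \<in> carrier ?R"
    show "(f \<oplus>\<^bsub>?R\<^esub> g) \<otimes>\<^bsub>?R\<^esub> h = f \<otimes>\<^bsub>?R\<^esub> h \<oplus>\<^bsub>?R\<^esub> g \<otimes>\<^bsub>?R\<^esub> h"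
      by (simp add: free_algebra_def distrib_right sum.distrib)
    show "h \<otimes>\<^bsub>?R\<^esub> (f \<oplus>\<^bsub>?R\<^esub> g) = h \<otimes>\<^bsub>?R\<^esub> f \<oplus>\<^bsub>?R\<^esub> h \<otimes>\<^bsub>?R\<^esub> g"
      by (simp add: free_algebra_def distrib_left sum.distrib)
  qed
qed
definition free_gen :: "'x \<Rightarrow> 'x list \<Rightarrow> 'k::field" where
  "free_gen x = (\<lambda>xs. if xs = [x] then 1 else 0)"

definition quotient_algebra :: "('k, 'a) module \<Rightarrow> 'a set \<Rightarrow> ('k, 'a set) module" where
  "quotient_algebra R J =
    \<lparr> carrier = carrier (R Quot J), mult = mult (R Quot J), one = one (R Quot J),
      zero = zero (R Quot J), add = add (R Quot J),
      smult = (\<lambda>c C. \<Union>x\<in>C. J +>\<^bsub>R\<^esub> (c \<odot>\<^bsub>R\<^esub> x)) \<rparr>"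

text \<open>The coproduct of a family of unital algebras \<open>B i\<close> (\<open>i \<in> I\<close>): the free algebra on the
  disjoint union of their carriers, modulo the relations that make each \<open>B i \<rightarrow> coproduct\<close> a
  unital algebra homomorphism.\<close>

definition coproduct_gens :: "'i set \<Rightarrow> ('i \<Rightarrow> ('k, 'a) module) \<Rightarrow> ('i \<times> 'a) set" where
  "coproduct_gens I B = (SIGMA i:I. carrier (B i))"

definition coproduct_rels ::
  "'i set \<Rightarrow> ('i \<Rightarrow> ('k::field, 'a) module) \<Rightarrow> (('i \<times> 'a) list \<Rightarrow> 'k) set" where
  "coproduct_rels I B = (let R = free_algebra (coproduct_gens I B) in
     {free_gen (i, a \<oplus>\<^bsub>B i\<^esub> b) \<ominus>\<^bsub>R\<^esub> (free_gen (i, a) \<oplus>\<^bsub>R\<^esub> free_gen (i, b)) | i a b.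
        i \<in> I \<and> a \<in> carrier (B i) \<and> b \<in> carrier (B i)} \<union>
     {free_gen (i, c \<odot>\<^bsub>B i\<^esub> a) \<ominus>\<^bsub>R\<^esub> (c \<odot>\<^bsub>R\<^esub> free_gen (i, a)) | i c a.
        i \<in> I \<and> a \<in> carrier (B i)} \<union>
     {free_gen (i, a \<otimes>\<^bsub>B i\<^esub> b) \<ominus>\<^bsub>R\<^esub> (free_gen (i, a) \<otimes>\<^bsub>R\<^esub> free_gen (i, b)) | i a b.
        i \<in> I \<and> a \<in> carrier (B i) \<and> b \<in> carrier (B i)} \<union>
     {free_gen (i, \<one>\<^bsub>B i\<^esub>) \<ominus>\<^bsub>R\<^esub> \<one>\<^bsub>R\<^esub> | i. i \<in> I})"

definition coproduct_ideal ::
  "'i set \<Rightarrow> ('i \<Rightarrow> ('k::field, 'a) module) \<Rightarrow> (('i \<times> 'a) list \<Rightarrow> 'k) set" where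
  "coproduct_ideal I B = genideal (free_algebra (coproduct_gens I B)) (coproduct_rels I B)"

definition coproduct_algebra ::
  "'i set \<Rightarrow> ('i \<Rightarrow> ('k::field, 'a) module) \<Rightarrow> ('k, (('i \<times> 'a) list \<Rightarrow> 'k) set) module" where
  "coproduct_algebra I B =
     quotient_algebra (free_algebra (coproduct_gens I B)) (coproduct_ideal I B)"

definition coproduct_inj ::
  "'i set \<Rightarrow> ('i \<Rightarrow> ('k::field, 'a) module) \<Rightarrow> 'i \<Rightarrow> 'a \<Rightarrow> (('i \<times> 'a) list \<Rightarrow> 'k) set" where
  "coproduct_inj I B i a =
     coproduct_ideal I B +>\<^bsub>free_algebra (coproduct_gens I B)\<^esub> free_gen (i, a)"


section \<open>Left modules over a (noncommutative) algebra\<close>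

text \<open>As the locale \<open>module\<close> of HOL-Algebra, but without commutativity of the ring.\<close>
locale left_module = R?: ring R + M?: abelian_group M
  for R :: "('a, 'm) ring_scheme" and M :: "('a, 'v, 'p) module_scheme" (structure) +
  assumes lsmult_closed: "\<lbrakk>a \<in> carrier R; x \<in> carrier M\<rbrakk> \<Longrightarrow> a \<odot>\<^bsub>M\<^esub> x \<in> carrier M"
    and lsmult_l_distr: "\<lbrakk>a \<in> carrier R; b \<in> carrier R; x \<in> carrier M\<rbrakk> \<Longrightarrow>
      (a \<oplus>\<^bsub>R\<^esub> b) \<odot>\<^bsub>M\<^esub> x = a \<odot>\<^bsub>M\<^esub> x \<oplus>\<^bsub>M\<^esub> b \<odot>\<^bsub>M\<^esub> x"
    and lsmult_r_distr: "\<lbrakk>a \<in> carrier R; x \<in> carrier M; y \<in> carrier M\<rbrakk> \<Longrightarrow>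
      a \<odot>\<^bsub>M\<^esub> (x \<oplus>\<^bsub>M\<^esub> y) = a \<odot>\<^bsub>M\<^esub> x \<oplus>\<^bsub>M\<^esub> a \<odot>\<^bsub>M\<^esub> y"
    and lsmult_assoc: "\<lbrakk>a \<in> carrier R; b \<in> carrier R; x \<in> carrier M\<rbrakk> \<Longrightarrow>
      (a \<otimes>\<^bsub>R\<^esub> b) \<odot>\<^bsub>M\<^esub> x = a \<odot>\<^bsub>M\<^esub> (b \<odot>\<^bsub>M\<^esub> x)"
    and lsmult_one: "x \<in> carrier M \<Longrightarrow> \<one>\<^bsub>R\<^esub> \<odot>\<^bsub>M\<^esub> x = x"

text \<open>The vector space underlying a left module over the algebra \<open>A\<close>: a scalar \<open>c\<close> acts as
  \<open>c \<cdot> 1\<close>.\<close>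
definition underlying_vs :: "('k, 'a) module \<Rightarrow> ('a, 'v) module \<Rightarrow> ('k, 'v) module" where
  "underlying_vs A M =
    \<lparr> carrier = carrier M, mult = mult M, one = one M, zero = zero M, add = add M,
      smult = (\<lambda>c x. (c \<odot>\<^bsub>A\<^esub> \<one>\<^bsub>A\<^esub>) \<odot>\<^bsub>M\<^esub> x) \<rparr>"

definition fd_left_module :: "('k::field, 'a) module \<Rightarrow> ('a, 'v) module \<Rightarrow> bool" where
  "fd_left_module A M \<longleftrightarrow>
     left_module A M \<and> vectorspace.fin_dim class_ring (underlying_vs A M)"

definition simple_left_module :: "('k, 'a) module \<Rightarrow> ('a, 'v) module \<Rightarrow> bool" where
  "simple_left_module A M \<longleftrightarrow>
     left_module A M \<and> carrier M \<noteq> {\<zero>\<^bsub>M\<^esub>} \<and>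
     (\<forall>N. Module.submodule N A M \<longrightarrow> N = {\<zero>\<^bsub>M\<^esub>} \<or> N = carrier M)"

definition image_space :: "('k, 'a) module \<Rightarrow> ('a, 'v) module \<Rightarrow> 'a \<Rightarrow> ('k, 'v) module" where
  "image_space A M a = (underlying_vs A M)\<lparr>carrier := (\<lambda>x. a \<odot>\<^bsub>M\<^esub> x) ` carrier M\<rparr>"


section \<open>Representations of quivers\<close>

text \<open>A quiver is a multidigraph, i.e. a \<open>pre_digraph\<close>.\<close>

record ('v, 'e, 'k, 'x) quiver_rep =
  vspace :: "'v \<Rightarrow> ('k, 'x) module"
  amap :: "'e \<Rightarrow> 'x \<Rightarrow> 'x"

definition fd_quiver_rep ::
  "('v, 'e) pre_digraph \<Rightarrow> ('v, 'e, 'k::field, 'x) quiver_rep \<Rightarrow> bool" where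
  "fd_quiver_rep Q X \<longleftrightarrow>
     (\<forall>v\<in>verts Q. vectorspace class_ring (vspace X v) \<and>
                  vectorspace.fin_dim class_ring (vspace X v)) \<and>
     (\<forall>e\<in>arcs Q. linear_map class_ring (vspace X (tail Q e)) (vspace X (head Q e)) (amap X e))"

definition dim_vec_rep :: "('v, 'e, 'k::field, 'x) quiver_rep \<Rightarrow> 'v \<Rightarrow> nat" where
  "dim_vec_rep X v = vectorspace.dim class_ring (vspace X v)"

definition has_dim_vec ::
  "('v, 'e) pre_digraph \<Rightarrow> ('v, 'e, 'k::field, 'x) quiver_rep \<Rightarrow> ('v \<Rightarrow> nat) \<Rightarrow> bool" where
  "has_dim_vec Q X d \<longleftrightarrow> (\<forall>v\<in>verts Q. dim_vec_rep X v = d v)"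

text \<open>A subrepresentation is given by the underlying sets \<open>W v\<close> of its spaces.\<close>
definition is_subrep ::
  "('v, 'e) pre_digraph \<Rightarrow> ('v, 'e, 'k::field, 'x) quiver_rep \<Rightarrow> ('v \<Rightarrow> 'x set) \<Rightarrow> bool" where
  "is_subrep Q X W \<longleftrightarrow>
     (\<forall>v\<in>verts Q. VectorSpace.subspace class_ring (W v) (vspace X v)) \<and>
     (\<forall>e\<in>arcs Q. amap X e ` W (tail Q e) \<subseteq> W (head Q e))"

definition restrict_rep ::
  "('v, 'e, 'k, 'x) quiver_rep \<Rightarrow> ('v \<Rightarrow> 'x set) \<Rightarrow> ('v, 'e, 'k, 'x) quiver_rep" where
  "restrict_rep X W = X\<lparr>vspace := (\<lambda>v. (vspace X v)\<lparr>carrier := W v\<rparr>)\<rparr>"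

definition nonzero_rep ::
  "('v, 'e) pre_digraph \<Rightarrow> ('v, 'e, 'k, 'x) quiver_rep \<Rightarrow> bool" where
  "nonzero_rep Q X \<longleftrightarrow> (\<exists>v\<in>verts Q. carrier (vspace X v) \<noteq> {\<zero>\<^bsub>vspace X v\<^esub>})"

definition rep_iso ::
  "('v, 'e) pre_digraph \<Rightarrow> ('v, 'e, 'k::field, 'x) quiver_rep \<Rightarrow>
     ('v, 'e, 'k, 'y) quiver_rep \<Rightarrow> bool" where
  "rep_iso Q X Y \<longleftrightarrow> (\<exists>\<phi>.
     (\<forall>v\<in>verts Q. linear_map class_ring (vspace X v) (vspace Y v) (\<phi> v) \<and>
                  bij_betw (\<phi> v) (carrier (vspace X v)) (carrier (vspace Y v))) \<and>
     (\<forall>e\<in>arcs Q. \<forall>x\<in>carrier (vspace X (tail Q e)).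
        \<phi> (head Q e) (amap X e x) = amap Y e (\<phi> (tail Q e) x)))"

definition pairing :: "('v, 'e) pre_digraph \<Rightarrow> ('v \<Rightarrow> int) \<Rightarrow> ('v \<Rightarrow> nat) \<Rightarrow> int" where
  "pairing Q \<theta> d = (\<Sum>v\<in>verts Q. \<theta> v * int (d v))"

definition stable_rep ::
  "('v, 'e) pre_digraph \<Rightarrow> ('v \<Rightarrow> int) \<Rightarrow> ('v, 'e, 'k::field, 'x) quiver_rep \<Rightarrow> bool" where
  "stable_rep Q \<theta> X \<longleftrightarrow>
     nonzero_rep Q X \<and> pairing Q \<theta> (dim_vec_rep X) = 0 \<and>
     (\<forall>W. is_subrep Q X W \<longrightarrow>
          nonzero_rep Q (restrict_rep X W) \<longrightarrow>
          (\<exists>v\<in>verts Q. W v \<noteq> carrier (vspace X v)) \<longrightarrow>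
          pairing Q \<theta> (dim_vec_rep (restrict_rep X W)) < 0)"

text \<open>Every finite dimensional representation is isomorphic to one whose spaces are coordinate
  spaces, so it suffices to let representations on subsets of the type \<open>'k vec\<close> witness stability
  of a dimension vector.\<close>
definition stable_dim_vec ::
  "'k::field itself \<Rightarrow> ('v, 'e) pre_digraph \<Rightarrow> ('v \<Rightarrow> int) \<Rightarrow> ('v \<Rightarrow> nat) \<Rightarrow> bool" where
  "stable_dim_vec _ Q \<theta> d \<longleftrightarrow>
     (\<exists>X :: ('v, 'e, 'k, 'k vec) quiver_rep.
        fd_quiver_rep Q X \<and> has_dim_vec Q X d \<and> stable_rep Q \<theta> X)"


section \<open>The representation space and its Zariski topology\<close>

definition rep_space ::
  "('v, 'e) pre_digraph \<Rightarrow> ('v \<Rightarrow> nat) \<Rightarrow> ('e \<Rightarrow> 'k::field mat) set" where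
  "rep_space Q d = (\<Pi>\<^sub>E e\<in>arcs Q. carrier_mat (d (head Q e)) (d (tail Q e)))"

definition matrix_rep :: "('v \<Rightarrow> nat) \<Rightarrow> ('e \<Rightarrow> 'k::field mat) \<Rightarrow> ('v, 'e, 'k, 'k vec) quiver_rep"
  where
  "matrix_rep d P =
    \<lparr> vspace = (\<lambda>v. module_vec TYPE('k) (d v)), amap = (\<lambda>e x. P e *\<^sub>v x) \<rparr>"

inductive_set poly_funs ::
  "('v, 'e) pre_digraph \<Rightarrow> ('v \<Rightarrow> nat) \<Rightarrow> (('e \<Rightarrow> 'k::field mat) \<Rightarrow> 'k) set"
  for Q :: "('v, 'e) pre_digraph" and d :: "'v \<Rightarrow> nat" where
  const: "(\<lambda>P. c) \<in> poly_funs Q d"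
| coord: "\<lbrakk>e \<in> arcs Q; p < d (head Q e); q < d (tail Q e)\<rbrakk>
    \<Longrightarrow> (\<lambda>P. P e $$ (p, q)) \<in> poly_funs Q d"
| add: "\<lbrakk>f \<in> poly_funs Q d; g \<in> poly_funs Q d\<rbrakk> \<Longrightarrow> (\<lambda>P. f P + g P) \<in> poly_funs Q d"
| mult: "\<lbrakk>f \<in> poly_funs Q d; g \<in> poly_funs Q d\<rbrakk> \<Longrightarrow> (\<lambda>P. f P * g P) \<in> poly_funs Q d"

definition zero_locus ::
  "('v, 'e) pre_digraph \<Rightarrow> ('v \<Rightarrow> nat) \<Rightarrow> (('e \<Rightarrow> 'k::field mat) \<Rightarrow> 'k) set \<Rightarrow> ('e \<Rightarrow> 'k mat) set"
  where
  "zero_locus Q d S = {P \<in> rep_space Q d. \<forall>f\<in>S. f P = 0}"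

definition zariski :: "('v, 'e) pre_digraph \<Rightarrow> ('v \<Rightarrow> nat) \<Rightarrow> ('e \<Rightarrow> 'k::field mat) topology" where
  "zariski Q d = topology (\<lambda>U. \<exists>S \<subseteq> poly_funs Q d. U = rep_space Q d - zero_locus Q d S)"

lemma istopology_zariski:
  fixes Q :: "('v, 'e) pre_digraph"
  shows "istopology (\<lambda>U. \<exists>S \<subseteq> poly_funs Q d. U = rep_space Q d - (zero_locus Q d S :: ('e \<Rightarrow> 'k::field mat) set))"
  unfolding istopology_def
proof (intro conjI allI impI)
  fix U V :: "('e \<Rightarrow> 'k mat) set"
  assume "\<exists>S\<subseteq>poly_funs Q d. U = rep_space Q d - zero_locus Q d S"
    and "\<exists>S\<subseteq>poly_funs Q d. V = rep_space Q d - zero_locus Q d S"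
  then obtain S T where S: "S \<subseteq> poly_funs Q d" "U = rep_space Q d - zero_locus Q d S"
    and T: "T \<subseteq> poly_funs Q d" "V = rep_space Q d - zero_locus Q d T"
    by blast
  let ?P = "(\<lambda>(f, g) P. f P * g P) ` (S \<times> T)"
  have "?P \<subseteq> poly_funs Q d"
    using S(1) T(1) by (auto intro!: poly_funs.mult)
  moreover have "U \<inter> V = rep_space Q d - zero_locus Q d ?P"
    unfolding S(2) T(2) zero_locus_def by fastforce
  ultimately show "\<exists>S\<subseteq>poly_funs Q d. U \<inter> V = rep_space Q d - zero_locus Q d S"
    by blast
next
  fix \<K> :: "('e \<Rightarrow> 'k mat) set set"
  assume "\<forall>U\<in>\<K>. \<exists>S\<subseteq>poly_funs Q d. U = rep_space Q d - zero_locus Q d S"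
  then obtain S where S: "\<And>U. U \<in> \<K> \<Longrightarrow> S U \<subseteq> poly_funs Q d"
      "\<And>U. U \<in> \<K> \<Longrightarrow> U = rep_space Q d - zero_locus Q d (S U)"
    by metis
  have "P \<in> \<Union>\<K> \<longleftrightarrow> P \<in> rep_space Q d - zero_locus Q d (\<Union>(S ` \<K>))" for P
  proof
    assume "P \<in> \<Union>\<K>"
    then obtain U where "U \<in> \<K>" "P \<in> U" by blast
    with S(2)[OF \<open>U \<in> \<K>\<close>] have "P \<in> rep_space Q d - zero_locus Q d (S U)" by blast
    with \<open>U \<in> \<K>\<close> show "P \<in> rep_space Q d - zero_locus Q d (\<Union>(S ` \<K>))"
      unfolding zero_locus_def by blast
  next
    assume "P \<in> rep_space Q d - zero_locus Q d (\<Union>(S ` \<K>))"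
    then obtain U where "U \<in> \<K>" "P \<in> rep_space Q d - zero_locus Q d (S U)"
      unfolding zero_locus_def by blast
    with S(2)[OF \<open>U \<in> \<K>\<close>] show "P \<in> \<Union>\<K>" by blast
  qed
  then have "\<Union>\<K> = rep_space Q d - zero_locus Q d (\<Union>(S ` \<K>))" by blast
  moreover have "\<Union>(S ` \<K>) \<subseteq> poly_funs Q d" using S(1) by blast
  ultimately show "\<exists>S\<subseteq>poly_funs Q d. \<Union>\<K> = rep_space Q d - zero_locus Q d S"
    by blast
qed

lemma openin_zariski:
  "openin (zariski Q d) U \<longleftrightarrow> (\<exists>S \<subseteq> poly_funs Q d. U = rep_space Q d - zero_locus Q d S)"
  by (simp add: zariski_def istopology_zariski topology_inverse')


section \<open>The free product of semisimple algebras and its quiver\<close>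

text \<open>The data are the number \<open>m\<close> of factors, the number \<open>r i\<close> of simple blocks of the
  \<open>i\<close>-th factor and the weights \<open>w i j\<close>, for \<open>1 \<le> i \<le> m\<close> and \<open>1 \<le> j \<le> r i\<close>.
  Values at other indices are irrelevant.\<close>

type_synonym 'k free_prod_elem = "((nat \<times> (nat \<Rightarrow> 'k mat)) list \<Rightarrow> 'k) set"

definition factor_alg :: "(nat \<Rightarrow> nat) \<Rightarrow> (nat \<Rightarrow> nat \<Rightarrow> nat) \<Rightarrow> nat
    \<Rightarrow> ('k::field, nat \<Rightarrow> 'k mat) module" where
  "factor_alg r w i = prod_algebra {1..r i} (\<lambda>j. module_mat TYPE('k) (w i j) (w i j))"

definition free_prod_alg :: "nat \<Rightarrow> (nat \<Rightarrow> nat) \<Rightarrow> (nat \<Rightarrow> nat \<Rightarrow> nat)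
    \<Rightarrow> ('k::field, 'k free_prod_elem) module" where
  "free_prod_alg m r w = coproduct_algebra {1..m} (factor_alg r w)"

text \<open>Matrix indices of \<open>mat\<close> start at \<open>0\<close>, those of matrix units at \<open>1\<close>.\<close>
definition mat_unit :: "nat \<Rightarrow> nat \<Rightarrow> nat \<Rightarrow> 'k::field mat" where
  "mat_unit s p q = mat s s (\<lambda>(a, b). if Suc a = p \<and> Suc b = q then 1 else 0)"

text \<open>The image in the free product of the element of the \<open>i\<close>-th factor whose \<open>j\<close>-th component
  is \<open>B\<close> and whose other components are zero.\<close>
definition block_elem :: "nat \<Rightarrow> (nat \<Rightarrow> nat) \<Rightarrow> (nat \<Rightarrow> nat \<Rightarrow> nat) \<Rightarrow> nat \<Rightarrow> nat
    \<Rightarrow> 'k::field mat \<Rightarrow> 'k free_prod_elem" where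
  "block_elem m r w i j B = coproduct_inj {1..m} (factor_alg r w) i
     (\<lambda>l\<in>{1..r i}. if l = j then B else 0\<^sub>m (w i l) (w i l))"

definition matrix_unit_elem :: "nat \<Rightarrow> (nat \<Rightarrow> nat) \<Rightarrow> (nat \<Rightarrow> nat \<Rightarrow> nat) \<Rightarrow> nat \<Rightarrow> nat
    \<Rightarrow> nat \<Rightarrow> nat \<Rightarrow> 'k::field free_prod_elem" where
  "matrix_unit_elem m r w i j p q = block_elem m r w i j (mat_unit (w i j) p q)"

definition block_one_elem :: "nat \<Rightarrow> (nat \<Rightarrow> nat) \<Rightarrow> (nat \<Rightarrow> nat \<Rightarrow> nat) \<Rightarrow> nat \<Rightarrow> nat
    \<Rightarrow> 'k::field free_prod_elem" where
  "block_one_elem m r w i j = block_elem m r w i j (1\<^sub>m (w i j))"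

datatype vertex = Sink | Src nat nat

text \<open>The arrow \<open>(i, j, k)\<close> is the \<open>k\<close>-th arrow from \<open>Src i j\<close> to \<open>Sink\<close>.\<close>
type_synonym arrow = "nat \<times> nat \<times> nat"

definition Gam :: "nat \<Rightarrow> (nat \<Rightarrow> nat) \<Rightarrow> (nat \<Rightarrow> nat \<Rightarrow> nat) \<Rightarrow> (vertex, arrow) pre_digraph" where
  "Gam m r w =
    \<lparr> verts = insert Sink {Src i j | i j. i \<in> {1..m} \<and> j \<in> {1..r i}},
      arcs = {(i, j, k). i \<in> {1..m} \<and> j \<in> {1..r i} \<and> k \<in> {1..w i j}},
      tail = (\<lambda>(i, j, k). Src i j),
      head = (\<lambda>_. Sink) \<rparr>"

text \<open>The functor from modules over the free product to representations of the quiver, on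
  objects.\<close>
definition functor_F :: "nat \<Rightarrow> (nat \<Rightarrow> nat) \<Rightarrow> (nat \<Rightarrow> nat \<Rightarrow> nat)
    \<Rightarrow> ('k::field free_prod_elem, 'x) module \<Rightarrow> (vertex, arrow, 'k, 'x) quiver_rep" where
  "functor_F m r w M =
    \<lparr> vspace = (\<lambda>v. case v of
        Sink \<Rightarrow> underlying_vs (free_prod_alg m r w) M
      | Src i j \<Rightarrow> image_space (free_prod_alg m r w) M (matrix_unit_elem m r w i j 1 1)),
      amap = (\<lambda>(i, j, k) x. matrix_unit_elem m r w i j k 1 \<odot>\<^bsub>M\<^esub> x) \<rparr>"

definition balanced :: "nat \<Rightarrow> (nat \<Rightarrow> nat) \<Rightarrow> (nat \<Rightarrow> nat \<Rightarrow> nat) \<Rightarrow> (vertex \<Rightarrow> nat) \<Rightarrow> bool" where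
  "balanced m r w d \<longleftrightarrow> (\<forall>i\<in>{1..m}. (\<Sum>j\<in>{1..r i}. w i j * d (Src i j)) = d Sink)"

definition balanced_rep :: "nat \<Rightarrow> (nat \<Rightarrow> nat) \<Rightarrow> (nat \<Rightarrow> nat \<Rightarrow> nat)
    \<Rightarrow> (vertex, arrow, 'k::field, 'x) quiver_rep \<Rightarrow> bool" where
  "balanced_rep m r w X \<longleftrightarrow> (\<forall>i\<in>{1..m}. let S = (SIGMA j:{1..r i}. {1..w i j}) in
     bij_betw (\<lambda>x. \<Oplus>\<^bsub>vspace X Sink\<^esub>s\<in>S. amap X (i, fst s, snd s) (x s))
       (\<Pi>\<^sub>E s\<in>S. carrier (vspace X (Src i (fst s)))) (carrier (vspace X Sink)))"

definition balanced_locus :: "nat \<Rightarrow> (nat \<Rightarrow> nat) \<Rightarrow> (nat \<Rightarrow> nat \<Rightarrow> nat) \<Rightarrow> (vertex \<Rightarrow> nat)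
    \<Rightarrow> (arrow \<Rightarrow> 'k::field mat) set" where
  "balanced_locus m r w d =
     {P \<in> rep_space (Gam m r w) d. balanced_rep m r w (matrix_rep d P)}"

text \<open>The points of \<open>balanced_locus\<close> corresponding, via \<open>functor_F\<close>, to simple modules.  Up to isomorphism,
  all finite dimensional modules live on the type \<open>'k vec\<close>.\<close>
definition simple_locus :: "nat \<Rightarrow> (nat \<Rightarrow> nat) \<Rightarrow> (nat \<Rightarrow> nat \<Rightarrow> nat) \<Rightarrow> (vertex \<Rightarrow> nat)
    \<Rightarrow> (arrow \<Rightarrow> 'k::field mat) set" where
  "simple_locus m r w d =
     {P \<in> balanced_locus m r w d. \<exists>M :: ('k free_prod_elem, 'k vec) module.
        fd_left_module (free_prod_alg m r w) M \<and>
        rep_iso (Gam m r w) (functor_F m r w M) (matrix_rep d P) \<and>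
        simple_left_module (free_prod_alg m r w) M}"

definition theta :: "nat \<Rightarrow> (nat \<Rightarrow> nat \<Rightarrow> nat) \<Rightarrow> vertex \<Rightarrow> int" where
  "theta m w v = (case v of Sink \<Rightarrow> - int m | Src i j \<Rightarrow> int (w i j))"

abbreviation theta_stable ::
  "'k::field itself \<Rightarrow> nat \<Rightarrow> (nat \<Rightarrow> nat) \<Rightarrow> (nat \<Rightarrow> nat \<Rightarrow> nat) \<Rightarrow> (vertex \<Rightarrow> nat) \<Rightarrow> bool" where
  "theta_stable K m r w d \<equiv> stable_dim_vec K (Gam m r w) (theta m w) d"


section \<open>Special dimension vectors\<close>

definition delta :: "(nat \<Rightarrow> nat \<Rightarrow> nat) \<Rightarrow> (nat \<Rightarrow> nat) \<Rightarrow> vertex \<Rightarrow> rat" where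
  "delta w u v = (case v of
     Sink \<Rightarrow> 1
   | Src i j \<Rightarrow> (if j = u i then 1 / of_nat (w i j) else 0))"

definition extremal_index :: "nat \<Rightarrow> (nat \<Rightarrow> nat) \<Rightarrow> (nat \<Rightarrow> nat) \<Rightarrow> bool" where
  "extremal_index m r u \<longleftrightarrow> (\<forall>i\<in>{1..m}. u i \<in> {1..r i})"

definition real_extremal :: "nat \<Rightarrow> (nat \<Rightarrow> nat \<Rightarrow> nat) \<Rightarrow> (nat \<Rightarrow> nat) \<Rightarrow> bool" where
  "real_extremal m w u \<longleftrightarrow> card {i\<in>{1..m}. w i (u i) \<noteq> 1} \<le> 1"

text \<open>The condition \<open>q > 0\<close> excludes the zero vector.\<close>
definition on_ray :: "'v set \<Rightarrow> ('v \<Rightarrow> rat) \<Rightarrow> ('v \<Rightarrow> nat) \<Rightarrow> bool" where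
  "on_ray V \<delta> d \<longleftrightarrow> (\<exists>q > 0. \<forall>v\<in>V. of_nat (d v) = q * \<delta> v)"

definition minimal_on_ray :: "'v set \<Rightarrow> ('v \<Rightarrow> rat) \<Rightarrow> ('v \<Rightarrow> nat) \<Rightarrow> bool" where
  "minimal_on_ray V \<delta> d \<longleftrightarrow>
     on_ray V \<delta> d \<and> (\<forall>d'. on_ray V \<delta> d' \<longrightarrow> (\<forall>v\<in>V. d v \<le> d' v))"

definition special_isotropic ::
  "nat \<Rightarrow> (nat \<Rightarrow> nat) \<Rightarrow> (nat \<Rightarrow> nat \<Rightarrow> nat) \<Rightarrow> (vertex \<Rightarrow> nat) \<Rightarrow> bool" where
  "special_isotropic m r w d \<longleftrightarrow> balanced m r w d \<and> d Sink \<ge> 2 \<and>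
     (let T = {(i, j). i \<in> {1..m} \<and> j \<in> {1..r i} \<and> 0 < d (Src i j) \<and> d (Src i j) < d Sink}
      in card T = 4 \<and> (\<forall>(i, j)\<in>T. 2 * d (Src i j) = d Sink \<and> w i j = 1))"

definition divisible :: "'v set \<Rightarrow> ('v \<Rightarrow> nat) \<Rightarrow> bool" where
  "divisible V d \<longleftrightarrow> (\<exists>k \<ge> 2. \<forall>v\<in>V. k dvd d v)"

definition condition_a :: "nat \<Rightarrow> (nat \<Rightarrow> nat) \<Rightarrow> (nat \<Rightarrow> nat \<Rightarrow> nat) \<Rightarrow> (vertex \<Rightarrow> nat) \<Rightarrow> bool" where
  "condition_a m r w d \<longleftrightarrow>
     (\<exists>u. extremal_index m r u \<and> real_extremal m w u \<and>
          minimal_on_ray (verts (Gam m r w)) (delta w u) d)"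

definition condition_b :: "nat \<Rightarrow> (nat \<Rightarrow> nat) \<Rightarrow> (nat \<Rightarrow> nat \<Rightarrow> nat) \<Rightarrow> (vertex \<Rightarrow> nat) \<Rightarrow> bool" where
  "condition_b m r w d \<longleftrightarrow>
     special_isotropic m r w d \<and> \<not> divisible (verts (Gam m r w)) d"

text \<open>Each factor has at least one block (\<open>r i \<ge> 1\<close>) as soon as \<open>d\<close> is balanced with \<open>d Sink > 0\<close>, so
  no \<open>Max\<close> of an empty set occurs.\<close>
definition condition_c :: "nat \<Rightarrow> (nat \<Rightarrow> nat) \<Rightarrow> (nat \<Rightarrow> nat \<Rightarrow> nat) \<Rightarrow> (vertex \<Rightarrow> nat) \<Rightarrow> bool" where
  "condition_c m r w d \<longleftrightarrow>
     \<not> special_isotropic m r w d \<and>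
     (\<Sum>i\<in>{1..m}. Max ((\<lambda>j. of_nat (d (Src i j)) / of_nat (w i j)) ` {1..r i}))
       \<le> (of_nat m - 1) * (of_nat (d Sink) :: rat)"

end

theory Submission
  imports Defs "Jordan_Normal_Form.Char_Poly"
begin

text \<open>
  Modules over the free product correspond to balanced representations of the quiver. If \<open>W\<close> is a
  subrepresentation of a balanced representation \<open>X\<close>, then in each cluster the map from the direct sum of
  the spaces \<open>W\<^sub>i\<^sub>j\<close> (each repeated \<open>w\<^sub>i\<^sub>j\<close> times) to \<open>W\<^sub>0\<close> is still injective. Hence
  \<open>\<Sum>\<^sub>j w\<^sub>i\<^sub>j dim W\<^sub>i\<^sub>j \<le> dim W\<^sub>0\<close> for every \<open>i\<close>, so \<open>\<theta>(W) \<le> 0\<close>, with equality exactly when the dimension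
  vector of \<open>W\<close> is balanced; and in that case \<open>W\<^sub>0\<close> is a submodule of the corresponding module. Thus a
  module is simple iff its representation is \<open>\<theta>\<close>-stable (\<open>simple_stable\<close>, \<open>stable_simple\<close>).

  Conditions (a), (b), (c) are sufficient by a parameter count. Let \<open>d = d' + d''\<close> with \<open>d'\<close>, \<open>d''\<close> balanced,
  and let \<open>n'\<close>, \<open>n''\<close> be their positive values at the sink. The representations
  with a subrepresentation of dimension vector \<open>d'\<close> lie in a proper closed subset as soon as
  \<open>\<Sum>\<^sub>i\<^sub>j d'\<^sub>i\<^sub>j d''\<^sub>i\<^sub>j < (m - 1) n' n''\<close>. This inequality is \<open>form_less\<close>: weighted products are estimated
  by \<open>product_le_weighted\<close>, the estimates add up to at most \<open>(m - 1) n' n''\<close> under the inequality of (c), and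
  equality forces \<open>d\<close> to be special isotropic with \<open>d'\<close> proportional to \<open>d\<close>, which an indivisible special
  isotropic vector does not allow. In case (a) there is no such decomposition at all. Instead
  of dimension theory the parameter count uses \<open>algebraically_dependent\<close>: more polynomials than variables
  satisfy a polynomial relation. In \<open>subrep_locus_degenerate\<close> it produces a nonzero polynomial that
  vanishes on the degenerate representations. There are finitely many cases, so a single nonzero polynomial
  \<open>G\<close> excludes them all. The balanced representations are the points where certain determinants do not
  vanish, and over an infinite field nonzero polynomials have a common nonzero value. Therefore \<open>G \<noteq> 0\<close>
  defines an open dense set of balanced representations, all of them stable.

  Conversely let \<open>d\<close> be the dimension vector of a stable representation. If the inequality of (c) fails, pick
  in each cluster an index \<open>u\<^sub>i\<close> with the largest ratio \<open>d\<^sub>i\<^sub>j / w\<^sub>i\<^sub>j\<close>. At most one of the chosen weights is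
  not \<open>1\<close>, say that of the cluster \<open>i\<^sub>0\<close>. By counting equations and unknowns there is a nonzero vector \<open>x\<close>
  at the chosen vertex of that cluster such that all of its images lie in the images of the other chosen
  arrows. The images of \<open>x\<close> generate a subrepresentation with \<open>\<theta> \<ge> 0\<close>; it must be everything, and \<open>d\<close> turns out to be
  the minimal vector on the ray of \<open>\<delta>\<^sub>u\<close> (\<open>inequality_fails\<close>). If \<open>d\<close> is special isotropic, an eigenvector
  of an operator built from the four half-dimensional subspaces yields a space of dimension at most \<open>2\<close>
  at the sink that generates a subrepresentation with \<open>\<theta> \<ge> 0\<close>, so \<open>n = 2\<close> and \<open>d\<close> is indivisible (\<open>special_isotropic_dim_2\<close>).
\<close>

section \<open>Families of vectors and dimension\<close>

text \<open>Eliminate one equation at a time: an unknown with a nonzero coefficient is expressed through the others.\<close>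

lemma homogeneous_system_nontrivial_solution:
  fixes a :: "'j \<Rightarrow> 'i \<Rightarrow> 'k::field"
  assumes "finite J" "finite I" "card J < card I"
  shows "\<exists>c. (\<exists>i\<in>I. c i \<noteq> 0) \<and> (\<forall>j\<in>J. (\<Sum>i\<in>I. a j i * c i) = 0)"
  using assms
proof (induction J arbitrary: I a rule: finite_induct)
  case empty
  then have "I \<noteq> {}" by auto
  then show ?case by (intro exI[of _ "\<lambda>_. 1"]) auto
next
  case (insert j J)
  show ?case
  proof (cases "\<forall>i\<in>I. a j i = 0")
    case True
    have "card J < card I" using insert by simp
    from insert.IH[OF insert.prems(1) this, of a] obtain c where
      "\<exists>i\<in>I. c i \<noteq> 0" "\<forall>j\<in>J. (\<Sum>i\<in>I. a j i * c i) = 0" by blast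
    with True show ?thesis by (intro exI[of _ c]) auto
  next
    case False
    then obtain i0 where i0: "i0 \<in> I" "a j i0 \<noteq> 0" by blast
    let ?I = "I - {i0}"
    define a' where "a' j' i = a j' i - a j' i0 * a j i / a j i0" for j' i
    have "card J < card ?I" "finite ?I" using insert i0 by auto
    from insert.IH[OF this(2,1), of a'] obtain c where
      c: "\<exists>i\<in>?I. c i \<noteq> 0" "\<And>j. j\<in>J \<Longrightarrow> (\<Sum>i\<in>?I. a' j i * c i) = 0" by blast
    define s where "s = (\<Sum>i\<in>?I. a j i * c i)"
    let ?c = "c(i0 := - s / a j i0)"
    have spl: "(\<Sum>i\<in>I. a j' i * ?c i) = a j' i0 * (- s / a j i0) + (\<Sum>i\<in>?I. a j' i * c i)" for j'
      using insert.prems i0 by (subst sum.remove[of I i0]) (auto intro!: sum.cong)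
    have "(\<Sum>i\<in>I. a j i * ?c i) = 0" unfolding spl using i0 by (simp add: s_def)
    moreover have "(\<Sum>i\<in>I. a j' i * ?c i) = 0" if "j' \<in> J" for j'
    proof -
      have "(\<Sum>i\<in>?I. a' j' i * c i) = (\<Sum>i\<in>?I. a j' i * c i) - (a j' i0 / a j i0) * s"
        unfolding a'_def s_def sum_distrib_left
        by (simp add: algebra_simps sum_subtractf)
      with c(2)[OF that] show ?thesis unfolding spl by (simp add: field_simps)
    qed
    moreover have "\<exists>i\<in>I. ?c i \<noteq> 0" using c(1) by auto
    ultimately show ?thesis by (intro exI[of _ ?c]) auto
  qed
qed

abbreviation "kvs \<equiv> vectorspace class_ring"
abbreviation "kfd \<equiv> vectorspace.fin_dim class_ring"
abbreviation "kdim \<equiv> vectorspace.dim class_ring"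
abbreviation "ksub \<equiv> VectorSpace.subspace class_ring"
abbreviation "klin \<equiv> linear_map class_ring"

text \<open>Bases are handled as indexed families rather than sets, so that repetitions and reindexing
  by products of index sets cause no trouble.\<close>

definition lcomb :: "('k::field, 'x) module \<Rightarrow> ('i \<Rightarrow> 'x) \<Rightarrow> ('i \<Rightarrow> 'k) \<Rightarrow> 'i set \<Rightarrow> 'x" where
  "lcomb V b c I = (\<Oplus>\<^bsub>V\<^esub>i\<in>I. c i \<odot>\<^bsub>V\<^esub> b i)"

definition independent_family :: "('k::field, 'x) module \<Rightarrow> ('i \<Rightarrow> 'x) \<Rightarrow> 'i set \<Rightarrow> bool" where
  "independent_family V b I \<longleftrightarrow> b \<in> I \<rightarrow> carrier V \<and>
     (\<forall>c. lcomb V b c I = \<zero>\<^bsub>V\<^esub> \<longrightarrow> (\<forall>i\<in>I. c i = 0))"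

definition spanning_family :: "('k::field, 'x) module \<Rightarrow> ('i \<Rightarrow> 'x) \<Rightarrow> 'i set \<Rightarrow> bool" where
  "spanning_family V b I \<longleftrightarrow> b \<in> I \<rightarrow> carrier V \<and> (\<forall>x\<in>carrier V. \<exists>c. x = lcomb V b c I)"

lemma field_class_ring: "field (class_ring :: 'k::field ring)"
  by (rule class_field.field_axioms)

context
  fixes V :: "('k::field, 'x) module"
  assumes V: "kvs V"
begin

interpretation V: vectorspace class_ring V by (rule V)

lemma kvs_simps:
  "x \<in> carrier V \<Longrightarrow> c \<odot>\<^bsub>V\<^esub> x \<in> carrier V"
  "x \<in> carrier V \<Longrightarrow> 1 \<odot>\<^bsub>V\<^esub> x = x"
  "x \<in> carrier V \<Longrightarrow> 0 \<odot>\<^bsub>V\<^esub> x = \<zero>\<^bsub>V\<^esub>"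
  "c \<odot>\<^bsub>V\<^esub> \<zero>\<^bsub>V\<^esub> = \<zero>\<^bsub>V\<^esub>"
  "\<zero>\<^bsub>V\<^esub> \<in> carrier V"
  "x \<in> carrier V \<Longrightarrow> y \<in> carrier V \<Longrightarrow> x \<oplus>\<^bsub>V\<^esub> y \<in> carrier V"
  "x \<in> carrier V \<Longrightarrow> \<zero>\<^bsub>V\<^esub> \<oplus>\<^bsub>V\<^esub> x = x"
  "x \<in> carrier V \<Longrightarrow> x \<oplus>\<^bsub>V\<^esub> \<zero>\<^bsub>V\<^esub> = x"
  using V.smult_closed[of c x] V.smult_one[of x] V.lmult_0[of x] V.rmult_0[of c]
  by simp_all

lemma kvs_distrib:
  "x \<in> carrier V \<Longrightarrow> (c + d) \<odot>\<^bsub>V\<^esub> x = c \<odot>\<^bsub>V\<^esub> x \<oplus>\<^bsub>V\<^esub> d \<odot>\<^bsub>V\<^esub> x"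
  "x \<in> carrier V \<Longrightarrow> (c * d) \<odot>\<^bsub>V\<^esub> x = c \<odot>\<^bsub>V\<^esub> (d \<odot>\<^bsub>V\<^esub> x)"
  "x \<in> carrier V \<Longrightarrow> y \<in> carrier V \<Longrightarrow> c \<odot>\<^bsub>V\<^esub> (x \<oplus>\<^bsub>V\<^esub> y) = c \<odot>\<^bsub>V\<^esub> x \<oplus>\<^bsub>V\<^esub> c \<odot>\<^bsub>V\<^esub> y"
  using V.smult_l_distr[of c d x] V.smult_assoc1[of c d x] V.smult_r_distr[of c x y]
  by (simp_all)

lemma kvs_abelian_group: "abelian_group V"
  by (rule V.M.abelian_group_axioms)

lemma lcomb_closed: "b \<in> I \<rightarrow> carrier V \<Longrightarrow> lcomb V b c I \<in> carrier V"
  unfolding lcomb_def by (rule V.M.finsum_closed) (auto simp: kvs_simps)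

lemma lcomb_cong:
  "b \<in> I \<rightarrow> carrier V \<Longrightarrow> (\<And>i. i \<in> I \<Longrightarrow> c i = c' i) \<Longrightarrow> lcomb V b c I = lcomb V b c' I"
  unfolding lcomb_def by (rule V.M.finsum_cong') (auto simp: kvs_simps)

lemma finsum_scale:
  "f \<in> I \<rightarrow> carrier V \<Longrightarrow> c \<odot>\<^bsub>V\<^esub> (\<Oplus>\<^bsub>V\<^esub>i\<in>I. f i) = (\<Oplus>\<^bsub>V\<^esub>i\<in>I. c \<odot>\<^bsub>V\<^esub> f i)"
proof (induction I rule: infinite_finite_induct)
  case (insert x F)
  then show ?case by (simp add: kvs_simps kvs_distrib Pi_def V.M.finsum_closed)
qed (simp_all add: kvs_simps)

lemma lcomb_scale: "b \<in> I \<rightarrow> carrier V \<Longrightarrow> c \<odot>\<^bsub>V\<^esub> lcomb V b d I = lcomb V b (\<lambda>i. c * d i) I"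
  unfolding lcomb_def
  by (subst finsum_scale) (auto simp: kvs_simps kvs_distrib Pi_def intro!: V.M.finsum_cong')

lemma lcomb_add:
  assumes b: "b \<in> I \<rightarrow> carrier V"
  shows "lcomb V b c I \<oplus>\<^bsub>V\<^esub> lcomb V b d I = lcomb V b (\<lambda>i. c i + d i) I"
proof -
  have "lcomb V b (\<lambda>i. c i + d i) I = (\<Oplus>\<^bsub>V\<^esub>i\<in>I. c i \<odot>\<^bsub>V\<^esub> b i \<oplus>\<^bsub>V\<^esub> d i \<odot>\<^bsub>V\<^esub> b i)"
    unfolding lcomb_def using b
    by (intro V.M.finsum_cong') (auto simp: kvs_simps kvs_distrib Pi_def)
  also have "\<dots> = lcomb V b c I \<oplus>\<^bsub>V\<^esub> lcomb V b d I"
    unfolding lcomb_def using b by (intro V.M.finsum_addf) (auto simp: kvs_simps Pi_def)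
  finally show ?thesis by simp
qed

lemma lcomb_zero: "b \<in> I \<rightarrow> carrier V \<Longrightarrow> (\<And>i. i \<in> I \<Longrightarrow> c i = 0) \<Longrightarrow> lcomb V b c I = \<zero>\<^bsub>V\<^esub>"
  unfolding lcomb_def
  by (subst V.M.finsum_cong'[of I I "\<lambda>_. \<zero>\<^bsub>V\<^esub>"]) (auto simp: kvs_simps Pi_def)

lemma lcomb_sum:
  assumes "b \<in> I \<rightarrow> carrier V" "finite J"
  shows "(\<Oplus>\<^bsub>V\<^esub>j\<in>J. lcomb V b (c j) I) = lcomb V b (\<lambda>i. \<Sum>j\<in>J. c j i) I"
  using assms(2)
proof induction
  case empty
  then show ?case using lcomb_zero[OF assms(1), of "\<lambda>_. 0"] by simp
next
  case (insert x F)
  have "(\<Oplus>\<^bsub>V\<^esub>j\<in>insert x F. lcomb V b (c j) I)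
      = lcomb V b (c x) I \<oplus>\<^bsub>V\<^esub> (\<Oplus>\<^bsub>V\<^esub>j\<in>F. lcomb V b (c j) I)"
    using insert lcomb_closed[OF assms(1)] by (intro V.M.finsum_insert) auto
  with insert show ?case by (simp add: lcomb_add[OF assms(1)])
qed

lemma lcomb_reindex:
  assumes h: "bij_betw h I' I" and b: "b \<in> I \<rightarrow> carrier V"
  shows "lcomb V b c I = lcomb V (b \<circ> h) (c \<circ> h) I'"
proof -
  have "lcomb V b c (h ` I') = lcomb V (b \<circ> h) (c \<circ> h) I'"
    unfolding lcomb_def using h b
    by (subst V.M.finsum_reindex) (auto simp: bij_betw_def Pi_def intro!: kvs_simps)
  then show ?thesis using h by (simp add: bij_betw_def)
qed

lemma independent_family_reindex:
  assumes h: "bij_betw h I' I" and b: "independent_family V b I"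
  shows "independent_family V (b \<circ> h) I'"
  unfolding independent_family_def
proof (intro conjI allI impI ballI)
  have bc: "b \<in> I \<rightarrow> carrier V" using b unfolding independent_family_def by blast
  show bh: "b \<circ> h \<in> I' \<rightarrow> carrier V" using bc h by (auto simp: bij_betw_def)
  fix c i assume c: "lcomb V (b \<circ> h) c I' = \<zero>\<^bsub>V\<^esub>" and i: "i \<in> I'"
  let ?c = "c \<circ> inv_into I' h"
  have inv: "inv_into I' h (h k) = k" if "k \<in> I'" for k
    using h that by (intro inv_into_f_f) (auto simp: bij_betw_def)
  have "lcomb V b ?c I = lcomb V (b \<circ> h) (?c \<circ> h) I'" by (rule lcomb_reindex[OF h bc])
  also have "\<dots> = lcomb V (b \<circ> h) c I'" by (rule lcomb_cong[OF bh]) (simp add: inv)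
  finally have "\<forall>j\<in>I. ?c j = 0" using b c unfolding independent_family_def by auto
  then have "?c (h i) = 0" using h i by (auto simp: bij_betw_def)
  then show "c i = 0" using inv[OF i] by simp
qed

lemma frame_exists:
  assumes fd: "kfd V"
  shows "\<exists>b. independent_family V b {..<kdim V} \<and> spanning_family V b {..<kdim V}"
proof -
  obtain B where B: "finite B" "V.basis B" using V.finite_basis_exists[OF fd] by blast
  have dim: "kdim V = card B" using V.dim_basis[OF B] .
  obtain b where b: "bij_betw b {..<card B} B"
    using ex_bij_betw_nat_finite[OF B(1)] by (auto simp: atLeast0LessThan)
  have BV: "B \<subseteq> carrier V" and li: "\<not> V.lin_dep B" and gen: "V.span B = carrier V"
    using B(2) unfolding V.basis_def by auto
  have bc: "b \<in> {..<card B} \<rightarrow> carrier V" using b BV by (auto simp: bij_betw_def)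
  have re: "V.lincomb a B = lcomb V b (a \<circ> b) {..<card B}" for a
  proof -
    have "V.lincomb a (b ` {..<card B}) = (\<Oplus>\<^bsub>V\<^esub>i\<in>{..<card B}. a (b i) \<odot>\<^bsub>V\<^esub> b i)"
      unfolding V.lincomb_def using b bc
      by (subst V.M.finsum_reindex[of "\<lambda>v. a v \<odot>\<^bsub>V\<^esub> v" b "{..<card B}"])
         (use BV in \<open>auto simp: bij_betw_def kvs_simps Pi_def\<close>)
    then show ?thesis using b by (simp add: lcomb_def bij_betw_def)
  qed
  have "independent_family V b {..<card B}"
    unfolding independent_family_def
  proof (intro conjI allI impI ballI bc)
    fix c i assume c0: "lcomb V b c {..<card B} = \<zero>\<^bsub>V\<^esub>" and i: "i \<in> {..<card B}"
    let ?a = "\<lambda>v. c (inv_into {..<card B} b v)"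
    have "lcomb V b c {..<card B} = V.lincomb ?a B"
      unfolding re using b by (intro lcomb_cong bc) (auto simp: bij_betw_def)
    then have "V.lincomb ?a B = \<zero>\<^bsub>V\<^esub>" using c0 by simp
    have "?a (b i) = 0"
    proof (rule ccontr)
      assume "?a (b i) \<noteq> 0"
      then have "V.lin_dep B" unfolding V.lin_dep_def using \<open>V.lincomb ?a B = \<zero>\<^bsub>V\<^esub>\<close> B(1) i b
        by (intro exI[of _ B] exI[of _ ?a] exI[of _ "b i"]) (auto simp: bij_betw_def)
      with li show False by simp
    qed
    then show "c i = 0" using i b by (simp add: bij_betw_def)
  qed
  moreover have "spanning_family V b {..<card B}"
    unfolding spanning_family_def
  proof (intro conjI ballI bc)
    fix x assume "x \<in> carrier V"
    then obtain a where "V.lincomb a B = x" using V.finite_in_span[OF B(1) BV, of x] gen by auto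
    then show "\<exists>c. x = lcomb V b c {..<card B}" unfolding re by blast
  qed
  ultimately show ?thesis unfolding dim by blast
qed

lemma spanning_family_dim:
  assumes "spanning_family V b I" "finite I"
  shows "kfd V" "kdim V \<le> card I"
proof -
  have bI: "b ` I \<subseteq> carrier V" "finite (b ` I)" using assms unfolding spanning_family_def by auto
  have "carrier V \<subseteq> V.span (b ` I)"
  proof
    fix x assume "x \<in> carrier V"
    then obtain c where x: "x = lcomb V b c I" using assms unfolding spanning_family_def by blast
    have "lcomb V b c J \<in> V.span (b ` I)" if "finite J" "J \<subseteq> I" for J
      using that
    proof induction
      case empty
      then show ?case unfolding lcomb_def using V.span_zero by simp
    next
      case (insert y F)
      have s: "ksub (V.span (b ` I)) V" by (rule V.span_is_subspace[OF bI(1)])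
      then interpret S: submodule class_ring "V.span (b ` I)" V by (rule V.is_module)
      have "b y \<in> V.span (b ` I)" by (rule V.span_mem[OF bI(1)]) (use insert in blast)
      then have "c y \<odot>\<^bsub>V\<^esub> b y \<in> V.span (b ` I)" using S.smult_closed[of "c y" "b y"] by simp
      moreover have "lcomb V b c (insert y F) = c y \<odot>\<^bsub>V\<^esub> b y \<oplus>\<^bsub>V\<^esub> lcomb V b c F"
        unfolding lcomb_def using insert bI(1)
        by (subst V.M.finsum_insert) (auto intro!: kvs_simps)
      ultimately show ?case using insert by (auto intro: S.m_closed)
    qed
    then show "x \<in> V.span (b ` I)" using x assms(2) by simp
  qed
  then have gen: "V.span (b ` I) = carrier V" using V.span_is_subset2[OF bI(1)] by blast
  show "kfd V" unfolding V.fin_dim_def using gen bI by blast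
  have "kdim V \<le> card (b ` I)" by (rule V.gen_ge_dim[OF bI(2,1) gen])
  also have "\<dots> \<le> card I" by (rule card_image_le[OF assms(2)])
  finally show "kdim V \<le> card I" .
qed

lemma finsum_lcomb_lcomb:
  assumes "b \<in> I \<rightarrow> carrier V" "finite J" 
    and f: "\<And>j. j \<in> J \<Longrightarrow> f j = lcomb V b (a j) I"
  shows "lcomb V f c J = lcomb V b (\<lambda>i. \<Sum>j\<in>J. c j * a j i) I"
proof -
  have "lcomb V f c J = (\<Oplus>\<^bsub>V\<^esub>j\<in>J. lcomb V b (\<lambda>i. c j * a j i) I)"
    unfolding lcomb_def[of V f]
    by (rule V.M.finsum_cong') (auto simp: f lcomb_scale[OF assms(1)] lcomb_closed[OF assms(1)])
  then show ?thesis by (simp add: lcomb_sum[OF assms(1,2)])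
qed

text \<open>Expressing the family through a basis turns a linear relation into a homogeneous system with more
  unknowns than equations.\<close>

lemma independent_family_card_le:
  assumes fd: "kfd V" and ind: "independent_family V f J" and J: "finite J"
  shows "card J \<le> kdim V"
proof (rule ccontr)
  assume "\<not> card J \<le> kdim V"
  obtain b where b: "spanning_family V b {..<kdim V}" using frame_exists[OF fd] by blast
  have bc: "b \<in> {..<kdim V} \<rightarrow> carrier V" using b unfolding spanning_family_def by blast
  have "\<forall>j\<in>J. \<exists>a. f j = lcomb V b a {..<kdim V}"
    using b ind unfolding spanning_family_def independent_family_def by blast
  then obtain a where a: "\<And>j. j \<in> J \<Longrightarrow> f j = lcomb V b (a j) {..<kdim V}" by metis
  obtain c where c: "\<exists>j\<in>J. c j \<noteq> 0" "\<forall>i\<in>{..<kdim V}. (\<Sum>j\<in>J. a j i * c j) = 0"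
    using homogeneous_system_nontrivial_solution[OF _ J, of "{..<kdim V}" "\<lambda>i j. a j i"]
      \<open>\<not> card J \<le> kdim V\<close> by auto
  have "lcomb V f c J = lcomb V b (\<lambda>i. \<Sum>j\<in>J. c j * a j i) {..<kdim V}"
    by (rule finsum_lcomb_lcomb[OF bc J a])
  also have "\<dots> = \<zero>\<^bsub>V\<^esub>" using c(2) by (intro lcomb_zero[OF bc]) (simp add: mult.commute)
  finally show False using ind c(1) unfolding independent_family_def by blast
qed

lemma frame_dim:
  assumes "independent_family V b I" "spanning_family V b I" "finite I"
  shows "kdim V = card I"
  by (rule antisym[OF spanning_family_dim(2)[OF assms(2,3)]
        independent_family_card_le[OF spanning_family_dim(1)[OF assms(2,3)] assms(1,3)]])

lemma independent_family_extend:
  assumes ind: "independent_family V f J" and J: "finite J"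
    and x: "x \<in> carrier V" and no: "\<nexists>c. x = lcomb V f c J"
  shows "independent_family V (case_option x f) (insert None (Some ` J))"
proof -
  let ?g = "case_option x f" and ?I = "insert None (Some ` J)"
  have fc: "f \<in> J \<rightarrow> carrier V" using ind unfolding independent_family_def by blast
  have split: "lcomb V ?g c ?I = c None \<odot>\<^bsub>V\<^esub> x \<oplus>\<^bsub>V\<^esub> lcomb V f (c \<circ> Some) J" for c
  proof -
    have "lcomb V ?g c ?I = c None \<odot>\<^bsub>V\<^esub> x \<oplus>\<^bsub>V\<^esub> (\<Oplus>\<^bsub>V\<^esub>t\<in>Some ` J. c t \<odot>\<^bsub>V\<^esub> ?g t)"
      unfolding lcomb_def using J x fc by (subst V.M.finsum_insert) (auto simp: kvs_simps Pi_def)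
    also have "(\<Oplus>\<^bsub>V\<^esub>t\<in>Some ` J. c t \<odot>\<^bsub>V\<^esub> ?g t) = lcomb V f (c \<circ> Some) J"
      unfolding lcomb_def using fc
      by (subst V.M.finsum_reindex) (auto simp: kvs_simps Pi_def)
    finally show ?thesis .
  qed
  show ?thesis
    unfolding independent_family_def
  proof (intro conjI allI impI)
    show "?g \<in> ?I \<rightarrow> carrier V" using fc x by auto
    fix c assume "lcomb V ?g c ?I = \<zero>\<^bsub>V\<^esub>"
    then have z: "c None \<odot>\<^bsub>V\<^esub> x \<oplus>\<^bsub>V\<^esub> lcomb V f (c \<circ> Some) J = \<zero>\<^bsub>V\<^esub>" unfolding split .
    have cN: "c None = 0"
    proof (rule ccontr)
      assume n: "c None \<noteq> 0"
      have lc: "lcomb V f d J \<in> carrier V" for d by (rule lcomb_closed[OF fc])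
      have "x = (inverse (c None) * c None) \<odot>\<^bsub>V\<^esub> x" using n x by (simp add: kvs_simps)
      also have "\<dots> = inverse (c None) \<odot>\<^bsub>V\<^esub> (c None \<odot>\<^bsub>V\<^esub> x)" using x by (simp only: kvs_distrib)
      also have "c None \<odot>\<^bsub>V\<^esub> x = lcomb V f (\<lambda>i. - 1 * (c \<circ> Some) i) J"
      proof -
        have "lcomb V f (\<lambda>i. - 1 * (c \<circ> Some) i) J \<oplus>\<^bsub>V\<^esub> lcomb V f (c \<circ> Some) J = \<zero>\<^bsub>V\<^esub>"
          unfolding lcomb_add[OF fc] by (rule lcomb_zero[OF fc]) simp
        then show ?thesis using z lc kvs_simps(1)[OF x, of "c None"]
          by (metis V.M.minus_equality)
      qed
      also have "inverse (c None) \<odot>\<^bsub>V\<^esub> \<dots> = lcomb V f (\<lambda>i. inverse (c None) * (- 1 * (c \<circ> Some) i)) J"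
        by (rule lcomb_scale[OF fc])
      finally show False using no by blast
    qed
    then have "lcomb V f (c \<circ> Some) J = \<zero>\<^bsub>V\<^esub>" using z x lcomb_closed[OF fc] by (simp add: kvs_simps)
    then show "\<forall>i\<in>?I. c i = 0" using ind cN unfolding independent_family_def by auto
  qed
qed

lemma independent_family_full_spanning:
  assumes fd: "kfd V" and ind: "independent_family V f J" and J: "finite J" and card: "card J = kdim V"
  shows "spanning_family V f J"
proof (rule ccontr)
  assume "\<not> ?thesis"
  then obtain x where "x \<in> carrier V" "\<nexists>c. x = lcomb V f c J"
    using ind unfolding spanning_family_def independent_family_def by blast
  then have "card (insert None (Some ` J)) \<le> kdim V"
    using independent_family_card_le[OF fd independent_family_extend[OF ind J]] J by simp
  then show False using J card by (simp add: card_image)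
qed

end

lemma klinI:
  fixes V :: "('k::field, 'x) module" and W :: "('k, 'y) module"
  assumes "kvs V" "kvs W"
    and "\<And>x. x \<in> carrier V \<Longrightarrow> f x \<in> carrier W"
    and "\<And>x y. x \<in> carrier V \<Longrightarrow> y \<in> carrier V \<Longrightarrow> f (x \<oplus>\<^bsub>V\<^esub> y) = f x \<oplus>\<^bsub>W\<^esub> f y"
    and "\<And>c x. x \<in> carrier V \<Longrightarrow> f (c \<odot>\<^bsub>V\<^esub> x) = c \<odot>\<^bsub>W\<^esub> f x"
  shows "klin V W f"
proof -
  interpret V: vectorspace class_ring V by fact
  interpret W: vectorspace class_ring W by fact
  have "f \<in> LinearCombinations.module_hom class_ring V W"
    unfolding LinearCombinations.module_hom_def using assms(3-5) by simp
  then show ?thesis by unfold_locales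
qed

lemma klinD:
  fixes V :: "('k::field, 'x) module" and W :: "('k, 'y) module"
  assumes "klin V W f"
  shows "kvs V" "kvs W" "x \<in> carrier V \<Longrightarrow> f x \<in> carrier W"
    and "x \<in> carrier V \<Longrightarrow> y \<in> carrier V \<Longrightarrow> f (x \<oplus>\<^bsub>V\<^esub> y) = f x \<oplus>\<^bsub>W\<^esub> f y"
    and "x \<in> carrier V \<Longrightarrow> f (c \<odot>\<^bsub>V\<^esub> x) = c \<odot>\<^bsub>W\<^esub> f x"
    and "f \<zero>\<^bsub>V\<^esub> = \<zero>\<^bsub>W\<^esub>"
proof -
  interpret linear_map class_ring V W f by fact
  show "kvs V" "kvs W" "x \<in> carrier V \<Longrightarrow> f x \<in> carrier W"
    "x \<in> carrier V \<Longrightarrow> y \<in> carrier V \<Longrightarrow> f (x \<oplus>\<^bsub>V\<^esub> y) = f x \<oplus>\<^bsub>W\<^esub> f y"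
    "x \<in> carrier V \<Longrightarrow> f (c \<odot>\<^bsub>V\<^esub> x) = c \<odot>\<^bsub>W\<^esub> f x"
    "f \<zero>\<^bsub>V\<^esub> = \<zero>\<^bsub>W\<^esub>"
    using T_smult[of c x] by (auto simp: V.vectorspace_axioms W.vectorspace_axioms)
qed

lemma klin_finsum:
  fixes V :: "('k::field, 'x) module" and W :: "('k, 'y) module"
  assumes f: "klin V W f" and g: "g \<in> I \<rightarrow> carrier V"
  shows "f (\<Oplus>\<^bsub>V\<^esub>i\<in>I. g i) = (\<Oplus>\<^bsub>W\<^esub>i\<in>I. f (g i))"
proof -
  interpret V: abelian_group V by (rule kvs_abelian_group[OF klinD(1)[OF f]])
  interpret W: abelian_group W by (rule kvs_abelian_group[OF klinD(2)[OF f]])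
  show ?thesis using g
    by (induction I rule: infinite_finite_induct)
       (simp_all add: Pi_def V.finsum_closed klinD[OF f])
qed

lemma klin_lcomb:
  fixes V :: "('k::field, 'x) module" and W :: "('k, 'y) module"
  assumes f: "klin V W f" and b: "b \<in> I \<rightarrow> carrier V"
  shows "f (lcomb V b c I) = lcomb W (f \<circ> b) c I"
proof -
  interpret W: abelian_group W by (rule kvs_abelian_group[OF klinD(2)[OF f]])
  have "f (lcomb V b c I) = (\<Oplus>\<^bsub>W\<^esub>i\<in>I. f (c i \<odot>\<^bsub>V\<^esub> b i))"
    unfolding lcomb_def using b kvs_simps(1)[OF klinD(1)[OF f]] by (intro klin_finsum[OF f]) auto
  also have "\<dots> = lcomb W (f \<circ> b) c I"
    unfolding lcomb_def using b klinD[OF f] kvs_simps(1)[OF klinD(2)[OF f]]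
    by (intro W.finsum_cong') (auto simp: Pi_def)
  finally show ?thesis .
qed

lemma ksubI:
  fixes V :: "('k::field, 'x) module"
  assumes "kvs V" "W \<subseteq> carrier V" "\<zero>\<^bsub>V\<^esub> \<in> W"
    "\<And>x y. x \<in> W \<Longrightarrow> y \<in> W \<Longrightarrow> x \<oplus>\<^bsub>V\<^esub> y \<in> W"
    "\<And>c x. x \<in> W \<Longrightarrow> c \<odot>\<^bsub>V\<^esub> x \<in> W"
  shows "ksub W V"
proof -
  interpret V: vectorspace class_ring V by fact
  show ?thesis
    by (intro subspace.intro submodule.intro assms V.module_axioms)
qed

lemma ksubD:
  fixes V :: "('k::field, 'x) module"
  assumes "ksub W V"
  shows "kvs V" "W \<subseteq> carrier V" "\<zero>\<^bsub>V\<^esub> \<in> W"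
    "\<And>x y. x \<in> W \<Longrightarrow> y \<in> W \<Longrightarrow> x \<oplus>\<^bsub>V\<^esub> y \<in> W"
    "\<And>c x. x \<in> W \<Longrightarrow> c \<odot>\<^bsub>V\<^esub> x \<in> W"
    "kvs (V\<lparr>carrier := W\<rparr>)"
proof -
  interpret S: VectorSpace.subspace class_ring W V by fact
  interpret V: vectorspace class_ring V by (rule S.vs)
  interpret M: submodule class_ring W V by (rule S.submod)
  show "kvs V" "W \<subseteq> carrier V" "\<zero>\<^bsub>V\<^esub> \<in> W"
    "\<And>x y. x \<in> W \<Longrightarrow> y \<in> W \<Longrightarrow> x \<oplus>\<^bsub>V\<^esub> y \<in> W"
    "\<And>c x. x \<in> W \<Longrightarrow> c \<odot>\<^bsub>V\<^esub> x \<in> W"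
    using M.subset M.smult_closed by (auto simp: S.vs)
  show "kvs (V\<lparr>carrier := W\<rparr>)" by (rule V.subspace_is_vs[OF assms])
qed

lemma finsum_subspace:
  fixes V :: "('k::field, 'x) module"
  assumes W: "ksub W V" and f: "f \<in> I \<rightarrow> W"
  shows "(\<Oplus>\<^bsub>V\<lparr>carrier := W\<rparr>\<^esub>i\<in>I. f i) = (\<Oplus>\<^bsub>V\<^esub>i\<in>I. f i)" "(\<Oplus>\<^bsub>V\<^esub>i\<in>I. f i) \<in> W"
proof -
  let ?W = "V\<lparr>carrier := W\<rparr>"
  interpret V: vectorspace class_ring V by (rule ksubD[OF W])
  interpret W: vectorspace class_ring ?W by (rule ksubD[OF W])
  have WV: "W \<subseteq> carrier V" by (rule ksubD[OF W])
  show eq: "(\<Oplus>\<^bsub>?W\<^esub>i\<in>I. f i) = (\<Oplus>\<^bsub>V\<^esub>i\<in>I. f i)" using f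
  proof (induction I rule: infinite_finite_induct)
    case (insert x F)
    have "f \<in> F \<rightarrow> carrier V" "f x \<in> carrier V" using insert WV by auto
    then show ?case using insert by (simp add: W.M.finsum_insert V.M.finsum_insert)
  qed simp_all
  show "(\<Oplus>\<^bsub>V\<^esub>i\<in>I. f i) \<in> W"
    using W.M.finsum_closed[of f I] f unfolding eq by simp
qed

lemma lcomb_subspace:
  fixes V :: "('k::field, 'x) module"
  assumes W: "ksub W V" and f: "b \<in> I \<rightarrow> W"
  shows "lcomb (V\<lparr>carrier := W\<rparr>) b c I = lcomb V b c I" "lcomb V b c I \<in> W"
proof -
  have "(\<lambda>i. c i \<odot>\<^bsub>V\<^esub> b i) \<in> I \<rightarrow> W" using f ksubD(5)[OF W] by auto
  from finsum_subspace[OF W this] show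
    "lcomb (V\<lparr>carrier := W\<rparr>) b c I = lcomb V b c I" "lcomb V b c I \<in> W"
    unfolding lcomb_def by simp_all
qed

lemma subspace_fd:
  fixes V :: "('k::field, 'x) module"
  assumes fd: "kfd V" and W: "ksub W V"
  shows "kfd (V\<lparr>carrier := W\<rparr>)" "kdim (V\<lparr>carrier := W\<rparr>) \<le> kdim V"
    "kdim (V\<lparr>carrier := W\<rparr>) = kdim V \<Longrightarrow> W = carrier V"
proof -
  let ?W = "V\<lparr>carrier := W\<rparr>"
  note V = ksubD(1)[OF W] note Wv = ksubD(6)[OF W] note WV = ksubD(2)[OF W]
  have trans: "independent_family V b I" if b: "independent_family ?W b I" for b :: "nat \<Rightarrow> 'x" and I
  proof -
    have bW: "b \<in> I \<rightarrow> W" using b unfolding independent_family_def by simp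
    show ?thesis
      using b bW WV lcomb_subspace[OF W bW] unfolding independent_family_def by auto
  qed
  define n where "n = (GREATEST n. \<exists>b::nat\<Rightarrow>'x. independent_family ?W b {..<n})"
  have "\<exists>b::nat\<Rightarrow>'x. independent_family ?W b {..<0}" unfolding independent_family_def by auto
  moreover have bound: "m \<le> kdim V" if "\<exists>b::nat\<Rightarrow>'x. independent_family ?W b {..<m}" for m
    using that trans independent_family_card_le[OF V fd, of _ "{..<m}"] by auto
  ultimately obtain b :: "nat \<Rightarrow> 'x" where b: "independent_family ?W b {..<n}"
    unfolding n_def using GreatestI_nat[of "\<lambda>n. \<exists>b::nat\<Rightarrow>'x. independent_family ?W b {..<n}" 0 "kdim V"] by blast
  have bc: "b \<in> {..<n} \<rightarrow> W" using b unfolding independent_family_def by simp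
  have span: "spanning_family ?W b {..<n}"
  proof (rule ccontr)
    assume "\<not> ?thesis"
    then obtain x where x: "x \<in> carrier ?W" "\<nexists>c. x = lcomb ?W b c {..<n}"
      using bc unfolding spanning_family_def by auto
    note ext = independent_family_extend[OF Wv b _ x]
    let ?g = "case_option x b" and ?I = "insert None (Some ` {..<n})"
    let ?h = "\<lambda>k. if k = n then None else Some k"
    have bij: "bij_betw ?h {..<Suc n} ?I"
      unfolding bij_betw_def by (auto simp: inj_on_def image_def)
    have "independent_family ?W (?g \<circ> ?h) {..<Suc n}"
      by (rule independent_family_reindex[OF Wv bij ext]) simp
    then have "Suc n \<le> n" unfolding n_def
      by (intro Greatest_le_nat[of _ _ "kdim V"]) (auto intro: bound simp: n_def)
    then show False by simp
  qed
  show "kfd ?W" using spanning_family_dim[OF Wv span] by simp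
  have dim: "kdim ?W = n" using frame_dim[OF Wv b span] by simp
  show "kdim ?W \<le> kdim V" using independent_family_card_le[OF V fd trans[OF b]] dim by simp
  assume "kdim ?W = kdim V"
  then have "spanning_family V b {..<n}"
    using independent_family_full_spanning[OF V fd trans[OF b]] dim by simp
  then have "carrier V \<subseteq> W"
    using lcomb_subspace(2)[OF W bc] unfolding spanning_family_def by auto
  then show "W = carrier V" using WV by simp
qed

section \<open>Coordinate spaces and sums of linear maps\<close>

lemma vec_space_simps [simp]:
  "carrier (module_vec TYPE('k::field) n) = carrier_vec n"
  "\<zero>\<^bsub>module_vec TYPE('k) n\<^esub> = 0\<^sub>v n"
  "x \<oplus>\<^bsub>module_vec TYPE('k) n\<^esub> y = x + y"
  "c \<odot>\<^bsub>module_vec TYPE('k) n\<^esub> x = c \<cdot>\<^sub>v x"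
  by (simp_all add: module_vec_def)

lemma kvs_module_vec: "kvs (module_vec TYPE('k::field) n)"
  by (rule vec_vs)

lemma finsum_vec_index:
  assumes "f \<in> I \<rightarrow> carrier_vec n" "p < n"
  shows "(\<Oplus>\<^bsub>module_vec TYPE('k::field) n\<^esub>i\<in>I. f i) $ p = (\<Sum>i\<in>I. f i $ p)"
proof -
  interpret V: abelian_group "module_vec TYPE('k) n" by (rule kvs_abelian_group[OF kvs_module_vec])
  have cl: "(\<Oplus>\<^bsub>module_vec TYPE('k) n\<^esub>i\<in>F. f i) \<in> carrier_vec n" if "F \<subseteq> I" for F
    using V.finsum_closed[of f F] assms that by auto
  show ?thesis using assms(1) cl
  proof (induction I rule: infinite_finite_induct)
    case (insert x F)
    have "(\<Oplus>\<^bsub>module_vec TYPE('k) n\<^esub>i\<in>insert x F. f i) = f x + (\<Oplus>\<^bsub>module_vec TYPE('k) n\<^esub>i\<in>F. f i)"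
      using insert by (subst V.finsum_insert) auto
    moreover have "dim_vec (\<Oplus>\<^bsub>module_vec TYPE('k) n\<^esub>i\<in>F. f i) = n"
      using insert.prems(2)[of F] by (auto dest: carrier_vecD)
    moreover have "dim_vec (f x) = n" using insert.prems(1) by (auto dest: carrier_vecD)
    moreover have "(\<Oplus>\<^bsub>module_vec TYPE('k) n\<^esub>i\<in>F. f i) $ p = (\<Sum>i\<in>F. f i $ p)"
      by (rule insert.IH) (use insert.prems in auto)
    ultimately show ?case using insert.hyps assms(2) by simp
  qed (use assms(2) in auto)
qed

lemma lcomb_vec_index:
  assumes "b \<in> I \<rightarrow> carrier_vec n" "p < n"
  shows "lcomb (module_vec TYPE('k::field) n) b c I $ p = (\<Sum>i\<in>I. c i * b i $ p)"
  unfolding lcomb_def vec_space_simps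
  by (subst finsum_vec_index) (use assms in \<open>auto intro!: sum.cong simp: Pi_def carrier_vecD\<close>)

lemma lcomb_vec_closed:
  "b \<in> I \<rightarrow> carrier_vec n \<Longrightarrow> lcomb (module_vec TYPE('k::field) n) b c I \<in> carrier_vec n"
  using lcomb_closed[OF kvs_module_vec, of b I n c] by simp

lemma lcomb_unit_vec:
  assumes "finite I" "\<And>i. i \<in> I \<Longrightarrow> i < n" 
  shows "lcomb (module_vec TYPE('k::field) n) (unit_vec n) c I = vec n (\<lambda>i. if i \<in> I then c i else 0)"
proof (rule eq_vecI)
  have u: "(unit_vec n :: nat \<Rightarrow> 'k vec) \<in> I \<rightarrow> carrier_vec n" by auto
  show "dim_vec (lcomb (module_vec TYPE('k) n) (unit_vec n) c I) = dim_vec (vec n (\<lambda>i. if i \<in> I then c i else 0))"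
    using lcomb_vec_closed[OF u] by (simp add: carrier_vecD)
  fix p assume "p < dim_vec (vec n (\<lambda>i. if i \<in> I then c i else 0))"
  then have p: "p < n" by simp
  have "lcomb (module_vec TYPE('k) n) (unit_vec n) c I $ p = (\<Sum>i\<in>I. c i * unit_vec n i $ p)"
    by (rule lcomb_vec_index[OF u p])
  also have "\<dots> = (\<Sum>i\<in>I. if i = p then c i else 0)"
    using assms(2) p by (intro sum.cong) (auto simp: unit_vec_def)
  also have "\<dots> = (if p \<in> I then c p else 0)" using assms(1) by simp
  finally show "lcomb (module_vec TYPE('k) n) (unit_vec n) c I $ p = vec n (\<lambda>i. if i \<in> I then c i else 0) $ p"
    using p by simp
qed

lemma unit_vec_frame:
  "independent_family (module_vec TYPE('k::field) n) (unit_vec n) {..<n}"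
  "spanning_family (module_vec TYPE('k) n) (unit_vec n) {..<n}"
proof -
  have l: "lcomb (module_vec TYPE('k) n) (unit_vec n) c {..<n} = vec n c" for c
    by (subst lcomb_unit_vec) (auto intro!: eq_vecI)
  show "independent_family (module_vec TYPE('k) n) (unit_vec n) {..<n}"
    unfolding independent_family_def l
  proof (intro conjI allI impI ballI)
    fix c :: "nat \<Rightarrow> 'k" and i assume "vec n c = \<zero>\<^bsub>module_vec TYPE('k) n\<^esub>" "i \<in> {..<n}"
    then have "vec n c $ i = 0\<^sub>v n $ i" "i < n" by simp_all
    then show "c i = 0" by simp
  qed auto
  show "spanning_family (module_vec TYPE('k) n) (unit_vec n) {..<n}"
    unfolding spanning_family_def l
  proof (intro conjI ballI)
    fix x assume "x \<in> carrier (module_vec TYPE('k) n)"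
    then have "x = vec n (\<lambda>i. x $ i)" by auto
    then show "\<exists>c. x = vec n c" by blast
  qed auto
qed

lemma module_vec_dim: "kfd (module_vec TYPE('k::field) n)" "kdim (module_vec TYPE('k) n) = n"
  by (rule spanning_family_dim(1)[OF kvs_module_vec unit_vec_frame(2)], simp)
    (use frame_dim[OF kvs_module_vec unit_vec_frame] in simp)

lemma klin_bij_dim:
  fixes V :: "('k::field, 'x) module" and W :: "('k, 'y) module"
  assumes f: "klin V W f" and bij: "bij_betw f (carrier V) (carrier W)" and fd: "kfd V"
  shows "kfd W" "kdim W = kdim V"
proof -
  interpret linear_map class_ring V W f by fact
  have im: "f ` carrier V = carrier W" "inj_on f (carrier V)" using bij by (auto simp: bij_betw_def)
  show "kfd W" by (rule surj_fin_dim[OF fd im(1)])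
  show "kdim W = kdim V" by (rule dim_eq[OF fd im(2,1), symmetric])
qed

lemma klin_inv:
  fixes V :: "('k::field, 'x) module" and W :: "('k, 'y) module"
  assumes f: "klin V W f" and bij: "bij_betw f (carrier V) (carrier W)"
  shows "klin W V (inv_into (carrier V) f)"
proof -
  let ?g = "inv_into (carrier V) f"
  have g: "?g y \<in> carrier V" "f (?g y) = y" if "y \<in> carrier W" for y
    using bij that by (auto simp: bij_betw_def inv_into_into f_inv_into_f)
  have gf: "?g (f x) = x" if "x \<in> carrier V" for x
    using bij that by (auto simp: bij_betw_def)
  note V = klinD(1)[OF f] and W = klinD(2)[OF f]
  show ?thesis
  proof (rule klinI[OF W V])
    fix x y assume xy: "x \<in> carrier W" "y \<in> carrier W"
    have "?g (x \<oplus>\<^bsub>W\<^esub> y) = ?g (f (?g x \<oplus>\<^bsub>V\<^esub> ?g y))"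
      using xy g klinD(4)[OF f] by simp
    then show "?g (x \<oplus>\<^bsub>W\<^esub> y) = ?g x \<oplus>\<^bsub>V\<^esub> ?g y" using gf xy g kvs_simps(6)[OF V] by simp
  next
    fix c x assume x: "x \<in> carrier W"
    have "?g (c \<odot>\<^bsub>W\<^esub> x) = ?g (f (c \<odot>\<^bsub>V\<^esub> ?g x))"
      using x g klinD(5)[OF f] by simp
    then show "?g (c \<odot>\<^bsub>W\<^esub> x) = c \<odot>\<^bsub>V\<^esub> ?g x" using gf x g kvs_simps(1)[OF V] by simp
  qed (rule g)
qed

lemma klin_restrict:
  fixes V :: "('k::field, 'x) module" and W :: "('k, 'y) module"
  assumes f: "klin V W f" and S: "ksub S V" and T: "ksub T W" and ST: "f ` S \<subseteq> T"
  shows "klin (V\<lparr>carrier := S\<rparr>) (W\<lparr>carrier := T\<rparr>) f"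
proof (rule klinI[OF ksubD(6)[OF S] ksubD(6)[OF T]])
  note S' = ksubD(2)[OF S]
  show "f x \<in> carrier (W\<lparr>carrier := T\<rparr>)" if "x \<in> carrier (V\<lparr>carrier := S\<rparr>)" for x
    using that ST by auto
  fix x y c assume "x \<in> carrier (V\<lparr>carrier := S\<rparr>)"
  then have x: "x \<in> carrier V" using S' by auto
  then show "f (c \<odot>\<^bsub>V\<lparr>carrier := S\<rparr>\<^esub> x) = c \<odot>\<^bsub>W\<lparr>carrier := T\<rparr>\<^esub> f x"
    using klinD(5)[OF f] by simp
  assume "y \<in> carrier (V\<lparr>carrier := S\<rparr>)"
  then have "y \<in> carrier V" using S' by auto
  with x show "f (x \<oplus>\<^bsub>V\<lparr>carrier := S\<rparr>\<^esub> y) = f x \<oplus>\<^bsub>W\<lparr>carrier := T\<rparr>\<^esub> f y"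
    using klinD(4)[OF f] by simp
qed

lemma ksub_vimage:
  fixes V :: "('k::field, 'x) module" and W :: "('k, 'y) module"
  assumes f: "klin V W f" and T: "ksub T W"
  shows "ksub {x \<in> carrier V. f x \<in> T} V"
  using klinD(3-6)[OF f] kvs_simps(1,5,6)[OF klinD(1)[OF f]] ksubD(3,4,5)[OF T]
  by (intro ksubI[OF klinD(1)[OF f]]) simp_all

lemma ksub_image:
  fixes V :: "('k::field, 'x) module" and W :: "('k, 'y) module"
  assumes f: "klin V W f" and S: "ksub S V"
  shows "ksub (f ` S) W"
proof (rule ksubI[OF klinD(2)[OF f]])
  note SV = subsetD[OF ksubD(2)[OF S]]
  show "f ` S \<subseteq> carrier W" using SV klinD(3)[OF f] by auto
  show "\<zero>\<^bsub>W\<^esub> \<in> f ` S" using klinD(6)[OF f] ksubD(3)[OF S] by (metis imageI)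
  fix x y c
  show "x \<oplus>\<^bsub>W\<^esub> y \<in> f ` S" if xy: "x \<in> f ` S" "y \<in> f ` S"
  proof -
    from xy obtain x' y' where "x' \<in> S" "y' \<in> S" "x = f x'" "y = f y'" by blast
    then have "x \<oplus>\<^bsub>W\<^esub> y = f (x' \<oplus>\<^bsub>V\<^esub> y')" "x' \<oplus>\<^bsub>V\<^esub> y' \<in> S"
      using SV klinD(4)[OF f] ksubD(4)[OF S] by auto
    then show ?thesis by blast
  qed
  show "c \<odot>\<^bsub>W\<^esub> x \<in> f ` S" if x: "x \<in> f ` S"
  proof -
    from x obtain x' where "x' \<in> S" "x = f x'" by blast
    then have "c \<odot>\<^bsub>W\<^esub> x = f (c \<odot>\<^bsub>V\<^esub> x')" "c \<odot>\<^bsub>V\<^esub> x' \<in> S"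
      using SV klinD(5)[OF f] ksubD(5)[OF S] by auto
    then show ?thesis by blast
  qed
qed

lemma kdim_zero:
  fixes V :: "('k::field, 'x) module"
  assumes "kvs V" "carrier V = {\<zero>\<^bsub>V\<^esub>}"
  shows "kfd V" "kdim V = 0"
proof -
  have "spanning_family V (undefined :: nat \<Rightarrow> 'x) {}"
    unfolding spanning_family_def using assms lcomb_zero[OF assms(1), of "undefined :: nat \<Rightarrow> 'x" "{}"]
    by (auto intro!: exI)
  from spanning_family_dim[OF assms(1) this] show "kfd V" "kdim V = 0" by simp_all
qed

lemma kdim_zeroD:
  fixes V :: "('k::field, 'x) module"
  assumes V: "kvs V" "kfd V" "kdim V = 0"
  shows "carrier V = {\<zero>\<^bsub>V\<^esub>}"
proof -
  obtain b where b: "spanning_family V b {..<kdim V}" using frame_exists[OF V(1,2)] by blast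
  then have "x = \<zero>\<^bsub>V\<^esub>" if "x \<in> carrier V" for x
    using that lcomb_zero[OF V(1), of b "{}"] unfolding spanning_family_def V(3) by force
  then show ?thesis using kvs_simps(5)[OF V(1)] by blast
qed

lemma finsum_Sigma:
  assumes V: "abelian_group V" and S: "finite S" "\<And>s. s \<in> S \<Longrightarrow> finite (T s)"
    and f: "\<And>s t. s \<in> S \<Longrightarrow> t \<in> T s \<Longrightarrow> f (s, t) \<in> carrier V"
  shows "(\<Oplus>\<^bsub>V\<^esub>p\<in>Sigma S T. f p) = (\<Oplus>\<^bsub>V\<^esub>s\<in>S. \<Oplus>\<^bsub>V\<^esub>t\<in>T s. f (s, t))"
proof -
  interpret V: abelian_group V by fact
  show ?thesis using S f
  proof (induction S rule: finite_induct)
    case (insert s S)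
    have "Sigma (insert s S) T = Pair s ` T s \<union> Sigma S T" by auto
    then have "(\<Oplus>\<^bsub>V\<^esub>p\<in>Sigma (insert s S) T. f p)
        = (\<Oplus>\<^bsub>V\<^esub>p\<in>Pair s ` T s. f p) \<oplus>\<^bsub>V\<^esub> (\<Oplus>\<^bsub>V\<^esub>p\<in>Sigma S T. f p)"
      using insert by (simp only:) (rule V.finsum_Un_disjoint, auto)
    also have "(\<Oplus>\<^bsub>V\<^esub>p\<in>Pair s ` T s. f p) = (\<Oplus>\<^bsub>V\<^esub>t\<in>T s. f (s, t))"
      using insert by (intro V.finsum_reindex) (auto simp: inj_on_def)
    finally show ?case using insert by (simp add: V.finsum_insert Pi_def V.finsum_closed)
  qed simp
qed

text \<open>The map from a finite direct sum of spaces \<open>W s\<close> to \<open>V\<close> that is given by linear maps \<open>f s\<close>. It is never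
  made into a map on a direct sum object: \<open>total\<close> acts on families, and \<open>total_frame\<close> transports bases of
  the \<open>W s\<close> into one family in \<open>V\<close>, whose independence or spanning gives the dimension estimates.\<close>

locale direct_sum_map =
  fixes S :: "'s set" and W :: "'s \<Rightarrow> ('k::field, 'x) module" and V :: "('k, 'y) module"
    and f :: "'s \<Rightarrow> 'x \<Rightarrow> 'y"
  assumes finite_S: "finite S" and lin: "\<And>s. s \<in> S \<Longrightarrow> klin (W s) V (f s)"
    and fd_W: "\<And>s. s \<in> S \<Longrightarrow> kfd (W s)" and V: "kvs V"
begin

definition total :: "('s \<Rightarrow> 'x) \<Rightarrow> 'y" where
  "total x = (\<Oplus>\<^bsub>V\<^esub>s\<in>S. f s (x s))"

lemma total_frame:
  obtains b where "\<And>c. lcomb V (\<lambda>(s, q). f s (b s q)) c (SIGMA s:S. {..<kdim (W s)})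
        = total (\<lambda>s\<in>S. lcomb (W s) (b s) (\<lambda>q. c (s, q)) {..<kdim (W s)})"
    and "\<And>s. s \<in> S \<Longrightarrow> independent_family (W s) (b s) {..<kdim (W s)}"
    and "\<And>s. s \<in> S \<Longrightarrow> spanning_family (W s) (b s) {..<kdim (W s)}"
    and "(\<lambda>(s, q). f s (b s q)) \<in> (SIGMA s:S. {..<kdim (W s)}) \<rightarrow> carrier V"
proof -
  have "\<forall>s\<in>S. \<exists>b. independent_family (W s) b {..<kdim (W s)} \<and> spanning_family (W s) b {..<kdim (W s)}"
    using frame_exists[OF klinD(1)[OF lin] fd_W] by blast
  then obtain b where b: "\<And>s. s \<in> S \<Longrightarrow> independent_family (W s) (b s) {..<kdim (W s)}"
      "\<And>s. s \<in> S \<Longrightarrow> spanning_family (W s) (b s) {..<kdim (W s)}"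
    by metis
  have bc: "b s \<in> {..<kdim (W s)} \<rightarrow> carrier (W s)" if "s \<in> S" for s
    using b(1)[OF that] unfolding independent_family_def by blast
  have fb: "f s (b s q) \<in> carrier V" if "s \<in> S" "q < kdim (W s)" for s q
    using bc[OF that(1)] that klinD(3)[OF lin[OF that(1)]] by auto
  interpret V: abelian_group V by (rule kvs_abelian_group[OF V])
  have "lcomb V (\<lambda>(s, q). f s (b s q)) c (SIGMA s:S. {..<kdim (W s)})
      = total (\<lambda>s\<in>S. lcomb (W s) (b s) (\<lambda>q. c (s, q)) {..<kdim (W s)})" for c
  proof -
    have "lcomb V (\<lambda>(s, q). f s (b s q)) c (SIGMA s:S. {..<kdim (W s)})
       = (\<Oplus>\<^bsub>V\<^esub>s\<in>S. lcomb V (f s \<circ> b s) (\<lambda>q. c (s, q)) {..<kdim (W s)})"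
      unfolding lcomb_def
      by (subst finsum_Sigma[OF V.abelian_group_axioms finite_S])
         (auto intro!: V.finsum_cong' V.finsum_closed kvs_simps(1)[OF V] fb)
    also have "\<dots> = total (\<lambda>s\<in>S. lcomb (W s) (b s) (\<lambda>q. c (s, q)) {..<kdim (W s)})"
      unfolding total_def
    proof (rule V.finsum_cong'[OF refl])
      show "(\<lambda>s. f s ((\<lambda>s\<in>S. lcomb (W s) (b s) (\<lambda>q. c (s, q)) {..<kdim (W s)}) s)) \<in> S \<rightarrow> carrier V"
        using lcomb_closed[OF klinD(1)[OF lin] bc] klinD(3)[OF lin] by auto
      fix s assume s: "s \<in> S"
      show "lcomb V (f s \<circ> b s) (\<lambda>q. c (s, q)) {..<kdim (W s)}
        = f s ((\<lambda>s\<in>S. lcomb (W s) (b s) (\<lambda>q. c (s, q)) {..<kdim (W s)}) s)"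
        using s klin_lcomb[OF lin[OF s] bc[OF s]] by simp
    qed
    finally show ?thesis .
  qed
  with b fb show thesis by (intro that[of b]) auto
qed

lemma sum_dim_le:
  assumes inj: "\<And>x. x \<in> (\<Pi>\<^sub>E s\<in>S. carrier (W s)) \<Longrightarrow> total x = \<zero>\<^bsub>V\<^esub> \<Longrightarrow> \<forall>s\<in>S. x s = \<zero>\<^bsub>W s\<^esub>"
    and fd: "kfd V"
  shows "(\<Sum>s\<in>S. kdim (W s)) \<le> kdim V"
    and "(\<Sum>s\<in>S. kdim (W s)) = kdim V \<Longrightarrow> y \<in> carrier V \<Longrightarrow>
      \<exists>x\<in>(\<Pi>\<^sub>E s\<in>S. carrier (W s)). total x = y"
proof -
  obtain b where b: "\<And>c. lcomb V (\<lambda>(s, q). f s (b s q)) c (SIGMA s:S. {..<kdim (W s)})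
        = total (\<lambda>s\<in>S. lcomb (W s) (b s) (\<lambda>q. c (s, q)) {..<kdim (W s)})"
    and ind: "\<And>s. s \<in> S \<Longrightarrow> independent_family (W s) (b s) {..<kdim (W s)}"
    and cl: "(\<lambda>(s, q). f s (b s q)) \<in> (SIGMA s:S. {..<kdim (W s)}) \<rightarrow> carrier V"
    by (rule total_frame) blast
  let ?I = "SIGMA s:S. {..<kdim (W s)}"
  have P: "(\<lambda>s\<in>S. lcomb (W s) (b s) (\<lambda>q. c (s, q)) {..<kdim (W s)}) \<in> (\<Pi>\<^sub>E s\<in>S. carrier (W s))" for c
    using ind by (auto intro!: lcomb_closed[OF klinD(1)[OF lin]] simp: independent_family_def)
  have I: "independent_family V (\<lambda>(s, q). f s (b s q)) ?I"
    unfolding independent_family_def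
  proof (intro conjI allI impI ballI cl)
    fix c p assume c: "lcomb V (\<lambda>(s, q). f s (b s q)) c ?I = \<zero>\<^bsub>V\<^esub>" and p: "p \<in> ?I"
    then obtain s q where p: "p = (s, q)" "s \<in> S" "q < kdim (W s)" by auto
    have "lcomb (W s) (b s) (\<lambda>q. c (s, q)) {..<kdim (W s)} = \<zero>\<^bsub>W s\<^esub>"
      using inj[OF P[of c]] c p(2) unfolding b by auto
    then show "c p = 0" using ind[OF p(2)] p unfolding independent_family_def by auto
  qed
  have fin: "finite ?I" "card ?I = (\<Sum>s\<in>S. kdim (W s))" using finite_S by auto
  show "(\<Sum>s\<in>S. kdim (W s)) \<le> kdim V"
    using independent_family_card_le[OF V fd I] fin by simp
  assume "(\<Sum>s\<in>S. kdim (W s)) = kdim V" and y: "y \<in> carrier V"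
  then have "spanning_family V (\<lambda>(s, q). f s (b s q)) ?I"
    using independent_family_full_spanning[OF V fd I fin(1)] fin(2) by simp
  then obtain c where "y = lcomb V (\<lambda>(s, q). f s (b s q)) c ?I"
    using y unfolding spanning_family_def by blast
  then show "\<exists>x\<in>(\<Pi>\<^sub>E s\<in>S. carrier (W s)). total x = y" unfolding b using P by blast
qed

lemma dim_le_sum:
  assumes surj: "\<And>y. y \<in> carrier V \<Longrightarrow> \<exists>x\<in>(\<Pi>\<^sub>E s\<in>S. carrier (W s)). total x = y"
  shows "kfd V" "kdim V \<le> (\<Sum>s\<in>S. kdim (W s))"
proof -
  obtain b where b: "\<And>c. lcomb V (\<lambda>(s, q). f s (b s q)) c (SIGMA s:S. {..<kdim (W s)})
        = total (\<lambda>s\<in>S. lcomb (W s) (b s) (\<lambda>q. c (s, q)) {..<kdim (W s)})"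
    and sp: "\<And>s. s \<in> S \<Longrightarrow> spanning_family (W s) (b s) {..<kdim (W s)}"
    and cl: "(\<lambda>(s, q). f s (b s q)) \<in> (SIGMA s:S. {..<kdim (W s)}) \<rightarrow> carrier V"
    by (rule total_frame) blast
  let ?I = "SIGMA s:S. {..<kdim (W s)}"
  have I: "spanning_family V (\<lambda>(s, q). f s (b s q)) ?I"
    unfolding spanning_family_def
  proof (intro conjI ballI cl)
    fix y assume "y \<in> carrier V"
    then obtain x where x: "x \<in> (\<Pi>\<^sub>E s\<in>S. carrier (W s))" "total x = y" using surj by blast
    have "\<forall>s\<in>S. \<exists>c. x s = lcomb (W s) (b s) c {..<kdim (W s)}"
      using sp x(1) unfolding spanning_family_def by (auto simp: PiE_def Pi_def)
    then obtain c where c: "\<And>s. s \<in> S \<Longrightarrow> x s = lcomb (W s) (b s) (c s) {..<kdim (W s)}" by metis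
    have "x = (\<lambda>s\<in>S. lcomb (W s) (b s) (\<lambda>q. (\<lambda>(s, q). c s q) (s, q)) {..<kdim (W s)})"
      using x(1) c by (intro ext) (auto simp: PiE_def extensional_def restrict_def)
    then show "\<exists>c. y = lcomb V (\<lambda>(s, q). f s (b s q)) c ?I"
      unfolding b using x(2) by (intro exI[of _ "\<lambda>(s, q). c s q"]) simp
  qed
  have fin: "finite ?I" "card ?I = (\<Sum>s\<in>S. kdim (W s))" using finite_S by auto
  show "kfd V" by (rule spanning_family_dim(1)[OF V I fin(1)])
  show "kdim V \<le> (\<Sum>s\<in>S. kdim (W s))" using spanning_family_dim(2)[OF V I fin(1)] unfolding fin(2) .
qed

end

section \<open>Quiver representations up to isomorphism\<close>

lemma kvs_diff_zero:
  fixes U :: "('k::field, 'z) module"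
  assumes U: "kvs U" and ab: "a \<in> carrier U" "b \<in> carrier U"
  shows "a \<oplus>\<^bsub>U\<^esub> (-1) \<odot>\<^bsub>U\<^esub> b = \<zero>\<^bsub>U\<^esub> \<longleftrightarrow> a = b"
proof -
  interpret U: abelian_group U by (rule kvs_abelian_group[OF U])
  have "b \<oplus>\<^bsub>U\<^esub> (-1) \<odot>\<^bsub>U\<^esub> b = (1 + (-1)) \<odot>\<^bsub>U\<^esub> b"
    using kvs_distrib(1)[OF U ab(2), of 1 "-1"] kvs_simps(2)[OF U ab(2)] by simp
  then have b0: "b \<oplus>\<^bsub>U\<^esub> (-1) \<odot>\<^bsub>U\<^esub> b = \<zero>\<^bsub>U\<^esub>" using kvs_simps(3)[OF U ab(2)] by simp
  have nb: "(-1) \<odot>\<^bsub>U\<^esub> b \<in> carrier U" by (rule kvs_simps(1)[OF U ab(2)])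
  show ?thesis
    using b0 U.add.right_cancel[OF nb ab] by metis
qed

lemma klin_injI:
  fixes V :: "('k::field, 'x) module" and W :: "('k, 'y) module"
  assumes f: "klin V W f" and z: "\<And>x. x \<in> carrier V \<Longrightarrow> f x = \<zero>\<^bsub>W\<^esub> \<Longrightarrow> x = \<zero>\<^bsub>V\<^esub>"
  shows "inj_on f (carrier V)"
proof (rule inj_onI)
  note V = klinD(1)[OF f] and W = klinD(2)[OF f]
  fix x y assume x: "x \<in> carrier V" and y: "y \<in> carrier V" and eq: "f x = f y"
  have ny: "(-1) \<odot>\<^bsub>V\<^esub> y \<in> carrier V" by (rule kvs_simps(1)[OF V y])
  have "f (x \<oplus>\<^bsub>V\<^esub> (-1) \<odot>\<^bsub>V\<^esub> y) = f y \<oplus>\<^bsub>W\<^esub> (-1) \<odot>\<^bsub>W\<^esub> f y"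
    by (simp only: klinD(4)[OF f x ny] klinD(5)[OF f y] eq)
  also have "\<dots> = \<zero>\<^bsub>W\<^esub>" using kvs_diff_zero[OF W klinD(3)[OF f y] klinD(3)[OF f y]] by simp
  finally have "x \<oplus>\<^bsub>V\<^esub> (-1) \<odot>\<^bsub>V\<^esub> y = \<zero>\<^bsub>V\<^esub>" by (rule z[OF kvs_simps(6)[OF V x ny]])
  then show "x = y" using kvs_diff_zero[OF V x y] by simp
qed

lemma klin_comp:
  fixes U :: "('k::field, 'x) module" and V :: "('k, 'y) module" and W :: "('k, 'z) module"
  assumes f: "klin U V f" and g: "klin V W g"
  shows "klin U W (\<lambda>x. g (f x))"
  by (rule klinI[OF klinD(1)[OF f] klinD(2)[OF g]]) (simp_all add: klinD(3-5)[OF f] klinD(3-5)[OF g])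

lemma fd_quiver_repD:
  assumes "fd_quiver_rep Q X"
  shows "v \<in> verts Q \<Longrightarrow> kvs (vspace X v)" "v \<in> verts Q \<Longrightarrow> kfd (vspace X v)"
    "e \<in> arcs Q \<Longrightarrow> klin (vspace X (tail Q e)) (vspace X (head Q e)) (amap X e)"
  using assms unfolding fd_quiver_rep_def by auto

lemma is_subrepD:
  assumes "is_subrep Q X W"
  shows "v \<in> verts Q \<Longrightarrow> ksub (W v) (vspace X v)"
    "e \<in> arcs Q \<Longrightarrow> x \<in> W (tail Q e) \<Longrightarrow> amap X e x \<in> W (head Q e)"
  using assms unfolding is_subrep_def by auto

lemma restrict_rep_simps [simp]:
  "vspace (restrict_rep X W) v = (vspace X v)\<lparr>carrier := W v\<rparr>"
  by (simp add: restrict_rep_def)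

lemma stable_repI:
  assumes "nonzero_rep Q X" "pairing Q \<theta> (dim_vec_rep X) = 0"
    and "\<And>W v0 v1. is_subrep Q X W \<Longrightarrow> v0 \<in> verts Q \<Longrightarrow> W v0 \<noteq> {\<zero>\<^bsub>vspace X v0\<^esub>} \<Longrightarrow>
       v1 \<in> verts Q \<Longrightarrow> W v1 \<noteq> carrier (vspace X v1) \<Longrightarrow>
       pairing Q \<theta> (dim_vec_rep (restrict_rep X W)) < 0"
  shows "stable_rep Q \<theta> X"
  using assms unfolding stable_rep_def nonzero_rep_def by auto

lemma stable_repD:
  assumes "stable_rep Q \<theta> X"
  shows "nonzero_rep Q X" "pairing Q \<theta> (dim_vec_rep X) = 0"
    and "is_subrep Q X W \<Longrightarrow> v0 \<in> verts Q \<Longrightarrow> W v0 \<noteq> {\<zero>\<^bsub>vspace X v0\<^esub>} \<Longrightarrow>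
       pairing Q \<theta> (dim_vec_rep (restrict_rep X W)) \<ge> 0 \<Longrightarrow>
       v1 \<in> verts Q \<Longrightarrow> W v1 = carrier (vspace X v1)"
  using assms unfolding stable_rep_def nonzero_rep_def restrict_rep_simps
  by (auto simp: not_less[symmetric])

lemma pairing_cong: "(\<And>v. v \<in> verts Q \<Longrightarrow> d v = d' v) \<Longrightarrow> pairing Q \<theta> d = pairing Q \<theta> d'"
  unfolding pairing_def by (intro sum.cong) auto

lemma rep_iso_sym:
  fixes X :: "('v, 'e, 'k::field, 'x) quiver_rep" and Y :: "('v, 'e, 'k, 'y) quiver_rep"
  assumes Q: "\<And>e. e \<in> arcs Q \<Longrightarrow> tail Q e \<in> verts Q \<and> head Q e \<in> verts Q"
    and X: "fd_quiver_rep Q X" and iso: "rep_iso Q X Y"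
  shows "rep_iso Q Y X"
proof -
  obtain \<phi> where \<phi>: "\<And>v. v \<in> verts Q \<Longrightarrow> klin (vspace X v) (vspace Y v) (\<phi> v)"
      "\<And>v. v \<in> verts Q \<Longrightarrow> bij_betw (\<phi> v) (carrier (vspace X v)) (carrier (vspace Y v))"
    and com: "\<And>e x. e \<in> arcs Q \<Longrightarrow> x \<in> carrier (vspace X (tail Q e)) \<Longrightarrow>
        \<phi> (head Q e) (amap X e x) = amap Y e (\<phi> (tail Q e) x)"
    using iso unfolding rep_iso_def by blast
  let ?\<psi> = "\<lambda>v. inv_into (carrier (vspace X v)) (\<phi> v)"
  show ?thesis
    unfolding rep_iso_def
  proof (intro exI[of _ ?\<psi>] conjI ballI)
    fix v assume v: "v \<in> verts Q"
    show "klin (vspace Y v) (vspace X v) (?\<psi> v)" by (rule klin_inv[OF \<phi>(1)[OF v] \<phi>(2)[OF v]])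
    show "bij_betw (?\<psi> v) (carrier (vspace Y v)) (carrier (vspace X v))"
      by (rule bij_betw_inv_into[OF \<phi>(2)[OF v]])
  next
    fix e y assume e: "e \<in> arcs Q" and y: "y \<in> carrier (vspace Y (tail Q e))"
    note t = \<phi>(2)[of "tail Q e"] and h = \<phi>(2)[of "head Q e"]
    let ?x = "?\<psi> (tail Q e) y"
    have x: "?x \<in> carrier (vspace X (tail Q e))" "\<phi> (tail Q e) ?x = y"
      using t Q[OF e] y by (auto simp: bij_betw_def inv_into_into f_inv_into_f)
    have "?\<psi> (head Q e) (amap Y e y) = ?\<psi> (head Q e) (\<phi> (head Q e) (amap X e ?x))"
      using com[OF e x(1)] x(2) by simp
    also have "\<dots> = amap X e ?x"
      using h Q[OF e] klinD(3)[OF fd_quiver_repD(3)[OF X e] x(1)]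
      by (intro inv_into_f_f) (auto simp: bij_betw_def)
    finally show "?\<psi> (head Q e) (amap Y e y) = amap X e (?\<psi> (tail Q e) y)" .
  qed
qed

text \<open>An isomorphism carries subrepresentations to subrepresentations of the same dimension vector.\<close>

lemma stable_rep_iso:
  fixes X :: "('v, 'e, 'k::field, 'x) quiver_rep" and Y :: "('v, 'e, 'k, 'y) quiver_rep"
  assumes Q: "\<And>e. e \<in> arcs Q \<Longrightarrow> tail Q e \<in> verts Q \<and> head Q e \<in> verts Q"
    and X: "fd_quiver_rep Q X" and iso: "rep_iso Q X Y" and st: "stable_rep Q \<theta> X"
  shows "stable_rep Q \<theta> Y"
proof -
  obtain \<phi> where \<phi>: "\<And>v. v \<in> verts Q \<Longrightarrow> klin (vspace X v) (vspace Y v) (\<phi> v)"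
      "\<And>v. v \<in> verts Q \<Longrightarrow> bij_betw (\<phi> v) (carrier (vspace X v)) (carrier (vspace Y v))"
    and com: "\<And>e x. e \<in> arcs Q \<Longrightarrow> x \<in> carrier (vspace X (tail Q e)) \<Longrightarrow>
        \<phi> (head Q e) (amap X e x) = amap Y e (\<phi> (tail Q e) x)"
    using iso unfolding rep_iso_def by blast
  note fd = fd_quiver_repD[OF X]
  have dim: "dim_vec_rep X v = dim_vec_rep Y v" if "v \<in> verts Q" for v
    using klin_bij_dim(2)[OF \<phi>(1)[OF that] \<phi>(2)[OF that] fd(2)[OF that]] by (simp add: dim_vec_rep_def)
  have zero: "\<phi> v \<zero>\<^bsub>vspace X v\<^esub> = \<zero>\<^bsub>vspace Y v\<^esub>" if "v \<in> verts Q" for v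
    by (rule klinD(6)[OF \<phi>(1)[OF that]])
  show ?thesis
  proof (rule stable_repI)
    show "pairing Q \<theta> (dim_vec_rep Y) = 0"
      using stable_repD(2)[OF st] pairing_cong[of Q "dim_vec_rep X" "dim_vec_rep Y" \<theta>] dim by simp
    obtain v where v: "v \<in> verts Q" "carrier (vspace X v) \<noteq> {\<zero>\<^bsub>vspace X v\<^esub>}"
      using stable_repD(1)[OF st] unfolding nonzero_rep_def by blast
    then obtain x where x: "x \<in> carrier (vspace X v)" "x \<noteq> \<zero>\<^bsub>vspace X v\<^esub>"
      using kvs_simps(5)[OF fd(1)[OF v(1)]] by blast
    have "\<phi> v x \<in> carrier (vspace Y v)" "\<phi> v x \<noteq> \<zero>\<^bsub>vspace Y v\<^esub>"
      using klinD(3)[OF \<phi>(1)[OF v(1)] x(1)] zero[OF v(1)] x \<phi>(2)[OF v(1)] kvs_simps(5)[OF fd(1)[OF v(1)]]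
      by (auto simp: bij_betw_def inj_on_def)
    then show "nonzero_rep Q Y" unfolding nonzero_rep_def using v(1) by blast
    fix W v0 v1 assume W: "is_subrep Q Y W" and v0: "v0 \<in> verts Q" "W v0 \<noteq> {\<zero>\<^bsub>vspace Y v0\<^esub>}"
      and v1: "v1 \<in> verts Q" "W v1 \<noteq> carrier (vspace Y v1)"
    let ?W = "\<lambda>v. {x \<in> carrier (vspace X v). \<phi> v x \<in> W v}"
    have sub: "ksub (?W v) (vspace X v)" if "v \<in> verts Q" for v
      by (rule ksub_vimage[OF \<phi>(1)[OF that] is_subrepD(1)[OF W that]])
    have im: "\<phi> v ` ?W v = W v" if v: "v \<in> verts Q" for v
      using ksubD(2)[OF is_subrepD(1)[OF W v]] \<phi>(2)[OF v] by (auto simp: bij_betw_def)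
    have sr: "is_subrep Q X ?W"
      unfolding is_subrep_def
    proof (intro conjI ballI sub subsetI)
      fix e y assume e: "e \<in> arcs Q" and "y \<in> amap X e ` ?W (tail Q e)"
      then obtain x where x: "x \<in> ?W (tail Q e)" "y = amap X e x" by blast
      then show "y \<in> ?W (head Q e)"
        using com[OF e, of x] klinD(3)[OF fd(3)[OF e], of x] is_subrepD(2)[OF W e] by auto
    qed auto
    have dimW: "dim_vec_rep (restrict_rep X ?W) v = dim_vec_rep (restrict_rep Y W) v" if v: "v \<in> verts Q" for v
    proof -
      have "klin ((vspace X v)\<lparr>carrier := ?W v\<rparr>) ((vspace Y v)\<lparr>carrier := W v\<rparr>) (\<phi> v)"
        by (rule klin_restrict[OF \<phi>(1)[OF v] sub[OF v] is_subrepD(1)[OF W v]]) auto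
      moreover have "bij_betw (\<phi> v) (?W v) (W v)"
        using im[OF v] \<phi>(2)[OF v] unfolding bij_betw_def by (auto intro: inj_on_subset)
      ultimately show ?thesis
        unfolding dim_vec_rep_def restrict_rep_simps
        by (intro klin_bij_dim(2)[symmetric]) (auto intro: subspace_fd(1)[OF fd(2)[OF v] sub[OF v]])
    qed
    have "?W v0 \<noteq> {\<zero>\<^bsub>vspace X v0\<^esub>}" using im[OF v0(1)] v0 zero[OF v0(1)] by fastforce
    moreover have "?W v1 \<noteq> carrier (vspace X v1)"
      using im[OF v1(1)] v1(2) \<phi>(2)[OF v1(1)] by (auto simp: bij_betw_def)
    ultimately have "\<not> pairing Q \<theta> (dim_vec_rep (restrict_rep X ?W)) \<ge> 0"
      using stable_repD(3)[OF st sr v0(1) _ _ v1(1)] by blast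
    moreover have "pairing Q \<theta> (dim_vec_rep (restrict_rep X ?W)) = pairing Q \<theta> (dim_vec_rep (restrict_rep Y W))"
      by (rule pairing_cong) (rule dimW)
    ultimately show "pairing Q \<theta> (dim_vec_rep (restrict_rep Y W)) < 0" by simp
  qed
qed

lemma matrix_rep_simps [simp]:
  "vspace (matrix_rep d P) v = module_vec TYPE('k::field) (d v)"
  "amap (matrix_rep d P) e x = P e *\<^sub>v x"
  by (simp_all add: matrix_rep_def)

lemma mult_mat_vec_klin:
  assumes "A \<in> carrier_mat n k"
  shows "klin (module_vec TYPE('k::field) k) (module_vec TYPE('k) n) (\<lambda>x. A *\<^sub>v x)"
  by (rule klinI[OF kvs_module_vec kvs_module_vec])
    (use assms in \<open>auto simp: mult_add_distrib_mat_vec mult_mat_vec\<close>)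

lemma fd_matrix_rep:
  assumes "P \<in> rep_space Q d"
  shows "fd_quiver_rep Q (matrix_rep d P :: ('v, 'e, 'k::field, 'k vec) quiver_rep)"
    "has_dim_vec Q (matrix_rep d P) d"
proof -
  have P: "P e \<in> carrier_mat (d (head Q e)) (d (tail Q e))" if "e \<in> arcs Q" for e
    using assms that unfolding rep_space_def by auto
  have "amap (matrix_rep d P) e = (\<lambda>x. P e *\<^sub>v x)" for e
    by (rule ext) simp
  then show "fd_quiver_rep Q (matrix_rep d P)"
    unfolding fd_quiver_rep_def
    using mult_mat_vec_klin[OF P] kvs_module_vec module_vec_dim(1) by auto
  show "has_dim_vec Q (matrix_rep d P) d"
    unfolding has_dim_vec_def dim_vec_rep_def by (simp add: module_vec_dim)
qed

text \<open>Coordinates with respect to a basis.\<close>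

lemma frame_coordinates:
  fixes V :: "('k::field, 'x) module"
  assumes V: "kvs V" "kfd V"
  obtains \<phi> where "klin V (module_vec TYPE('k) (kdim V)) \<phi>"
    "bij_betw \<phi> (carrier V) (carrier_vec (kdim V))"
proof -
  let ?n = "kdim V"
  obtain b where b: "independent_family V b {..<?n}" "spanning_family V b {..<?n}"
    using frame_exists[OF V] by blast
  have bc: "b \<in> {..<?n} \<rightarrow> carrier V" using b(1) unfolding independent_family_def by blast
  let ?f = "\<lambda>x. lcomb V b (\<lambda>i. x $ i) {..<?n}"
  have lin: "klin (module_vec TYPE('k) ?n) V ?f"
  proof (rule klinI[OF kvs_module_vec V(1)])
    show "?f x \<in> carrier V" for x by (rule lcomb_closed[OF V(1) bc])
    show "?f (x \<oplus>\<^bsub>module_vec TYPE('k) ?n\<^esub> y) = ?f x \<oplus>\<^bsub>V\<^esub> ?f y"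
      if "x \<in> carrier (module_vec TYPE('k) ?n)" "y \<in> carrier (module_vec TYPE('k) ?n)" for x y
      unfolding lcomb_add[OF V(1) bc] using that by (intro lcomb_cong[OF V(1) bc]) auto
    show "?f (c \<odot>\<^bsub>module_vec TYPE('k) ?n\<^esub> x) = c \<odot>\<^bsub>V\<^esub> ?f x"
      if "x \<in> carrier (module_vec TYPE('k) ?n)" for x c
      unfolding lcomb_scale[OF V(1) bc] using that by (intro lcomb_cong[OF V(1) bc]) auto
  qed
  have "inj_on ?f (carrier (module_vec TYPE('k) ?n))"
  proof (rule klin_injI[OF lin])
    fix x assume "x \<in> carrier (module_vec TYPE('k) ?n)" "?f x = \<zero>\<^bsub>V\<^esub>"
    then show "x = \<zero>\<^bsub>module_vec TYPE('k) ?n\<^esub>"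
      using b(1) unfolding independent_family_def by (auto intro!: eq_vecI)
  qed
  moreover have "?f ` carrier_vec ?n = carrier V"
  proof
    show "?f ` carrier_vec ?n \<subseteq> carrier V" using lcomb_closed[OF V(1) bc] by auto
    show "carrier V \<subseteq> ?f ` carrier_vec ?n"
    proof
      fix x assume "x \<in> carrier V"
      then obtain c where "x = lcomb V b c {..<?n}" using b(2) unfolding spanning_family_def by blast
      also have "\<dots> = ?f (vec ?n c)" by (intro lcomb_cong[OF V(1) bc]) auto
      finally show "x \<in> ?f ` carrier_vec ?n" by auto
    qed
  qed
  ultimately have bij: "bij_betw ?f (carrier (module_vec TYPE('k) ?n)) (carrier V)"
    unfolding bij_betw_def by simp
  from that[OF klin_inv[OF lin bij]] bij_betw_inv_into[OF bij] show thesis by simp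
qed

lemma klin_matrix:
  assumes f: "klin (module_vec TYPE('k::field) k) (module_vec TYPE('k) n) f"
  shows "\<exists>A\<in>carrier_mat n k. \<forall>x\<in>carrier_vec k. f x = A *\<^sub>v x"
proof (intro bexI ballI)
  let ?A = "mat n k (\<lambda>(p, q). f (unit_vec k q) $ p)"
  show "?A \<in> carrier_mat n k" by simp
  fix x :: "'k vec" assume x: "x \<in> carrier_vec k"
  have u: "(unit_vec k :: nat \<Rightarrow> 'k vec) \<in> {..<k} \<rightarrow> carrier (module_vec TYPE('k) k)" by auto
  have "x = lcomb (module_vec TYPE('k) k) (unit_vec k) (\<lambda>i. x $ i) {..<k}"
    using x by (subst lcomb_unit_vec) (auto intro!: eq_vecI)
  then have fx: "f x = lcomb (module_vec TYPE('k) n) (f \<circ> unit_vec k) (\<lambda>i. x $ i) {..<k}"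
    using klin_lcomb[OF f u] by metis
  have fu: "f \<circ> unit_vec k \<in> {..<k} \<rightarrow> carrier_vec n" using klinD(3)[OF f] u by auto
  show "f x = ?A *\<^sub>v x"
  proof (rule eq_vecI)
    have "f x \<in> carrier_vec n" using klinD(3)[OF f] x by simp
    then show "dim_vec (f x) = dim_vec (?A *\<^sub>v x)" by simp
    fix p assume "p < dim_vec (?A *\<^sub>v x)"
    then have p: "p < n" by simp
    show "f x $ p = (?A *\<^sub>v x) $ p"
      unfolding fx lcomb_vec_index[OF fu p] using p x
      by (auto simp: scalar_prod_def atLeast0LessThan mult.commute intro!: sum.cong)
  qed
qed

text \<open>Choose coordinates at every vertex. The matrices are restricted to the arrows because points of
  \<open>rep_space\<close> are extensional functions.\<close>

lemma fd_rep_iso_matrix_rep: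
  fixes X :: "('v, 'e, 'k::field, 'x) quiver_rep"
  assumes Q: "\<And>e. e \<in> arcs Q \<Longrightarrow> tail Q e \<in> verts Q \<and> head Q e \<in> verts Q"
    and X: "fd_quiver_rep Q X" and d: "has_dim_vec Q X d"
  shows "\<exists>P\<in>rep_space Q d. rep_iso Q X (matrix_rep d P)"
proof -
  note fd = fd_quiver_repD[OF X]
  have "\<exists>\<phi>. klin (vspace X v) (module_vec TYPE('k) (d v)) \<phi> \<and> bij_betw \<phi> (carrier (vspace X v)) (carrier_vec (d v))"
    if v: "v \<in> verts Q" for v
  proof -
    have "kdim (vspace X v) = d v" using d v unfolding has_dim_vec_def dim_vec_rep_def by blast
    then show ?thesis using frame_coordinates[OF fd(1)[OF v] fd(2)[OF v]] by metis
  qed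
  then obtain \<phi> where \<phi>: "\<And>v. v \<in> verts Q \<Longrightarrow> klin (vspace X v) (module_vec TYPE('k) (d v)) (\<phi> v)"
    "\<And>v. v \<in> verts Q \<Longrightarrow> bij_betw (\<phi> v) (carrier (vspace X v)) (carrier_vec (d v))" by metis
  let ?\<psi> = "\<lambda>v. inv_into (carrier (vspace X v)) (\<phi> v)"
  have \<psi>: "klin (module_vec TYPE('k) (d v)) (vspace X v) (?\<psi> v)" if "v \<in> verts Q" for v
    by (rule klin_inv[OF \<phi>(1)[OF that]]) (use \<phi>(2)[OF that] in simp)
  have "\<exists>A\<in>carrier_mat (d (head Q e)) (d (tail Q e)). \<forall>x\<in>carrier_vec (d (tail Q e)).
      \<phi> (head Q e) (amap X e (?\<psi> (tail Q e) x)) = A *\<^sub>v x" if e: "e \<in> arcs Q" for e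
  proof (rule klin_matrix)
    note t = \<psi>[of "tail Q e"] and h = \<phi>(1)[of "head Q e"] and a = fd(3)[OF e]
    show "klin (module_vec TYPE('k) (d (tail Q e))) (module_vec TYPE('k) (d (head Q e)))
       (\<lambda>x. \<phi> (head Q e) (amap X e (?\<psi> (tail Q e) x)))"
      using klin_comp[OF klin_comp[OF t a] h] Q[OF e] by simp
  qed
  then obtain P where P: "\<And>e. e \<in> arcs Q \<Longrightarrow> P e \<in> carrier_mat (d (head Q e)) (d (tail Q e))"
    "\<And>e x. e \<in> arcs Q \<Longrightarrow> x \<in> carrier_vec (d (tail Q e)) \<Longrightarrow>
      \<phi> (head Q e) (amap X e (?\<psi> (tail Q e) x)) = P e *\<^sub>v x" by metis
  let ?P = "restrict P (arcs Q)"
  show ?thesis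
  proof (intro bexI)
    show "?P \<in> rep_space Q d" unfolding rep_space_def using P(1) by auto
    show "rep_iso Q X (matrix_rep d ?P)"
      unfolding rep_iso_def
    proof (intro exI[of _ \<phi>] conjI ballI)
      fix e x assume e: "e \<in> arcs Q" and x: "x \<in> carrier (vspace X (tail Q e))"
      have t: "tail Q e \<in> verts Q" using Q[OF e] by simp
      have "?\<psi> (tail Q e) (\<phi> (tail Q e) x) = x" using \<phi>(2)[OF t] x by (simp add: bij_betw_def)
      moreover have "\<phi> (tail Q e) x \<in> carrier_vec (d (tail Q e))" using klinD(3)[OF \<phi>(1)[OF t] x] by simp
      ultimately show "\<phi> (head Q e) (amap X e x) = amap (matrix_rep d ?P) e (\<phi> (tail Q e) x)"
        using P(2)[OF e] e by fastforce
    qed (use \<phi> in auto)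
  qed
qed

section \<open>Polynomial functions and algebraic dependence\<close>

text \<open>Polynomials are represented by the functions they induce on all of \<open>'e \<Rightarrow> 'k\<close>; over an infinite field
  nothing is lost. The index set \<open>E\<close> names the coordinates that may occur.\<close>

inductive_set polynomial_functions :: "'e set \<Rightarrow> (('e \<Rightarrow> 'k::field) \<Rightarrow> 'k) set" for E :: "'e set" where
  pf_const: "(\<lambda>x. c) \<in> polynomial_functions E"
| pf_coord: "e \<in> E \<Longrightarrow> (\<lambda>x. x e) \<in> polynomial_functions E"
| pf_add: "\<lbrakk>f \<in> polynomial_functions E; g \<in> polynomial_functions E\<rbrakk> \<Longrightarrow> (\<lambda>x. f x + g x) \<in> polynomial_functions E"
| pf_mult: "\<lbrakk>f \<in> polynomial_functions E; g \<in> polynomial_functions E\<rbrakk> \<Longrightarrow> (\<lambda>x. f x * g x) \<in> polynomial_functions E"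

lemma pf_sum:
  assumes "\<And>i. i \<in> I \<Longrightarrow> f i \<in> polynomial_functions E"
  shows "(\<lambda>x. \<Sum>i\<in>I. f i x) \<in> polynomial_functions E"
  using assms
proof (induction I rule: infinite_finite_induct)
  case (insert i I)
  then have "(\<lambda>x. f i x + (\<Sum>i\<in>I. f i x)) \<in> polynomial_functions E"
    by (intro pf_add[of "f i"]) simp_all
  with insert show ?case by simp
qed (simp_all add: pf_const)

lemma pf_prod:
  assumes "\<And>i. i \<in> I \<Longrightarrow> f i \<in> polynomial_functions E"
  shows "(\<lambda>x. \<Prod>i\<in>I. f i x) \<in> polynomial_functions E"
  using assms
proof (induction I rule: infinite_finite_induct)
  case (insert i I)
  then have "(\<lambda>x. f i x * (\<Prod>i\<in>I. f i x)) \<in> polynomial_functions E"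
    by (intro pf_mult[of "f i"]) simp_all
  with insert show ?case by simp
qed (simp_all add: pf_const)

lemma pf_power: "f \<in> polynomial_functions E \<Longrightarrow> (\<lambda>x. f x ^ k) \<in> polynomial_functions E"
proof (induction k)
  case (Suc k)
  then have "(\<lambda>x. f x * f x ^ k) \<in> polynomial_functions E" by (intro pf_mult[of f]) simp_all
  then show ?case by simp
qed (simp add: pf_const)

lemma pf_cong:
  assumes f: "f \<in> polynomial_functions E" and eq: "\<And>e. e \<in> E \<Longrightarrow> x e = y e"
  shows "f x = f y"
  using f by (induction rule: polynomial_functions.induct) (simp_all add: eq)

text \<open>Restriction to the line through two points is a univariate polynomial. This is what reduces statements on
  nonvanishing to the finiteness of the set of roots.\<close>

lemma pf_line:
  assumes "f \<in> polynomial_functions E"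
  shows "\<exists>p. \<forall>t. f (\<lambda>e. x e + t * (y e - x e)) = poly p t"
  using assms
proof induction
  case (pf_const c)
  show ?case by (rule exI[of _ "[:c:]"]) simp
next
  case (pf_coord e)
  show ?case by (rule exI[of _ "[:x e, y e - x e:]"]) simp
next
  case (pf_add f g)
  then obtain p q where "\<forall>t. f (\<lambda>e. x e + t * (y e - x e)) = poly p t"
    "\<forall>t. g (\<lambda>e. x e + t * (y e - x e)) = poly q t" by blast
  then show ?case by (intro exI[of _ "p + q"]) simp
next
  case (pf_mult f g)
  then obtain p q where "\<forall>t. f (\<lambda>e. x e + t * (y e - x e)) = poly p t"
    "\<forall>t. g (\<lambda>e. x e + t * (y e - x e)) = poly q t" by blast
  then show ?case by (intro exI[of _ "p * q"]) simp
qed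

text \<open>On the line through a nonzero point of \<open>f\<close> and one of \<open>g\<close> both restrict to nonzero
  univariate polynomials, and these have only finitely many roots.\<close>

lemma pf_common_nonzero:
  fixes f g :: "('e \<Rightarrow> 'k::field) \<Rightarrow> 'k"
  assumes inf: "infinite (UNIV :: 'k set)"
    and f: "f \<in> polynomial_functions E" "f x \<noteq> 0" and g: "g \<in> polynomial_functions E" "g y \<noteq> 0"
  shows "\<exists>z. f z \<noteq> 0 \<and> g z \<noteq> 0"
proof -
  obtain p q where p: "\<And>t. f (\<lambda>e. x e + t * (y e - x e)) = poly p t"
    and q: "\<And>t. g (\<lambda>e. x e + t * (y e - x e)) = poly q t"
    using pf_line[OF f(1)] pf_line[OF g(1)] by metis
  have "p \<noteq> 0" "q \<noteq> 0" using p[of 0] q[of 1] f(2) g(2) by auto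
  then have "finite {t. poly (p * q) t = 0}" by (intro poly_roots_finite) simp
  then obtain t where "poly (p * q) t \<noteq> 0" using inf ex_new_if_finite by (metis (mono_tags) mem_Collect_eq)
  then show ?thesis using p[of t] q[of t] by (intro exI[of _ "\<lambda>e. x e + t * (y e - x e)"]) auto
qed

lemma pf_prod_nonzero:
  fixes f :: "'i \<Rightarrow> ('e \<Rightarrow> 'k::field) \<Rightarrow> 'k"
  assumes inf: "infinite (UNIV :: 'k set)" and "finite I"
    and "\<And>i. i \<in> I \<Longrightarrow> f i \<in> polynomial_functions E" "\<And>i. i \<in> I \<Longrightarrow> \<exists>x. f i x \<noteq> 0"
  shows "\<exists>x. (\<Prod>i\<in>I. f i x) \<noteq> 0"
  using assms(2-4)
proof (induction I rule: finite_induct)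
  case (insert i I)
  have "\<exists>x. (\<Prod>i\<in>I. f i x) \<noteq> 0" by (rule insert.IH) (use insert.prems in simp_all)
  then obtain x where x: "(\<Prod>i\<in>I. f i x) \<noteq> 0" by (rule exE)
  have "\<exists>y. f i y \<noteq> 0" by (rule insert.prems) simp
  then obtain y where y: "f i y \<noteq> 0" by (rule exE)
  have h: "(\<lambda>x. \<Prod>i\<in>I. f i x) \<in> polynomial_functions E" by (rule pf_prod) (use insert in simp)
  have fi: "f i \<in> polynomial_functions E" using insert by simp
  from pf_common_nonzero[OF inf h x fi y] obtain z where "(\<Prod>i\<in>I. f i z) \<noteq> 0" "f i z \<noteq> 0"
    by (elim exE conjE)
  with insert.hyps show ?case by (intro exI[of _ z]) simp
qed simp

definition monomial :: "'e set \<Rightarrow> ('e \<Rightarrow> nat) \<Rightarrow> ('e \<Rightarrow> 'k::field) \<Rightarrow> 'k" where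
  "monomial E \<alpha> x = (\<Prod>e\<in>E. x e ^ \<alpha> e)"

text \<open>Exponents bounded by \<open>D\<close> in every variable: a box, whose cardinality \<open>D ^ card E\<close> is easier to
  count than that of the monomials of bounded total degree.\<close>

definition exponents :: "'e set \<Rightarrow> nat \<Rightarrow> ('e \<Rightarrow> nat) set" where
  "exponents E D = (\<Pi>\<^sub>E e\<in>E. {..<D})"

lemma finite_exponents: "finite E \<Longrightarrow> finite (exponents E D)"
  unfolding exponents_def by (intro finite_PiE) auto

lemma card_exponents: "finite E \<Longrightarrow> card (exponents E D) = D ^ card E"
  unfolding exponents_def by (simp add: card_PiE)

text \<open>Induction on the number of variables: freezing all but one of them leaves a univariate polynomial with
  infinitely many zeros.\<close>

lemma monomials_independent:
  fixes c :: "('e \<Rightarrow> nat) \<Rightarrow> 'k::field"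
  assumes inf: "infinite (UNIV :: 'k set)" and "finite E"
    and "\<And>x. (\<Sum>\<alpha>\<in>exponents E D. c \<alpha> * monomial E \<alpha> x) = 0"
    and "\<alpha> \<in> exponents E D"
  shows "c \<alpha> = 0"
  using assms(2-4)
proof (induction E arbitrary: c \<alpha> rule: finite_induct)
  case empty
  then show ?case by (simp add: exponents_def monomial_def)
next
  case (insert e E)
  have ex: "exponents (insert e E) D = (\<lambda>(k, \<beta>). \<beta>(e := k)) ` ({..<D} \<times> exponents E D)"
    unfolding exponents_def by (rule PiE_insert_eq)
  have inj: "inj_on (\<lambda>(k, \<beta>). \<beta>(e := k)) ({..<D} \<times> exponents E D)"
    unfolding exponents_def using insert.hyps(2) by (rule inj_combinator)
  have mon: "monomial (insert e E) (\<beta>(e := k)) x = x e ^ k * monomial E \<beta> x" for \<beta> k and x :: "'e \<Rightarrow> 'k"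
  proof -
    have "(\<Prod>a\<in>E. x a ^ (\<beta>(e := k)) a) = (\<Prod>a\<in>E. x a ^ \<beta> a)"
      using insert.hyps(2) by (intro prod.cong) auto
    then show ?thesis unfolding monomial_def using insert.hyps by simp
  qed
  have sum: "(\<Sum>\<alpha>\<in>exponents (insert e E) D. c \<alpha> * monomial (insert e E) \<alpha> x)
     = (\<Sum>k<D. x e ^ k * (\<Sum>\<beta>\<in>exponents E D. c (\<beta>(e := k)) * monomial E \<beta> x))" for x
    unfolding ex sum.reindex[OF inj] by (simp add: sum.cartesian_product mon sum_distrib_left case_prod_beta algebra_simps)
  obtain k \<beta> where kb: "k < D" "\<beta> \<in> exponents E D" "\<alpha> = \<beta>(e := k)"
    using insert.prems(2) unfolding ex by auto
  have z: "(\<Sum>\<beta>\<in>exponents E D. c (\<beta>(e := k)) * monomial E \<beta> x) = 0" if k: "k < D" for k x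
  proof -
    let ?a = "\<lambda>k. \<Sum>\<beta>\<in>exponents E D. c (\<beta>(e := k)) * monomial E \<beta> x"
    let ?p = "\<Sum>k<D. monom (?a k) k"
    have "poly ?p t = 0" for t
    proof -
      have "monomial E \<beta> (x(e := t)) = monomial E \<beta> x" for \<beta>
        unfolding monomial_def using insert.hyps(2) by (intro prod.cong) auto
      then have "poly ?p t = (\<Sum>\<alpha>\<in>exponents (insert e E) D. c \<alpha> * monomial (insert e E) \<alpha> (x(e := t)))"
        unfolding sum by (simp add: poly_sum poly_monom mult.commute)
      then show ?thesis using insert.prems(1) by simp
    qed
    then have "{t. poly ?p t = 0} = UNIV" by auto
    then have "?p = 0" using poly_roots_finite[of ?p] inf by auto
    then have "coeff ?p k = 0" by simp
    then show ?thesis using k by (simp add: coeff_sum)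
  qed
  from insert.IH[OF z[OF kb(1)] kb(2)] kb(3) show ?case by simp
qed

definition monomial_span :: "'a set \<Rightarrow> nat \<Rightarrow> (('a \<Rightarrow> 'k::field) \<Rightarrow> 'k) set" where
  "monomial_span A D = {f. \<exists>c. \<forall>x. f x = (\<Sum>\<alpha>\<in>exponents A D. c \<alpha> * monomial A \<alpha> x)}"

lemma monomial_spanI: "(\<And>x. f x = (\<Sum>\<alpha>\<in>exponents A D. c \<alpha> * monomial A \<alpha> x)) \<Longrightarrow> f \<in> monomial_span A D"
  unfolding monomial_span_def by blast

lemma monomial_in_span:
  assumes "finite A" "\<alpha> \<in> exponents A D"
  shows "(\<lambda>x. c * monomial A \<alpha> x) \<in> monomial_span A D"
  by (rule monomial_spanI[where c = "\<lambda>\<beta>. if \<beta> = \<alpha> then c else 0"])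
    (use assms finite_exponents[OF assms(1), of D] in \<open>simp add: if_distrib[of "\<lambda>z. z * _"] sum.delta' cong: if_cong\<close>)

lemma monomial_span_add:
  assumes "f \<in> monomial_span A D" "g \<in> monomial_span A D"
  shows "(\<lambda>x. f x + g x) \<in> monomial_span A D"
proof -
  obtain c d where "\<forall>x. f x = (\<Sum>\<alpha>\<in>exponents A D. c \<alpha> * monomial A \<alpha> x)"
    "\<forall>x. g x = (\<Sum>\<alpha>\<in>exponents A D. d \<alpha> * monomial A \<alpha> x)" using assms unfolding monomial_span_def by blast
  then show ?thesis
    by (intro monomial_spanI[where c = "\<lambda>\<alpha>. c \<alpha> + d \<alpha>"]) (simp add: algebra_simps sum.distrib)
qed

lemma monomial_span_sum:
  assumes "\<And>i. i \<in> I \<Longrightarrow> f i \<in> monomial_span A D"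
  shows "(\<lambda>x. \<Sum>i\<in>I. f i x) \<in> monomial_span A D"
  using assms
proof (induction I rule: infinite_finite_induct)
  case (insert i I)
  then show ?case using monomial_span_add[of "f i" A D "\<lambda>x. \<Sum>i\<in>I. f i x"] by auto
qed (auto intro: monomial_spanI[where c = "\<lambda>_. 0"])

lemma monomial_span_mult:
  fixes f :: "('a \<Rightarrow> 'k::field) \<Rightarrow> 'k"
  assumes A: "finite A" and f: "f \<in> monomial_span A (Suc D)" and g: "g \<in> monomial_span A (Suc D')"
  shows "(\<lambda>x. f x * g x) \<in> monomial_span A (Suc (D + D'))"
proof -
  obtain c d where c: "\<And>x. f x = (\<Sum>\<alpha>\<in>exponents A (Suc D). c \<alpha> * monomial A \<alpha> x)"
    and d: "\<And>x. g x = (\<Sum>\<alpha>\<in>exponents A (Suc D'). d \<alpha> * monomial A \<alpha> x)"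
    using f g unfolding monomial_span_def by blast
  have "(\<lambda>x. f x * g x) = (\<lambda>x. \<Sum>\<alpha>\<in>exponents A (Suc D). \<Sum>\<beta>\<in>exponents A (Suc D').
      (c \<alpha> * d \<beta>) * monomial A (\<lambda>e\<in>A. \<alpha> e + \<beta> e) x)"
  proof
    fix x :: "'a \<Rightarrow> 'k"
    have "monomial A \<alpha> x * monomial A \<beta> x = monomial A (\<lambda>e\<in>A. \<alpha> e + \<beta> e) x" for \<alpha> \<beta>
      unfolding monomial_def by (simp add: power_add prod.distrib)
    then show "f x * g x = (\<Sum>\<alpha>\<in>exponents A (Suc D). \<Sum>\<beta>\<in>exponents A (Suc D').
      (c \<alpha> * d \<beta>) * monomial A (\<lambda>e\<in>A. \<alpha> e + \<beta> e) x)"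
      unfolding c d sum_product by (intro sum.cong refl) (metis mult.assoc mult.left_commute)
  qed
  moreover have "\<dots> \<in> monomial_span A (Suc (D + D'))"
    by (intro monomial_span_sum monomial_in_span[OF A]) (fastforce simp: exponents_def PiE_def Pi_def)
  ultimately show ?thesis by simp
qed

lemma monomial_span_mono:
  assumes A: "finite A" and f: "f \<in> monomial_span A D" and le: "D \<le> D'"
  shows "f \<in> monomial_span A D'"
proof -
  obtain c where c: "\<And>x. f x = (\<Sum>\<alpha>\<in>exponents A D. c \<alpha> * monomial A \<alpha> x)"
    using f unfolding monomial_span_def by blast
  have "f = (\<lambda>x. \<Sum>\<alpha>\<in>exponents A D. c \<alpha> * monomial A \<alpha> x)" using c by blast
  also have "\<dots> \<in> monomial_span A D'"
    by (intro monomial_span_sum monomial_in_span[OF A]) (use le in \<open>force simp: exponents_def PiE_def Pi_def\<close>)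
  finally show ?thesis .
qed

lemma pf_in_monomial_span:
  fixes f :: "('a \<Rightarrow> 'k::field) \<Rightarrow> 'k"
  assumes A: "finite A" and f: "f \<in> polynomial_functions A"
  shows "\<exists>D. f \<in> monomial_span A (Suc D)"
  using f
proof induction
  case (pf_const c)
  have "(\<lambda>x. c * monomial A (\<lambda>e\<in>A. 0) x) \<in> monomial_span A (Suc 0)"
    by (rule monomial_in_span[OF A]) (auto simp: exponents_def)
  then show ?case by (auto simp: monomial_def)
next
  case (pf_coord e)
  have "(\<lambda>x :: 'a \<Rightarrow> 'k. 1 * monomial A (\<lambda>a\<in>A. if a = e then 1 else 0) x) \<in> monomial_span A (Suc 1)"
    by (rule monomial_in_span[OF A]) (auto simp: exponents_def)
  moreover have "monomial A (\<lambda>a\<in>A. if a = e then 1 else 0) x = x e" for x :: "'a \<Rightarrow> 'k"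
  proof -
    have "monomial A (\<lambda>a\<in>A. if a = e then 1 else 0) x = (\<Prod>a\<in>A. if a = e then x a else 1)"
      unfolding monomial_def by (rule prod.cong) auto
    then show ?thesis using A pf_coord by simp
  qed
  then have "(\<lambda>x :: 'a \<Rightarrow> 'k. 1 * monomial A (\<lambda>a\<in>A. if a = e then 1 else 0) x) = (\<lambda>x. x e)"
    by (simp add: fun_eq_iff)
  ultimately show ?case by (intro exI[of _ 1]) simp
next
  case (pf_add f g)
  from pf_add.IH(1) obtain D where f: "f \<in> monomial_span A (Suc D)" by (rule exE)
  from pf_add.IH(2) obtain D' where g: "g \<in> monomial_span A (Suc D')" by (rule exE)
  have "f \<in> monomial_span A (Suc (max D D'))" by (rule monomial_span_mono[OF A f]) simp
  moreover have "g \<in> monomial_span A (Suc (max D D'))" by (rule monomial_span_mono[OF A g]) simp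
  ultimately have "(\<lambda>x. f x + g x) \<in> monomial_span A (Suc (max D D'))" by (rule monomial_span_add)
  then show ?case by (rule exI[where x = "max D D'"])
next
  case (pf_mult f g)
  from pf_mult.IH(1) obtain D where f: "f \<in> monomial_span A (Suc D)" by (rule exE)
  from pf_mult.IH(2) obtain D' where g: "g \<in> monomial_span A (Suc D')" by (rule exE)
  show ?case by (rule exI[where x = "D + D'"]) (rule monomial_span_mult[OF A f g])
qed

lemma monomial_span_power:
  fixes f :: "('a \<Rightarrow> 'k::field) \<Rightarrow> 'k"
  assumes A: "finite A" and f: "f \<in> monomial_span A (Suc D)"
  shows "(\<lambda>x. f x ^ k) \<in> monomial_span A (Suc (k * D))"
proof (induction k)
  case 0
  have "(\<lambda>x. 1 * monomial A (\<lambda>e\<in>A. 0) x) \<in> monomial_span A (Suc 0)"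
    by (rule monomial_in_span[OF A]) (auto simp: exponents_def)
  then show ?case by (auto simp: monomial_def)
next
  case (Suc k)
  then show ?case using monomial_span_mult[OF A f Suc] by (simp add: add.commute)
qed

lemma monomial_span_monomial:
  fixes f :: "'e \<Rightarrow> ('a \<Rightarrow> 'k::field) \<Rightarrow> 'k"
  assumes A: "finite A" and "finite E" and "\<And>e. e \<in> E \<Longrightarrow> f e \<in> monomial_span A (Suc D)"
    and "\<And>e. e \<in> E \<Longrightarrow> \<alpha> e \<le> B"
  shows "(\<lambda>x. monomial E \<alpha> (\<lambda>e. f e x)) \<in> monomial_span A (Suc (card E * (B * D)))"
  unfolding monomial_def using assms(2-4)
proof (induction E rule: finite_induct)
  case empty
  have "(\<lambda>x. 1 * monomial A (\<lambda>e\<in>A. 0) x) \<in> monomial_span A (Suc 0)"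
    by (rule monomial_in_span[OF A]) (auto simp: exponents_def)
  then show ?case by (auto simp: monomial_def)
next
  case (insert e E)
  have "(\<lambda>x. f e x ^ \<alpha> e) \<in> monomial_span A (Suc (\<alpha> e * D))"
    using monomial_span_power[OF A] insert by blast
  then have "(\<lambda>x. f e x ^ \<alpha> e) \<in> monomial_span A (Suc (B * D))"
    by (rule monomial_span_mono[OF A]) (use insert in auto)
  from monomial_span_mult[OF A this] insert show ?case by simp
qed

lemma monomial_pf: "monomial E \<alpha> \<in> polynomial_functions E"
proof -
  have "(\<lambda>x. \<Prod>e\<in>E. x e ^ \<alpha> e) \<in> polynomial_functions E"
    by (intro pf_prod pf_power pf_coord)
  then show ?thesis by (simp add: monomial_def[abs_def])
qed

text \<open>More polynomials than variables are algebraically dependent. The \<open>N ^ card E\<close> monomials in the \<open>f e\<close> with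
  exponents below \<open>N\<close> lie in a space spanned by \<open>O(N ^ card A)\<close> monomials, so for large \<open>N\<close> they satisfy a
  linear relation; its coefficients are those of \<open>G\<close>. \<open>G\<close> is nonzero by \<open>monomials_independent\<close>.\<close>

theorem algebraically_dependent:
  fixes f :: "'e \<Rightarrow> ('a \<Rightarrow> 'k::field) \<Rightarrow> 'k"
  assumes inf: "infinite (UNIV :: 'k set)"
    and E: "finite E" and A: "finite A" and less: "card A < card E"
    and f: "\<And>e. e \<in> E \<Longrightarrow> f e \<in> polynomial_functions A"
  shows "\<exists>G\<in>polynomial_functions E. (\<exists>x. G x \<noteq> 0) \<and> (\<forall>a. G (\<lambda>e. f e a) = 0)"
proof -
  have "\<forall>e\<in>E. \<exists>D. f e \<in> monomial_span A (Suc D)" using pf_in_monomial_span[OF A f] by blast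
  then obtain D where D: "\<And>e. e \<in> E \<Longrightarrow> f e \<in> monomial_span A (Suc (D e))" by metis
  define M where "M = (\<Sum>e\<in>E. D e)"
  have fM: "f e \<in> monomial_span A (Suc M)" if "e \<in> E" for e
    by (rule monomial_span_mono[OF A D[OF that]]) (use E that in \<open>auto simp: M_def intro: member_le_sum\<close>)
  define c where "c = card E * M"
  \<comment> \<open>large enough for \<open>(N (c + 1)) ^ card A < N ^ card E\<close>\<close>
  define N where "N = Suc ((c + 1) ^ card A)"
  let ?L = "Suc (card E * (N * M))"
  have "?L ^ card A \<le> (N * (c + 1)) ^ card A"
    by (intro power_mono) (auto simp: c_def N_def algebra_simps)
  also have "\<dots> = N ^ card A * (c + 1) ^ card A" by (rule power_mult_distrib)
  also have "\<dots> < N ^ card A * N" by (intro mult_strict_left_mono) (auto simp: N_def)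
  also have "\<dots> = N ^ Suc (card A)" by simp
  also have "\<dots> \<le> N ^ card E" using less by (intro power_increasing) (auto simp: N_def)
  finally have count: "card (exponents A ?L) < card (exponents E N)"
    by (simp add: card_exponents[OF A] card_exponents[OF E])
  have "\<forall>\<alpha>\<in>exponents E N. \<exists>b. \<forall>x. monomial E \<alpha> (\<lambda>e. f e x) = (\<Sum>\<beta>\<in>exponents A ?L. b \<beta> * monomial A \<beta> x)"
  proof
    fix \<alpha> assume "\<alpha> \<in> exponents E N"
    then have "\<And>e. e \<in> E \<Longrightarrow> \<alpha> e \<le> N" unfolding exponents_def by (fastforce simp: PiE_def Pi_def)
    then have "(\<lambda>x. monomial E \<alpha> (\<lambda>e. f e x)) \<in> monomial_span A ?L"
      by (intro monomial_span_monomial[OF A E fM])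
    then show "\<exists>b. \<forall>x. monomial E \<alpha> (\<lambda>e. f e x) = (\<Sum>\<beta>\<in>exponents A ?L. b \<beta> * monomial A \<beta> x)"
      unfolding monomial_span_def by blast
  qed
  then obtain b where b: "\<And>\<alpha> x. \<alpha> \<in> exponents E N \<Longrightarrow>
      monomial E \<alpha> (\<lambda>e. f e x) = (\<Sum>\<beta>\<in>exponents A ?L. b \<alpha> \<beta> * monomial A \<beta> x)" by metis
  obtain l where l: "\<exists>\<alpha>\<in>exponents E N. l \<alpha> \<noteq> 0"
      "\<And>\<beta>. \<beta> \<in> exponents A ?L \<Longrightarrow> (\<Sum>\<alpha>\<in>exponents E N. b \<alpha> \<beta> * l \<alpha>) = 0"
    using homogeneous_system_nontrivial_solution[OF finite_exponents[OF A] finite_exponents[OF E] count, of "\<lambda>\<beta> \<alpha>. b \<alpha> \<beta>"] by blast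
  define G where "G x = (\<Sum>\<alpha>\<in>exponents E N. l \<alpha> * monomial E \<alpha> x)" for x :: "'e \<Rightarrow> 'k"
  have "G \<in> polynomial_functions E"
    unfolding G_def[abs_def] by (intro pf_sum pf_mult pf_const monomial_pf)
  moreover have "\<exists>x. G x \<noteq> 0"
    using monomials_independent[OF inf E, where D = N and c = l] l(1) unfolding G_def by blast
  moreover have "G (\<lambda>e. f e a) = 0" for a
  proof -
    have "G (\<lambda>e. f e a) = (\<Sum>\<alpha>\<in>exponents E N. \<Sum>\<beta>\<in>exponents A ?L. l \<alpha> * (b \<alpha> \<beta> * monomial A \<beta> a))"
      unfolding G_def by (intro sum.cong refl) (simp add: b sum_distrib_left)
    also have "\<dots> = (\<Sum>\<beta>\<in>exponents A ?L. \<Sum>\<alpha>\<in>exponents E N. l \<alpha> * (b \<alpha> \<beta> * monomial A \<beta> a))"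
      by (rule sum.swap)
    also have "\<dots> = (\<Sum>\<beta>\<in>exponents A ?L. (\<Sum>\<alpha>\<in>exponents E N. b \<alpha> \<beta> * l \<alpha>) * monomial A \<beta> a)"
      unfolding sum_distrib_right by (intro sum.cong refl) (simp only: ac_simps)
    also have "\<dots> = 0" using l(2) by (intro sum.neutral) simp
    finally show ?thesis .
  qed
  ultimately show ?thesis by blast
qed

section \<open>Representations with a prescribed subrepresentation\<close>

text \<open>The subspace is the graph of the linear map with matrix \<open>b\<close> from the coordinates in \<open>S\<close> to the
  remaining ones: a standard chart of the Grassmannian.\<close>

definition in_chart :: "nat \<Rightarrow> nat set \<Rightarrow> 'k::field vec set \<Rightarrow> (nat \<Rightarrow> nat \<Rightarrow> 'k) \<Rightarrow> bool" where
  "in_chart n S W b \<longleftrightarrow>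
     (\<forall>t\<in>S. vec n (\<lambda>s. if s \<in> S then (if s = t then 1 else 0) else b s t) \<in> W) \<and>
     (\<forall>x\<in>W. \<forall>s\<in>{..<n} - S. x $ s = (\<Sum>t\<in>S. b s t * x $ t))"

text \<open>Take \<open>S\<close> to be a smallest set of coordinates on which the projection of \<open>W\<close> is injective.\<close>

lemma subspace_in_chart:
  fixes W :: "'k::field vec set"
  assumes W: "ksub W (module_vec TYPE('k) n)"
  shows "\<exists>S b. S \<subseteq> {..<n} \<and> card S = kdim (module_vec TYPE('k) n\<lparr>carrier := W\<rparr>) \<and> in_chart n S W b"
proof -
  note WV = ksubD(2)[OF W] and Wa = ksubD(4)[OF W] and Ws = ksubD(5)[OF W]
  have Wn: "dim_vec x = n" if "x \<in> W" for x using WV that by auto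
  let ?inj = "\<lambda>S. S \<subseteq> {..<n} \<and> (\<forall>x\<in>W. (\<forall>s\<in>S. x $ s = 0) \<longrightarrow> x = 0\<^sub>v n)"
  have "?inj {..<n}" using Wn by (auto intro!: eq_vecI)
  then obtain S where S: "?inj S" and min: "\<And>T. ?inj T \<Longrightarrow> card S \<le> card T"
    using ex_has_least_nat[of ?inj "{..<n}" card] by blast
  have fin: "finite S" using S finite_subset by blast
  have "\<exists>y\<in>W. y $ t = 1 \<and> (\<forall>s\<in>S - {t}. y $ s = 0)" if t: "t \<in> S" for t
  proof -
    have "card (S - {t}) < card S" using t fin by (intro psubset_card_mono) auto
    then have "\<not> ?inj (S - {t})" using min[of "S - {t}"] by linarith
    then obtain y where y: "y \<in> W" "\<forall>s\<in>S - {t}. y $ s = 0" "y \<noteq> 0\<^sub>v n" using S by blast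
    then have yt: "y $ t \<noteq> 0" using S by blast
    have "inverse (y $ t) \<cdot>\<^sub>v y \<in> W" using Ws[OF y(1)] by simp
    moreover have "t < n" using S t by auto
    moreover have "s < n" if "s \<in> S" for s using S that by auto
    ultimately show ?thesis using y yt Wn[OF y(1)] by (intro bexI[of _ "inverse (y $ t) \<cdot>\<^sub>v y"]) auto
  qed
  then obtain h where h: "\<And>t. t \<in> S \<Longrightarrow> h t \<in> W" "\<And>t. t \<in> S \<Longrightarrow> h t $ t = 1"
    "\<And>t s. t \<in> S \<Longrightarrow> s \<in> S \<Longrightarrow> s \<noteq> t \<Longrightarrow> h t $ s = 0" by (metis Diff_iff singletonD)
  have hW: "h \<in> S \<rightarrow> W" using h(1) by blast
  then have hn: "h \<in> S \<rightarrow> carrier_vec n" using WV by auto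
  let ?V = "module_vec TYPE('k) n"
  have lS: "lcomb ?V h c S $ s = c s" if "s \<in> S" for c s
  proof -
    have "lcomb ?V h c S $ s = (\<Sum>t\<in>S. c t * h t $ s)"
      by (rule lcomb_vec_index[OF hn]) (use S that in auto)
    also have "\<dots> = (\<Sum>t\<in>S. if t = s then c t else 0)"
      using h(2,3) that by (intro sum.cong) auto
    finally show ?thesis using fin that by simp
  qed
  have expand: "x = lcomb ?V h (\<lambda>t. x $ t) S" if x: "x \<in> W" for x
  proof -
    let ?y = "x + (-1) \<cdot>\<^sub>v lcomb ?V h (\<lambda>t. x $ t) S"
    have lW: "lcomb ?V h (\<lambda>t. x $ t) S \<in> W" by (rule lcomb_subspace(2)[OF W hW])
    then have "(-1) \<cdot>\<^sub>v lcomb ?V h (\<lambda>t. x $ t) S \<in> W" using Ws by fastforce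
    then have "?y \<in> W" using Wa[OF x] by simp
    moreover have "?y $ s = 0" if "s \<in> S" for s
    proof -
      have "s < n" using S that by auto
      then show ?thesis using lS[OF that, of "\<lambda>t. x $ t"] Wn[OF lW] Wn[OF x] by simp
    qed
    ultimately have y0: "?y = 0\<^sub>v n" using S by blast
    show ?thesis
    proof (rule eq_vecI)
      show "dim_vec x = dim_vec (lcomb ?V h (\<lambda>t. x $ t) S)" using Wn x lW by simp
      fix i assume "i < dim_vec (lcomb ?V h (\<lambda>t. x $ t) S)"
      then have i: "i < n" using Wn lW by simp
      have "?y $ i = 0" using y0 i by simp
      then show "x $ i = lcomb ?V h (\<lambda>t. x $ t) S $ i" using i Wn[OF lW] Wn[OF x] by simp
    qed
  qed
  let ?W = "?V\<lparr>carrier := W\<rparr>"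
  have "independent_family ?W h S"
    unfolding independent_family_def lcomb_subspace(1)[OF W hW]
  proof (intro conjI allI impI ballI)
    fix c i assume "lcomb ?V h c S = \<zero>\<^bsub>?W\<^esub>" and i: "i \<in> S"
    then have "lcomb ?V h c S = 0\<^sub>v n" by simp
    moreover have "i < n" using S i by auto
    ultimately show "c i = 0" using lS[OF i, of c] by simp
  qed (use hW in simp)
  moreover have "spanning_family ?W h S"
    unfolding spanning_family_def lcomb_subspace(1)[OF W hW] using hW expand by auto
  ultimately have "kdim ?W = card S" by (intro frame_dim[OF ksubD(6)[OF W] _ _ fin])
  moreover have "in_chart n S W (\<lambda>s t. h t $ s)"
    unfolding in_chart_def
  proof (intro conjI ballI)
    fix t assume t: "t \<in> S"
    have "vec n (\<lambda>s. if s \<in> S then (if s = t then 1 else 0) else h t $ s) = h t"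
      using h t Wn[OF h(1)[OF t]] by (intro eq_vecI) auto
    then show "vec n (\<lambda>s. if s \<in> S then (if s = t then 1 else 0) else h t $ s) \<in> W" using h(1)[OF t] by simp
  next
    fix x s assume x: "x \<in> W" and s: "s \<in> {..<n} - S"
    have "x $ s = lcomb ?V h (\<lambda>t. x $ t) S $ s" using expand[OF x] by simp
    also have "\<dots> = (\<Sum>t\<in>S. x $ t * h t $ s)" by (rule lcomb_vec_index[OF hn]) (use s in simp)
    finally show "x $ s = (\<Sum>t\<in>S. h t $ s * x $ t)" by (simp add: mult.commute)
  qed
  ultimately show ?thesis using S by (intro exI[of _ S] exI[of _ "\<lambda>s t. h t $ s"]) simp
qed

definition entries :: "('v, 'e) pre_digraph \<Rightarrow> ('v \<Rightarrow> nat) \<Rightarrow> ('e \<times> nat \<times> nat) set" where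
  "entries Q d = (SIGMA e:arcs Q. {..<d (head Q e)} \<times> {..<d (tail Q e)})"

definition entry :: "('e \<Rightarrow> 'k mat) \<Rightarrow> 'e \<times> nat \<times> nat \<Rightarrow> 'k" where
  "entry P = (\<lambda>(e, p, q). P e $$ (p, q))"

text \<open>The two notions of polynomial function, in abstract coordinates and in matrix entries, agree.\<close>

lemma polynomial_functions_poly_funs:
  assumes "G \<in> polynomial_functions (entries Q d)"
  shows "(\<lambda>P. G (entry P)) \<in> poly_funs Q d"
  using assms
proof induction
  case (pf_coord e)
  then obtain a p q where e: "e = (a, p, q)" "a \<in> arcs Q" "p < d (head Q a)" "q < d (tail Q a)"
    by (auto simp: entries_def)
  from poly_funs.coord[of a Q p d q, OF e(2-4)] show ?case by (simp add: entry_def e(1))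
qed (auto intro: poly_funs.intros)

lemma poly_funs_polynomial_functions:
  assumes "g \<in> poly_funs Q d"
  shows "\<exists>G\<in>polynomial_functions (entries Q d). \<forall>P. g P = G (entry P)"
  using assms
proof induction
  case (const c)
  show ?case by (rule bexI[OF _ pf_const[of c]]) simp
next
  case (coord e p q)
  then have "(e, p, q) \<in> entries Q d" by (simp add: entries_def)
  from pf_coord[OF this] show ?case by (rule bexI[rotated]) (simp add: entry_def)
next
  case (add f g)
  then obtain F G where "F \<in> polynomial_functions (entries Q d)" "\<forall>P. f P = F (entry P)"
    "G \<in> polynomial_functions (entries Q d)" "\<forall>P. g P = G (entry P)" by blast
  then show ?case by (intro bexI[OF _ pf_add[of F _ G]]) auto
next
  case (mult f g)
  then obtain F G where "F \<in> polynomial_functions (entries Q d)" "\<forall>P. f P = F (entry P)"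
    "G \<in> polynomial_functions (entries Q d)" "\<forall>P. g P = G (entry P)" by blast
  then show ?case by (intro bexI[OF _ pf_mult[of F _ G]]) auto
qed

definition rep_of_entries :: "('v, 'e) pre_digraph \<Rightarrow> ('v \<Rightarrow> nat) \<Rightarrow> ('e \<times> nat \<times> nat \<Rightarrow> 'k::field) \<Rightarrow> 'e \<Rightarrow> 'k mat" where
  "rep_of_entries Q d x = (\<lambda>e\<in>arcs Q. mat (d (head Q e)) (d (tail Q e)) (\<lambda>(p, q). x (e, p, q)))"

lemma rep_of_entries:
  "rep_of_entries Q d x \<in> rep_space Q d"
  "z \<in> entries Q d \<Longrightarrow> entry (rep_of_entries Q d x) z = x z"
  by (auto simp: rep_of_entries_def rep_space_def entries_def entry_def)

lemma finite_entries: "finite (arcs Q) \<Longrightarrow> finite (entries Q d)"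
  unfolding entries_def by blast

text \<open>Suppose \<open>W\<close> is a subrepresentation in the charts \<open>S v\<close> with parameters \<open>b v\<close>. Applying an arrow \<open>e\<close> to the
  basis vector with index \<open>q \<in> S (tail e)\<close> gives a vector of \<open>W (head e)\<close>, so its coordinates outside
  \<open>S (head e)\<close> are determined by the others. Solving for the entries \<open>P e $$ (p, q)\<close> with
  \<open>p \<notin> S (head e)\<close> and \<open>q \<in> S (tail e)\<close>, the set \<open>dep\<close> below, expresses them as polynomials in the other entries
  and the \<open>b v\<close>. By the assumption \<open>codim\<close> there are fewer chart parameters than dependent entries, and
  the entries of all such representations satisfy a common polynomial relation.\<close>

lemma subrep_locus_degenerate:
  fixes Q :: "('v, 'e) pre_digraph" and d :: "'v \<Rightarrow> nat"
  assumes inf: "infinite (UNIV :: 'k::field set)"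
    and Q: "\<And>e. e \<in> arcs Q \<Longrightarrow> tail Q e \<in> verts Q \<and> head Q e \<in> verts Q"
    and fin: "finite (verts Q)" "finite (arcs Q)"
    and S: "\<And>v. v \<in> verts Q \<Longrightarrow> S v \<subseteq> {..<d v}"
    and codim: "(\<Sum>v\<in>verts Q. card (S v) * (d v - card (S v)))
       < (\<Sum>e\<in>arcs Q. card (S (tail Q e)) * (d (head Q e) - card (S (head Q e))))"
  shows "\<exists>G\<in>polynomial_functions (entries Q d). (\<exists>x::'e \<times> nat \<times> nat \<Rightarrow> 'k. G x \<noteq> 0) \<and>
     (\<forall>P W b. P \<in> rep_space Q d \<longrightarrow> is_subrep Q (matrix_rep d P) W \<longrightarrow>
        (\<forall>v\<in>verts Q. in_chart (d v) (S v) (W v) (b v)) \<longrightarrow> G (entry P) = 0)"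
proof -
  define C where "C v = {..<d v} - S v" for v
  define dep where "dep = (SIGMA e:arcs Q. C (head Q e) \<times> S (tail Q e))"
  define par where "par = (SIGMA v:verts Q. C v \<times> S v)"
  define A where "A = Inl ` (entries Q d - dep) \<union> Inr ` par"
  have finS: "finite (S v)" if "v \<in> verts Q" for v using S[OF that] finite_subset by blast
  have finC: "finite (C v)" for v unfolding C_def by simp
  have cC: "card (C v) = d v - card (S v)" if "v \<in> verts Q" for v
    unfolding C_def using S[OF that] finS[OF that] by (simp add: card_Diff_subset)
  have finp: "finite par" unfolding par_def using fin finS finC by blast
  have finE: "finite (entries Q d)" by (rule finite_entries[OF fin(2)])
  have depE: "dep \<subseteq> entries Q d"
    unfolding dep_def entries_def C_def using S Q by fastforce
  have cd: "card dep = (\<Sum>e\<in>arcs Q. card (S (tail Q e)) * (d (head Q e) - card (S (head Q e))))"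
    unfolding dep_def using fin Q finS finC cC by (simp add: card_cartesian_product mult.commute)
  have cp: "card par = (\<Sum>v\<in>verts Q. card (S v) * (d v - card (S v)))"
    unfolding par_def using fin finS finC cC by (simp add: card_cartesian_product mult.commute)
  have "card A = card (entries Q d - dep) + card par"
    unfolding A_def using finE finp by (subst card_Un_disjoint) (auto simp: card_image)
  also have "\<dots> < card (entries Q d)"
    using codim cd cp card_mono[OF finE depE] depE finE finite_subset[OF depE finE]
    by (simp add: card_Diff_subset)
  finally have cA: "card A < card (entries Q d)" .
  have finA: "finite A" unfolding A_def using finE finp by blast
  define f :: "'e \<times> nat \<times> nat \<Rightarrow> (('e \<times> nat \<times> nat) + ('v \<times> nat \<times> nat) \<Rightarrow> 'k) \<Rightarrow> 'k" where
    "f = (\<lambda>(e, p, q) a. if (e, p, q) \<in> dep then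
        (\<Sum>t\<in>S (head Q e). a (Inr (head Q e, p, t)) *
           (a (Inl (e, t, q)) + (\<Sum>s\<in>C (tail Q e). a (Inl (e, t, s)) * a (Inr (tail Q e, s, q)))))
        + (-1) * (\<Sum>s\<in>C (tail Q e). a (Inl (e, p, s)) * a (Inr (tail Q e, s, q)))
      else a (Inl (e, p, q)))"
  have fpf: "f z \<in> polynomial_functions A" if z: "z \<in> entries Q d" for z
  proof -
    obtain e p q where e: "z = (e, p, q)" "e \<in> arcs Q" "p < d (head Q e)" "q < d (tail Q e)"
      using z unfolding entries_def by auto
    note th = Q[OF e(2)]
    show ?thesis
    proof (cases "z \<in> dep")
      case False
      then have "Inl z \<in> A" using z unfolding A_def by blast
      then show ?thesis using False pf_coord[of "Inl z" A] by (simp add: f_def e(1))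
    next
      case True
      then have pq: "p \<in> C (head Q e)" "q \<in> S (tail Q e)" unfolding e dep_def by auto
      have a1: "Inr (head Q e, p, t) \<in> A" if "t \<in> S (head Q e)" for t
        using that pq th unfolding A_def par_def by auto
      have a2: "Inl (e, t, q) \<in> A" if "t \<in> S (head Q e)" for t
        using that S e th unfolding A_def dep_def entries_def C_def by auto
      have a3: "Inl (e, t, s) \<in> A" if "t < d (head Q e)" "s \<in> C (tail Q e)" for t s
        using that e th unfolding A_def dep_def entries_def C_def by auto
      have a4: "Inr (tail Q e, s, q) \<in> A" if "s \<in> C (tail Q e)" for s
        using that pq th unfolding A_def par_def by auto
      have a5: "t < d (head Q e)" if "t \<in> S (head Q e)" for t using S th that by blast
      have "f z = (\<lambda>a. (\<Sum>t\<in>S (head Q e). a (Inr (head Q e, p, t)) *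
           (a (Inl (e, t, q)) + (\<Sum>s\<in>C (tail Q e). a (Inl (e, t, s)) * a (Inr (tail Q e, s, q)))))
        + (-1) * (\<Sum>s\<in>C (tail Q e). a (Inl (e, p, s)) * a (Inr (tail Q e, s, q))))"
        using True by (simp add: f_def e(1))
      also have "\<dots> \<in> polynomial_functions A"
        by (intro pf_add pf_mult pf_sum pf_const pf_coord a1 a2 a3 a4 a5 e(3))
      finally show ?thesis .
    qed
  qed
  have "\<exists>G\<in>polynomial_functions (entries Q d). (\<exists>x. G x \<noteq> 0) \<and> (\<forall>a. G (\<lambda>e. f e a) = 0)"
    by (rule algebraically_dependent[OF inf finE finA cA]) (rule fpf)
  then obtain G where G: "G \<in> polynomial_functions (entries Q d)" "\<exists>x. G x \<noteq> 0" "\<And>a. G (\<lambda>e. f e a) = 0"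
    by blast
  have "G (entry P) = 0"
    if P: "P \<in> rep_space Q d" and W: "is_subrep Q (matrix_rep d P) W"
      and b: "\<forall>v\<in>verts Q. in_chart (d v) (S v) (W v) (b v)" for P W b
  proof -
    define a where "a = case_sum (entry P) (\<lambda>(v, s, t). b v s t)"
    have "entry P z = f z a" if z: "z \<in> entries Q d" for z
    proof -
      obtain e p q where e: "z = (e, p, q)" "e \<in> arcs Q" "p < d (head Q e)" "q < d (tail Q e)"
        using z unfolding entries_def by auto
      note th = Q[OF e(2)]
      show ?thesis
      proof (cases "z \<in> dep")
        case False
        then show ?thesis by (simp add: f_def e(1) a_def)
      next
        case True
        then have pq: "p \<in> C (head Q e)" "q \<in> S (tail Q e)" unfolding e dep_def by auto
        let ?h = "vec (d (tail Q e)) (\<lambda>s. if s \<in> S (tail Q e) then (if s = q then 1 else 0) else b (tail Q e) s q)"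
        have "?h \<in> W (tail Q e)" using b th pq(2) unfolding in_chart_def by blast
        then have y: "P e *\<^sub>v ?h \<in> W (head Q e)" using is_subrepD(2)[OF W e(2)] by simp
        have Pe: "P e \<in> carrier_mat (d (head Q e)) (d (tail Q e))" using P e(2) unfolding rep_space_def by auto
        have ent: "(P e *\<^sub>v ?h) $ t = P e $$ (t, q) + (\<Sum>s\<in>C (tail Q e). P e $$ (t, s) * b (tail Q e) s q)"
          if t: "t < d (head Q e)" for t
        proof -
          have "(P e *\<^sub>v ?h) $ t = (\<Sum>s<d (tail Q e). P e $$ (t, s) * ?h $ s)"
            using Pe t by (auto simp: scalar_prod_def atLeast0LessThan)
          also have "\<dots> = (\<Sum>s\<in>S (tail Q e) \<union> C (tail Q e). P e $$ (t, s) * ?h $ s)"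
            using S[of "tail Q e"] th unfolding C_def by (intro sum.cong) auto
          also have "\<dots> = (\<Sum>s\<in>S (tail Q e). P e $$ (t, s) * ?h $ s) + (\<Sum>s\<in>C (tail Q e). P e $$ (t, s) * ?h $ s)"
            using finS th finC by (intro sum.union_disjoint) (auto simp: C_def)
          also have "(\<Sum>s\<in>S (tail Q e). P e $$ (t, s) * ?h $ s) = (\<Sum>s\<in>S (tail Q e). if s = q then P e $$ (t, s) else 0)"
            using S[of "tail Q e"] th by (intro sum.cong) auto
          also have "\<dots> = P e $$ (t, q)" using finS th pq(2) by simp
          also have "(\<Sum>s\<in>C (tail Q e). P e $$ (t, s) * ?h $ s) = (\<Sum>s\<in>C (tail Q e). P e $$ (t, s) * b (tail Q e) s q)"
            by (intro sum.cong) (auto simp: C_def)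
          finally show ?thesis .
        qed
        have "(P e *\<^sub>v ?h) $ p = (\<Sum>t\<in>S (head Q e). b (head Q e) p t * (P e *\<^sub>v ?h) $ t)"
          using b th y pq(1) unfolding in_chart_def C_def by blast
        also have "\<dots> = (\<Sum>t\<in>S (head Q e). b (head Q e) p t *
            (P e $$ (t, q) + (\<Sum>s\<in>C (tail Q e). P e $$ (t, s) * b (tail Q e) s q)))"
          using S[of "head Q e"] th by (intro sum.cong refl) (subst ent, auto)
        finally show ?thesis using True unfolding ent[OF e(3)]
          by (simp add: f_def e(1) a_def entry_def algebra_simps)
      qed
    qed
    then have "G (entry P) = G (\<lambda>e. f e a)" by (intro pf_cong[OF G(1)]) simp
    then show ?thesis using G(3) by simp
  qed
  with G show ?thesis by blast
qed

section \<open>The quadratic form of a balanced decomposition\<close>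

text \<open>The estimate behind the whole inequality. It is \<open>x y \<le> (x + y) ((1 - s)\<^sup>2 x + s\<^sup>2 y)\<close>, where the
  difference of the two sides is \<open>((1 - s) x - s y)\<^sup>2\<close>, combined with \<open>x + y \<le> M w\<close>.\<close>

lemma product_le_weighted:
  fixes x y w s M :: real
  assumes "x \<ge> 0" "y \<ge> 0" "w > 0" "x + y \<le> M * w"
  shows "x * y \<le> M * ((1 - s)\<^sup>2 * (w * x) + s\<^sup>2 * (w * y))"
    and "x * y = M * ((1 - s)\<^sup>2 * (w * x) + s\<^sup>2 * (w * y)) \<Longrightarrow> (1 - s)\<^sup>2 * x + s\<^sup>2 * y > 0 \<Longrightarrow>
      x + y = M * w \<and> (1 - s) * x = s * y"
proof -
  let ?h = "(1 - s)\<^sup>2 * x + s\<^sup>2 * y"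
  have id: "(x + y) * ?h = x * y + ((1 - s) * x - s * y)\<^sup>2"
    by (simp add: power2_eq_square algebra_simps)
  have h: "?h \<ge> 0" using assms by simp
  have le: "(x + y) * ?h \<le> M * w * ?h" using assms h by (intro mult_right_mono) auto
  have eq: "M * ((1 - s)\<^sup>2 * (w * x) + s\<^sup>2 * (w * y)) = M * w * ?h" by (simp add: algebra_simps)
  show "x * y \<le> M * ((1 - s)\<^sup>2 * (w * x) + s\<^sup>2 * (w * y))"
    unfolding eq using le id zero_le_power2[of "(1 - s) * x - s * y"] by linarith
  assume e: "x * y = M * ((1 - s)\<^sup>2 * (w * x) + s\<^sup>2 * (w * y))" and pos: "?h > 0"
  have "x * y = M * w * ?h" using e unfolding eq .
  with le id zero_le_power2[of "(1 - s) * x - s * y"]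
  have "((1 - s) * x - s * y)\<^sup>2 = 0" "(x + y) * ?h = M * w * ?h" by linarith+
  then show "x + y = M * w \<and> (1 - s) * x = s * y" using pos by simp
qed

text \<open>Each term with \<open>Q i \<noteq> 1\<close> lies in \<open>[1/2, 1)\<close>, so a sum equal to \<open>1\<close> consists of exactly two of them,
  both equal to \<open>1/2\<close>.\<close>

lemma inverse_sum_one:
  fixes Q :: "'i \<Rightarrow> nat"
  assumes fin: "finite I" and Q: "\<And>i. i \<in> I \<Longrightarrow> Q i \<ge> 1"
    and sum: "(\<Sum>i\<in>I. 1 - 1 / real (Q i)) = 1"
  shows "card {i\<in>I. Q i \<noteq> 1} = 2 \<and> (\<forall>i\<in>I. Q i \<noteq> 1 \<longrightarrow> Q i = 2)"
proof -
  define J where "J = {i\<in>I. Q i \<noteq> 1}"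
  have J: "finite J" using fin by (simp add: J_def)
  have sJ: "(\<Sum>i\<in>J. 1 - 1 / real (Q i)) = 1"
  proof -
    have "(\<Sum>i\<in>J. 1 - 1 / real (Q i)) = (\<Sum>i\<in>I. 1 - 1 / real (Q i))"
      unfolding J_def using fin by (intro sum.mono_neutral_left) auto
    then show ?thesis using sum by simp
  qed
  have half: "1 - 1 / real (Q i) \<ge> 1/2" and lt1: "1 - 1 / real (Q i) < 1" if "i \<in> J" for i
  proof -
    have "Q i \<ge> 2" using Q[of i] that by (auto simp: J_def)
    then have "real (Q i) \<ge> 2" by linarith
    then show "1 - 1 / real (Q i) \<ge> 1/2" "1 - 1 / real (Q i) < 1" by (simp_all add: field_simps)
  qed
  have "(\<Sum>i\<in>J. 1/2::real) \<le> (\<Sum>i\<in>J. 1 - 1 / real (Q i))" by (rule sum_mono) (rule half)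
  then have "real (card J) \<le> 2" using sJ by simp
  then have le2: "card J \<le> 2" by linarith
  have ne0: "card J \<noteq> 0" using sJ J by (cases "J = {}") auto
  have ne1: "card J \<noteq> 1"
  proof
    assume "card J = 1"
    then obtain i where i: "J = {i}" by (rule card_1_singletonE)
    then have "i \<in> J" by simp
    from lt1[OF this] sJ show False unfolding i by simp
  qed
  have c2: "card J = 2" using le2 ne0 ne1 by arith
  then obtain a b where ab: "J = {a, b}" "a \<noteq> b" using card_2_iff by metis
  have mem: "a \<in> J" "b \<in> J" unfolding ab(1) by simp_all
  have s: "(1 - 1 / real (Q a)) + (1 - 1 / real (Q b)) = 1" using sJ ab(2) unfolding ab(1) by simp
  have "1 - 1 / real (Q a) = 1/2" "1 - 1 / real (Q b) = 1/2"
    using s half[OF mem(1)] half[OF mem(2)] by linarith+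
  then have "real (Q a) = 2" "real (Q b) = 2" by (simp_all add: field_simps)
  then have "Q a = 2" "Q b = 2" by simp_all
  moreover have "i = a \<or> i = b" if "i \<in> I" "Q i \<noteq> 1" for i
    using that ab(1) unfolding J_def by blast
  ultimately show ?thesis using c2 unfolding J_def by metis
qed

lemma Gam_simps [simp]:
  "verts (Gam m r w) = insert Sink {Src i j | i j. i \<in> {1..m} \<and> j \<in> {1..r i}}"
  "arcs (Gam m r w) = {(i, j, k). i \<in> {1..m} \<and> j \<in> {1..r i} \<and> k \<in> {1..w i j}}"
  "tail (Gam m r w) (i, j, k) = Src i j"
  "head (Gam m r w) e = Sink"
  by (simp_all add: Gam_def)

lemma verts_Gam_image: "verts (Gam m r w) = insert Sink ((\<lambda>(i, j). Src i j) ` (SIGMA i:{1..m}. {1..r i}))"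
  by auto

lemma finite_Gam [simp]: "finite (verts (Gam m r w))" "finite (arcs (Gam m r w))"
proof -
  show "finite (verts (Gam m r w))" unfolding verts_Gam_image by blast
  have "arcs (Gam m r w) = (SIGMA i:{1..m}. SIGMA j:{1..r i}. {1..w i j})" by auto
  then show "finite (arcs (Gam m r w))" by (simp only: finite_SigmaI finite_atLeastAtMost)
qed

lemma pairing_Gam:
  "pairing (Gam m r w) (theta m w) d
     = (\<Sum>i\<in>{1..m}. \<Sum>j\<in>{1..r i}. int (w i j * d (Src i j))) - int m * int (d Sink)"
proof -
  have "pairing (Gam m r w) (theta m w) d
     = - int m * int (d Sink) + (\<Sum>v\<in>(\<lambda>(i, j). Src i j) ` (SIGMA i:{1..m}. {1..r i}). theta m w v * int (d v))"
    unfolding pairing_def verts_Gam_image by (subst sum.insert) (auto simp: theta_def)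
  also have "(\<Sum>v\<in>(\<lambda>(i, j). Src i j) ` (SIGMA i:{1..m}. {1..r i}). theta m w v * int (d v))
     = (\<Sum>(i, j)\<in>(SIGMA i:{1..m}. {1..r i}). int (w i j * d (Src i j)))"
    by (subst sum.reindex) (auto simp: inj_on_def theta_def intro!: sum.cong)
  finally show ?thesis by (simp add: sum.Sigma)
qed

lemma pairing_balanced: "balanced m r w d \<Longrightarrow> pairing (Gam m r w) (theta m w) d = 0"
proof -
  assume b: "balanced m r w d"
  have "(\<Sum>j\<in>{1..r i}. int (w i j * d (Src i j))) = int (d Sink)" if "i \<in> {1..m}" for i
    using b that unfolding balanced_def by (metis of_nat_sum)
  then show ?thesis unfolding pairing_Gam by simp
qed

definition max_ratio :: "(nat \<Rightarrow> nat) \<Rightarrow> (nat \<Rightarrow> nat \<Rightarrow> nat) \<Rightarrow> (vertex \<Rightarrow> nat) \<Rightarrow> nat \<Rightarrow> real" where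
  "max_ratio r w d i = Max ((\<lambda>j. real (d (Src i j)) / real (w i j)) ` {1..r i})"

lemma max_ratio_rat:
  assumes "r i \<ge> 1"
  shows "max_ratio r w d i = real_of_rat (Max ((\<lambda>j. of_nat (d (Src i j)) / of_nat (w i j)) ` {1..r i}))"
proof -
  have m: "mono real_of_rat" by (simp add: mono_def of_rat_less_eq)
  show ?thesis unfolding max_ratio_def
    by (subst mono_Max_commute[OF m]) (use assms in \<open>auto simp: image_image of_rat_divide\<close>)
qed

text \<open>The inequality of condition (c) is stated over the rationals; the estimates are carried out over the reals.\<close>

lemma inequality_real:
  assumes "\<And>i. i \<in> {1..m} \<Longrightarrow> r i \<ge> 1"
  shows "(\<Sum>i\<in>{1..m}. Max ((\<lambda>j. of_nat (d (Src i j)) / of_nat (w i j)) ` {1..r i}))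
       \<le> (of_nat m - 1) * (of_nat (d Sink) :: rat) \<longleftrightarrow>
     (\<Sum>i\<in>{1..m}. max_ratio r w d i) \<le> (real m - 1) * real (d Sink)"
proof -
  have "(\<Sum>i\<in>{1..m}. max_ratio r w d i)
     = real_of_rat (\<Sum>i\<in>{1..m}. Max ((\<lambda>j. of_nat (d (Src i j)) / of_nat (w i j)) ` {1..r i}))"
    unfolding of_rat_sum using assms by (intro sum.cong refl max_ratio_rat) auto
  moreover have "(real m - 1) * real (d Sink) = real_of_rat ((of_nat m - 1) * of_nat (d Sink))"
    by (simp add: of_rat_mult of_rat_diff)
  ultimately show ?thesis by (simp only: of_rat_less_eq)
qed

locale balanced_decomposition =
  fixes m :: nat and r :: "nat \<Rightarrow> nat" and w :: "nat \<Rightarrow> nat \<Rightarrow> nat" and d d' d'' :: "vertex \<Rightarrow> nat"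
  assumes weights: "\<And>i j. \<lbrakk>i \<in> {1..m}; j \<in> {1..r i}\<rbrakk> \<Longrightarrow> w i j \<ge> 1"
    and bal': "balanced m r w d'" and bal'': "balanced m r w d''"
    and decomp: "\<And>v. v \<in> verts (Gam m r w) \<Longrightarrow> d v = d' v + d'' v"
    and pos: "d' Sink > 0" "d'' Sink > 0"
begin

lemma decomp': "i \<in> {1..m} \<Longrightarrow> j \<in> {1..r i} \<Longrightarrow> d (Src i j) = d' (Src i j) + d'' (Src i j)"
  "d Sink = d' Sink + d'' Sink"
  using decomp by auto

lemma bal: "balanced m r w d"
  unfolding balanced_def
proof
  fix i assume i: "i \<in> {1..m}"
  have "(\<Sum>j\<in>{1..r i}. w i j * d (Src i j)) = (\<Sum>j\<in>{1..r i}. w i j * d' (Src i j) + w i j * d'' (Src i j))"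
    by (rule sum.cong) (use decomp' i in \<open>auto simp: algebra_simps\<close>)
  then show "(\<Sum>j\<in>{1..r i}. w i j * d (Src i j)) = d Sink"
    using bal' bal'' i unfolding balanced_def sum.distrib by (simp add: decomp')
qed

abbreviation "n' \<equiv> real (d' Sink)"
abbreviation "n'' \<equiv> real (d'' Sink)"
abbreviation "n \<equiv> real (d Sink)"

definition "s = n' / n"

lemma s: "0 < s" "s < 1" "1 - s = n'' / n"
  using pos decomp'(2) by (auto simp: s_def field_simps)

text \<open>The estimate of \<open>product_le_weighted\<close> at one vertex, with the largest ratio of the cluster as \<open>M\<close>.\<close>

definition "bound i j = max_ratio r w d i *
  ((1 - s)\<^sup>2 * (real (w i j) * real (d' (Src i j))) + s\<^sup>2 * (real (w i j) * real (d'' (Src i j))))"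

lemma bal_real:
  assumes "i \<in> {1..m}"
  shows "(\<Sum>j\<in>{1..r i}. real (w i j) * real (d' (Src i j))) = n'"
    "(\<Sum>j\<in>{1..r i}. real (w i j) * real (d'' (Src i j))) = n''"
    "(\<Sum>j\<in>{1..r i}. real (w i j) * real (d (Src i j))) = n"
  using arg_cong[OF bspec[OF bal'[unfolded balanced_def] assms], of real]
    arg_cong[OF bspec[OF bal''[unfolded balanced_def] assms], of real]
    arg_cong[OF bspec[OF bal[unfolded balanced_def] assms], of real]
  by simp_all

text \<open>With \<open>s = n' / n\<close> the weights combine to \<open>(1 - s)\<^sup>2 n' + s\<^sup>2 n'' = n' n'' / n\<close>.\<close>

lemma sum_bound:
  assumes "i \<in> {1..m}"
  shows "(\<Sum>j\<in>{1..r i}. bound i j) = max_ratio r w d i * (n' * n'' / n)"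
proof -
  let ?M = "max_ratio r w d i"
  have "(\<Sum>j\<in>{1..r i}. bound i j)
    = (\<Sum>j\<in>{1..r i}. (?M * (1 - s)\<^sup>2) * (real (w i j) * real (d' (Src i j)))
        + (?M * s\<^sup>2) * (real (w i j) * real (d'' (Src i j))))"
    unfolding bound_def by (intro sum.cong refl) (simp only: distrib_left mult.assoc)
  also have "\<dots> = ?M * (1 - s)\<^sup>2 * n' + ?M * s\<^sup>2 * n''"
    unfolding sum.distrib sum_distrib_left[symmetric] bal_real[OF assms] ..
  also have "\<dots> = ?M * ((1 - s)\<^sup>2 * n' + s\<^sup>2 * n'')" by (simp only: distrib_left mult.assoc)
  also have "(1 - s)\<^sup>2 * n' + s\<^sup>2 * n'' = n' * n'' * (n' + n'') / (n * n)"
    unfolding s(3) by (simp add: s_def power2_eq_square distrib_left add_divide_distrib ac_simps)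
  also have "\<dots> = n' * n'' / n" using pos decomp'(2) by simp
  finally show ?thesis .
qed

lemma ratio_le:
  assumes "i \<in> {1..m}" "j \<in> {1..r i}"
  shows "real (d (Src i j)) \<le> max_ratio r w d i * real (w i j)"
proof -
  have "real (d (Src i j)) / real (w i j) \<le> max_ratio r w d i"
    unfolding max_ratio_def using assms by (intro Max_ge) auto
  then show ?thesis using weights[OF assms] by (simp add: field_simps)
qed

lemma term_le:
  assumes "i \<in> {1..m}" "j \<in> {1..r i}"
  shows "real (d' (Src i j)) * real (d'' (Src i j)) \<le> bound i j"
  unfolding bound_def
  by (rule product_le_weighted(1)) (use weights[OF assms] ratio_le[OF assms] decomp'(1)[OF assms] in simp_all)

lemma term_eq:
  assumes ij: "i \<in> {1..m}" "j \<in> {1..r i}" and d: "d (Src i j) > 0"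
    and eq: "real (d' (Src i j)) * real (d'' (Src i j)) = bound i j"
  shows "real (d (Src i j)) = max_ratio r w d i * real (w i j)"
    "n'' * real (d' (Src i j)) = n' * real (d'' (Src i j))"
proof -
  have hpos: "(1 - s)\<^sup>2 * real (d' (Src i j)) + s\<^sup>2 * real (d'' (Src i j)) > 0"
  proof (cases "d' (Src i j) > 0")
    case True then show ?thesis using s(1,2) by (intro add_pos_nonneg mult_pos_pos) simp_all
  next
    case False
    then have "d'' (Src i j) > 0" using d decomp'(1)[OF ij] by simp
    then show ?thesis using s(1,2) by (intro add_nonneg_pos mult_pos_pos) simp_all
  qed
  have *: "real (d' (Src i j)) + real (d'' (Src i j)) = max_ratio r w d i * real (w i j) \<and>
      (1 - s) * real (d' (Src i j)) = s * real (d'' (Src i j))"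
    by (rule product_le_weighted(2)[OF _ _ _ _ eq[unfolded bound_def] hpos])
       (use weights[OF ij] ratio_le[OF ij] decomp'(1)[OF ij] in simp_all)
  then show "real (d (Src i j)) = max_ratio r w d i * real (w i j)" using decomp'(1)[OF ij] by simp
  have "n > 0" using pos decomp'(2) by simp
  with * show "n'' * real (d' (Src i j)) = n' * real (d'' (Src i j))"
    unfolding s(3) by (simp add: s_def)
qed

abbreviation "form \<equiv> \<Sum>i\<in>{1..m}. \<Sum>j\<in>{1..r i}. d' (Src i j) * d'' (Src i j)"

lemma form_real: "real form = (\<Sum>i\<in>{1..m}. \<Sum>j\<in>{1..r i}. real (d' (Src i j)) * real (d'' (Src i j)))"
  by simp

lemma form_le:
  assumes ineq: "(\<Sum>i\<in>{1..m}. max_ratio r w d i) \<le> (real m - 1) * n"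
  shows "real form \<le> (real m - 1) * (n' * n'')"
    and "real form = (real m - 1) * (n' * n'') \<Longrightarrow> (\<Sum>i\<in>{1..m}. max_ratio r w d i) = (real m - 1) * n"
    and "real form = (real m - 1) * (n' * n'') \<Longrightarrow> i \<in> {1..m} \<Longrightarrow> j \<in> {1..r i} \<Longrightarrow>
      real (d' (Src i j)) * real (d'' (Src i j)) = bound i j"
proof -
  let ?B = "\<Sum>i\<in>{1..m}. \<Sum>j\<in>{1..r i}. bound i j"
  have npos: "n > 0" "n' * n'' / n > 0" using pos decomp'(2) by auto
  have B: "?B = (\<Sum>i\<in>{1..m}. max_ratio r w d i) * (n' * n'' / n)"
    unfolding sum_distrib_right by (intro sum.cong refl sum_bound)
  have R: "(real m - 1) * n * (n' * n'' / n) = (real m - 1) * (n' * n'')" using npos by simp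
  have fB: "real form \<le> ?B" unfolding form_real by (intro sum_mono term_le)
  have BR: "?B \<le> (real m - 1) * n * (n' * n'' / n)"
    unfolding B using ineq npos by (intro mult_right_mono) auto
  show "real form \<le> (real m - 1) * (n' * n'')" using fB BR R by linarith
  assume eq: "real form = (real m - 1) * (n' * n'')"
  then have e1: "?B = (real m - 1) * n * (n' * n'' / n)" and e2: "real form = ?B" using fB BR R by linarith+
  from e1 show "(\<Sum>i\<in>{1..m}. max_ratio r w d i) = (real m - 1) * n" 
  proof -
    have "n' * n'' / n \<noteq> 0" using npos(2) by linarith
    from mult_right_cancel[THEN iffD1, OF this e1[unfolded B]] show ?thesis .
  qed
  assume i: "i \<in> {1..m}" and j: "j \<in> {1..r i}"
  have le: "(\<Sum>j\<in>{1..r i}. real (d' (Src i j)) * real (d'' (Src i j))) \<le> (\<Sum>j\<in>{1..r i}. bound i j)"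
    if "i \<in> {1..m}" for i
    by (rule sum_mono) (rule term_le[OF that])
  have "(\<Sum>j\<in>{1..r i}. real (d' (Src i j)) * real (d'' (Src i j))) = (\<Sum>j\<in>{1..r i}. bound i j)"
    by (rule sum_mono_inv[OF e2[unfolded form_real] le i]) simp_all
  then show "real (d' (Src i j)) * real (d'' (Src i j)) = bound i j"
    by (rule sum_mono_inv[OF _ term_le[OF i] j]) simp_all
qed

text \<open>Equality in every estimate makes the nonzero \<open>d (Src i j)\<close> proportional to the weights within each cluster. With
  \<open>Q i\<close> the sum of the squares of these weights, the largest ratio is \<open>n / Q i\<close>, and the equality of the
  totals reads \<open>\<Sum>\<^sub>i (1 - 1 / Q i) = 1\<close>. So exactly two of the \<open>Q i\<close> equal \<open>2 = 1 + 1\<close>, which means two entries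
  \<open>n/2\<close> of weight one, and all the others equal \<open>1\<close>.\<close>

lemma equality_special_isotropic:
  assumes ineq: "(\<Sum>i\<in>{1..m}. max_ratio r w d i) \<le> (real m - 1) * n"
    and eq: "real form = (real m - 1) * (n' * n'')"
  shows "special_isotropic m r w d"
proof -
  let ?J = "\<lambda>i. {j\<in>{1..r i}. d (Src i j) > 0}"
  define Q where "Q i = (\<Sum>j\<in>?J i. (w i j)\<^sup>2)" for i
  let ?M = "max_ratio r w d"
  have npos: "n > 0" using pos decomp'(2) by auto
  have dM: "real (d (Src i j)) = ?M i * real (w i j)" if "i \<in> {1..m}" "j \<in> ?J i" for i j
    using term_eq(1)[of i j] form_le(3)[OF ineq eq, of i j] that by auto
  have MQ: "?M i * real (Q i) = n" if i: "i \<in> {1..m}" for i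
  proof -
    have "n = (\<Sum>j\<in>?J i. real (w i j) * real (d (Src i j)))"
      unfolding bal_real(3)[OF i, symmetric] by (rule sum.mono_neutral_right) auto
    also have "\<dots> = (\<Sum>j\<in>?J i. ?M i * real ((w i j)\<^sup>2))"
      using dM[OF i] by (intro sum.cong) (auto simp: power2_eq_square)
    finally show ?thesis unfolding Q_def by (simp add: sum_distrib_left)
  qed
  have Q0: "Q i \<ge> 1" if "i \<in> {1..m}" for i using MQ[OF that] npos by (cases "Q i") auto
  have M: "?M i = n / real (Q i)" if "i \<in> {1..m}" for i
    using MQ[OF that] Q0[OF that] by (simp add: field_simps)
  have "(\<Sum>i\<in>{1..m}. 1 - 1 / real (Q i)) = 1"
  proof -
    have "n * (\<Sum>i\<in>{1..m}. 1 - 1 / real (Q i)) = n * real m - (\<Sum>i\<in>{1..m}. ?M i)"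
      using M by (simp add: sum_distrib_left right_diff_distrib sum_subtractf)
    also have "\<dots> = n" unfolding form_le(2)[OF ineq eq] by (simp add: algebra_simps)
    finally show ?thesis using npos by simp
  qed
  from inverse_sum_one[OF _ Q0 this]
  have Q2: "card {i\<in>{1..m}. Q i \<noteq> 1} = 2" "\<And>i. i \<in> {1..m} \<Longrightarrow> Q i \<noteq> 1 \<Longrightarrow> Q i = 2" by auto
  have wJ: "w i j \<ge> 1" if "i \<in> {1..m}" "j \<in> ?J i" for i j using weights that by auto
  have cardQ: "card (?J i) \<le> Q i" if i: "i \<in> {1..m}" for i
  proof -
    have "(\<Sum>j\<in>?J i. 1) \<le> Q i" unfolding Q_def using wJ[OF i] by (intro sum_mono) (simp add: Suc_le_eq)
    then show ?thesis by simp
  qed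
  have wQ: "(w i j)\<^sup>2 \<le> Q i" if "i \<in> {1..m}" "j \<in> ?J i" for i j
    unfolding Q_def using that by (intro member_le_sum) auto
  have w1: "w i j = 1" if "i \<in> {1..m}" "j \<in> ?J i" for i j
  proof (rule ccontr)
    assume "w i j \<noteq> 1"
    then have "w i j \<ge> 2" using wJ[OF that] by auto
    then have "2\<^sup>2 \<le> (w i j)\<^sup>2" by (rule power_mono) simp
    then show False using wQ[OF that] Q2(2)[OF that(1)] by (cases "Q i = 1") auto
  qed
  have cJ: "card (?J i) = Q i" if i: "i \<in> {1..m}" for i
    unfolding Q_def using w1[OF i] by simp
  let ?T = "{(i, j). i \<in> {1..m} \<and> j \<in> {1..r i} \<and> 0 < d (Src i j) \<and> d (Src i j) < d Sink}"
  have dv: "real (d (Src i j)) * real (Q i) = n" if "i \<in> {1..m}" "j \<in> ?J i" for i j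
    using dM[OF that] w1[OF that] MQ[OF that(1)] by simp
  have lt: "d (Src i j) < d Sink \<longleftrightarrow> Q i \<noteq> 1" if "i \<in> {1..m}" "j \<in> ?J i" for i j
  proof (cases "Q i = 1")
    case True then show ?thesis using dv[OF that] by simp
  next
    case False
    then have "real (d (Src i j)) * 2 = n" using dv[OF that] Q2(2)[OF that(1)] by simp
    then show ?thesis using False npos by linarith
  qed
  have T: "?T = (SIGMA i:{i\<in>{1..m}. Q i \<noteq> 1}. ?J i)" using lt by auto
  have "card ?T = (\<Sum>i\<in>{i\<in>{1..m}. Q i \<noteq> 1}. card (?J i))" unfolding T by (subst card_SigmaI) auto
  also have "\<dots> = (\<Sum>i\<in>{i\<in>{1..m}. Q i \<noteq> 1}. 2)" using cJ Q2(2) by (intro sum.cong) auto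
  also have "\<dots> = 4" using Q2(1) by simp
  finally have c4: "card ?T = 4" .
  have "2 * d (Src i j) = d Sink \<and> w i j = 1" if "(i, j) \<in> ?T" for i j
  proof -
    have ij: "i \<in> {1..m}" "j \<in> ?J i" "Q i \<noteq> 1" using that unfolding T by auto
    then have "real (d (Src i j)) * 2 = n" using dv[OF ij(1,2)] Q2(2)[OF ij(1)] by simp
    then show ?thesis using w1[OF ij(1,2)] by linarith
  qed
  moreover have "d Sink \<ge> 2" using pos decomp'(2) by linarith
  ultimately show ?thesis unfolding special_isotropic_def Let_def using bal c4 by auto
qed

lemma equality_proportional:
  assumes ineq: "(\<Sum>i\<in>{1..m}. max_ratio r w d i) \<le> (real m - 1) * n"
    and eq: "real form = (real m - 1) * (n' * n'')"
    and ij: "i \<in> {1..m}" "j \<in> {1..r i}" "d (Src i j) > 0"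
  shows "d Sink * d' (Src i j) = d' Sink * d (Src i j)"
proof -
  have "n'' * real (d' (Src i j)) = n' * real (d'' (Src i j))"
    using term_eq(2)[OF ij] form_le(3)[OF ineq eq] ij by blast
  then have "real (d Sink * d' (Src i j)) = real (d' Sink * d (Src i j))"
    using decomp'(1)[OF ij(1,2)] decomp'(2) by (simp add: algebra_simps)
  then show ?thesis by (simp only: of_nat_eq_iff)
qed

end

section \<open>Special isotropic vectors and the strict inequality\<close>

lemma ratio_bounds:
  fixes D W N :: real
  assumes D: "0 \<le> D" and W: "1 \<le> W" and WD: "W * D \<le> N"
  shows "D / W \<le> N" "2 \<le> W \<Longrightarrow> D / W \<le> N / 4"
proof -
  have "1 * D \<le> W * D" by (rule mult_right_mono[OF W D])
  then have DN: "D \<le> N" using WD by linarith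
  have "N \<le> N * W" using mult_left_mono[OF W, of N] D DN by simp
  then show "D / W \<le> N" using DN W by (simp add: divide_le_eq)
  assume W2: "2 \<le> W"
  have "2 * D \<le> W * D" by (rule mult_right_mono[OF W2 D])
  then have D2: "2 * D \<le> N" using WD by linarith
  have "N * 2 \<le> N * W" using mult_left_mono[OF W2, of N] D D2 by simp
  then show "D / W \<le> N / 4" using D2 W2 by (simp add: divide_le_eq)
qed

locale balanced_vector =
  fixes m :: nat and r :: "nat \<Rightarrow> nat" and w :: "nat \<Rightarrow> nat \<Rightarrow> nat" and d :: "vertex \<Rightarrow> nat"
  assumes weights: "\<And>i j. \<lbrakk>i \<in> {1..m}; j \<in> {1..r i}\<rbrakk> \<Longrightarrow> w i j \<ge> 1"
    and bal: "balanced m r w d" and pos: "d Sink > 0"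
begin

text \<open>For a special isotropic vector these are the four vertices whose entry is half of \<open>d Sink\<close>.\<close>

definition halves :: "(nat \<times> nat) set" where
  "halves = {(i, j). i \<in> {1..m} \<and> j \<in> {1..r i} \<and> 0 < d (Src i j) \<and> d (Src i j) < d Sink}"

lemma special_isotropicD:
  assumes "special_isotropic m r w d"
  shows "card halves = 4" "d Sink \<ge> 2"
    "(i, j) \<in> halves \<Longrightarrow> 2 * d (Src i j) = d Sink" "(i, j) \<in> halves \<Longrightarrow> w i j = 1"
  using assms unfolding special_isotropic_def halves_def Let_def by blast+

text \<open>The entries of the cluster other than \<open>j\<close> contribute \<open>n/2\<close>, and every contribution is \<open>0\<close>, \<open>n/2\<close> or at
  least \<open>n\<close>.\<close>

lemma halves_partner:
  assumes sp: "special_isotropic m r w d" and h: "(i, j) \<in> halves"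
  shows "\<exists>j'. j' \<noteq> j \<and> (i, j') \<in> halves \<and> (\<forall>l. (i, l) \<in> halves \<longrightarrow> l = j \<or> l = j')"
proof -
  let ?k = "d (Src i j)"
  have i: "i \<in> {1..m}" and j: "j \<in> {1..r i}" and k: "0 < ?k" "2 * ?k = d Sink" "w i j = 1"
    using h special_isotropicD(3,4)[OF sp h] by (auto simp: halves_def)
  have "d Sink = (\<Sum>l\<in>{1..r i}. w i l * d (Src i l))" using bal i by (simp add: balanced_def)
  also have "\<dots> = w i j * ?k + (\<Sum>l\<in>{1..r i} - {j}. w i l * d (Src i l))"
    using j by (intro sum.remove) auto
  finally have rest: "(\<Sum>l\<in>{1..r i} - {j}. w i l * d (Src i l)) = ?k" using k by simp
  have val: "w i l * d (Src i l) = (if (i, l) \<in> halves then ?k else 0)" if l: "l \<in> {1..r i} - {j}" for l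
  proof (cases "(i, l) \<in> halves")
    case True
    then show ?thesis using special_isotropicD(3,4)[OF sp True] k by simp
  next
    case False
    then have "d (Src i l) = 0 \<or> d (Src i l) \<ge> d Sink" using l i by (auto simp: halves_def)
    moreover have "\<not> d (Src i l) \<ge> d Sink"
    proof
      assume ge: "d (Src i l) \<ge> d Sink"
      have "1 * d Sink \<le> w i l * d (Src i l)" using weights[OF i] l ge by (intro mult_le_mono) auto
      also have "\<dots> \<le> (\<Sum>l\<in>{1..r i} - {j}. w i l * d (Src i l))" using l by (intro member_le_sum) auto
      finally show False using rest k by simp
    qed
    ultimately show ?thesis using False by simp
  qed
  let ?L = "{l \<in> {1..r i} - {j}. (i, l) \<in> halves}"
  have "?k = (\<Sum>l\<in>{1..r i} - {j}. if (i, l) \<in> halves then ?k else 0)" using rest val by simp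
  also have "\<dots> = card ?L * ?k" by (simp add: sum.If_cases Int_def)
  finally have "card ?L = 1" using k by simp
  then obtain j' where L: "?L = {j'}" by (rule card_1_singletonE)
  then have "j' \<in> ?L" by simp
  then have "j' \<noteq> j" "(i, j') \<in> halves" by simp_all
  moreover have "l = j \<or> l = j'" if "(i, l) \<in> halves" for l
  proof (cases "l = j")
    case False
    moreover have "l \<in> {1..r i}" using that by (simp add: halves_def)
    ultimately have "l \<in> ?L" using that by simp
    then have "l \<in> {j'}" by (simp only: L)
    then show ?thesis by simp
  qed simp
  ultimately show ?thesis by (intro exI[of _ j'] conjI allI impI)
qed

lemma halves_structure:
  assumes sp: "special_isotropic m r w d"
  obtains i1 a b i2 c e where "i1 \<noteq> i2" "a \<noteq> b" "c \<noteq> e"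
    "halves = {(i1, a), (i1, b), (i2, c), (i2, e)}"
proof -
  note c4 = special_isotropicD(1)[OF sp]
  have fin: "finite halves" by (rule ccontr) (use c4 in simp)
  have "halves \<noteq> {}" using c4 by auto
  then obtain i1 a where 1: "(i1, a) \<in> halves" by auto
  obtain b where b: "b \<noteq> a" "(i1, b) \<in> halves" "\<And>l. (i1, l) \<in> halves \<Longrightarrow> l = a \<or> l = b"
    using halves_partner[OF sp 1] by blast
  have "\<not> halves \<subseteq> {(i1, a), (i1, b)}"
  proof
    assume "halves \<subseteq> {(i1, a), (i1, b)}"
    from card_mono[OF _ this] c4 b show False by simp
  qed
  then obtain i2 c where 2: "(i2, c) \<in> halves" "(i2, c) \<notin> {(i1, a), (i1, b)}" by auto
  have ne: "i1 \<noteq> i2" using 2 b(3) by auto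
  obtain e where e: "e \<noteq> c" "(i2, e) \<in> halves" using halves_partner[OF sp 2(1)] by blast
  have "{(i1, a), (i1, b), (i2, c), (i2, e)} = halves"
    by (rule card_subset_eq[OF fin]) (use 1 2 b e ne c4 in auto)
  then show thesis using that[OF ne] b(1) e(1) by metis
qed

lemma entry_le: "i \<in> {1..m} \<Longrightarrow> j \<in> {1..r i} \<Longrightarrow> w i j * d (Src i j) \<le> d Sink"
proof -
  assume i: "i \<in> {1..m}" and j: "j \<in> {1..r i}"
  have "w i j * d (Src i j) \<le> (\<Sum>j\<in>{1..r i}. w i j * d (Src i j))"
    using j by (intro member_le_sum) auto
  then show ?thesis using bal i unfolding balanced_def by auto
qed

lemma cluster_nonempty: "i \<in> {1..m} \<Longrightarrow> r i \<ge> 1"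
proof -
  assume i: "i \<in> {1..m}"
  have "(\<Sum>j\<in>{1..r i}. w i j * d (Src i j)) > 0" using bal i pos unfolding balanced_def by simp
  then show ?thesis by (cases "r i") auto
qed

lemma max_ratio_le:
  assumes i: "i \<in> {1..m}" and b: "\<And>j. j \<in> {1..r i} \<Longrightarrow> real (d (Src i j)) / real (w i j) \<le> b"
  shows "max_ratio r w d i \<le> b"
proof -
  have "{1..r i} \<noteq> {}" using cluster_nonempty[OF i] by auto
  then show ?thesis unfolding max_ratio_def using b by (subst Max_le_iff) auto
qed

lemma max_ratio_le_total: "i \<in> {1..m} \<Longrightarrow> max_ratio r w d i \<le> real (d Sink)"
proof (rule max_ratio_le)
  fix j assume ij: "i \<in> {1..m}" "j \<in> {1..r i}"
  have "real (w i j) * real (d (Src i j)) \<le> real (d Sink)"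
    using entry_le[OF ij] by (simp flip: of_nat_mult)
  then show "real (d (Src i j)) / real (w i j) \<le> real (d Sink)"
    by (intro ratio_bounds(1)) (use weights[OF ij] in simp_all)
qed

text \<open>The two clusters that contain the four entries have largest ratio at most \<open>n/2\<close>, the others at most \<open>n\<close>.\<close>

lemma special_isotropic_inequality:
  assumes sp: "special_isotropic m r w d"
  shows "(\<Sum>i\<in>{1..m}. max_ratio r w d i) \<le> (real m - 1) * real (d Sink)"
proof -
  obtain i1 a b i2 c e where ne: "i1 \<noteq> i2" and hv: "halves = {(i1, a), (i1, b), (i2, c), (i2, e)}"
    by (rule halves_structure[OF sp])
  have half: "max_ratio r w d i \<le> real (d Sink) / 2" if h: "(i, j) \<in> halves" for i j
  proof (rule max_ratio_le)
    show i: "i \<in> {1..m}" using h by (simp add: halves_def)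
    have j: "j \<in> {1..r i}" using h by (simp add: halves_def)
    fix l assume l: "l \<in> {1..r i}"
    show "real (d (Src i l)) / real (w i l) \<le> real (d Sink) / 2"
    proof (cases "l = j \<or> (i, l) \<in> halves")
      case True
      then have "(i, l) \<in> halves" using h by auto
      from special_isotropicD(3,4)[OF sp this] show ?thesis by simp
    next
      case False
      have "w i j * d (Src i j) + w i l * d (Src i l) = (\<Sum>s\<in>{j, l}. w i s * d (Src i s))" using False by simp
      also have "\<dots> \<le> (\<Sum>s\<in>{1..r i}. w i s * d (Src i s))" by (rule sum_mono2) (use j l in auto)
      also have "\<dots> = d Sink" using bal i by (simp add: balanced_def)
      finally have le: "d (Src i j) + w i l * d (Src i l) \<le> d Sink" using special_isotropicD(4)[OF sp h] by simp
      have "1 * d (Src i l) \<le> w i l * d (Src i l)" by (rule mult_le_mono1[OF weights[OF i l]])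
      then have "d (Src i l) < d Sink" using le special_isotropicD(3)[OF sp h] pos by linarith
      then have "d (Src i l) = 0" using False i l by (auto simp: halves_def)
      then show ?thesis by simp
    qed
  qed
  have i12: "i1 \<in> {1..m}" "i2 \<in> {1..m}" using hv by (auto simp: halves_def)
  let ?R = "{1..m} - {i1, i2}"
  have "(\<Sum>i\<in>{1..m}. max_ratio r w d i) = (\<Sum>i\<in>{i1, i2}. max_ratio r w d i) + (\<Sum>i\<in>?R. max_ratio r w d i)"
    using sum.subset_diff[of "{i1, i2}" "{1..m}" "max_ratio r w d"] i12 by (simp add: add.commute)
  also have "\<dots> \<le> real (d Sink) + (\<Sum>i\<in>?R. real (d Sink))"
  proof (rule add_mono)
    show "(\<Sum>i\<in>{i1, i2}. max_ratio r w d i) \<le> real (d Sink)"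
      using half[of i1 a] half[of i2 c] ne hv by simp
    show "(\<Sum>i\<in>?R. max_ratio r w d i) \<le> (\<Sum>i\<in>?R. real (d Sink))"
      by (rule sum_mono[OF max_ratio_le_total]) simp
  qed
  also have "(\<Sum>i\<in>?R. real (d Sink)) = real (m - 2) * real (d Sink)"
    using i12 ne by (simp add: card_Diff_subset)
  also have "real (m - 2) = real m - 2"
    using card_mono[of "{1..m}" "{i1, i2}"] i12 ne by (simp add: of_nat_diff)
  finally show ?thesis by (simp add: algebra_simps)
qed

end

context balanced_decomposition
begin

sublocale vec: balanced_vector m r w d
  by (rule balanced_vector.intro[OF weights bal]) (use decomp'(2) pos in auto)

text \<open>The vector \<open>e\<close> below lies on the ray of \<open>\<delta>\<^sub>u\<close>, so by minimality \<open>d\<close> has entry \<open>1\<close> at the only vertex of the cluster \<open>i0\<close>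
  where it does not vanish. But both parts of a balanced decomposition are nonzero at that vertex.\<close>

lemma not_condition_a:
  assumes m: "m \<ge> 1" and a: "condition_a m r w d"
  shows False
proof -
  obtain u where u: "\<And>i. i \<in> {1..m} \<Longrightarrow> u i \<in> {1..r i}"
    and re: "card {i\<in>{1..m}. w i (u i) \<noteq> 1} \<le> 1"
    and ray: "on_ray (verts (Gam m r w)) (delta w u) d"
    and min: "\<And>e v. on_ray (verts (Gam m r w)) (delta w u) e \<Longrightarrow> v \<in> verts (Gam m r w) \<Longrightarrow> d v \<le> e v"
    using a unfolding condition_a_def extremal_index_def real_extremal_def minimal_on_ray_def by blast
  obtain q where q: "\<And>v. v \<in> verts (Gam m r w) \<Longrightarrow> of_nat (d v) = q * delta w u v"
    using ray unfolding on_ray_def by blast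
  obtain i0 where i0: "i0 \<in> {1..m}" and triv: "\<And>i. i \<in> {1..m} \<Longrightarrow> i \<noteq> i0 \<Longrightarrow> w i (u i) = 1"
  proof (cases "{i\<in>{1..m}. w i (u i) \<noteq> 1} = {}")
    case True
    then show thesis using that[of 1] m by auto
  next
    case False
    then obtain i where i: "i \<in> {i\<in>{1..m}. w i (u i) \<noteq> 1}" by (auto simp del: mem_Collect_eq)
    have "l = i" if "l \<in> {i\<in>{1..m}. w i (u i) \<noteq> 1}" for l
    proof (rule ccontr)
      assume "l \<noteq> i"
      then have "card {l, i} = 2" by simp
      moreover have "card {l, i} \<le> card {i\<in>{1..m}. w i (u i) \<noteq> 1}"
        by (rule card_mono) (use i that in auto)
      ultimately show False using re by simp
    qed
    then show thesis using that[of i] i by blast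
  qed
  let ?w0 = "w i0 (u i0)"
  have w0: "?w0 \<ge> 1" by (rule weights[OF i0 u[OF i0]])
  \<comment> \<open>the minimal vector on the ray: \<open>\<delta>\<^sub>u\<close> multiplied by the only weight that may be nontrivial\<close>
  define e where "e v = (case v of Sink \<Rightarrow> ?w0 | Src i j \<Rightarrow> if j = u i then (if i = i0 then 1 else ?w0) else 0)" for v
  have "on_ray (verts (Gam m r w)) (delta w u) e"
    unfolding on_ray_def
  proof (rule exI[of _ "of_nat ?w0"], intro conjI ballI)
    show "(0::rat) < of_nat ?w0" using w0 by simp
    fix v assume v: "v \<in> verts (Gam m r w)"
    show "of_nat (e v) = of_nat ?w0 * delta w u v"
      using v w0 triv by (cases v) (auto simp: e_def delta_def)
  qed
  from min[OF this, of "Src i0 (u i0)"] have le1: "d (Src i0 (u i0)) \<le> 1"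
    using i0 u[OF i0] by (simp add: e_def)
  have d0: "d (Src i0 j) = 0" if "j \<in> {1..r i0}" "j \<noteq> u i0" for j
    using q[of "Src i0 j"] i0 that by (simp add: delta_def)
  have one: "x (Src i0 (u i0)) \<ge> 1"
    if x: "balanced m r w x" "x Sink > 0" "\<And>j. j \<in> {1..r i0} \<Longrightarrow> x (Src i0 j) \<le> d (Src i0 j)" for x :: "vertex \<Rightarrow> nat"
  proof (rule ccontr)
    assume "\<not> 1 \<le> x (Src i0 (u i0))"
    then have "x (Src i0 j) = 0" if "j \<in> {1..r i0}" for j
      using x(3)[OF that] d0[OF that] by (cases "j = u i0") auto
    then have "(\<Sum>j\<in>{1..r i0}. w i0 j * x (Src i0 j)) = 0" by (intro sum.neutral) simp
    moreover have "(\<Sum>j\<in>{1..r i0}. w i0 j * x (Src i0 j)) = x Sink"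
      using x(1) i0 unfolding balanced_def by blast
    ultimately show False using x(2) by linarith
  qed
  have le: "d' (Src i0 j) \<le> d (Src i0 j)" "d'' (Src i0 j) \<le> d (Src i0 j)" if "j \<in> {1..r i0}" for j
    using decomp'(1)[OF i0 that] by linarith+
  have "d' (Src i0 (u i0)) \<ge> 1" by (rule one[OF bal' pos(1) le(1)])
  moreover have "d'' (Src i0 (u i0)) \<ge> 1" by (rule one[OF bal'' pos(2) le(2)])
  ultimately show False using le1 decomp'(1)[OF i0 u[OF i0]] by linarith
qed

text \<open>If \<open>d'\<close> is proportional to \<open>d\<close> at one of the four entries \<open>k = n/2\<close>, then \<open>n'\<close> and \<open>n''\<close> are both even and
  positive, so \<open>k \<ge> 2\<close>; and \<open>k\<close> divides all the values \<open>0\<close>, \<open>k\<close>, \<open>2 k\<close> of \<open>d\<close>.\<close>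

lemma divisible_of_proportional:
  assumes sp: "special_isotropic m r w d"
    and pr: "\<And>i j. i \<in> {1..m} \<Longrightarrow> j \<in> {1..r i} \<Longrightarrow> d (Src i j) > 0 \<Longrightarrow> d Sink * d' (Src i j) = d' Sink * d (Src i j)"
  shows "divisible (verts (Gam m r w)) d"
proof -
  have "vec.halves \<noteq> {}" using vec.special_isotropicD(1)[OF sp] by auto
  then obtain i j where h: "(i, j) \<in> vec.halves" by auto
  have ij: "i \<in> {1..m}" "j \<in> {1..r i}" "d (Src i j) > 0" using h by (auto simp: vec.halves_def)
  let ?k = "d (Src i j)"
  have k: "2 * ?k = d Sink" by (rule vec.special_isotropicD(3)[OF sp h])
  have "2 * ?k * d' (Src i j) = d' Sink * ?k" using pr[OF ij] by (simp only: k)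
  then have "?k * (2 * d' (Src i j)) = ?k * d' Sink" by (simp only: mult.commute mult.left_commute)
  then have e': "2 * d' (Src i j) = d' Sink" using ij(3) mult_cancel1 by auto
  have e'': "2 * d'' (Src i j) = d'' Sink" using e' k decomp'(1)[OF ij(1,2)] decomp'(2) by linarith
  have k2: "?k \<ge> 2" using e' e'' pos decomp'(1)[OF ij(1,2)] by arith
  have "?k dvd d v" if v: "v \<in> verts (Gam m r w)" for v
  proof (cases v)
    case Sink
    then show ?thesis using dvd_triv_right[of ?k 2] by (simp only: k)
  next
    case (Src i' j')
    then have ij': "i' \<in> {1..m}" "j' \<in> {1..r i'}" using v by auto
    show ?thesis
    proof (cases "(i', j') \<in> vec.halves")
      case True
      then have "2 * d v = 2 * ?k" using vec.special_isotropicD(3)[OF sp True] k Src by simp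
      then show ?thesis by simp
    next
      case False
      have "1 * d (Src i' j') \<le> w i' j' * d (Src i' j')" by (rule mult_le_mono1[OF weights[OF ij']])
      then have "d (Src i' j') \<le> d Sink" using vec.entry_le[OF ij'] by linarith
      then have "d v = 0 \<or> d v = d Sink" using False Src ij' by (auto simp: vec.halves_def)
      moreover have "?k dvd d Sink" using dvd_triv_right[of ?k 2] by (simp only: k)
      ultimately show ?thesis by auto
    qed
  qed
  then show ?thesis unfolding divisible_def using k2 by blast
qed

lemma form_less:
  assumes m: "m \<ge> 1" and c: "condition_a m r w d \<or> condition_b m r w d \<or> condition_c m r w d"
  shows "real form < (real m - 1) * (n' * n'')"
proof -
  have ineq: "(\<Sum>i\<in>{1..m}. max_ratio r w d i) \<le> (real m - 1) * n"
    if "\<not> condition_b m r w d"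
  proof -
    have "condition_c m r w d" using c that not_condition_a[OF m] by blast
    from iffD1[OF inequality_real[OF vec.cluster_nonempty] conjunct2[OF this[unfolded condition_c_def]]]
    show ?thesis .
  qed
  have ineq': "(\<Sum>i\<in>{1..m}. max_ratio r w d i) \<le> (real m - 1) * n"
  proof (cases "condition_b m r w d")
    case True
    then show ?thesis unfolding condition_b_def by (intro vec.special_isotropic_inequality) simp
  qed (rule ineq)
  have "real form \<noteq> (real m - 1) * (n' * n'')"
  proof
    assume eq: "real form = (real m - 1) * (n' * n'')"
    have sp: "special_isotropic m r w d" by (rule equality_special_isotropic[OF ineq' eq])
    have "\<not> divisible (verts (Gam m r w)) d"
      using c sp not_condition_a[OF m] unfolding condition_b_def condition_c_def by blast
    then show False using divisible_of_proportional[OF sp equality_proportional[OF ineq' eq]] by blast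
  qed
  then show ?thesis using form_le(1)[OF ineq'] by simp
qed

end

section \<open>Balanced representations and stability\<close>

context direct_sum_map
begin

lemma total_mem:
  assumes "\<And>s. s \<in> S \<Longrightarrow> x s \<in> carrier (W s)"
  shows "(\<lambda>s. f s (x s)) \<in> S \<rightarrow> carrier V"
  using assms klinD(3)[OF lin] by blast

lemma total_cong:
  assumes "\<And>s. s \<in> S \<Longrightarrow> x s \<in> carrier (W s)" "\<And>s. s \<in> S \<Longrightarrow> x s = y s"
  shows "total x = total y"
proof -
  interpret V: abelian_group V by (rule kvs_abelian_group[OF V])
  show ?thesis unfolding total_def
    by (rule V.finsum_cong'[OF refl]) (use total_mem[of y] assms in auto)
qed

lemma total_closed: "(\<And>s. s \<in> S \<Longrightarrow> x s \<in> carrier (W s)) \<Longrightarrow> total x \<in> carrier V"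
proof -
  assume x: "\<And>s. s \<in> S \<Longrightarrow> x s \<in> carrier (W s)"
  interpret V: abelian_group V by (rule kvs_abelian_group[OF V])
  show ?thesis unfolding total_def by (rule V.finsum_closed[OF total_mem[OF x]])
qed

lemma total_add:
  assumes x: "\<And>s. s \<in> S \<Longrightarrow> x s \<in> carrier (W s)" and y: "\<And>s. s \<in> S \<Longrightarrow> y s \<in> carrier (W s)"
  shows "total (\<lambda>s. x s \<oplus>\<^bsub>W s\<^esub> y s) = total x \<oplus>\<^bsub>V\<^esub> total y"
proof -
  interpret V: abelian_group V by (rule kvs_abelian_group[OF V])
  have "total (\<lambda>s. x s \<oplus>\<^bsub>W s\<^esub> y s) = (\<Oplus>\<^bsub>V\<^esub>s\<in>S. f s (x s) \<oplus>\<^bsub>V\<^esub> f s (y s))"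
    unfolding total_def
  proof (rule V.finsum_cong'[OF refl])
    show "(\<lambda>s. f s (x s) \<oplus>\<^bsub>V\<^esub> f s (y s)) \<in> S \<rightarrow> carrier V"
      using total_mem[OF x] total_mem[OF y] by auto
    fix s assume s: "s \<in> S"
    show "f s (x s \<oplus>\<^bsub>W s\<^esub> y s) = f s (x s) \<oplus>\<^bsub>V\<^esub> f s (y s)"
      by (rule klinD(4)[OF lin[OF s] x[OF s] y[OF s]])
  qed
  also have "\<dots> = total x \<oplus>\<^bsub>V\<^esub> total y"
    unfolding total_def by (rule V.finsum_addf[OF total_mem[OF x] total_mem[OF y]])
  finally show ?thesis .
qed

lemma total_smult:
  assumes x: "\<And>s. s \<in> S \<Longrightarrow> x s \<in> carrier (W s)"
  shows "total (\<lambda>s. c \<odot>\<^bsub>W s\<^esub> x s) = c \<odot>\<^bsub>V\<^esub> total x"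
proof -
  interpret V: abelian_group V by (rule kvs_abelian_group[OF V])
  have "total (\<lambda>s. c \<odot>\<^bsub>W s\<^esub> x s) = (\<Oplus>\<^bsub>V\<^esub>s\<in>S. c \<odot>\<^bsub>V\<^esub> f s (x s))"
    unfolding total_def
  proof (rule V.finsum_cong'[OF refl])
    show "(\<lambda>s. c \<odot>\<^bsub>V\<^esub> f s (x s)) \<in> S \<rightarrow> carrier V"
      using total_mem[OF x] kvs_simps(1)[OF V] by auto
    fix s assume s: "s \<in> S"
    show "f s (c \<odot>\<^bsub>W s\<^esub> x s) = c \<odot>\<^bsub>V\<^esub> f s (x s)" by (rule klinD(5)[OF lin[OF s] x[OF s]])
  qed
  also have "\<dots> = c \<odot>\<^bsub>V\<^esub> total x"
    unfolding total_def by (rule finsum_scale[OF V total_mem[OF x], symmetric])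
  finally show ?thesis .
qed

lemma total_bij:
  assumes inj: "\<And>x. x \<in> (\<Pi>\<^sub>E s\<in>S. carrier (W s)) \<Longrightarrow> total x = \<zero>\<^bsub>V\<^esub> \<Longrightarrow> \<forall>s\<in>S. x s = \<zero>\<^bsub>W s\<^esub>"
    and fd: "kfd V" and dim: "(\<Sum>s\<in>S. kdim (W s)) = kdim V"
  shows "bij_betw total (\<Pi>\<^sub>E s\<in>S. carrier (W s)) (carrier V)"
  unfolding bij_betw_def
proof
  let ?P = "\<Pi>\<^sub>E s\<in>S. carrier (W s)"
  show "inj_on total ?P"
  proof (rule inj_onI)
    fix x y assume x: "x \<in> ?P" and y: "y \<in> ?P" and eq: "total x = total y"
    have xc: "x s \<in> carrier (W s)" and yc: "y s \<in> carrier (W s)" if "s \<in> S" for s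
      using PiE_mem[OF x that] PiE_mem[OF y that] .
    let ?z = "\<lambda>s. x s \<oplus>\<^bsub>W s\<^esub> (-1) \<odot>\<^bsub>W s\<^esub> y s"
    note W = klinD(1)[OF lin]
    have nc: "(-1) \<odot>\<^bsub>W s\<^esub> y s \<in> carrier (W s)" if "s \<in> S" for s
      by (rule kvs_simps(1)[OF W[OF that] yc[OF that]])
    have zc: "?z s \<in> carrier (W s)" if "s \<in> S" for s
      by (rule kvs_simps(6)[OF W[OF that] xc[OF that] nc[OF that]])
    have "total (\<lambda>s. (-1) \<odot>\<^bsub>W s\<^esub> y s) = (-1) \<odot>\<^bsub>V\<^esub> total y" by (rule total_smult[OF yc])
    moreover have "total ?z = total x \<oplus>\<^bsub>V\<^esub> total (\<lambda>s. (-1) \<odot>\<^bsub>W s\<^esub> y s)" by (rule total_add[OF xc nc])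
    moreover have "total x \<oplus>\<^bsub>V\<^esub> (-1) \<odot>\<^bsub>V\<^esub> total y = \<zero>\<^bsub>V\<^esub>"
      using kvs_diff_zero[OF V total_closed[OF xc] total_closed[OF yc]] eq by simp
    moreover have "total (restrict ?z S) = total ?z" by (rule total_cong) (simp_all add: zc)
    ultimately have t0: "total (restrict ?z S) = \<zero>\<^bsub>V\<^esub>" by simp
    have "restrict ?z S \<in> ?P" by (rule restrict_PiE_iff[THEN iffD2]) (use zc in blast)
    from inj[OF this t0] have z0: "?z s = \<zero>\<^bsub>W s\<^esub>" if "s \<in> S" for s using that by simp
    show "x = y"
    proof (rule PiE_ext[OF x y])
      fix s assume s: "s \<in> S"
      show "x s = y s" using kvs_diff_zero[OF W[OF s] xc[OF s] yc[OF s]] z0[OF s] by simp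
    qed
  qed
  show "total ` ?P = carrier V"
  proof
    show "total ` ?P \<subseteq> carrier V" by (intro image_subsetI total_closed) (rule PiE_mem)
    show "carrier V \<subseteq> total ` ?P"
    proof
      fix y assume y: "y \<in> carrier V"
      have "\<exists>x\<in>?P. total x = y" by (rule sum_dim_le(2)[OF inj fd dim y])
      then show "y \<in> total ` ?P" by blast
    qed
  qed
qed

lemma total_single:
  assumes t: "t \<in> S" and y: "y \<in> carrier (W t)"
  shows "total (\<lambda>s. if s = t then y else \<zero>\<^bsub>W s\<^esub>) = f t y"
proof -
  interpret V: abelian_group V by (rule kvs_abelian_group[OF V])
  have fy: "f t y \<in> carrier V" by (rule klinD(3)[OF lin[OF t] y])
  have "total (\<lambda>s. if s = t then y else \<zero>\<^bsub>W s\<^esub>) = (\<Oplus>\<^bsub>V\<^esub>s\<in>S. if t = s then f t y else \<zero>\<^bsub>V\<^esub>)"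
    unfolding total_def
    by (rule V.finsum_cong'[OF refl]) (use fy klinD(6)[OF lin] in auto)
  also have "\<dots> = f t y" by (rule V.finsum_singleton[OF t finite_S]) (use fy in auto)
  finally show ?thesis .
qed

text \<open>If the total map is bijective, its inverse is given by linear maps to the summands.\<close>

lemma components:
  assumes bij: "bij_betw total (\<Pi>\<^sub>E s\<in>S. carrier (W s)) (carrier V)"
  obtains \<pi> where "\<And>s. s \<in> S \<Longrightarrow> klin V (W s) (\<pi> s)"
    "\<And>v. v \<in> carrier V \<Longrightarrow> total (\<lambda>s. \<pi> s v) = v"
    "\<And>x s. (\<And>s. s \<in> S \<Longrightarrow> x s \<in> carrier (W s)) \<Longrightarrow> s \<in> S \<Longrightarrow> \<pi> s (total x) = x s"
proof -
  let ?W = "\<Pi>\<^sub>E s\<in>S. carrier (W s)"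
  define \<pi> where "\<pi> s v = inv_into ?W total v s" for s v
  have inj: "inj_on total ?W" and sur: "total ` ?W = carrier V" using bij by (auto simp: bij_betw_def)
  have mem: "\<pi> s v \<in> carrier (W s)" if "v \<in> carrier V" "s \<in> S" for s v
    unfolding \<pi>_def using inv_into_into[of v total ?W] sur that by (auto simp: PiE_def Pi_def)
  have tot: "total (\<lambda>s. \<pi> s v) = v" if v: "v \<in> carrier V" for v
    unfolding \<pi>_def using f_inv_into_f[of v total ?W] sur v by simp
  have uniq: "\<pi> s (total x) = x s" if x: "\<And>s. s \<in> S \<Longrightarrow> x s \<in> carrier (W s)" and s: "s \<in> S" for x s
  proof -
    have xr: "restrict x S \<in> ?W" using x by auto
    have "total x = total (restrict x S)" by (rule total_cong) (use x in auto)
    then have "inv_into ?W total (total x) = restrict x S" using inv_into_f_f[OF inj xr] by simp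
    then show ?thesis unfolding \<pi>_def using s by simp
  qed
  show thesis
  proof (rule that[OF _ tot uniq])
    fix s assume s: "s \<in> S"
    show "klin V (W s) (\<pi> s)"
    proof (rule klinI[OF V klinD(1)[OF lin[OF s]]])
      show "\<pi> s v \<in> carrier (W s)" if "v \<in> carrier V" for v by (rule mem[OF that s])
      fix v assume v: "v \<in> carrier V"
      fix c
      show "\<pi> s (c \<odot>\<^bsub>V\<^esub> v) = c \<odot>\<^bsub>W s\<^esub> \<pi> s v"
        using uniq[of "\<lambda>s. c \<odot>\<^bsub>W s\<^esub> \<pi> s v" s] total_smult[of "\<lambda>s. \<pi> s v" c] mem[OF v]
          kvs_simps(1)[OF klinD(1)[OF lin]] tot[OF v] s by simp
      fix u assume u: "u \<in> carrier V"
      show "\<pi> s (v \<oplus>\<^bsub>V\<^esub> u) = \<pi> s v \<oplus>\<^bsub>W s\<^esub> \<pi> s u"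
        using uniq[of "\<lambda>s. \<pi> s v \<oplus>\<^bsub>W s\<^esub> \<pi> s u" s] total_add[of "\<lambda>s. \<pi> s v" "\<lambda>s. \<pi> s u"] mem[OF v] mem[OF u]
          kvs_simps(6)[OF klinD(1)[OF lin]] tot[OF v] tot[OF u] s by simp
    qed
  qed
qed

end

abbreviation cluster_arrows :: "(nat \<Rightarrow> nat) \<Rightarrow> (nat \<Rightarrow> nat \<Rightarrow> nat) \<Rightarrow> nat \<Rightarrow> (nat \<times> nat) set" where
  "cluster_arrows r w i \<equiv> (SIGMA j:{1..r i}. {1..w i j})"

lemma sum_cluster_arrows: "(\<Sum>s\<in>cluster_arrows r w i. g (fst s)) = (\<Sum>j\<in>{1..r i}. w i j * g j)" for g :: "nat \<Rightarrow> nat"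
proof -
  have "(\<Sum>s\<in>cluster_arrows r w i. g (fst s)) = (\<Sum>j\<in>{1..r i}. \<Sum>k\<in>{1..w i j}. g j)"
    by (subst sum.Sigma) (auto simp: case_prod_beta)
  then show ?thesis by simp
qed

locale balanced_representation =
  fixes m :: nat and r :: "nat \<Rightarrow> nat" and w :: "nat \<Rightarrow> nat \<Rightarrow> nat" and d :: "vertex \<Rightarrow> nat"
    and X :: "(vertex, arrow, 'k::field, 'x) quiver_rep"
  assumes weights: "\<And>i j. \<lbrakk>i \<in> {1..m}; j \<in> {1..r i}\<rbrakk> \<Longrightarrow> w i j \<ge> 1"
    and fd: "fd_quiver_rep (Gam m r w) X" and dims: "has_dim_vec (Gam m r w) X d"
    and bal: "balanced m r w d" and pos: "d Sink > 0"
    and balanced_X: "balanced_rep m r w X"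
begin

abbreviation "Q \<equiv> Gam m r w"

lemma spaces: "v \<in> verts Q \<Longrightarrow> kvs (vspace X v)" "v \<in> verts Q \<Longrightarrow> kfd (vspace X v)"
    "v \<in> verts Q \<Longrightarrow> kdim (vspace X v) = d v"
  using fd_quiver_repD[OF fd] dims unfolding has_dim_vec_def dim_vec_rep_def by auto

lemma cluster:
  assumes i: "i \<in> {1..m}"
  shows "direct_sum_map (cluster_arrows r w i) (\<lambda>s. vspace X (Src i (fst s))) (vspace X Sink)
    (\<lambda>s. amap X (i, fst s, snd s))"
proof (rule direct_sum_map.intro)
  show "finite (cluster_arrows r w i)" by auto
  show "kvs (vspace X Sink)" by (rule spaces) simp
  fix s assume s: "s \<in> cluster_arrows r w i"
  then obtain j k where jk: "s = (j, k)" "j \<in> {1..r i}" "k \<in> {1..w i j}" by auto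
  show "kfd (vspace X (Src i (fst s)))" by (rule spaces) (use jk i in auto)
  have e: "(i, j, k) \<in> arcs Q" using jk i by simp
  show "klin (vspace X (Src i (fst s))) (vspace X Sink) (amap X (i, fst s, snd s))"
    using fd_quiver_repD(3)[OF fd e] jk by simp
qed

lemma cluster_bij:
  assumes i: "i \<in> {1..m}"
  shows "bij_betw (direct_sum_map.total (cluster_arrows r w i) (vspace X Sink) (\<lambda>s. amap X (i, fst s, snd s)))
    (\<Pi>\<^sub>E s\<in>cluster_arrows r w i. carrier (vspace X (Src i (fst s)))) (carrier (vspace X Sink))"
proof -
  interpret D: direct_sum_map "cluster_arrows r w i" "\<lambda>s. vspace X (Src i (fst s))" "vspace X Sink"
    "\<lambda>s. amap X (i, fst s, snd s)" by (rule cluster[OF i])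
  have "D.total = (\<lambda>x. \<Oplus>\<^bsub>vspace X Sink\<^esub>s\<in>cluster_arrows r w i. amap X (i, fst s, snd s) (x s))"
    by (rule ext) (rule D.total_def)
  then show ?thesis using balanced_X i unfolding balanced_rep_def Let_def by simp
qed

abbreviation sub_dim :: "(vertex \<Rightarrow> 'x set) \<Rightarrow> vertex \<Rightarrow> nat" where
  "sub_dim W v \<equiv> kdim (vspace X v\<lparr>carrier := W v\<rparr>)"

lemma sub_cluster:
  assumes W: "is_subrep Q X W" and i: "i \<in> {1..m}"
  shows "direct_sum_map (cluster_arrows r w i) (\<lambda>s. vspace X (Src i (fst s))\<lparr>carrier := W (Src i (fst s))\<rparr>)
    (vspace X Sink\<lparr>carrier := W Sink\<rparr>) (\<lambda>s. amap X (i, fst s, snd s))"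
proof (rule direct_sum_map.intro)
  have S: "ksub (W Sink) (vspace X Sink)" by (rule is_subrepD(1)[OF W]) simp
  show "finite (cluster_arrows r w i)" by auto
  show "kvs (vspace X Sink\<lparr>carrier := W Sink\<rparr>)" by (rule ksubD(6)[OF S])
  fix s assume s: "s \<in> cluster_arrows r w i"
  then obtain j k where jk: "s = (j, k)" "j \<in> {1..r i}" "k \<in> {1..w i j}" by auto
  have v: "Src i j \<in> verts Q" using jk i by simp
  have e: "(i, j, k) \<in> arcs Q" using jk i by simp
  show "kfd (vspace X (Src i (fst s))\<lparr>carrier := W (Src i (fst s))\<rparr>)"
    using subspace_fd(1)[OF spaces(2)[OF v] is_subrepD(1)[OF W v]] jk by simp
  have "klin (vspace X (Src i j)) (vspace X Sink) (amap X (i, j, k))"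
    using fd_quiver_repD(3)[OF fd e] by simp
  from klin_restrict[OF this is_subrepD(1)[OF W v] S]
  show "klin (vspace X (Src i (fst s))\<lparr>carrier := W (Src i (fst s))\<rparr>)
      (vspace X Sink\<lparr>carrier := W Sink\<rparr>) (amap X (i, fst s, snd s))"
    using is_subrepD(2)[OF W e] jk by auto
qed

lemma sub_total:
  assumes W: "is_subrep Q X W" and i: "i \<in> {1..m}"
    and x: "\<And>s. s \<in> cluster_arrows r w i \<Longrightarrow> x s \<in> W (Src i (fst s))"
  shows "direct_sum_map.total (cluster_arrows r w i) (vspace X Sink\<lparr>carrier := W Sink\<rparr>) (\<lambda>s. amap X (i, fst s, snd s)) x
    = direct_sum_map.total (cluster_arrows r w i) (vspace X Sink) (\<lambda>s. amap X (i, fst s, snd s)) x"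
proof -
  interpret D: direct_sum_map "cluster_arrows r w i" "\<lambda>s. vspace X (Src i (fst s))" "vspace X Sink"
    "\<lambda>s. amap X (i, fst s, snd s)" by (rule cluster[OF i])
  interpret E: direct_sum_map "cluster_arrows r w i" "\<lambda>s. vspace X (Src i (fst s))\<lparr>carrier := W (Src i (fst s))\<rparr>"
    "vspace X Sink\<lparr>carrier := W Sink\<rparr>" "\<lambda>s. amap X (i, fst s, snd s)" by (rule sub_cluster[OF W i])
  have S: "ksub (W Sink) (vspace X Sink)" by (rule is_subrepD(1)[OF W]) simp
  have "(\<lambda>s. amap X (i, fst s, snd s) (x s)) \<in> cluster_arrows r w i \<rightarrow> carrier (vspace X Sink\<lparr>carrier := W Sink\<rparr>)"
    by (rule E.total_mem) (simp add: x)
  then show ?thesis unfolding D.total_def E.total_def by (intro finsum_subspace(1)[OF S]) simp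
qed

text \<open>The total map of a cluster stays injective on a subrepresentation. If the dimensions agree, it is also
  surjective onto the space of the subrepresentation at the sink.\<close>

lemma sub_cluster_le:
  assumes W: "is_subrep Q X W" and i: "i \<in> {1..m}"
  shows "(\<Sum>j\<in>{1..r i}. w i j * sub_dim W (Src i j)) \<le> sub_dim W Sink"
    and "(\<Sum>j\<in>{1..r i}. w i j * sub_dim W (Src i j)) = sub_dim W Sink \<Longrightarrow> y \<in> W Sink \<Longrightarrow>
      \<exists>x. (\<forall>s\<in>cluster_arrows r w i. x s \<in> W (Src i (fst s))) \<and>
        y = (\<Oplus>\<^bsub>vspace X Sink\<^esub>s\<in>cluster_arrows r w i. amap X (i, fst s, snd s) (x s))"
proof -
  let ?S = "cluster_arrows r w i"
  interpret D: direct_sum_map ?S "\<lambda>s. vspace X (Src i (fst s))" "vspace X Sink"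
    "\<lambda>s. amap X (i, fst s, snd s)" by (rule cluster[OF i])
  interpret E: direct_sum_map ?S "\<lambda>s. vspace X (Src i (fst s))\<lparr>carrier := W (Src i (fst s))\<rparr>"
    "vspace X Sink\<lparr>carrier := W Sink\<rparr>" "\<lambda>s. amap X (i, fst s, snd s)" by (rule sub_cluster[OF W i])
  have S: "ksub (W Sink) (vspace X Sink)" by (rule is_subrepD(1)[OF W]) simp
  have Wv: "ksub (W (Src i (fst s))) (vspace X (Src i (fst s)))" if "s \<in> ?S" for s
    by (rule is_subrepD(1)[OF W]) (use that i in auto)
  let ?P = "\<Pi>\<^sub>E s\<in>?S. carrier (vspace X (Src i (fst s)))"
  have injD: "inj_on D.total ?P" using cluster_bij[OF i] by (simp add: bij_betw_def)
  let ?z = "\<lambda>s\<in>?S. \<zero>\<^bsub>vspace X (Src i (fst s))\<^esub>"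
  have inj: "\<forall>s\<in>?S. x s = \<zero>\<^bsub>vspace X (Src i (fst s))\<lparr>carrier := W (Src i (fst s))\<rparr>\<^esub>"
    if x: "x \<in> (\<Pi>\<^sub>E s\<in>?S. carrier (vspace X (Src i (fst s))\<lparr>carrier := W (Src i (fst s))\<rparr>))"
      and z: "E.total x = \<zero>\<^bsub>vspace X Sink\<lparr>carrier := W Sink\<rparr>\<^esub>" for x
  proof -
    have xW: "x s \<in> W (Src i (fst s))" if "s \<in> ?S" for s using PiE_mem[OF x that] by simp
    have xc: "x s \<in> carrier (vspace X (Src i (fst s)))" if "s \<in> ?S" for s
      using subsetD[OF ksubD(2)[OF Wv[OF that]] xW[OF that]] .
    have xP: "x \<in> ?P" by (rule PiE_I[OF xc PiE_arb[OF x]])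
    have zs: "\<zero>\<^bsub>vspace X (Src i (fst s))\<^esub> \<in> carrier (vspace X (Src i (fst s)))" if "s \<in> ?S" for s
      using ksubD(2,3)[OF Wv[OF that]] by blast
    have tz: "D.total ?z = \<zero>\<^bsub>vspace X Sink\<^esub>"
    proof -
      interpret V: abelian_group "vspace X Sink" by (rule kvs_abelian_group[OF spaces(1)]) simp
      show ?thesis unfolding D.total_def
        by (rule V.add.finprod_one_eqI) (use klinD(6)[OF D.lin] in auto)
    qed
    have "E.total x = D.total x" by (rule sub_total[OF W i xW])
    then have tx: "D.total x = \<zero>\<^bsub>vspace X Sink\<^esub>" using z by simp
    have zP: "?z \<in> ?P" using zs by auto
    have "x = ?z" by (rule inj_onD[OF injD _ xP zP]) (simp only: tz tx)
    then show ?thesis by simp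
  qed
  have fdS: "kfd (vspace X Sink\<lparr>carrier := W Sink\<rparr>)" by (rule subspace_fd(1)[OF spaces(2) S]) simp
  note le = E.sum_dim_le[OF inj fdS, unfolded sum_cluster_arrows[of "\<lambda>j. sub_dim W (Src i j)"]]
  show "(\<Sum>j\<in>{1..r i}. w i j * sub_dim W (Src i j)) \<le> sub_dim W Sink" by (rule le(1))
  assume eq: "(\<Sum>j\<in>{1..r i}. w i j * sub_dim W (Src i j)) = sub_dim W Sink" and y: "y \<in> W Sink"
  have "\<exists>x\<in>(\<Pi>\<^sub>E s\<in>?S. carrier (vspace X (Src i (fst s))\<lparr>carrier := W (Src i (fst s))\<rparr>)). E.total x = y"
    by (rule le(2)[OF _ _ eq], assumption+) (simp add: y)
  then obtain x where x: "x \<in> (\<Pi>\<^sub>E s\<in>?S. carrier (vspace X (Src i (fst s))\<lparr>carrier := W (Src i (fst s))\<rparr>))"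
    "E.total x = y" by blast
  have xW: "x s \<in> W (Src i (fst s))" if "s \<in> ?S" for s using PiE_mem[OF x(1) that] by simp
  have "y = D.total x" using x(2) sub_total[OF W i, of x] xW by simp
  then show "\<exists>x. (\<forall>s\<in>?S. x s \<in> W (Src i (fst s))) \<and>
        y = (\<Oplus>\<^bsub>vspace X Sink\<^esub>s\<in>?S. amap X (i, fst s, snd s) (x s))"
    unfolding D.total_def using xW by blast
qed

text \<open>By \<open>sub_cluster_le\<close> the value of \<open>\<theta>\<close> on a subrepresentation is a sum of nonpositive terms, one for each
  cluster. It vanishes only if the dimension vector is balanced, and then the space at the sink determines whether
  the subrepresentation is zero or everything.\<close>

lemma stable_of_balanced_subreps:
  assumes no: "\<And>W. is_subrep Q X W \<Longrightarrow> balanced m r w (sub_dim W) \<Longrightarrow>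
    W Sink = {\<zero>\<^bsub>vspace X Sink\<^esub>} \<or> W Sink = carrier (vspace X Sink)"
  shows "stable_rep Q (theta m w) X"
proof (rule stable_repI)
  have sink: "Sink \<in> verts Q" by simp
  have "carrier (vspace X Sink) \<noteq> {\<zero>\<^bsub>vspace X Sink\<^esub>}"
    using kdim_zero(2)[OF spaces(1)[OF sink]] spaces(3)[OF sink] pos by auto
  then show "nonzero_rep Q X" unfolding nonzero_rep_def using sink by blast
  have "pairing Q (theta m w) (dim_vec_rep X) = pairing Q (theta m w) d"
    by (rule pairing_cong) (simp add: dim_vec_rep_def spaces)
  then show "pairing Q (theta m w) (dim_vec_rep X) = 0" using pairing_balanced[OF bal] by simp
  fix W v0 v1
  assume W: "is_subrep Q X W" and v0: "v0 \<in> verts Q" "W v0 \<noteq> {\<zero>\<^bsub>vspace X v0\<^esub>}"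
    and v1: "v1 \<in> verts Q" "W v1 \<noteq> carrier (vspace X v1)"
  note Wv = is_subrepD(1)[OF W]
  note le = sub_cluster_le(1)[OF W]
  let ?g = "\<lambda>i. int (sub_dim W Sink) - int (\<Sum>j\<in>{1..r i}. w i j * sub_dim W (Src i j))"
  have g0: "?g i \<ge> 0" if "i \<in> {1..m}" for i using le[OF that] by (simp only: diff_ge_0_iff_ge of_nat_le_iff)
  have p: "pairing Q (theta m w) (dim_vec_rep (restrict_rep X W)) = - (\<Sum>i\<in>{1..m}. ?g i)"
    unfolding pairing_Gam dim_vec_rep_def restrict_rep_simps by (simp add: sum_subtractf)
  show "pairing Q (theta m w) (dim_vec_rep (restrict_rep X W)) < 0"
  proof (rule ccontr)
    assume "\<not> ?thesis"
    then have "(\<Sum>i\<in>{1..m}. ?g i) \<le> 0" unfolding p by simp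
    moreover have "(\<Sum>i\<in>{1..m}. ?g i) \<ge> 0" by (rule sum_nonneg[OF g0])
    ultimately have "(\<Sum>i\<in>{1..m}. ?g i) = 0" by simp
    then have gz: "?g i = 0" if "i \<in> {1..m}" for i
      using sum_nonneg_eq_0_iff[of "{1..m}" ?g] g0 that by simp
    have eq: "(\<Sum>j\<in>{1..r i}. w i j * sub_dim W (Src i j)) = sub_dim W Sink" if "i \<in> {1..m}" for i
      using gz[OF that] by (simp only: right_minus_eq of_nat_eq_iff)
    then have "balanced m r w (sub_dim W)" unfolding balanced_def by blast
    from no[OF W this] show False
    proof
      assume z: "W Sink = {\<zero>\<^bsub>vspace X Sink\<^esub>}"
      have "sub_dim W Sink = 0"
        by (rule kdim_zero(2)[OF ksubD(6)[OF Wv[OF sink]]]) (simp add: z)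
      have "W v = {\<zero>\<^bsub>vspace X v\<^esub>}" if v: "v \<in> verts Q" for v
      proof (cases v)
        case (Src i j)
        then have ij: "i \<in> {1..m}" "j \<in> {1..r i}" using v by auto
        have "(\<Sum>j\<in>{1..r i}. w i j * sub_dim W (Src i j)) = 0" using eq[OF ij(1)] \<open>sub_dim W Sink = 0\<close> by simp
        then have "w i j * sub_dim W (Src i j) = 0" using ij(2) by (subst (asm) sum_eq_0_iff) auto
        then have "sub_dim W v = 0" using weights[OF ij] Src by simp
        from kdim_zeroD[OF ksubD(6)[OF Wv[OF v]] subspace_fd(1)[OF spaces(2)[OF v] Wv[OF v]] this]
        show ?thesis by simp
      qed (simp add: z)
      then show False using v0 by blast
    next
      assume full: "W Sink = carrier (vspace X Sink)"
      have dS: "sub_dim W Sink = d Sink" unfolding full using spaces(3)[OF sink] by simp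
      have "W v = carrier (vspace X v)" if v: "v \<in> verts Q" for v
      proof (cases v)
        case (Src i j)
        then have ij: "i \<in> {1..m}" "j \<in> {1..r i}" using v by auto
        have sub_le: "sub_dim W (Src i j) \<le> d (Src i j)" if "j \<in> {1..r i}" for j
          using subspace_fd(2)[OF spaces(2) Wv, of "Src i j"] spaces(3)[of "Src i j"] ij(1) that by simp
        have sums: "(\<Sum>j\<in>{1..r i}. w i j * sub_dim W (Src i j)) = (\<Sum>j\<in>{1..r i}. w i j * d (Src i j))"
          using eq[OF ij(1)] dS bal ij(1) by (simp add: balanced_def)
        have "w i j * sub_dim W (Src i j) = w i j * d (Src i j)"
        proof (rule ccontr)
          assume ne: "w i j * sub_dim W (Src i j) \<noteq> w i j * d (Src i j)"
          have "(\<Sum>j\<in>{1..r i}. w i j * sub_dim W (Src i j)) < (\<Sum>j\<in>{1..r i}. w i j * d (Src i j))"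
          proof (rule sum_strict_mono_ex1)
            show "\<forall>j\<in>{1..r i}. w i j * sub_dim W (Src i j) \<le> w i j * d (Src i j)"
              using sub_le by (intro ballI mult_le_mono2)
            show "\<exists>j\<in>{1..r i}. w i j * sub_dim W (Src i j) < w i j * d (Src i j)"
              using ij(2) ne mult_le_mono2[OF sub_le[OF ij(2)], of "w i j"] by (intro bexI[of _ j]) linarith+
          qed simp
          then show False using sums by simp
        qed
        then have "sub_dim W v = kdim (vspace X v)" using weights[OF ij] Src spaces(3)[OF v] by simp
        then show ?thesis by (rule subspace_fd(3)[OF spaces(2)[OF v] Wv[OF v]])
      qed (simp add: full)
      then show False using v1 by blast
    qed
  qed
qed

end

section \<open>Subspaces of a stable point\<close>

lemma alg_closed_eigenvector:
  assumes N: "(N :: 'k::alg_closed_field mat) \<in> carrier_mat k k" and k: "k > 0"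
  shows "\<exists>\<mu> x. x \<in> carrier_vec k \<and> x \<noteq> 0\<^sub>v k \<and> N *\<^sub>v x = \<mu> \<cdot>\<^sub>v x"
proof -
  have "degree (char_poly N) = k" using degree_monic_char_poly[OF N] by simp
  then have "degree (char_poly N) > 0" using k by simp
  then obtain \<mu> where "poly (char_poly N) \<mu> = 0" using alg_closed_imp_poly_has_root by blast
  then have "eigenvalue N \<mu>" using eigenvalue_root_char_poly[OF N] by blast
  then show ?thesis using N unfolding eigenvalue_def eigenvector_def by auto
qed

lemma complementary_projections:
  fixes V :: "('k::field, 'y) module" and V1 V2 :: "('k, 'x) module"
  assumes f1: "klin V1 V f1" and f2: "klin V2 V f2"
    and inj: "\<And>x y. x \<in> carrier V1 \<Longrightarrow> y \<in> carrier V2 \<Longrightarrow> f1 x \<oplus>\<^bsub>V\<^esub> f2 y = \<zero>\<^bsub>V\<^esub> \<Longrightarrow> x = \<zero>\<^bsub>V1\<^esub> \<and> y = \<zero>\<^bsub>V2\<^esub>"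
    and fd: "kfd V1" "kfd V2" "kfd V" and dim: "kdim V1 + kdim V2 = kdim V"
  obtains g1 g2 where "klin V V1 g1" "klin V V2 g2"
    "\<And>v. v \<in> carrier V \<Longrightarrow> v = f1 (g1 v) \<oplus>\<^bsub>V\<^esub> f2 (g2 v)"
proof -
  note V1 = klinD(1)[OF f1] and V2 = klinD(1)[OF f2] and V = klinD(2)[OF f1]
  \<comment> \<open>the direct sum of two spaces, indexed by \<open>bool\<close>\<close>
  let ?W = "\<lambda>b. if b then V1 else V2" and ?f = "\<lambda>b. if b then f1 else f2"
  interpret D: direct_sum_map "UNIV :: bool set" ?W V ?f
  proof (rule direct_sum_map.intro)
    fix s :: bool
    show "klin (?W s) V (?f s)" using f1 f2 by (cases s) simp_all
    show "kfd (?W s)" using fd by (cases s) simp_all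
  qed (simp_all add: V)
  interpret V: abelian_group V by (rule kvs_abelian_group[OF V])
  have cl: "f1 x \<in> carrier V" "f2 y \<in> carrier V" if "x \<in> carrier V1" "y \<in> carrier V2" for x y
    using klinD(3)[OF f1 that(1)] klinD(3)[OF f2 that(2)] .
  have tot: "D.total x = f1 (x True) \<oplus>\<^bsub>V\<^esub> f2 (x False)" if x: "x True \<in> carrier V1" "x False \<in> carrier V2" for x
  proof -
    have U: "(UNIV :: bool set) = insert True {False}" by auto
    have "D.total x = (\<Oplus>\<^bsub>V\<^esub>s\<in>insert True {False}. ?f s (x s))" unfolding D.total_def by (subst U) (rule refl)
    also have "\<dots> = f1 (x True) \<oplus>\<^bsub>V\<^esub> (\<Oplus>\<^bsub>V\<^esub>s\<in>{False}. ?f s (x s))"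
      using cl[OF x] by (subst V.finsum_insert) auto
    also have "(\<Oplus>\<^bsub>V\<^esub>s\<in>{False}. ?f s (x s)) = f2 (x False)"
      using cl[OF x] by (subst V.finsum_insert) auto
    finally show ?thesis .
  qed
  have mem: "x True \<in> carrier V1" "x False \<in> carrier V2" if "x \<in> (\<Pi>\<^sub>E s\<in>UNIV. carrier (?W s))" for x
    using PiE_mem[OF that, of True] PiE_mem[OF that, of False] by simp_all
  have "bij_betw D.total (\<Pi>\<^sub>E s\<in>UNIV. carrier (?W s)) (carrier V)"
  proof (rule D.total_bij[OF _ fd(3)])
    fix x assume x: "x \<in> (\<Pi>\<^sub>E s\<in>UNIV. carrier (?W s))" and "D.total x = \<zero>\<^bsub>V\<^esub>"
    then show "\<forall>s\<in>UNIV. x s = \<zero>\<^bsub>?W s\<^esub>" using inj[OF mem[OF x]] tot[OF mem[OF x]] by simp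
  next
    show "(\<Sum>s\<in>UNIV. kdim (?W s)) = kdim V" using dim by (simp add: UNIV_bool)
  qed
  then obtain \<pi> where \<pi>: "\<And>s. s \<in> UNIV \<Longrightarrow> klin V (?W s) (\<pi> s)"
    "\<And>v. v \<in> carrier V \<Longrightarrow> D.total (\<lambda>s. \<pi> s v) = v" by (rule D.components) blast
  have k: "klin V V1 (\<pi> True)" "klin V V2 (\<pi> False)" using \<pi>(1)[of True] \<pi>(1)[of False] by simp_all
  show thesis
  proof (rule that[OF k])
    fix v assume v: "v \<in> carrier V"
    have "D.total (\<lambda>s. \<pi> s v) = f1 (\<pi> True v) \<oplus>\<^bsub>V\<^esub> f2 (\<pi> False v)"
      by (rule tot[OF klinD(3)[OF k(1) v] klinD(3)[OF k(2) v]])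
    then show "v = f1 (\<pi> True v) \<oplus>\<^bsub>V\<^esub> f2 (\<pi> False v)" by (simp only: \<pi>(2)[OF v])
  qed
qed

lemma span_ksub:
  fixes V :: "('k::field, 'x) module"
  assumes V: "kvs V" and b: "b \<in> I \<rightarrow> carrier V" and I: "finite I"
  shows "ksub (range (\<lambda>c. lcomb V b c I)) V"
    "i \<in> I \<Longrightarrow> b i \<in> range (\<lambda>c. lcomb V b c I)"
    "kdim (V\<lparr>carrier := range (\<lambda>c. lcomb V b c I)\<rparr>) \<le> card I"
proof -
  let ?U = "range (\<lambda>c. lcomb V b c I)"
  interpret V: abelian_group V by (rule kvs_abelian_group[OF V])
  show U: "ksub ?U V"
  proof (rule ksubI[OF V])
    show "?U \<subseteq> carrier V" using lcomb_closed[OF V b] by auto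
    show "\<zero>\<^bsub>V\<^esub> \<in> ?U" using lcomb_zero[OF V b, of "\<lambda>_. 0"] by (metis rangeI)
    show "x \<oplus>\<^bsub>V\<^esub> y \<in> ?U" if "x \<in> ?U" "y \<in> ?U" for x y
      using that by (auto simp: lcomb_add[OF V b])
    show "c \<odot>\<^bsub>V\<^esub> x \<in> ?U" if "x \<in> ?U" for c x
      using that by (auto simp: lcomb_scale[OF V b])
  qed
  have bU: "b i \<in> ?U" if i: "i \<in> I" for i
  proof -
    have "lcomb V b (\<lambda>j. if i = j then 1 else 0) I
        = (\<Oplus>\<^bsub>V\<^esub>j\<in>I. if i = j then b j else \<zero>\<^bsub>V\<^esub>)"
      unfolding lcomb_def using b by (intro V.finsum_cong') (auto simp: kvs_simps[OF V] Pi_def)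
    also have "\<dots> = b i" using b by (intro V.finsum_singleton[OF i I]) auto
    finally show ?thesis by (metis rangeI)
  qed
  then show "i \<in> I \<Longrightarrow> b i \<in> ?U" .
  have bI: "b \<in> I \<rightarrow> ?U" using bU by blast
  have "spanning_family (V\<lparr>carrier := ?U\<rparr>) b I"
    unfolding spanning_family_def using bI lcomb_subspace(1)[OF U bI] by auto
  then show "kdim (V\<lparr>carrier := ?U\<rparr>) \<le> card I"
    by (rule spanning_family_dim(2)[OF ksubD(6)[OF U] _ I])
qed

lemma kdim_ge_1:
  fixes V :: "('k::field, 'x) module"
  assumes "kfd V" "ksub W V" "x \<in> W" "x \<noteq> \<zero>\<^bsub>V\<^esub>"
  shows "kdim (V\<lparr>carrier := W\<rparr>) \<ge> 1"
proof (rule ccontr)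
  assume "\<not> ?thesis"
  then have "kdim (V\<lparr>carrier := W\<rparr>) = 0" by simp
  from kdim_zeroD[OF ksubD(6)[OF assms(2)] subspace_fd(1)[OF assms(1,2)] this] assms(3,4)
  show False by simp
qed

text \<open>Necessity is proved for a point of the representation space. Stability is tested on
  the subrepresentations that are largest for their space at the sink.\<close>

locale stable_point =
  fixes m :: nat and r :: "nat \<Rightarrow> nat" and w :: "nat \<Rightarrow> nat \<Rightarrow> nat" and d :: "vertex \<Rightarrow> nat"
    and P :: "arrow \<Rightarrow> 'k::alg_closed_field mat"
  assumes m: "m \<ge> 1" and weights: "\<And>i j. \<lbrakk>i \<in> {1..m}; j \<in> {1..r i}\<rbrakk> \<Longrightarrow> w i j \<ge> 1"
    and P: "P \<in> rep_space (Gam m r w) d"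
    and bal: "balanced m r w d" and pos: "d Sink > 0"
    and stable: "stable_rep (Gam m r w) (theta m w) (matrix_rep d P)"
begin

abbreviation "n \<equiv> d Sink"
abbreviation "Q \<equiv> Gam m r w"
abbreviation "S \<equiv> (SIGMA i:{1..m}. {1..r i})"

lemma Pc: "(i, j) \<in> S \<Longrightarrow> k \<in> {1..w i j} \<Longrightarrow> P (i, j, k) \<in> carrier_mat n (d (Src i j))"
proof -
  assume "(i, j) \<in> S" "k \<in> {1..w i j}"
  then have "(i, j, k) \<in> arcs Q" by simp
  from PiE_mem[OF P[unfolded rep_space_def] this] show ?thesis by simp
qed

lemma Plin: "(i, j) \<in> S \<Longrightarrow> k \<in> {1..w i j} \<Longrightarrow>
    klin (module_vec TYPE('k) (d (Src i j))) (module_vec TYPE('k) n) (\<lambda>x. P (i, j, k) *\<^sub>v x)"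
  by (rule mult_mat_vec_klin[OF Pc])

text \<open>At a source, the largest subspace that all arrows map into \<open>U\<close>.\<close>

definition maxsub :: "'k vec set \<Rightarrow> nat \<times> nat \<Rightarrow> 'k vec set" where
  "maxsub U = (\<lambda>(i, j). {x \<in> carrier_vec (d (Src i j)). \<forall>k\<in>{1..w i j}. P (i, j, k) *\<^sub>v x \<in> U})"

abbreviation vdim :: "nat \<Rightarrow> 'k vec set \<Rightarrow> nat" where
  "vdim k W \<equiv> kdim (module_vec TYPE('k) k\<lparr>carrier := W\<rparr>)"

abbreviation mdim :: "'k vec set \<Rightarrow> nat \<times> nat \<Rightarrow> nat" where
  "mdim U p \<equiv> vdim (d (Src (fst p) (snd p))) (maxsub U p)"

lemma maxsub_ksub:
  assumes U: "ksub U (module_vec TYPE('k) n)" and ij: "(i, j) \<in> S"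
  shows "ksub (maxsub U (i, j)) (module_vec TYPE('k) (d (Src i j)))"
proof (rule ksubI[OF kvs_module_vec])
  note lin = klinD(4-6)[OF Plin[OF ij], simplified] and sub = ksubD(3-5)[OF U, simplified]
  show "maxsub U (i, j) \<subseteq> carrier (module_vec TYPE('k) (d (Src i j)))" unfolding maxsub_def by auto
  show "\<zero>\<^bsub>module_vec TYPE('k) (d (Src i j))\<^esub> \<in> maxsub U (i, j)"
    unfolding maxsub_def using lin(3) sub(1) by simp
  fix x y c assume x: "x \<in> maxsub U (i, j)"
  then show "c \<odot>\<^bsub>module_vec TYPE('k) (d (Src i j))\<^esub> x \<in> maxsub U (i, j)"
    using lin(2) sub(3) unfolding maxsub_def by simp
  assume y: "y \<in> maxsub U (i, j)"
  then show "x \<oplus>\<^bsub>module_vec TYPE('k) (d (Src i j))\<^esub> y \<in> maxsub U (i, j)"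
    using lin(1) sub(2) x unfolding maxsub_def by simp
qed

definition maxrep :: "'k vec set \<Rightarrow> vertex \<Rightarrow> 'k vec set" where
  "maxrep U v = (case v of Sink \<Rightarrow> U | Src i j \<Rightarrow> maxsub U (i, j))"

lemma maxrep:
  assumes U: "ksub U (module_vec TYPE('k) n)"
  shows "is_subrep Q (matrix_rep d P) (maxrep U)"
    "pairing Q (theta m w) (dim_vec_rep (restrict_rep (matrix_rep d P) (maxrep U)))
      = int (\<Sum>p\<in>S. w (fst p) (snd p) * mdim U p) - int (m * vdim n U)"
proof -
  show "pairing Q (theta m w) (dim_vec_rep (restrict_rep (matrix_rep d P) (maxrep U)))
      = int (\<Sum>p\<in>S. w (fst p) (snd p) * mdim U p) - int (m * vdim n U)"
    unfolding pairing_Gam dim_vec_rep_def maxrep_def by (simp add: sum.Sigma case_prod_beta)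
  show "is_subrep Q (matrix_rep d P) (maxrep U)"
    unfolding is_subrep_def
  proof (intro conjI ballI)
    fix v assume "v \<in> verts Q"
    then show "ksub (maxrep U v) (vspace (matrix_rep d P) v)"
      using U maxsub_ksub[OF U] by (cases v) (auto simp: maxrep_def)
  next
    fix e assume "e \<in> arcs Q"
    then obtain i j k where "e = (i, j, k)" "(i, j) \<in> S" "k \<in> {1..w i j}" by auto
    then show "amap (matrix_rep d P) e ` maxrep U (tail Q e) \<subseteq> maxrep U (head Q e)"
      unfolding maxrep_def maxsub_def by auto
  qed
qed

text \<open>A common kernel vector would span a subrepresentation concentrated at a source, where \<open>\<theta>\<close> is positive.\<close>

lemma kernel_trivial:
  assumes ij: "(i, j) \<in> S" and x: "x \<in> carrier_vec (d (Src i j))"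
    and z: "\<And>k. k \<in> {1..w i j} \<Longrightarrow> P (i, j, k) *\<^sub>v x = 0\<^sub>v n"
  shows "x = 0\<^sub>v (d (Src i j))"
proof (rule ccontr)
  assume ne: "x \<noteq> 0\<^sub>v (d (Src i j))"
  have zero_ksub: "ksub {0\<^sub>v n} (module_vec TYPE('k) n)"
    by (rule ksubI[OF kvs_module_vec]) auto
  have vzero: "vdim n {0\<^sub>v n} = 0"
    by (rule kdim_zero(2)[OF ksubD(6)[OF zero_ksub]]) simp
  have "x \<in> maxsub {0\<^sub>v n} (i, j)" using x z unfolding maxsub_def by simp
  then have "maxrep {0\<^sub>v n} (Src i j) \<noteq> {\<zero>\<^bsub>vspace (matrix_rep d P) (Src i j)\<^esub>}"
    using ne unfolding maxrep_def by auto
  moreover have "pairing Q (theta m w) (dim_vec_rep (restrict_rep (matrix_rep d P) (maxrep {0\<^sub>v n}))) \<ge> 0"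
    unfolding maxrep(2)[OF zero_ksub] vzero by (simp add: sum_nonneg)
  ultimately have "maxrep {0\<^sub>v n} Sink = carrier (vspace (matrix_rep d P) Sink)"
    using stable_repD(3)[OF stable maxrep(1)[OF zero_ksub], of "Src i j" Sink] ij by auto
  then have "(unit_vec n 0 :: 'k vec) \<in> {0\<^sub>v n}" unfolding maxrep_def by simp
  then have "(unit_vec n 0 :: 'k vec) $ 0 = 0" using pos by simp
  then show False using pos by simp
qed

lemma subspace_bound:
  assumes U: "ksub U (module_vec TYPE('k) n)" "x \<in> U" "x \<noteq> 0\<^sub>v n" and full: "U \<noteq> carrier_vec n"
  shows "(\<Sum>p\<in>S. w (fst p) (snd p) * mdim U p) < m * vdim n U"
proof (rule ccontr)
  assume ne: "\<not> ?thesis"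
  then have "int (m * vdim n U) \<le> int (\<Sum>p\<in>S. w (fst p) (snd p) * mdim U p)" by linarith
  then have "pairing Q (theta m w) (dim_vec_rep (restrict_rep (matrix_rep d P) (maxrep U))) \<ge> 0"
    unfolding maxrep(2)[OF U(1)] by linarith
  moreover have "maxrep U Sink \<noteq> {\<zero>\<^bsub>vspace (matrix_rep d P) Sink\<^esub>}"
    using U(2,3) unfolding maxrep_def by auto
  ultimately have "maxrep U Sink = carrier (vspace (matrix_rep d P) Sink)"
    using stable_repD(3)[OF stable maxrep(1)[OF U(1)], of Sink Sink] by simp
  then show False using full unfolding maxrep_def by simp
qed

lemma trivial_weight_injective:
  assumes "(i, j) \<in> S" "w i j = 1" "x \<in> carrier_vec (d (Src i j))" "P (i, j, 1) *\<^sub>v x = 0\<^sub>v n"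
  shows "x = 0\<^sub>v (d (Src i j))"
  by (rule kernel_trivial[OF assms(1,3)]) (use assms in auto)

lemma trivial_weight_inj_on:
  assumes ij: "(i, j) \<in> S" and w1: "w i j = 1"
  shows "inj_on (\<lambda>x. P (i, j, 1) *\<^sub>v x) (carrier_vec (d (Src i j)))"
  using klin_injI[OF Plin[OF ij, of 1]] trivial_weight_injective[OF ij w1] w1 by simp

text \<open>For weight one the single arrow is injective, hence identifies \<open>maxsub U\<close> with \<open>U\<close>.\<close>

lemma trivial_weight_mdim:
  assumes ij: "(i, j) \<in> S" and w1: "w i j = 1" and U: "ksub U (module_vec TYPE('k) n)"
    and img: "U \<subseteq> (\<lambda>x. P (i, j, 1) *\<^sub>v x) ` carrier_vec (d (Src i j))"
  shows "mdim U (i, j) = vdim n U"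
proof -
  note ms = maxsub_ksub[OF U ij]
  have lin: "klin (module_vec TYPE('k) (d (Src i j))) (module_vec TYPE('k) n) (\<lambda>x. P (i, j, 1) *\<^sub>v x)"
    using Plin[OF ij, of 1] w1 by simp
  have mx: "maxsub U (i, j) = {x \<in> carrier_vec (d (Src i j)). P (i, j, 1) *\<^sub>v x \<in> U}"
    unfolding maxsub_def using w1 by auto
  have l: "klin (module_vec TYPE('k) (d (Src i j))\<lparr>carrier := maxsub U (i, j)\<rparr>)
      (module_vec TYPE('k) n\<lparr>carrier := U\<rparr>) (\<lambda>x. P (i, j, 1) *\<^sub>v x)"
    by (rule klin_restrict[OF lin ms U]) (auto simp: mx)
  have b: "bij_betw (\<lambda>x. P (i, j, 1) *\<^sub>v x) (maxsub U (i, j)) U"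
    unfolding bij_betw_def
  proof
    show "inj_on (\<lambda>x. P (i, j, 1) *\<^sub>v x) (maxsub U (i, j))"
      by (rule inj_on_subset[OF trivial_weight_inj_on[OF ij w1]]) (auto simp: mx)
    show "(\<lambda>x. P (i, j, 1) *\<^sub>v x) ` maxsub U (i, j) = U" using img unfolding mx by auto
  qed
  have "vdim n U = vdim (d (Src i j)) (maxsub U (i, j))"
    by (rule klin_bij_dim(2)[OF l]) (use b subspace_fd(1)[OF module_vec_dim(1) ms] in simp_all)
  then show ?thesis by simp
qed

lemma bal_le: "(i, j) \<in> S \<Longrightarrow> w i j * d (Src i j) \<le> n"
proof -
  assume ij: "(i, j) \<in> S"
  have "w i j * d (Src i j) \<le> (\<Sum>j\<in>{1..r i}. w i j * d (Src i j))"
    using ij by (intro member_le_sum) auto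
  then show ?thesis using bal ij unfolding balanced_def by auto
qed

end

section \<open>Failure of the inequality: real extremal vectors\<close>

lemma balanced_zero_elsewhere:
  fixes a :: "nat \<Rightarrow> nat"
  assumes "finite J" "j0 \<in> J" "(\<Sum>j\<in>J. a j) = N" "a j0 = N" "j \<in> J" "j \<noteq> j0"
  shows "a j = 0"
proof -
  have "(\<Sum>j\<in>J. a j) = a j0 + (\<Sum>j\<in>J - {j0}. a j)" by (rule sum.remove[OF assms(1,2)])
  then have "(\<Sum>j\<in>J - {j0}. a j) = 0" using assms(3,4) by simp
  then show ?thesis using assms by simp
qed

context stable_point
begin

sublocale balanced_vector m r w d
  by (rule balanced_vector.intro[OF weights bal pos])

text \<open>The condition on \<open>x\<close> at \<open>(i0, u i0)\<close> and on further vectors \<open>y (i, k)\<close> at \<open>(i, u i)\<close> is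
  \<open>P (i0, u i0, k) x = P (i, u i, 1) (y (i, k))\<close> for all \<open>k\<close> and all \<open>i \<noteq> i0\<close>. The assumption \<open>ineq\<close> says that this
  system has more unknowns than equations. The span \<open>U\<close> of the images of \<open>x\<close> has dimension at most \<open>w0\<close>, while
  the largest subrepresentation over \<open>U\<close> has total weighted dimension at least \<open>w0 + (m - 1) dim U\<close>. Stability then forces
  \<open>U\<close> to be the whole space, so \<open>n \<le> w0\<close>, and the dimensions follow.\<close>

lemma real_extremal_case:
  assumes u: "\<And>i. i \<in> {1..m} \<Longrightarrow> u i \<in> {1..r i}" and i0: "i0 \<in> {1..m}"
    and triv: "\<And>i. i \<in> {1..m} \<Longrightarrow> i \<noteq> i0 \<Longrightarrow> w i (u i) = 1"
    and ineq: "card ({1..m} - {i0}) * w i0 (u i0) * n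
        < d (Src i0 (u i0)) + (\<Sum>i\<in>{1..m} - {i0}. w i0 (u i0) * d (Src i (u i)))"
  shows "n = w i0 (u i0)" "d (Src i0 (u i0)) = 1"
    "\<And>i. i \<in> {1..m} \<Longrightarrow> i \<noteq> i0 \<Longrightarrow> d (Src i (u i)) = n"
proof -
  define w0 d0 I' where "w0 = w i0 (u i0)" and "d0 = d (Src i0 (u i0))" and "I' = {1..m} - {i0}"
  define di where "di i = d (Src i (u i))" for i
  have S0: "(i0, u i0) \<in> S" and Si: "(i, u i) \<in> S" if "i \<in> I'" for i
    using u i0 that by (auto simp: I'_def)
  have S0: "(i0, u i0) \<in> S" using u i0 by auto
  have wi: "w i (u i) = 1" if "i \<in> I'" for i using triv that by (auto simp: I'_def)
  define X where "X = (\<lambda>k. P (i0, u i0, k))"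
  define Y where "Y = (\<lambda>i. P (i, u i, 1))"
  have Xc: "X k \<in> carrier_mat n d0" if "k \<in> {1..w0}" for k
    using Pc[OF S0, of k] that by (simp add: X_def d0_def w0_def)
  have Yc: "Y i \<in> carrier_mat n (di i)" if "i \<in> I'" for i
    using Pc[OF Si[OF that], of 1] wi[OF that] by (simp add: Y_def di_def)
  let ?Z = "Inl ` {..<d0} \<union> Inr ` (SIGMA ik:I' \<times> {1..w0}. {..<di (fst ik)})"
  let ?J = "(I' \<times> {1..w0}) \<times> {..<n}"
  \<comment> \<open>unknowns: \<open>Inl q\<close> is a coordinate of \<open>x\<close> and \<open>Inr (ik, q)\<close> one of \<open>y ik\<close>; an equation is a coordinate \<open>p\<close> for one pair \<open>ik\<close>\<close>
  define a :: "(nat \<times> nat) \<times> nat \<Rightarrow> nat + (nat \<times> nat) \<times> nat \<Rightarrow> 'k" where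
    "a = (\<lambda>(ik, p) z. case z of Inl q \<Rightarrow> X (snd ik) $$ (p, q)
       | Inr (ik', q) \<Rightarrow> if ik' = ik then - (Y (fst ik) $$ (p, q)) else 0)"
  have finI: "finite I'" by (simp add: I'_def)
  have cZ: "card ?Z = d0 + (\<Sum>i\<in>I'. w0 * di i)"
  proof -
    have "card ?Z = card {..<d0} + card (SIGMA ik:I' \<times> {1..w0}. {..<di (fst ik)})"
      using finI by (subst card_Un_disjoint) (auto simp: card_image)
    also have "card (SIGMA ik:I' \<times> {1..w0}. {..<di (fst ik)}) = (\<Sum>ik\<in>I' \<times> {1..w0}. di (fst ik))"
      using finI by (subst card_SigmaI) auto
    also have "\<dots> = (\<Sum>i\<in>I'. \<Sum>k\<in>{1..w0}. di i)"
      unfolding sum.cartesian_product by (rule sum.cong) auto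
    also have "\<dots> = (\<Sum>i\<in>I'. w0 * di i)" by (intro sum.cong refl) simp
    finally show ?thesis by simp
  qed
  have cJ: "card ?J = card I' * w0 * n" using finI by (simp add: card_cartesian_product)
  have "card I' * w0 * n < d0 + (\<Sum>i\<in>I'. w0 * di i)"
    using ineq unfolding w0_def d0_def I'_def di_def .
  then have lt: "card ?J < card ?Z" unfolding cZ cJ .
  have fJ: "finite ?J" and fZ: "finite ?Z" using finI by simp_all
  have "\<exists>c. (\<exists>z\<in>?Z. c z \<noteq> 0) \<and> (\<forall>j\<in>?J. (\<Sum>z\<in>?Z. a j z * c z) = 0)"
    by (rule homogeneous_system_nontrivial_solution[OF fJ fZ lt])
  then obtain c where c: "\<exists>z\<in>?Z. c z \<noteq> 0" and c0: "\<forall>j\<in>?J. (\<Sum>z\<in>?Z. a j z * c z) = 0"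
    by (elim exE conjE)
  define x where "x = vec d0 (\<lambda>q. c (Inl q))"
  define y where "y ik = vec (di (fst ik)) (\<lambda>q. c (Inr (ik, q)))" for ik
  have eq: "X k *\<^sub>v x = Y i *\<^sub>v y (i, k)" if i: "i \<in> I'" and k: "k \<in> {1..w0}" for i k
  proof (rule eq_vecI)
    show "dim_vec (X k *\<^sub>v x) = dim_vec (Y i *\<^sub>v y (i, k))" using Xc[OF k] Yc[OF i] by simp
    fix p assume "p < dim_vec (Y i *\<^sub>v y (i, k))"
    then have p: "p < n" using Yc[OF i] by simp
    have xp: "(X k *\<^sub>v x) $ p = (\<Sum>q<d0. X k $$ (p, q) * c (Inl q))"
      using Xc[OF k] p by (auto simp: x_def scalar_prod_def atLeast0LessThan)
    have yp: "(Y i *\<^sub>v y (i, k)) $ p = (\<Sum>q<di i. Y i $$ (p, q) * c (Inr ((i, k), q)))"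
      using Yc[OF i] p by (auto simp: y_def scalar_prod_def atLeast0LessThan)
    have "0 = (\<Sum>z\<in>?Z. a ((i, k), p) z * c z)" using bspec[OF c0, of "((i, k), p)"] i k p by simp
    also have "\<dots> = (\<Sum>z\<in>Inl ` {..<d0}. a ((i, k), p) z * c z)
        + (\<Sum>z\<in>Inr ` (SIGMA ik:I' \<times> {1..w0}. {..<di (fst ik)}). a ((i, k), p) z * c z)"
      using finI by (intro sum.union_disjoint) auto
    also have "(\<Sum>z\<in>Inl ` {..<d0}. a ((i, k), p) z * c z) = (X k *\<^sub>v x) $ p"
      unfolding xp by (subst sum.reindex) (auto simp: a_def)
    also have "(\<Sum>z\<in>Inr ` (SIGMA ik:I' \<times> {1..w0}. {..<di (fst ik)}). a ((i, k), p) z * c z)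
       = (\<Sum>z\<in>(SIGMA ik:I' \<times> {1..w0}. {..<di (fst ik)}). a ((i, k), p) (Inr z) * c (Inr z))"
      by (subst sum.reindex) auto
    also have "\<dots> = (\<Sum>ik\<in>I' \<times> {1..w0}. \<Sum>q<di (fst ik). a ((i, k), p) (Inr (ik, q)) * c (Inr (ik, q)))"
      using finI by (subst sum.Sigma) (auto simp: case_prod_beta)
    also have "\<dots> = (\<Sum>ik\<in>I' \<times> {1..w0}. if ik = (i, k) then - ((Y i *\<^sub>v y (i, k)) $ p) else 0)"
      by (intro sum.cong refl) (auto simp: a_def yp sum_negf)
    also have "\<dots> = - ((Y i *\<^sub>v y (i, k)) $ p)" using finI i k by simp
    finally show "(X k *\<^sub>v x) $ p = (Y i *\<^sub>v y (i, k)) $ p" by simp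
  qed
  have xc: "x \<in> carrier_vec d0" by (simp add: x_def)
  have yc: "y (i, k) \<in> carrier_vec (di i)" for i k by (simp add: y_def)
  have x0: "x \<noteq> 0\<^sub>v d0"
  proof
    assume x: "x = 0\<^sub>v d0"
    have "y (i, k) = 0\<^sub>v (di i)" if i: "i \<in> I'" and k: "k \<in> {1..w0}" for i k
    proof -
      have "P (i, u i, 1) *\<^sub>v y (i, k) = X k *\<^sub>v x" using eq[OF i k] by (simp add: Y_def)
      also have "\<dots> = 0\<^sub>v n" unfolding x using Xc[OF k] by (intro eq_vecI) auto
      finally show ?thesis
        using trivial_weight_injective[OF Si[OF i] wi[OF i], of "y (i, k)"] yc by (simp add: di_def)
    qed
    then have "c (Inr ((i, k), q)) = 0" if "i \<in> I'" "k \<in> {1..w0}" "q < di i" for i k q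
    proof -
      have "y (i, k) $ q = 0" using \<open>\<And>k i. i \<in> I' \<Longrightarrow> k \<in> {1..w0} \<Longrightarrow> y (i, k) = 0\<^sub>v (di i)\<close> that by simp
      then show ?thesis using that by (simp add: y_def)
    qed
    moreover have "c (Inl q) = 0" if "q < d0" for q
    proof -
      have "x $ q = 0" using x that by simp
      then show ?thesis using that by (simp add: x_def)
    qed
    ultimately have "\<forall>z\<in>?Z. c z = 0" by auto
    then show False using c by blast
  qed
  let ?V = "module_vec TYPE('k) n"
  have bX: "(\<lambda>k. X k *\<^sub>v x) \<in> {1..w0} \<rightarrow> carrier ?V" using mult_mat_vec_carrier[OF Xc xc] by auto
  define U where "U = range (\<lambda>c. lcomb ?V (\<lambda>k. X k *\<^sub>v x) c {1..w0})"
  have U: "ksub U ?V" and XU: "\<And>k. k \<in> {1..w0} \<Longrightarrow> X k *\<^sub>v x \<in> U" and dU: "vdim n U \<le> w0"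
    using span_ksub[OF kvs_module_vec bX] unfolding U_def by auto
  have Uim: "U \<subseteq> (\<lambda>x. P (i, u i, 1) *\<^sub>v x) ` carrier_vec (d (Src i (u i)))" if i: "i \<in> I'" for i
  proof -
    let ?Vi = "module_vec TYPE('k) (di i)"
    have lin: "klin ?Vi ?V (\<lambda>x. Y i *\<^sub>v x)" by (rule mult_mat_vec_klin[OF Yc[OF i]])
    have full: "ksub (carrier ?Vi) ?Vi"
      by (rule ksubI[OF kvs_module_vec]) auto
    have im: "ksub ((\<lambda>x. Y i *\<^sub>v x) ` carrier ?Vi) ?V" by (rule ksub_image[OF lin full])
    have "(\<lambda>k. X k *\<^sub>v x) \<in> {1..w0} \<rightarrow> (\<lambda>x. Y i *\<^sub>v x) ` carrier ?Vi"
      using eq[OF i] yc by auto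
    from lcomb_subspace(2)[OF im this] show ?thesis unfolding U_def Y_def di_def by auto
  qed
  have "\<exists>k\<in>{1..w0}. X k *\<^sub>v x \<noteq> 0\<^sub>v n"
    using kernel_trivial[OF S0, of x] xc x0 by (auto simp: X_def w0_def d0_def)
  then obtain k where k: "k \<in> {1..w0}" "X k *\<^sub>v x \<noteq> 0\<^sub>v n" by blast
  have Ufull: "U = carrier_vec n"
  proof (rule ccontr)
    assume nf: "U \<noteq> carrier_vec n"
    have lt: "(\<Sum>p\<in>S. w (fst p) (snd p) * mdim U p) < m * vdim n U"
      by (rule subspace_bound[OF U XU[OF k(1)] k(2) nf])
    have "x \<in> maxsub U (i0, u i0)" using xc XU by (simp add: maxsub_def X_def w0_def d0_def)
    then have "mdim U (i0, u i0) \<ge> 1"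
      using kdim_ge_1[OF module_vec_dim(1) maxsub_ksub[OF U S0], of x] x0 by (simp add: d0_def)
    then have m0: "w0 \<le> w i0 (u i0) * mdim U (i0, u i0)" by (simp add: w0_def)
    have mi: "w i (u i) * mdim U (i, u i) = vdim n U" if "i \<in> I'" for i
      using trivial_weight_mdim[OF Si[OF that] wi[OF that] U Uim[OF that]] wi[OF that] by simp
    have "w0 + card I' * vdim n U \<le> w i0 (u i0) * mdim U (i0, u i0) + (\<Sum>i\<in>I'. w i (u i) * mdim U (i, u i))"
      using m0 mi by simp
    also have "\<dots> = (\<Sum>i\<in>{1..m}. w i (u i) * mdim U (i, u i))"
      unfolding I'_def by (rule sum.remove[symmetric, OF _ i0]) simp
    also have "\<dots> = (\<Sum>p\<in>(\<lambda>i. (i, u i)) ` {1..m}. w (fst p) (snd p) * mdim U p)"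
      by (subst sum.reindex) (auto simp: inj_on_def)
    also have "\<dots> \<le> (\<Sum>p\<in>S. w (fst p) (snd p) * mdim U p)"
      by (rule sum_mono2) (use u in auto)
    finally have "w0 + card I' * vdim n U < m * vdim n U" using lt by linarith
    moreover have "m = Suc (card I')" using i0 by (simp add: I'_def)
    ultimately have "w0 < vdim n U" by simp
    then show False using dU by simp
  qed
  have "vdim n U = n"
    using module_vec_dim(2)[of n, where ?'k='k] unfolding Ufull by (simp add: module_vec_def)
  then have nw: "n \<le> w0" using dU by simp
  have d0p: "d0 \<ge> 1" using x0 xc by (cases d0) auto
  have b0: "w0 * d0 \<le> n" using bal_le[OF S0] by (simp add: w0_def d0_def)
  have w0p: "w0 \<ge> 1" using weights[OF i0 u[OF i0]] by (simp add: w0_def)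
  have "w0 * 1 \<le> w0 * d0" using d0p by (intro mult_le_mono2)
  then have n_eq: "n = w0" using b0 nw by linarith
  then have "w0 * d0 \<le> w0 * 1" using b0 by simp
  then have d0_eq: "d0 = 1" using w0p d0p by simp
  show "n = w i0 (u i0)" "d (Src i0 (u i0)) = 1" using n_eq d0_eq by (simp_all add: w0_def d0_def)
  have di_le: "di i \<le> n" if "i \<in> I'" for i using bal_le[OF Si[OF that]] wi[OF that] by (simp add: di_def)
  fix i assume i: "i \<in> {1..m}" "i \<noteq> i0"
  then have iI: "i \<in> I'" by (simp add: I'_def)
  show "d (Src i (u i)) = n"
  proof (rule ccontr)
    assume "d (Src i (u i)) \<noteq> n"
    then have lt: "Suc (di i) \<le> n" using di_le[OF iI] by (simp add: di_def)
    have "Suc (\<Sum>i\<in>I'. di i) = Suc (di i) + (\<Sum>i\<in>I' - {i}. di i)"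
      using sum.remove[OF finI iI, of di] by simp
    also have "\<dots> \<le> n + (\<Sum>i\<in>I' - {i}. n)"
      using lt di_le by (intro add_mono sum_mono) auto
    also have "\<dots> = card I' * n" using sum.remove[OF finI iI, of "\<lambda>_. n"] by simp
    finally have "w0 * Suc (\<Sum>i\<in>I'. di i) \<le> w0 * (card I' * n)" by (rule mult_le_mono2)
    moreover have "card I' * w0 * n < d0 + w0 * (\<Sum>i\<in>I'. di i)"
      using ineq by (simp add: w0_def d0_def I'_def di_def sum_distrib_left)
    ultimately have "w0 < 1" using d0_eq by (simp add: algebra_simps)
    then show False using w0p by simp
  qed
qed

lemma condition_aI:
  assumes u: "\<And>i. i \<in> {1..m} \<Longrightarrow> u i \<in> {1..r i}" and i0: "i0 \<in> {1..m}"
    and triv: "\<And>i. i \<in> {1..m} \<Longrightarrow> i \<noteq> i0 \<Longrightarrow> w i (u i) = 1"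
    and n: "n = w i0 (u i0)" "d (Src i0 (u i0)) = 1"
    and di: "\<And>i. i \<in> {1..m} \<Longrightarrow> i \<noteq> i0 \<Longrightarrow> d (Src i (u i)) = n"
  shows "condition_a m r w d"
proof -
  have bi: "(\<Sum>j\<in>{1..r i}. w i j * d (Src i j)) = n" if "i \<in> {1..m}" for i
    using bal that unfolding balanced_def by auto
  have wd: "w i (u i) * d (Src i (u i)) = n" if "i \<in> {1..m}" for i
    using n triv[OF that] di[OF that] by (cases "i = i0") auto
  have zero: "d (Src i j) = 0" if i: "i \<in> {1..m}" and j: "j \<in> {1..r i}" "j \<noteq> u i" for i j
    using balanced_zero_elsewhere[OF _ u[OF i] bi[OF i] wd[OF i] j] weights[OF i j(1)] by simp
  have real: "real_extremal m w u"
  proof -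
    have "{i \<in> {1..m}. w i (u i) \<noteq> 1} \<subseteq> {i0}" using triv by auto
    then have "card {i \<in> {1..m}. w i (u i) \<noteq> 1} \<le> card {i0}" by (intro card_mono) auto
    then show ?thesis unfolding real_extremal_def by simp
  qed
  have wp: "w i (u i) > 0" if "i \<in> {1..m}" for i using weights[OF that u[OF that]] by simp
  have ray: "of_nat (d v) = (of_nat n :: rat) * delta w u v" if v: "v \<in> verts Q" for v
  proof (cases v)
    case (Src i j)
    then have ij: "i \<in> {1..m}" "j \<in> {1..r i}" using v by auto
    show ?thesis
    proof (cases "j = u i")
      case True
      have "of_nat (w i (u i)) * of_nat (d (Src i (u i))) = (of_nat n :: rat)"
        using wd[OF ij(1)] by (simp flip: of_nat_mult)
      then show ?thesis using Src True wp[OF ij(1)] by (simp add: delta_def field_simps)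
    next
      case False
      then show ?thesis using Src zero[OF ij False] by (simp add: delta_def)
    qed
  qed (simp add: delta_def)
  have "minimal_on_ray (verts Q) (delta w u) d"
    unfolding minimal_on_ray_def
  proof (intro conjI allI impI)
    show "on_ray (verts Q) (delta w u) d"
      unfolding on_ray_def by (rule exI[of _ "of_nat n"], intro conjI ballI ray) (use pos in simp_all)
    fix d' assume "on_ray (verts Q) (delta w u) d'"
    then have "\<exists>q. q > 0 \<and> (\<forall>v\<in>verts Q. of_nat (d' v) = q * delta w u v)" unfolding on_ray_def .
    then obtain q where qq: "q > 0 \<and> (\<forall>v\<in>verts Q. of_nat (d' v) = q * delta w u v)" by (rule exE)
    note q = conjunct1[OF qq] bspec[OF conjunct2[OF qq]]
    have v0: "Src i0 (u i0) \<in> verts Q" using i0 u[OF i0] by auto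
    have d0: "of_nat (d' (Src i0 (u i0))) = q / of_nat (w i0 (u i0))"
      using q(2)[OF v0] by (simp add: delta_def)
    then have "(of_nat (d' (Src i0 (u i0))) :: rat) > 0" using q(1) wp[OF i0] by simp
    then have "(1::rat) \<le> of_nat (d' (Src i0 (u i0)))" by simp
    then have qn: "of_nat n \<le> q" using d0 wp[OF i0] n(1) by (simp add: field_simps)
    show "\<forall>v\<in>verts Q. d v \<le> d' v"
    proof
      fix v assume v: "v \<in> verts Q"
      have "delta w u v \<ge> 0" by (cases v) (auto simp: delta_def)
      then have "(of_nat (d v) :: rat) \<le> of_nat (d' v)"
        unfolding ray[OF v] q(2)[OF v] using qn by (intro mult_right_mono)
      then show "d v \<le> d' v" by simp
    qed
  qed
  then show ?thesis unfolding condition_a_def extremal_index_def using u real by blast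
qed

text \<open>A weight \<open>w \<ge> 2\<close> bounds the ratio of its vertex by \<open>n / w\<^sup>2 \<le> n/4\<close>. Two such indices \<open>u i\<close> would leave at most
  \<open>(m - 2) n + n/2\<close> for the sum of the largest ratios.\<close>

lemma inequality_fails:
  assumes "\<not> (\<Sum>i\<in>{1..m}. max_ratio r w d i) \<le> (real m - 1) * real n"
  shows "condition_a m r w d"
proof -
  have "\<forall>i\<in>{1..m}. \<exists>j\<in>{1..r i}. max_ratio r w d i = real (d (Src i j)) / real (w i j)"
  proof
    fix i assume "i \<in> {1..m}"
    then have "{1..r i} \<noteq> {}" using cluster_nonempty by auto
    then have "max_ratio r w d i \<in> (\<lambda>j. real (d (Src i j)) / real (w i j)) ` {1..r i}"
      unfolding max_ratio_def by (intro Max_in) auto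
    then show "\<exists>j\<in>{1..r i}. max_ratio r w d i = real (d (Src i j)) / real (w i j)" by blast
  qed
  then obtain u where u: "\<And>i. i \<in> {1..m} \<Longrightarrow> u i \<in> {1..r i}"
    and M: "\<And>i. i \<in> {1..m} \<Longrightarrow> max_ratio r w d i = real (d (Src i (u i))) / real (w i (u i))" by metis
  let ?M = "\<lambda>i. real (d (Src i (u i))) / real (w i (u i))"
  have Si: "(i, u i) \<in> S" if "i \<in> {1..m}" for i using u[OF that] that by auto
  have wp: "w i (u i) \<ge> 1" if "i \<in> {1..m}" for i using weights[OF that u[OF that]] .
  have big: "(real m - 1) * real n < (\<Sum>i\<in>{1..m}. ?M i)" using assms M by simp
  have wd: "real (w i (u i)) * real (d (Src i (u i))) \<le> real n" if "i \<in> {1..m}" for i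
    using bal_le[OF Si[OF that]] by (simp flip: of_nat_mult)
  have Mn: "?M i \<le> real n" if i: "i \<in> {1..m}" for i
    by (rule ratio_bounds(1)[OF _ _ wd[OF i]]) (use wp[OF i] in simp_all)
  have M4: "?M i \<le> real n / 4" if i: "i \<in> {1..m}" and w2: "w i (u i) \<noteq> 1" for i
  proof (rule ratio_bounds(2)[OF _ _ wd[OF i]])
    have "w i (u i) \<ge> 2" using wp[OF i] w2 by arith
    then show "2 \<le> real (w i (u i))" "1 \<le> real (w i (u i))" by simp_all
  qed simp
  have atmost1: "i = i'" if i: "i \<in> {1..m}" "w i (u i) \<noteq> 1" and i': "i' \<in> {1..m}" "w i' (u i') \<noteq> 1" for i i'
  proof (rule ccontr)
    assume ne: "i \<noteq> i'"
    have "(\<Sum>i\<in>{1..m}. ?M i) = ?M i + (\<Sum>l\<in>{1..m} - {i}. ?M l)" using i by (intro sum.remove) auto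
    also have "(\<Sum>l\<in>{1..m} - {i}. ?M l) = ?M i' + (\<Sum>l\<in>{1..m} - {i} - {i'}. ?M l)"
      using i' ne by (intro sum.remove) auto
    finally have s: "(\<Sum>i\<in>{1..m}. ?M i) = ?M i + ?M i' + (\<Sum>l\<in>{1..m} - {i} - {i'}. ?M l)" by simp
    have "(\<Sum>l\<in>{1..m} - {i} - {i'}. ?M l) \<le> (\<Sum>l\<in>{1..m} - {i} - {i'}. real n)"
      by (intro sum_mono Mn) auto
    also have "\<dots> = real (m - 2) * real n" using i i' ne by (simp add: card_Diff_singleton)
    also have "real (m - 2) = real m - 2"
    proof -
      have "card {i, i'} \<le> card {1..m}" using i i' by (intro card_mono) auto
      then show ?thesis using ne by simp
    qed
    finally have "(\<Sum>i\<in>{1..m}. ?M i) \<le> real n / 4 + real n / 4 + (real m - 2) * real n"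
      unfolding s using M4[OF i] M4[OF i'] by linarith
    then show False using big by (simp add: algebra_simps)
  qed
  obtain i0 where i0: "i0 \<in> {1..m}" and triv: "\<And>i. i \<in> {1..m} \<Longrightarrow> i \<noteq> i0 \<Longrightarrow> w i (u i) = 1"
  proof (cases "\<exists>i\<in>{1..m}. w i (u i) \<noteq> 1")
    case True
    then obtain i where "i \<in> {1..m}" "w i (u i) \<noteq> 1" by blast
    then show thesis using that[of i] atmost1 by blast
  next
    case False
    then show thesis using that[of 1] m by auto
  qed
  let ?w0 = "w i0 (u i0)"
  have "real (card ({1..m} - {i0}) * ?w0 * n) < real (d (Src i0 (u i0)) + (\<Sum>i\<in>{1..m} - {i0}. ?w0 * d (Src i (u i))))"
  proof -
    have "(\<Sum>i\<in>{1..m}. ?M i) = ?M i0 + (\<Sum>i\<in>{1..m} - {i0}. ?M i)" using i0 by (intro sum.remove) auto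
    also have "(\<Sum>i\<in>{1..m} - {i0}. ?M i) = (\<Sum>i\<in>{1..m} - {i0}. real (d (Src i (u i))))"
      using triv by (intro sum.cong) auto
    finally have "real ?w0 * ((real m - 1) * real n) < real ?w0 * (?M i0 + (\<Sum>i\<in>{1..m} - {i0}. real (d (Src i (u i)))))"
      using big wp[OF i0] by simp
    also have "\<dots> = real (d (Src i0 (u i0))) + (\<Sum>i\<in>{1..m} - {i0}. real ?w0 * real (d (Src i (u i))))"
      using wp[OF i0] by (simp add: distrib_left sum_distrib_left)
    finally show ?thesis using i0 m by (simp add: of_nat_diff mult_ac)
  qed
  then have ineq: "card ({1..m} - {i0}) * ?w0 * n < d (Src i0 (u i0)) + (\<Sum>i\<in>{1..m} - {i0}. ?w0 * d (Src i (u i)))"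
    by (simp only: of_nat_less_iff)
  show ?thesis
    by (rule condition_aI[OF u i0 triv real_extremal_case[OF u i0 triv ineq]])
qed

end

section \<open>The special isotropic case\<close>

context stable_point
begin

text \<open>In each cluster without one of the four entries, one arrow of weight one is bijective and contributes \<open>dim U\<close> to
  the inequality of stability. What remains is a bound for the four special vertices.\<close>

lemma isotropic_bound:
  assumes sp: "special_isotropic m r w d"
    and hv: "halves = {(i1, a), (i1, b), (i2, c), (i2, e)}" "i1 \<noteq> i2"
    and U: "ksub U (module_vec TYPE('k) n)" "x \<in> U" "x \<noteq> 0\<^sub>v n" and full: "U \<noteq> carrier_vec n"
  shows "(\<Sum>p\<in>halves. mdim U p) < 2 * vdim n U"
proof -
  let ?R = "{1..m} - {i1, i2}"
  have hS: "halves \<subseteq> S" by (auto simp: halves_def)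
  have i12: "i1 \<in> {1..m}" "i2 \<in> {1..m}" using hv(1) hS by auto
  have "\<exists>j. j \<in> {1..r i} \<and> w i j = 1 \<and> d (Src i j) = n" if i: "i \<in> ?R" for i
  proof -
    have "(\<Sum>l\<in>{1..r i}. w i l * d (Src i l)) \<noteq> 0" using bal pos i by (simp add: balanced_def)
    then obtain l where l: "l \<in> {1..r i}" "w i l * d (Src i l) \<noteq> 0" by (meson sum.neutral)
    have "(i, l) \<notin> halves" using i hv by auto
    then have dn: "n \<le> d (Src i l)" using l i by (auto simp: halves_def)
    have lS: "(i, l) \<in> S" using i l by simp
    have "w i l * n \<le> w i l * d (Src i l)" by (rule mult_le_mono2[OF dn])
    also have "\<dots> \<le> 1 * n" using bal_le[OF lS] by simp
    finally have "w i l = 1" using l pos by (cases "w i l") auto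
    then show ?thesis using l dn bal_le[OF lS] by auto
  qed
  then obtain u where u: "\<And>i. i \<in> ?R \<Longrightarrow> u i \<in> {1..r i} \<and> w i (u i) = 1 \<and> d (Src i (u i)) = n" by metis
  have mu: "mdim U (i, u i) = vdim n U" if i: "i \<in> ?R" for i
  proof (rule trivial_weight_mdim[OF _ _ U(1)])
    show ij: "(i, u i) \<in> S" and w1: "w i (u i) = 1" using u[OF i] i by auto
    have dn: "d (Src i (u i)) = n" using u[OF i] by simp
    have lin: "klin (module_vec TYPE('k) n) (module_vec TYPE('k) n) (\<lambda>x. P (i, u i, 1) *\<^sub>v x)"
      using Plin[OF ij, of 1] w1 dn by simp
    let ?V = "module_vec TYPE('k) n" and ?f = "\<lambda>x. P (i, u i, 1) *\<^sub>v x"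
    have im: "ksub (?f ` carrier ?V) ?V"
      by (rule ksub_image[OF lin]) (rule ksubI[OF kvs_module_vec], auto)
    have eqV: "?V\<lparr>carrier := carrier ?V\<rparr> = ?V" by (simp add: module_vec_def)
    have full_V: "ksub (carrier ?V) ?V" by (rule ksubI[OF kvs_module_vec]) auto
    have l: "klin ?V (?V\<lparr>carrier := ?f ` carrier ?V\<rparr>) ?f"
      by (rule klin_restrict[OF lin full_V im subset_refl, unfolded eqV])
    have "bij_betw ?f (carrier ?V) (carrier (?V\<lparr>carrier := ?f ` carrier ?V\<rparr>))"
      using trivial_weight_inj_on[OF ij w1] dn by (simp add: bij_betw_def)
    from klin_bij_dim(2)[OF l this module_vec_dim(1)] have "vdim n (?f ` carrier ?V) = n"
      using module_vec_dim(2) by simp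
    then have "vdim n (?f ` carrier ?V) = kdim ?V" by (simp only: module_vec_dim(2))
    then have "?f ` carrier ?V = carrier ?V" by (rule subspace_fd(3)[OF module_vec_dim(1) im])
    then show "U \<subseteq> ?f ` carrier_vec (d (Src i (u i)))" using ksubD(2)[OF U(1)] dn by simp
  qed
  have "fst p \<in> {i1, i2}" if "p \<in> halves" for p using that unfolding hv(1) by (elim insertE) simp_all
  then have disj: "halves \<inter> (\<lambda>i. (i, u i)) ` ?R = {}" by fastforce
  have fin: "finite halves" using hv by simp
  have cR: "card ?R = m - 2" using i12 hv(2) by (simp add: card_Diff_subset)
  have m2: "m \<ge> 2" using card_mono[of "{1..m}" "{i1, i2}"] i12 hv(2) by simp
  have "(\<Sum>p\<in>halves. mdim U p) + (m - 2) * vdim n U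
      = (\<Sum>p\<in>halves. w (fst p) (snd p) * mdim U p) + (\<Sum>i\<in>?R. w i (u i) * mdim U (i, u i))"
  proof -
    have "(\<Sum>i\<in>?R. w i (u i) * mdim U (i, u i)) = (\<Sum>i\<in>?R. vdim n U)" using u mu by (intro sum.cong) auto
    moreover have "(\<Sum>p\<in>halves. w (fst p) (snd p) * mdim U p) = (\<Sum>p\<in>halves. mdim U p)"
      using special_isotropicD(4)[OF sp] by (intro sum.cong) auto
    ultimately show ?thesis using cR by simp
  qed
  also have "(\<Sum>i\<in>?R. w i (u i) * mdim U (i, u i)) = (\<Sum>p\<in>(\<lambda>i. (i, u i)) ` ?R. w (fst p) (snd p) * mdim U p)"
    by (subst sum.reindex) (auto simp: inj_on_def)
  also have "(\<Sum>p\<in>halves. w (fst p) (snd p) * mdim U p) + \<dots>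
      = (\<Sum>p\<in>halves \<union> (\<lambda>i. (i, u i)) ` ?R. w (fst p) (snd p) * mdim U p)"
    by (rule sum.union_disjoint[symmetric]) (use fin disj in auto)
  also have "\<dots> \<le> (\<Sum>p\<in>S. w (fst p) (snd p) * mdim U p)"
    by (rule sum_mono2) (use hS u in auto)
  also have "\<dots> < m * vdim n U" by (rule subspace_bound[OF U full])
  also have "m * vdim n U = 2 * vdim n U + (m - 2) * vdim n U"
    by (simp only: add_mult_distrib[symmetric] le_add_diff_inverse[OF m2])
  finally show ?thesis by simp
qed

text \<open>The images of the four arrows \<open>A\<close>, \<open>B\<close>, \<open>C\<close>, \<open>E\<close> are half-dimensional. Any two of them meet trivially,
  because a common vector would span a line that contradicts stability. So both \<open>A\<close>, \<open>B\<close> and \<open>C\<close>, \<open>E\<close> are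
  complementary. Let \<open>x\<close> be an eigenvector of the operator that writes \<open>A x = C s + E t\<close> and takes the \<open>A\<close>-component of
  \<open>C s\<close>. Then \<open>C s = \<mu> A x + B y\<close>, and the span of \<open>A x\<close> and \<open>B y\<close> meets all four
  images nontrivially.\<close>

lemma special_isotropic_dim_2:
  assumes sp: "special_isotropic m r w d"
  shows "n = 2"
proof -
  obtain i1 a b i2 c e where ne: "i1 \<noteq> i2" "a \<noteq> b" "c \<noteq> e"
    and hv: "halves = {(i1, a), (i1, b), (i2, c), (i2, e)}"
    by (rule halves_structure[OF sp])
  define k where "k = d (Src i1 a)"
  have hd: "d (Src i j) = k \<and> 2 * k = n \<and> w i j = 1 \<and> (i, j) \<in> S" if "(i, j) \<in> halves" for i j
  proof -
    have "(i1, a) \<in> halves" by (simp add: hv)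
    then have "2 * k = n" unfolding k_def by (rule special_isotropicD(3)[OF sp])
    moreover have "2 * d (Src i j) = n" "w i j = 1" by (rule special_isotropicD(3,4)[OF sp that])+
    moreover have "(i, j) \<in> S" using that unfolding halves_def by simp
    ultimately show ?thesis by simp
  qed
  let ?V = "module_vec TYPE('k) n" and ?K = "module_vec TYPE('k) k"
  define f where "f p x = P (fst p, snd p, 1) *\<^sub>v x" for p x
  have k: "2 * k = n" using hd[of i1 a] unfolding hv by simp
  have lin: "klin ?K ?V (f p)" if "p \<in> halves" for p
    using Plin[of "fst p" "snd p" 1] hd[of "fst p" "snd p"] that by (simp add: f_def[abs_def])
  have inj: "x = 0\<^sub>v k" if "p \<in> halves" "x \<in> carrier_vec k" "f p x = 0\<^sub>v n" for p x
    using trivial_weight_injective[of "fst p" "snd p" x] hd[of "fst p" "snd p"] that by (simp add: f_def)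
  have fc: "f p x \<in> carrier_vec n" if "p \<in> halves" "x \<in> carrier_vec k" for p x
    using klinD(3)[OF lin[OF that(1)]] that(2) by simp
  have one_le: "mdim U p \<ge> 1"
    if p: "p \<in> halves" and U: "ksub U ?V" and x: "x \<in> carrier_vec k" "x \<noteq> 0\<^sub>v k" "f p x \<in> U" for p U x
  proof -
    have q: "(fst p, snd p) \<in> S" "d (Src (fst p) (snd p)) = k" "w (fst p) (snd p) = 1"
      using hd[of "fst p" "snd p"] p by auto
    have "x \<in> maxsub U (fst p, snd p)" unfolding maxsub_def case_prod_conv using x q by (simp add: f_def)
    then show ?thesis
      using kdim_ge_1[OF module_vec_dim(1) maxsub_ksub[OF U q(1)], of x] x(2) q(2) by simp
  qed
  have four: "mdim U (i1, a) + mdim U (i1, b) + mdim U (i2, c) + mdim U (i2, e) = (\<Sum>p\<in>halves. mdim U p)" for U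
    unfolding hv using ne by simp
  have full_dim: "vdim n (carrier_vec n :: 'k vec set) = n" using module_vec_dim(2)[of n, where ?'k='k] by (simp add: module_vec_def)
  have indep: "x = 0\<^sub>v k" if p: "p \<in> halves" and q: "q \<in> halves" and pq: "p \<noteq> q"
    and x: "x \<in> carrier_vec k" and y: "y \<in> carrier_vec k" and eq: "f p x = f q y" for p q x y
  proof (rule ccontr)
    assume x0: "x \<noteq> 0\<^sub>v k"
    have fx: "f p x \<noteq> 0\<^sub>v n" using inj[OF p x] x0 by blast
    have y0: "y \<noteq> 0\<^sub>v k" using klinD(6)[OF lin[OF q]] fx eq by auto
    let ?U = "range (\<lambda>c. lcomb ?V (\<lambda>_. f p x) c {()})"
    have bc: "(\<lambda>_. f p x) \<in> {()} \<rightarrow> carrier ?V" using fc[OF p x] by simp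
    have U': "ksub ?U ?V" "f p x \<in> ?U" "vdim n ?U \<le> 1" using span_ksub[OF kvs_module_vec bc] by auto
    have nf: "?U \<noteq> carrier_vec n" using U'(3) full_dim special_isotropicD(2)[OF sp] by auto
    have "1 \<le> mdim ?U p" by (rule one_le[OF p U'(1) x x0 U'(2)])
    moreover have "1 \<le> mdim ?U q" by (rule one_le[OF q U'(1) y y0]) (use U'(2) eq in simp)
    moreover have "mdim ?U p + mdim ?U q \<le> (\<Sum>p\<in>halves. mdim ?U p)"
    proof -
      have "(\<Sum>s\<in>{p, q}. mdim ?U s) \<le> (\<Sum>p\<in>halves. mdim ?U p)"
        by (rule sum_mono2) (use p q hv in auto)
      then show ?thesis using pq by simp
    qed
    ultimately show False using isotropic_bound[OF sp hv ne(1) U'(1,2) fx nf] U'(3) by linarith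
  qed
  have split: "\<exists>g1 g2. klin ?V ?K g1 \<and> klin ?V ?K g2 \<and> (\<forall>v\<in>carrier ?V. v = f p (g1 v) + f q (g2 v))"
    if p: "p \<in> halves" and q: "q \<in> halves" and pq: "p \<noteq> q" for p q
  proof -
    have z: "x = \<zero>\<^bsub>?K\<^esub> \<and> y = \<zero>\<^bsub>?K\<^esub>"
      if x: "x \<in> carrier ?K" and y: "y \<in> carrier ?K" and s: "f p x \<oplus>\<^bsub>?V\<^esub> f q y = \<zero>\<^bsub>?V\<^esub>" for x y
    proof -
      have y': "(-1) \<cdot>\<^sub>v y \<in> carrier_vec k" using y by simp
      have "f q ((-1) \<cdot>\<^sub>v y) = (-1) \<cdot>\<^sub>v f q y" using klinD(5)[OF lin[OF q] y, of "-1"] by simp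
      also have "\<dots> = f p x"
      proof (rule eq_vecI)
        show "dim_vec ((- 1) \<cdot>\<^sub>v f q y) = dim_vec (f p x)"
          using fc[OF p, of x] fc[OF q, of y] x y by simp
        fix i assume "i < dim_vec (f p x)"
        then have i: "i < n" using fc[OF p, of x] x by simp
        have "(f p x + f q y) $ i = 0" using s i by simp
        then have "f p x $ i + f q y $ i = 0" using fc[OF q, of y] y i by simp
        then show "((- 1) \<cdot>\<^sub>v f q y) $ i = f p x $ i"
          using fc[OF q, of y] y i by (simp add: eq_neg_iff_add_eq_0 add.commute minus_unique)
      qed
      finally have eq: "f p x = f q ((-1) \<cdot>\<^sub>v y)" ..
      have x0: "x = 0\<^sub>v k" using indep[OF p q pq _ y' eq] x by simp
      have "f p x = 0\<^sub>v n" unfolding x0 using klinD(6)[OF lin[OF p]] by simp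
      then have "f q y = 0\<^sub>v n" using s fc[OF q, of y] y by simp
      then show ?thesis using inj[OF q _ ] y x0 by simp
    qed
    have dim: "kdim ?K + kdim ?K = kdim ?V" using k by (simp add: module_vec_dim(2))
    show ?thesis
    proof (rule complementary_projections[OF lin[OF p] lin[OF q] z module_vec_dim(1) module_vec_dim(1) module_vec_dim(1) dim])
      fix g1 g2
      assume g: "klin ?V ?K g1" "klin ?V ?K g2" "\<And>v. v \<in> carrier ?V \<Longrightarrow> v = f p (g1 v) \<oplus>\<^bsub>?V\<^esub> f q (g2 v)"
      show ?thesis
        by (intro exI[of _ g1] exI[of _ g2] conjI ballI g(1,2)) (rule g(3)[unfolded vec_space_simps(3)])
    qed
  qed
  define A B C E where "A = f (i1, a)" and "B = f (i1, b)" and "C = f (i2, c)" and "E = f (i2, e)"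
  have mem: "(i1, a) \<in> halves" "(i1, b) \<in> halves" "(i2, c) \<in> halves" "(i2, e) \<in> halves" by (simp_all add: hv)
  have pairs: "(i1, a) \<noteq> (i1, b)" "(i2, c) \<noteq> (i2, e)" using ne by simp_all
  from split[OF mem(1,2) pairs(1), folded A_def B_def] obtain \<alpha> \<beta> where \<alpha>: "klin ?V ?K \<alpha>" and \<beta>: "klin ?V ?K \<beta>"
    and AB0: "\<forall>v\<in>carrier ?V. v = A (\<alpha> v) + B (\<beta> v)" by (elim exE conjE)
  from split[OF mem(3,4) pairs(2), folded C_def E_def] obtain \<sigma> \<tau> where \<sigma>: "klin ?V ?K \<sigma>" and \<tau>: "klin ?V ?K \<tau>"
    and CE0: "\<forall>v\<in>carrier ?V. v = C (\<sigma> v) + E (\<tau> v)" by (elim exE conjE)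
  note AB = bspec[OF AB0] and CE = bspec[OF CE0]
  \<comment> \<open>the operator whose eigenvector is needed\<close>
  have "klin ?K ?K (\<lambda>x. \<alpha> (C (\<sigma> (A x))))"
    by (rule klin_comp[OF klin_comp[OF klin_comp[OF lin[OF mem(1), folded A_def] \<sigma>] lin[OF mem(3), folded C_def]] \<alpha>])
  from klin_matrix[OF this] obtain N where N: "N \<in> carrier_mat k k"
      "\<And>x. x \<in> carrier_vec k \<Longrightarrow> \<alpha> (C (\<sigma> (A x))) = N *\<^sub>v x" by blast
  have "k > 0" using k pos by simp
  from alg_closed_eigenvector[OF N(1) this] obtain \<mu> x
    where x: "x \<in> carrier_vec k" "x \<noteq> 0\<^sub>v k" "N *\<^sub>v x = \<mu> \<cdot>\<^sub>v x" by blast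
  define s t y where "s = \<sigma> (A x)" and "t = \<tau> (A x)" and "y = \<beta> (C s)"
  have Ax: "A x \<in> carrier_vec n" using fc[OF mem(1) x(1)] by (simp add: A_def)
  have sc: "s \<in> carrier_vec k" and tc: "t \<in> carrier_vec k"
    using klinD(3)[OF \<sigma>, of "A x"] klinD(3)[OF \<tau>, of "A x"] Ax by (simp_all add: s_def t_def)
  have Cs: "C s \<in> carrier_vec n" and Et: "E t \<in> carrier_vec n"
    using fc[OF mem(3) sc] fc[OF mem(4) tc] by (simp_all add: C_def E_def)
  have yc: "y \<in> carrier_vec k" using klinD(3)[OF \<beta>, of "C s"] Cs by (simp add: y_def)
  have By: "B y \<in> carrier_vec n" using fc[OF mem(2) yc] by (simp add: B_def)
  have Z: "A (0\<^sub>v k) = 0\<^sub>v n" "B (0\<^sub>v k) = 0\<^sub>v n" "C (0\<^sub>v k) = 0\<^sub>v n" "E (0\<^sub>v k) = 0\<^sub>v n"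
    using klinD(6)[OF lin[OF mem(1)]] klinD(6)[OF lin[OF mem(2)]] klinD(6)[OF lin[OF mem(3)]] klinD(6)[OF lin[OF mem(4)]]
    by (simp_all add: A_def B_def C_def E_def)
  have e1: "A x = C s + E t" unfolding s_def t_def by (rule CE) (simp add: Ax)
  have "\<alpha> (C s) = \<mu> \<cdot>\<^sub>v x" using N(2)[OF x(1)] x(3) by (simp add: s_def)
  moreover have "C s = A (\<alpha> (C s)) + B y" unfolding y_def by (rule AB) (simp add: Cs)
  ultimately have e2: "C s = A (\<mu> \<cdot>\<^sub>v x) + B y" by metis
  have Amu: "A (\<mu> \<cdot>\<^sub>v x) = \<mu> \<cdot>\<^sub>v A x" using klinD(5)[OF lin[OF mem(1)], of x \<mu>] x(1) by (simp add: A_def)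
  have s0: "s \<noteq> 0\<^sub>v k"
  proof
    assume s: "s = 0\<^sub>v k"
    have "A x = E t" using e1 Et unfolding s Z by simp
    from indep[OF mem(1,4) _ x(1) tc this[unfolded A_def E_def]] ne x(2) show False by simp
  qed
  have t0: "t \<noteq> 0\<^sub>v k"
  proof
    assume t: "t = 0\<^sub>v k"
    have "A x = C s" using e1 Cs unfolding t Z by simp
    from indep[OF mem(1,3) _ x(1) sc this[unfolded A_def C_def]] ne x(2) show False by simp
  qed
  have y0: "y \<noteq> 0\<^sub>v k"
  proof
    assume y: "y = 0\<^sub>v k"
    have mx: "\<mu> \<cdot>\<^sub>v x \<in> carrier_vec k" using x(1) by simp
    have "C s = A (\<mu> \<cdot>\<^sub>v x)" using e2 Ax unfolding y Z Amu by simp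
    from indep[OF mem(3,1) _ sc mx this[unfolded A_def C_def]] ne s0 show False by simp
  qed
  \<comment> \<open>the span of \<open>A x\<close> and \<open>B y\<close>, as a family indexed by \<open>bool\<close>\<close>
  let ?bb = "\<lambda>z. if z then A x else B y"
  have bb: "?bb \<in> UNIV \<rightarrow> carrier ?V" using Ax By by simp
  define U where "U = range (\<lambda>c. lcomb ?V ?bb c UNIV)"
  have U: "ksub U ?V" and dU: "vdim n U \<le> 2"
    using span_ksub(1,3)[OF kvs_module_vec bb] unfolding U_def by auto
  have AU: "A x \<in> U" and BU: "B y \<in> U"
    using span_ksub(2)[OF kvs_module_vec bb, of True] span_ksub(2)[OF kvs_module_vec bb, of False] unfolding U_def by auto
  have muA: "c \<cdot>\<^sub>v v \<in> U" if "v \<in> U" for c v using ksubD(5)[OF U that] by simp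
  have addU: "v + v' \<in> U" if "v \<in> U" "v' \<in> U" for v v' using ksubD(4)[OF U that] by simp
  have CU: "C s \<in> U" unfolding e2 Amu by (intro addU muA AU BU)
  have "E t = A x + (-1) \<cdot>\<^sub>v C s" unfolding e1 using Cs Et by (intro eq_vecI) auto
  then have EU: "E t \<in> U" using addU[OF AU muA[OF CU]] by simp
  have Ax0: "A x \<noteq> 0\<^sub>v n" using inj[OF mem(1) x(1)] x(2) by (auto simp: A_def)
  have "mdim U (i1, a) \<ge> 1" by (rule one_le[OF mem(1) U x(1,2)]) (use AU in \<open>simp add: A_def\<close>)
  moreover have "mdim U (i1, b) \<ge> 1" by (rule one_le[OF mem(2) U yc y0]) (use BU in \<open>simp add: B_def\<close>)
  moreover have "mdim U (i2, c) \<ge> 1" by (rule one_le[OF mem(3) U sc s0]) (use CU in \<open>simp add: C_def\<close>)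
  moreover have "mdim U (i2, e) \<ge> 1" by (rule one_le[OF mem(4) U tc t0]) (use EU in \<open>simp add: E_def\<close>)
  ultimately have "(\<Sum>p\<in>halves. mdim U p) \<ge> 4" unfolding four[symmetric] by linarith
  then have "\<not> (\<Sum>p\<in>halves. mdim U p) < 2 * vdim n U" using dU by linarith
  then have "U = carrier_vec n" using isotropic_bound[OF sp hv ne(1) U AU Ax0] by blast
  then have "n \<le> 2" using dU full_dim by simp
  then show ?thesis using special_isotropicD(2)[OF sp] by simp
qed

lemma special_isotropic_condition_b:
  assumes sp: "special_isotropic m r w d"
  shows "condition_b m r w d"
proof -
  have n2: "n = 2" by (rule special_isotropic_dim_2[OF sp])
  have "halves \<noteq> {}" using special_isotropicD(1)[OF sp] by auto
  then obtain i j where h: "(i, j) \<in> halves" by auto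
  have "Src i j \<in> verts Q" "d (Src i j) = 1"
    using h special_isotropicD(3)[OF sp h] n2 by (auto simp: halves_def)
  then have "\<not> divisible (verts Q) d" unfolding divisible_def by force
  then show ?thesis using sp unfolding condition_b_def by simp
qed

lemma conditions: "condition_a m r w d \<or> condition_b m r w d \<or> condition_c m r w d"
proof (cases "special_isotropic m r w d")
  case True
  then show ?thesis using special_isotropic_condition_b by blast
next
  case False
  show ?thesis
  proof (cases "(\<Sum>i\<in>{1..m}. max_ratio r w d i) \<le> (real m - 1) * real n")
    case True
    have "condition_c m r w d"
      unfolding condition_c_def by (rule conjI[OF False iffD2[OF inequality_real[OF cluster_nonempty] True]])
    then show ?thesis by blast
  next
    case False
    then show ?thesis using inequality_fails by blast
  qed
qed

end

lemma stable_conditions: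
  fixes X :: "(vertex, arrow, 'k::alg_closed_field, 'x) quiver_rep"
  assumes m: "m \<ge> 1" and weights: "\<And>i j. \<lbrakk>i \<in> {1..m}; j \<in> {1..r i}\<rbrakk> \<Longrightarrow> w i j \<ge> 1"
    and bal: "balanced m r w d" and pos: "d Sink > 0"
    and X: "fd_quiver_rep (Gam m r w) X" "has_dim_vec (Gam m r w) X d" "stable_rep (Gam m r w) (theta m w) X"
  shows "condition_a m r w d \<or> condition_b m r w d \<or> condition_c m r w d"
proof -
  have arcsQ: "tail (Gam m r w) e \<in> verts (Gam m r w) \<and> head (Gam m r w) e \<in> verts (Gam m r w)"
    if "e \<in> arcs (Gam m r w)" for e using that by auto
  obtain P where P: "P \<in> rep_space (Gam m r w) d" "rep_iso (Gam m r w) X (matrix_rep d P)"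
    using fd_rep_iso_matrix_rep[OF arcsQ X(1,2)] by blast
  have st: "stable_rep (Gam m r w) (theta m w) (matrix_rep d P)"
    by (rule stable_rep_iso[OF arcsQ X(1) P(2) X(3)])
  show ?thesis
    by (rule stable_point.conditions[OF stable_point.intro[OF m weights P(1) bal pos st]])
qed

section \<open>Coproducts of algebras and their modules\<close>

definition word :: "'x list \<Rightarrow> 'x list \<Rightarrow> 'k::field" where
  "word u = (\<lambda>xs. if xs = u then 1 else 0)"

definition support :: "('x list \<Rightarrow> 'k::field) \<Rightarrow> 'x list set" where
  "support f = {xs. f xs \<noteq> 0}"

lemma word_singleton: "word [x] = free_gen x"
  by (simp add: word_def free_gen_def)

context
  fixes X :: "'x set"
begin

abbreviation "FA \<equiv> (free_algebra X :: ('k::field, 'x list \<Rightarrow> 'k) module)"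

lemma FA_simps:
  "f \<in> carrier FA \<longleftrightarrow> finite (support f) \<and> support f \<subseteq> lists X"
  "(f \<oplus>\<^bsub>FA\<^esub> g) xs = f xs + g xs"
  "(c \<odot>\<^bsub>FA\<^esub> f) xs = c * f xs"
  "\<zero>\<^bsub>FA\<^esub> xs = 0"
  "(f \<otimes>\<^bsub>FA\<^esub> g) xs = (\<Sum>k\<le>length xs. f (take k xs) * g (drop k xs))"
  "\<one>\<^bsub>FA\<^esub> = word []"
  by (simp_all add: free_algebra_def support_def word_def)

lemma word_closed:
  assumes u: "u \<in> lists X"
  shows "(word u :: 'x list \<Rightarrow> 'k::field) \<in> carrier FA"
proof -
  have "support (word u :: 'x list \<Rightarrow> 'k) = {u}" by (auto simp: support_def word_def)
  then show ?thesis using u by (simp add: FA_simps(1))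
qed

lemma free_gen_closed: "x \<in> X \<Longrightarrow> free_gen x \<in> carrier FA"
  using word_closed[of "[x]"] by (simp add: word_singleton)

lemma FA_smult_closed: "f \<in> carrier FA \<Longrightarrow> c \<odot>\<^bsub>FA\<^esub> f \<in> carrier FA"
proof -
  assume f: "f \<in> carrier FA"
  have "support (c \<odot>\<^bsub>FA\<^esub> f) \<subseteq> support f" by (auto simp: support_def FA_simps(3))
  then show "c \<odot>\<^bsub>FA\<^esub> f \<in> carrier FA" using f finite_subset unfolding FA_simps(1) by blast
qed

lemma FA_smult_mult:
  "(c \<odot>\<^bsub>FA\<^esub> f) \<otimes>\<^bsub>FA\<^esub> g = c \<odot>\<^bsub>FA\<^esub> (f \<otimes>\<^bsub>FA\<^esub> g)"
  "f \<otimes>\<^bsub>FA\<^esub> (c \<odot>\<^bsub>FA\<^esub> g) = c \<odot>\<^bsub>FA\<^esub> (f \<otimes>\<^bsub>FA\<^esub> g)"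
  by (rule ext, simp add: FA_simps sum_distrib_left mult.assoc)
    (rule ext, simp add: FA_simps sum_distrib_left mult.left_commute)

lemma FA_smult_simps:
  "(c + c') \<odot>\<^bsub>FA\<^esub> f = c \<odot>\<^bsub>FA\<^esub> f \<oplus>\<^bsub>FA\<^esub> c' \<odot>\<^bsub>FA\<^esub> f"
  "(c * c') \<odot>\<^bsub>FA\<^esub> f = c \<odot>\<^bsub>FA\<^esub> (c' \<odot>\<^bsub>FA\<^esub> f)"
  "1 \<odot>\<^bsub>FA\<^esub> f = f"
  by (rule ext, simp add: FA_simps algebra_simps)+

lemma free_gen_mult:
  "(free_gen x \<otimes>\<^bsub>FA\<^esub> h) ys = (case ys of [] \<Rightarrow> 0 | y # zs \<Rightarrow> if y = x then h zs else 0)"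
proof (cases ys)
  case Nil
  then show ?thesis by (simp add: FA_simps free_gen_def)
next
  case (Cons y zs)
  have "(free_gen x \<otimes>\<^bsub>FA\<^esub> h) ys
      = (\<Sum>k\<le>length ys. if k = 1 then (if y = x then h zs else 0) else 0)"
    unfolding FA_simps(5)
  proof (rule sum.cong[OF refl])
    fix k assume k: "k \<in> {..length ys}"
    have "take k ys = [x] \<longleftrightarrow> k = 1 \<and> y = x"
    proof
      assume t: "take k ys = [x]"
      have "length (take k ys) = k" using k by simp
      then have "k = 1" using t by simp
      then show "k = 1 \<and> y = x" using t Cons by simp
    qed (use Cons in simp)
    then show "free_gen x (take k ys) * h (drop k ys) = (if k = 1 then (if y = x then h zs else 0) else 0)"
      using Cons by (auto simp: free_gen_def)
  qed
  also have "\<dots> = (if y = x then h zs else 0)" by (subst sum.delta) (use Cons in auto)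
  finally show ?thesis using Cons by simp
qed

lemma word_Cons: "word (x # u) = free_gen x \<otimes>\<^bsub>FA\<^esub> (word u :: 'x list \<Rightarrow> 'k::field)"
  by (rule ext, subst free_gen_mult) (auto simp: word_def split: list.splits)

text \<open>Every element is a linear combination of words; induction on the support.\<close>

lemma FA_induct [consumes 1, case_names zero add]:
  fixes f :: "'x list \<Rightarrow> 'k::field"
  assumes f: "f \<in> carrier FA" and zero: "P \<zero>\<^bsub>FA\<^esub>"
    and add: "\<And>c u f. u \<in> lists X \<Longrightarrow> f \<in> carrier FA \<Longrightarrow> P f \<Longrightarrow> P (c \<odot>\<^bsub>FA\<^esub> word u \<oplus>\<^bsub>FA\<^esub> f)"
  shows "P f"
  using f
proof (induction "card (support f)" arbitrary: f rule: less_induct)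
  case less
  have fin: "finite (support f)" "support f \<subseteq> lists X" using less.prems by (simp_all add: FA_simps(1))
  show ?case
  proof (cases "support f = {}")
    case True
    then have "f = \<zero>\<^bsub>FA\<^esub>" by (auto simp: support_def free_algebra_def)
    then show ?thesis using zero by simp
  next
    case False
    then obtain u where u: "u \<in> support f" by blast
    let ?g = "f(u := 0)"
    have sg: "support ?g = support f - {u}" by (auto simp: support_def)
    then have "?g \<in> carrier FA" using fin by (auto simp: FA_simps(1))
    moreover have "card (support ?g) < card (support f)"
      unfolding sg using fin(1) u by (intro psubset_card_mono) auto
    ultimately have "P (f u \<odot>\<^bsub>FA\<^esub> word u \<oplus>\<^bsub>FA\<^esub> ?g)"
      using less.hyps[of ?g] u fin(2) by (intro add) auto
    moreover have "f u \<odot>\<^bsub>FA\<^esub> word u \<oplus>\<^bsub>FA\<^esub> ?g = f"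
      by (rule ext) (simp add: FA_simps word_def)
    ultimately show ?thesis by simp
  qed
qed

end

lemma quotient_algebra_simps [simp]:
  "carrier (quotient_algebra R J) = carrier (R Quot J)"
  "monoid.mult (quotient_algebra R J) = monoid.mult (R Quot J)"
  "one (quotient_algebra R J) = one (R Quot J)"
  "zero (quotient_algebra R J) = zero (R Quot J)"
  "add (quotient_algebra R J) = add (R Quot J)"
  "module.smult (quotient_algebra R J) c C = (\<Union>x\<in>C. J +>\<^bsub>R\<^esub> (c \<odot>\<^bsub>R\<^esub> x))"
  by (simp_all add: quotient_algebra_def)

lemma ring_quotient_algebra:
  assumes "ring (R Quot J)"
  shows "ring (quotient_algebra R J)"
proof -
  interpret Q: ring "R Quot J" by fact
  show ?thesis
  proof (rule ringI)
    show "abelian_group (quotient_algebra R J)"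
      by (rule abelian_groupI)
        (simp_all add: Q.a_assoc Q.a_comm Q.a_lcomm Q.add.l_inv_ex)
    show "Group.monoid (quotient_algebra R J)"
      by (rule monoidI) (auto simp: Q.m_assoc)
  qed (simp_all add: Q.l_distr Q.r_distr)
qed

locale coproduct_data =
  fixes I :: "'i set" and B :: "'i \<Rightarrow> ('k::field, 'a) module"
  assumes B_closed: "\<And>i a b. i \<in> I \<Longrightarrow> a \<in> carrier (B i) \<Longrightarrow> b \<in> carrier (B i) \<Longrightarrow> a \<oplus>\<^bsub>B i\<^esub> b \<in> carrier (B i)"
    "\<And>i c a. i \<in> I \<Longrightarrow> a \<in> carrier (B i) \<Longrightarrow> c \<odot>\<^bsub>B i\<^esub> a \<in> carrier (B i)"
    "\<And>i a b. i \<in> I \<Longrightarrow> a \<in> carrier (B i) \<Longrightarrow> b \<in> carrier (B i) \<Longrightarrow> a \<otimes>\<^bsub>B i\<^esub> b \<in> carrier (B i)"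
    "\<And>i. i \<in> I \<Longrightarrow> \<one>\<^bsub>B i\<^esub> \<in> carrier (B i)"
begin

abbreviation "X \<equiv> coproduct_gens I B"
abbreviation "R \<equiv> (free_algebra X :: ('k, ('i \<times> 'a) list \<Rightarrow> 'k) module)"
abbreviation "J \<equiv> coproduct_ideal I B"
abbreviation "A \<equiv> coproduct_algebra I B"
abbreviation "cls x \<equiv> J +>\<^bsub>R\<^esub> x"
abbreviation "emb \<equiv> coproduct_inj I B"

sublocale R: ring R by (rule ring_free_algebra)

lemma gen: "i \<in> I \<Longrightarrow> a \<in> carrier (B i) \<Longrightarrow> free_gen (i, a) \<in> carrier R"
  by (rule free_gen_closed) (simp add: coproduct_gens_def)

lemma rels_closed: "coproduct_rels I B \<subseteq> carrier R"
  unfolding coproduct_rels_def Let_def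
  by (auto intro!: R.minus_closed R.add.m_closed R.m_closed gen B_closed FA_smult_closed)

sublocale J: ideal J R
  unfolding coproduct_ideal_def by (rule R.genideal_ideal[OF rels_closed])

lemma rels_J: "coproduct_rels I B \<subseteq> J"
  unfolding coproduct_ideal_def by (rule R.genideal_self[OF rels_closed])

sublocale A: ring A
  unfolding coproduct_algebra_def by (rule ring_quotient_algebra[OF J.quotient_is_ring])

lemma A_carrier: "C \<in> carrier A \<longleftrightarrow> (\<exists>x\<in>carrier R. C = cls x)"
  by (auto simp: coproduct_algebra_def FactRing_def A_RCOSETS_def')

lemma cls_closed [simp]: "x \<in> carrier R \<Longrightarrow> cls x \<in> carrier A"
  using A_carrier by blast

lemma cls_hom:
  "x \<in> carrier R \<Longrightarrow> y \<in> carrier R \<Longrightarrow> cls (x \<oplus>\<^bsub>R\<^esub> y) = cls x \<oplus>\<^bsub>A\<^esub> cls y"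
  "x \<in> carrier R \<Longrightarrow> y \<in> carrier R \<Longrightarrow> cls (x \<otimes>\<^bsub>R\<^esub> y) = cls x \<otimes>\<^bsub>A\<^esub> cls y"
  "cls \<one>\<^bsub>R\<^esub> = \<one>\<^bsub>A\<^esub>"
  using ring_hom_add[OF J.rcos_ring_hom] ring_hom_mult[OF J.rcos_ring_hom] ring_hom_one[OF J.rcos_ring_hom]
  by (simp_all add: coproduct_algebra_def)

lemma cls_eq: "x \<in> carrier R \<Longrightarrow> y \<in> carrier R \<Longrightarrow> x \<ominus>\<^bsub>R\<^esub> y \<in> J \<Longrightarrow> cls x = cls y"
  using R.quotient_eq_iff_same_a_r_cos[OF J.ideal_axioms] by blast

lemma cls_zero: "cls \<zero>\<^bsub>R\<^esub> = \<zero>\<^bsub>A\<^esub>"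
proof -
  have "cls \<zero>\<^bsub>R\<^esub> \<oplus>\<^bsub>A\<^esub> cls \<zero>\<^bsub>R\<^esub> = cls \<zero>\<^bsub>R\<^esub>" by (simp flip: cls_hom(1))
  then show ?thesis using A.add.l_cancel_one[of "cls \<zero>\<^bsub>R\<^esub>" "cls \<zero>\<^bsub>R\<^esub>"] by simp
qed

lemma smult_J: "z \<in> J \<Longrightarrow> c \<odot>\<^bsub>R\<^esub> z \<in> J"
proof -
  assume z: "z \<in> J"
  have zR: "z \<in> carrier R" using z J.a_subset by blast
  have "(c \<odot>\<^bsub>R\<^esub> \<one>\<^bsub>R\<^esub>) \<otimes>\<^bsub>R\<^esub> z = c \<odot>\<^bsub>R\<^esub> z" using zR by (simp add: FA_smult_mult)
  moreover have "(c \<odot>\<^bsub>R\<^esub> \<one>\<^bsub>R\<^esub>) \<otimes>\<^bsub>R\<^esub> z \<in> J"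
    by (rule J.I_l_closed[OF z]) (rule FA_smult_closed, simp)
  ultimately show ?thesis by simp
qed

text \<open>Scalar multiplication in \<open>quotient_algebra\<close> is a union over a coset. It is
  well defined because the ideal is closed under scalars: they act as multiples of \<open>1\<close>.\<close>

lemma cls_smult: "x \<in> carrier R \<Longrightarrow> c \<odot>\<^bsub>A\<^esub> cls x = cls (c \<odot>\<^bsub>R\<^esub> x)"
proof -
  assume x: "x \<in> carrier R"
  have "cls (c \<odot>\<^bsub>R\<^esub> z) = cls (c \<odot>\<^bsub>R\<^esub> x)" if z: "z \<in> cls x" for z
  proof -
    obtain j where j: "j \<in> J" "z = j \<oplus>\<^bsub>R\<^esub> x" using z unfolding a_r_coset_def' by blast
    have jR: "j \<in> carrier R" using j(1) J.a_subset by blast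
    have "c \<odot>\<^bsub>R\<^esub> z = c \<odot>\<^bsub>R\<^esub> j \<oplus>\<^bsub>R\<^esub> c \<odot>\<^bsub>R\<^esub> x"
      unfolding j(2) by (rule ext) (simp add: FA_simps distrib_left)
    moreover have "c \<odot>\<^bsub>R\<^esub> j \<in> carrier R" "c \<odot>\<^bsub>R\<^esub> x \<in> carrier R" using jR x FA_smult_closed by blast+
    ultimately have "c \<odot>\<^bsub>R\<^esub> z \<ominus>\<^bsub>R\<^esub> c \<odot>\<^bsub>R\<^esub> x = c \<odot>\<^bsub>R\<^esub> j"
      by (simp add: R.minus_eq R.a_assoc R.r_neg)
    then show ?thesis using smult_J[OF j(1)] jR x j(2)
      by (intro cls_eq FA_smult_closed) auto
  qed
  moreover have "cls x \<noteq> {}" using J.a_rcos_self[OF x] by blast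
  ultimately show ?thesis by (auto simp: coproduct_algebra_def)
qed

lemma emb_closed: "i \<in> I \<Longrightarrow> a \<in> carrier (B i) \<Longrightarrow> emb i a \<in> carrier A"
  unfolding coproduct_inj_def by (rule cls_closed[OF gen])

lemma emb_hom:
  assumes i: "i \<in> I"
  shows "a \<in> carrier (B i) \<Longrightarrow> b \<in> carrier (B i) \<Longrightarrow> emb i (a \<oplus>\<^bsub>B i\<^esub> b) = emb i a \<oplus>\<^bsub>A\<^esub> emb i b"
    "a \<in> carrier (B i) \<Longrightarrow> b \<in> carrier (B i) \<Longrightarrow> emb i (a \<otimes>\<^bsub>B i\<^esub> b) = emb i a \<otimes>\<^bsub>A\<^esub> emb i b"
    "a \<in> carrier (B i) \<Longrightarrow> emb i (c \<odot>\<^bsub>B i\<^esub> a) = c \<odot>\<^bsub>A\<^esub> emb i a"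
    "emb i \<one>\<^bsub>B i\<^esub> = \<one>\<^bsub>A\<^esub>"
proof -
  note rel = subsetD[OF rels_J[unfolded coproduct_rels_def Let_def]]
  show "emb i (a \<oplus>\<^bsub>B i\<^esub> b) = emb i a \<oplus>\<^bsub>A\<^esub> emb i b" if "a \<in> carrier (B i)" "b \<in> carrier (B i)"
    unfolding coproduct_inj_def cls_hom(1)[OF gen[OF i that(1)] gen[OF i that(2)], symmetric]
    using i that by (intro cls_eq rel gen R.add.m_closed B_closed) blast+
  show "emb i (a \<otimes>\<^bsub>B i\<^esub> b) = emb i a \<otimes>\<^bsub>A\<^esub> emb i b" if "a \<in> carrier (B i)" "b \<in> carrier (B i)"
    unfolding coproduct_inj_def cls_hom(2)[OF gen[OF i that(1)] gen[OF i that(2)], symmetric]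
    using i that by (intro cls_eq rel gen R.m_closed B_closed) blast+
  show "emb i (c \<odot>\<^bsub>B i\<^esub> a) = c \<odot>\<^bsub>A\<^esub> emb i a" if "a \<in> carrier (B i)"
    unfolding coproduct_inj_def cls_smult[OF gen[OF i that]]
    using i that by (intro cls_eq rel gen FA_smult_closed B_closed) blast+
  show "emb i \<one>\<^bsub>B i\<^esub> = \<one>\<^bsub>A\<^esub>"
    unfolding coproduct_inj_def cls_hom(3)[symmetric]
    using i by (intro cls_eq rel gen R.one_closed B_closed) blast+
qed

definition "scalar c = c \<odot>\<^bsub>A\<^esub> \<one>\<^bsub>A\<^esub>"

lemma scalar_cls: "scalar c = cls (c \<odot>\<^bsub>R\<^esub> \<one>\<^bsub>R\<^esub>)"
  unfolding scalar_def cls_hom(3)[symmetric] by (rule cls_smult) simp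

lemma scalar:
  "scalar c \<in> carrier A"
  "scalar (c + c') = scalar c \<oplus>\<^bsub>A\<^esub> scalar c'"
  "scalar (c * c') = scalar c \<otimes>\<^bsub>A\<^esub> scalar c'"
  "scalar 1 = \<one>\<^bsub>A\<^esub>"
  "C \<in> carrier A \<Longrightarrow> scalar c \<otimes>\<^bsub>A\<^esub> C = c \<odot>\<^bsub>A\<^esub> C"
  "C \<in> carrier A \<Longrightarrow> C \<otimes>\<^bsub>A\<^esub> scalar c = c \<odot>\<^bsub>A\<^esub> C"
proof -
  have c1: "c \<odot>\<^bsub>R\<^esub> \<one>\<^bsub>R\<^esub> \<in> carrier R" for c by (rule FA_smult_closed) simp
  show "scalar c \<in> carrier A" unfolding scalar_cls using c1 by simp
  show "scalar (c + c') = scalar c \<oplus>\<^bsub>A\<^esub> scalar c'"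
    unfolding scalar_cls FA_smult_simps by (rule cls_hom(1)[OF c1 c1])
  have "(c * c') \<odot>\<^bsub>R\<^esub> \<one>\<^bsub>R\<^esub> = (c \<odot>\<^bsub>R\<^esub> \<one>\<^bsub>R\<^esub>) \<otimes>\<^bsub>R\<^esub> (c' \<odot>\<^bsub>R\<^esub> \<one>\<^bsub>R\<^esub>)"
    unfolding FA_smult_mult(1) R.l_one[OF c1] FA_smult_simps(2) ..
  then show "scalar (c * c') = scalar c \<otimes>\<^bsub>A\<^esub> scalar c'"
    unfolding scalar_cls using cls_hom(2)[OF c1 c1] by simp
  show "scalar 1 = \<one>\<^bsub>A\<^esub>" unfolding scalar_cls FA_smult_simps(3) by (rule cls_hom(3))
  assume "C \<in> carrier A"
  then obtain x where x: "x \<in> carrier R" "C = cls x" unfolding A_carrier by blast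
  show "scalar c \<otimes>\<^bsub>A\<^esub> C = c \<odot>\<^bsub>A\<^esub> C"
    unfolding scalar_cls x(2) cls_hom(2)[OF c1 x(1), symmetric] cls_smult[OF x(1)]
    using x(1) by (simp add: FA_smult_mult)
  show "C \<otimes>\<^bsub>A\<^esub> scalar c = c \<odot>\<^bsub>A\<^esub> C"
    unfolding scalar_cls x(2) cls_hom(2)[OF x(1) c1, symmetric] cls_smult[OF x(1)]
    using x(1) by (simp add: FA_smult_mult)
qed

text \<open>The coproduct is spanned by products of images of elements of the factors.\<close>

lemma coproduct_induct [consumes 1, case_names zero add]:
  assumes C: "C \<in> carrier A" and zero: "P \<zero>\<^bsub>A\<^esub>"
    and add: "\<And>c u D. u \<in> lists X \<Longrightarrow> D \<in> carrier A \<Longrightarrow> P D \<Longrightarrow>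
      P (scalar c \<otimes>\<^bsub>A\<^esub> foldr (\<lambda>(i, a) E. emb i a \<otimes>\<^bsub>A\<^esub> E) u \<one>\<^bsub>A\<^esub> \<oplus>\<^bsub>A\<^esub> D)"
  shows "P C"
proof -
  obtain x where x: "x \<in> carrier R" "C = cls x" using C unfolding A_carrier by blast
  have w: "cls (word u) = foldr (\<lambda>(i, a) E. emb i a \<otimes>\<^bsub>A\<^esub> E) u \<one>\<^bsub>A\<^esub>" if "u \<in> lists X" for u
    using that
  proof (induction u)
    case Nil
    then show ?case using cls_hom(3) by (simp add: FA_simps(6))
  next
    case (Cons p u)
    obtain i a where p: "p = (i, a)" "i \<in> I" "a \<in> carrier (B i)" using Cons(1) by (cases p) (auto simp: coproduct_gens_def)
    have "cls (word (p # u)) = cls (free_gen p) \<otimes>\<^bsub>A\<^esub> cls (word u)"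
      unfolding word_Cons[where X = X] using Cons by (intro cls_hom(2) free_gen_closed word_closed)
    then show ?case using Cons p by (simp add: coproduct_inj_def)
  qed
  have "P (cls x)" using x(1)
  proof (induction x rule: FA_induct)
    case zero
    then show ?case using assms(2) by (simp add: cls_zero)
  next
    case (add c u f)
    have "cls (c \<odot>\<^bsub>R\<^esub> word u) = scalar c \<otimes>\<^bsub>A\<^esub> cls (word u)"
      unfolding scalar(5)[OF cls_closed[OF word_closed[OF add(1)]]] cls_smult[OF word_closed[OF add(1)]] ..
    moreover have "cls (c \<odot>\<^bsub>R\<^esub> word u \<oplus>\<^bsub>R\<^esub> f) = cls (c \<odot>\<^bsub>R\<^esub> word u) \<oplus>\<^bsub>A\<^esub> cls f"
      by (rule cls_hom(1)[OF FA_smult_closed[OF word_closed[OF add(1)]] add(2)])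
    ultimately show ?case using assms(3)[OF add(1) cls_closed[OF add(2)] add(3), of c] w[OF add(1)] by simp
  qed
  then show ?thesis using x(2) by simp
qed

end

lemma underlying_vs_simps [simp]:
  "carrier (underlying_vs A M) = carrier M"
  "add (underlying_vs A M) = add M"
  "zero (underlying_vs A M) = zero M"
  by (simp_all add: underlying_vs_def)

lemma underlying_vs_smult: "module.smult (underlying_vs A M) c x = (c \<odot>\<^bsub>A\<^esub> \<one>\<^bsub>A\<^esub>) \<odot>\<^bsub>M\<^esub> x"
  by (simp add: underlying_vs_def)

locale coproduct_module = coproduct_data I B for I :: "'i set" and B :: "'i \<Rightarrow> ('k::field, 'a) module" +
  fixes M :: "((('i \<times> 'a) list \<Rightarrow> 'k) set, 'v) module"
  assumes M: "left_module (coproduct_algebra I B) M"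
begin

sublocale M: left_module A M by (rule M)

abbreviation "V \<equiv> underlying_vs A M"
abbreviation "act i a x \<equiv> emb i a \<odot>\<^bsub>M\<^esub> x"

lemma smult_V: "module.smult V c x = scalar c \<odot>\<^bsub>M\<^esub> x"
  by (simp add: scalar_def underlying_vs_smult)

lemma kvs_V: "kvs V"
proof (rule vs_criteria[OF field_class_ring])
  show "\<forall>v\<in>carrier V. \<exists>neg_v\<in>carrier V. v \<oplus>\<^bsub>V\<^esub> neg_v = \<zero>\<^bsub>V\<^esub>"
  proof
    fix v assume "v \<in> carrier V"
    then show "\<exists>neg_v\<in>carrier V. v \<oplus>\<^bsub>V\<^esub> neg_v = \<zero>\<^bsub>V\<^esub>"
      using M.M.r_neg M.M.a_inv_closed by auto
  qed
qed (simp_all add: smult_V scalar(1-4) M.lsmult_closed M.lsmult_l_distr M.lsmult_r_distr M.lsmult_assoc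
    M.lsmult_one M.M.a_ac)

lemma act_closed: "i \<in> I \<Longrightarrow> a \<in> carrier (B i) \<Longrightarrow> x \<in> carrier M \<Longrightarrow> act i a x \<in> carrier M"
  by (rule M.lsmult_closed[OF emb_closed])

lemma scalar_act: "C \<in> carrier A \<Longrightarrow> x \<in> carrier M \<Longrightarrow> C \<odot>\<^bsub>M\<^esub> (scalar c \<odot>\<^bsub>M\<^esub> x) = scalar c \<odot>\<^bsub>M\<^esub> (C \<odot>\<^bsub>M\<^esub> x)"
  using M.lsmult_assoc[of C "scalar c" x] M.lsmult_assoc[of "scalar c" C x] scalar(1)[of c] scalar(5,6)[of C c] by simp

lemma act_klin: "C \<in> carrier A \<Longrightarrow> klin V V (\<lambda>x. C \<odot>\<^bsub>M\<^esub> x)"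
  by (rule klinI[OF kvs_V kvs_V])
    (simp_all only: smult_V underlying_vs_simps(1,2) M.lsmult_closed M.lsmult_r_distr scalar_act)

lemma act_hom:
  assumes i: "i \<in> I" and a: "a \<in> carrier (B i)" and x: "x \<in> carrier M"
  shows "b \<in> carrier (B i) \<Longrightarrow> act i (a \<oplus>\<^bsub>B i\<^esub> b) x = act i a x \<oplus>\<^bsub>M\<^esub> act i b x"
    "b \<in> carrier (B i) \<Longrightarrow> act i (a \<otimes>\<^bsub>B i\<^esub> b) x = act i a (act i b x)"
    "act i (c \<odot>\<^bsub>B i\<^esub> a) x = c \<odot>\<^bsub>V\<^esub> act i a x"
    "act i \<one>\<^bsub>B i\<^esub> x = x"
proof -
  show "act i (a \<oplus>\<^bsub>B i\<^esub> b) x = act i a x \<oplus>\<^bsub>M\<^esub> act i b x" if "b \<in> carrier (B i)"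
    by (simp add: emb_hom(1)[OF i a that] M.lsmult_l_distr emb_closed i a x that)
  show "act i (a \<otimes>\<^bsub>B i\<^esub> b) x = act i a (act i b x)" if "b \<in> carrier (B i)"
    by (simp add: emb_hom(2)[OF i a that] M.lsmult_assoc emb_closed i a x that)
  show "act i (c \<odot>\<^bsub>B i\<^esub> a) x = c \<odot>\<^bsub>V\<^esub> act i a x"
    by (simp add: smult_V emb_hom(3)[OF i a] scalar(5)[symmetric] M.lsmult_assoc emb_closed i a x scalar(1))
  show "act i \<one>\<^bsub>B i\<^esub> x = x" by (simp add: emb_hom(4)[OF i] M.lsmult_one x)
qed

lemma invariant_subspace:
  assumes N: "ksub N V" and inv: "\<And>i a x. i \<in> I \<Longrightarrow> a \<in> carrier (B i) \<Longrightarrow> x \<in> N \<Longrightarrow> act i a x \<in> N"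
    and C: "C \<in> carrier A" and x: "x \<in> N"
  shows "C \<odot>\<^bsub>M\<^esub> x \<in> N"
  using C
proof (induction C rule: coproduct_induct)
  note NM = subsetD[OF ksubD(2)[OF N], unfolded underlying_vs_simps]
  case zero
  have "\<zero>\<^bsub>A\<^esub> \<odot>\<^bsub>M\<^esub> x \<oplus>\<^bsub>M\<^esub> \<zero>\<^bsub>A\<^esub> \<odot>\<^bsub>M\<^esub> x = \<zero>\<^bsub>A\<^esub> \<odot>\<^bsub>M\<^esub> x"
    using M.lsmult_l_distr[of "\<zero>\<^bsub>A\<^esub>" "\<zero>\<^bsub>A\<^esub>" x] NM[OF x] by simp
  moreover have "\<zero>\<^bsub>A\<^esub> \<odot>\<^bsub>M\<^esub> x \<in> carrier M" using NM[OF x] by (intro M.lsmult_closed) auto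
  ultimately have "\<zero>\<^bsub>A\<^esub> \<odot>\<^bsub>M\<^esub> x = \<zero>\<^bsub>M\<^esub>" using M.M.add.l_cancel_one by blast
  then show ?case using ksubD(3)[OF N] by simp
next
  note NM = subsetD[OF ksubD(2)[OF N], unfolded underlying_vs_simps]
  case (add c u D)
  let ?f = "\<lambda>u. foldr (\<lambda>(i, a) E. emb i a \<otimes>\<^bsub>A\<^esub> E) u \<one>\<^bsub>A\<^esub>"
  have w: "?f u \<in> carrier A \<and> ?f u \<odot>\<^bsub>M\<^esub> x \<in> N" if "u \<in> lists X" for u
    using that
  proof (induction u)
    case Nil
    then show ?case using x M.lsmult_one[OF NM[OF x]] by simp
  next
    case (Cons p u)
    obtain i a where p: "p = (i, a)" "i \<in> I" "a \<in> carrier (B i)" using Cons(1) by (cases p) (auto simp: coproduct_gens_def)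
    then show ?case using Cons inv[OF p(2,3)] emb_closed[OF p(2,3)]
      by (simp add: M.lsmult_assoc NM[OF x])
  qed
  have "(scalar c \<otimes>\<^bsub>A\<^esub> ?f u \<oplus>\<^bsub>A\<^esub> D) \<odot>\<^bsub>M\<^esub> x = c \<odot>\<^bsub>V\<^esub> (?f u \<odot>\<^bsub>M\<^esub> x) \<oplus>\<^bsub>M\<^esub> D \<odot>\<^bsub>M\<^esub> x"
    using w[OF add(1)] add(2) scalar(1)[of c] NM[OF x]
    by (simp add: smult_V M.lsmult_l_distr M.lsmult_assoc)
  moreover have "c \<odot>\<^bsub>V\<^esub> (?f u \<odot>\<^bsub>M\<^esub> x) \<in> N" by (rule ksubD(5)[OF N]) (use w[OF add(1)] in simp)
  ultimately show ?case using ksubD(4)[OF N _ add(3)] by simp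
qed

text \<open>Since the factors generate the coproduct, it suffices to test the action of their elements.\<close>

lemma submodule_iff:
  "Module.submodule N A M \<longleftrightarrow> ksub N V \<and> (\<forall>i\<in>I. \<forall>a\<in>carrier (B i). \<forall>x\<in>N. act i a x \<in> N)"
proof
  assume N: "Module.submodule N A M"
  have sub: "N \<subseteq> carrier M" using subgroup.subset[OF Module.submodule.axioms(1)[OF N]] by simp
  show "ksub N V \<and> (\<forall>i\<in>I. \<forall>a\<in>carrier (B i). \<forall>x\<in>N. act i a x \<in> N)"
  proof (intro conjI ballI)
    show "ksub N V"
    proof (rule ksubI[OF kvs_V])
      show "\<zero>\<^bsub>V\<^esub> \<in> N" using subgroup.one_closed[OF Module.submodule.axioms(1)[OF N]] by simp
      show "x \<oplus>\<^bsub>V\<^esub> y \<in> N" if "x \<in> N" "y \<in> N" for x y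
        using subgroup.m_closed[OF Module.submodule.axioms(1)[OF N] that] by simp
      show "c \<odot>\<^bsub>V\<^esub> x \<in> N" if "x \<in> N" for c x
        unfolding smult_V by (rule Module.submodule.smult_closed[OF N scalar(1) that])
    qed (use sub in simp)
    show "act i a x \<in> N" if "i \<in> I" "a \<in> carrier (B i)" "x \<in> N" for i a x
      by (rule Module.submodule.smult_closed[OF N emb_closed[OF that(1,2)] that(3)])
  qed
next
  assume N: "ksub N V \<and> (\<forall>i\<in>I. \<forall>a\<in>carrier (B i). \<forall>x\<in>N. act i a x \<in> N)"
  then have K: "ksub N V" by blast
  note NM = ksubD(2)[OF K, unfolded underlying_vs_simps]
  show "Module.submodule N A M"
  proof (rule Module.submodule.intro)
    show "subgroup N (add_monoid M)"
    proof (rule M.M.add.subgroupI)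
      show "N \<subseteq> carrier M" by (rule NM)
      show "N \<noteq> {}" using ksubD(3)[OF K] by blast
      show "x \<oplus>\<^bsub>M\<^esub> y \<in> N" if "x \<in> N" "y \<in> N" for x y using ksubD(4)[OF K that] by simp
      show "\<ominus>\<^bsub>M\<^esub> x \<in> N" if x: "x \<in> N" for x
      proof -
        have xM: "x \<in> carrier M" using x NM by blast
        have y: "(-1) \<odot>\<^bsub>V\<^esub> x \<in> N" by (rule ksubD(5)[OF K x])
        have "x \<oplus>\<^bsub>V\<^esub> (-1) \<odot>\<^bsub>V\<^esub> x = \<zero>\<^bsub>V\<^esub>" using kvs_diff_zero[OF kvs_V, of x x] xM by simp
        then have "(-1) \<odot>\<^bsub>V\<^esub> x = \<ominus>\<^bsub>M\<^esub> x"
          using xM y NM M.M.minus_equality[of "(-1) \<odot>\<^bsub>V\<^esub> x" x] M.M.a_comm[of x "(-1) \<odot>\<^bsub>V\<^esub> x"]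
          by (simp add: subset_iff)
        then show ?thesis using y by simp
      qed
    qed
    show "Module.submodule_axioms N A M"
      unfolding Module.submodule_axioms_def using invariant_subspace[OF K] N by blast
  qed
qed

end

section \<open>Modules from compatible actions of the factors\<close>

lemma (in ring) ideal_criterion:
  assumes sub: "K \<subseteq> carrier R" and zero: "\<zero> \<in> K"
    and add: "\<And>x y. x \<in> K \<Longrightarrow> y \<in> K \<Longrightarrow> x \<oplus> y \<in> K"
    and l: "\<And>x y. x \<in> carrier R \<Longrightarrow> y \<in> K \<Longrightarrow> x \<otimes> y \<in> K"
    and r: "\<And>x y. x \<in> carrier R \<Longrightarrow> y \<in> K \<Longrightarrow> y \<otimes> x \<in> K"
  shows "ideal K R"
proof (rule idealI[OF ring_axioms])
  show "subgroup K (add_monoid R)"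
  proof (rule add.subgroupI[OF sub])
    show "K \<noteq> {}" using zero by blast
    show "\<ominus> x \<in> K" if x: "x \<in> K" for x
    proof -
      have xR: "x \<in> carrier R" using x sub by blast
      then have "\<ominus> x = (\<ominus> \<one>) \<otimes> x" by (simp add: l_minus)
      then show ?thesis using l[OF _ x, of "\<ominus> \<one>"] by simp
    qed
  qed (rule add)
qed (use l r in auto)

text \<open>Unital representations of all the factors on one space \<open>V\<close>. By the universal property they
  extend to the coproduct: the free algebra acts on \<open>V\<close> through words, and the relations act as zero.\<close>

locale coproduct_action = coproduct_data I B for I :: "'i set" and B :: "'i \<Rightarrow> ('k::field, 'a) module" +
  fixes V :: "('k, 'v) module" and \<rho> :: "'i \<Rightarrow> 'a \<Rightarrow> 'v \<Rightarrow> 'v"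
  assumes kvs_V: "kvs V"
    and \<rho>_klin: "\<And>i a. i \<in> I \<Longrightarrow> a \<in> carrier (B i) \<Longrightarrow> klin V V (\<rho> i a)"
    and \<rho>_add: "\<And>i a b x. i \<in> I \<Longrightarrow> a \<in> carrier (B i) \<Longrightarrow> b \<in> carrier (B i) \<Longrightarrow> x \<in> carrier V \<Longrightarrow>
      \<rho> i (a \<oplus>\<^bsub>B i\<^esub> b) x = \<rho> i a x \<oplus>\<^bsub>V\<^esub> \<rho> i b x"
    and \<rho>_smult: "\<And>i a c x. i \<in> I \<Longrightarrow> a \<in> carrier (B i) \<Longrightarrow> x \<in> carrier V \<Longrightarrow>
      \<rho> i (c \<odot>\<^bsub>B i\<^esub> a) x = c \<odot>\<^bsub>V\<^esub> \<rho> i a x"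
    and \<rho>_mult: "\<And>i a b x. i \<in> I \<Longrightarrow> a \<in> carrier (B i) \<Longrightarrow> b \<in> carrier (B i) \<Longrightarrow> x \<in> carrier V \<Longrightarrow>
      \<rho> i (a \<otimes>\<^bsub>B i\<^esub> b) x = \<rho> i a (\<rho> i b x)"
    and \<rho>_one: "\<And>i x. i \<in> I \<Longrightarrow> x \<in> carrier V \<Longrightarrow> \<rho> i \<one>\<^bsub>B i\<^esub> x = x"
begin

sublocale V: abelian_group V by (rule kvs_abelian_group[OF kvs_V])

definition word_act :: "('i \<times> 'a) list \<Rightarrow> 'v \<Rightarrow> 'v" where
  "word_act u x = foldr (\<lambda>(i, a). \<rho> i a) u x"

lemma word_act_simps: "word_act [] x = x" "word_act ((i, a) # u) x = \<rho> i a (word_act u x)"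
  by (simp_all add: word_act_def)

lemma word_act_closed: "u \<in> lists X \<Longrightarrow> x \<in> carrier V \<Longrightarrow> word_act u x \<in> carrier V"
  by (induction u) (auto simp: word_act_simps coproduct_gens_def intro: klinD(3)[OF \<rho>_klin])

definition free_act :: "(('i \<times> 'a) list \<Rightarrow> 'k) \<Rightarrow> 'v \<Rightarrow> 'v" where
  "free_act f x = lcomb V (\<lambda>u. word_act u x) f (support f)"

lemma free_act_superset:
  assumes T: "finite T" "T \<subseteq> lists X" "support f \<subseteq> T" and x: "x \<in> carrier V"
  shows "free_act f x = lcomb V (\<lambda>u. word_act u x) f T"
  unfolding free_act_def lcomb_def
proof (rule V.add.finprod_mono_neutral_cong_left[OF T(1,3)])
  have c: "word_act u x \<in> carrier V" if "u \<in> T" for u using word_act_closed[OF _ x] T(2) that by blast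
  show "f i \<odot>\<^bsub>V\<^esub> word_act i x = \<zero>\<^bsub>V\<^esub>" if "i \<in> T - support f" for i
    using c that kvs_simps(3)[OF kvs_V] by (auto simp: support_def)
  show "(\<lambda>i. f i \<odot>\<^bsub>V\<^esub> word_act i x) \<in> T \<rightarrow> carrier V"
    using c kvs_simps(1)[OF kvs_V] by auto
qed simp

lemma free_act_closed: "f \<in> carrier R \<Longrightarrow> x \<in> carrier V \<Longrightarrow> free_act f x \<in> carrier V"
  unfolding free_act_def FA_simps(1)
  by (rule lcomb_closed[OF kvs_V]) (auto intro: word_act_closed)

lemma free_act_add:
  assumes "f \<in> carrier R" "g \<in> carrier R" "x \<in> carrier V"
  shows "free_act (f \<oplus>\<^bsub>R\<^esub> g) x = free_act f x \<oplus>\<^bsub>V\<^esub> free_act g x"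
proof -
  let ?T = "support f \<union> support g"
  have T: "finite ?T" "?T \<subseteq> lists X" using assms(1,2) by (auto simp: FA_simps(1))
  have c: "(\<lambda>u. word_act u x) \<in> ?T \<rightarrow> carrier V" using word_act_closed[OF _ assms(3)] T(2) by blast
  have s: "support (f \<oplus>\<^bsub>R\<^esub> g) \<subseteq> ?T" by (auto simp: support_def FA_simps(2))
  have "free_act f x = lcomb V (\<lambda>u. word_act u x) f ?T" "free_act g x = lcomb V (\<lambda>u. word_act u x) g ?T"
    "free_act (f \<oplus>\<^bsub>R\<^esub> g) x = lcomb V (\<lambda>u. word_act u x) (f \<oplus>\<^bsub>R\<^esub> g) ?T"
    by (rule free_act_superset[OF T _ assms(3)], use s in blast)+
  moreover have "lcomb V (\<lambda>u. word_act u x) (f \<oplus>\<^bsub>R\<^esub> g) ?T = lcomb V (\<lambda>u. word_act u x) (\<lambda>u. f u + g u) ?T"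
    by (rule lcomb_cong[OF kvs_V c]) (simp add: FA_simps(2))
  ultimately show ?thesis by (simp add: lcomb_add[OF kvs_V c])
qed

lemma free_act_smult:
  assumes "f \<in> carrier R" "x \<in> carrier V"
  shows "free_act (c \<odot>\<^bsub>R\<^esub> f) x = c \<odot>\<^bsub>V\<^esub> free_act f x"
proof -
  have T: "finite (support f)" "support f \<subseteq> lists X" using assms(1) by (auto simp: FA_simps(1))
  have c: "(\<lambda>u. word_act u x) \<in> support f \<rightarrow> carrier V" using word_act_closed[OF _ assms(2)] T(2) by blast
  have "free_act (c \<odot>\<^bsub>R\<^esub> f) x = lcomb V (\<lambda>u. word_act u x) (c \<odot>\<^bsub>R\<^esub> f) (support f)"
    by (rule free_act_superset[OF T _ assms(2)]) (auto simp: support_def FA_simps(3))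
  also have "\<dots> = lcomb V (\<lambda>u. word_act u x) (\<lambda>u. c * f u) (support f)"
    by (rule lcomb_cong[OF kvs_V c]) (simp add: FA_simps(3))
  also have "\<dots> = c \<odot>\<^bsub>V\<^esub> free_act f x"
    unfolding free_act_def by (rule lcomb_scale[OF kvs_V c, symmetric])
  finally show ?thesis .
qed

lemma free_act_word:
  assumes u: "u \<in> lists X" and x: "x \<in> carrier V"
  shows "free_act (word u) x = word_act u x"
proof -
  have s: "support (word u :: _ \<Rightarrow> 'k) = {u}" by (auto simp: support_def word_def)
  have "free_act (word u) x = (word u u) \<odot>\<^bsub>V\<^esub> word_act u x"
    unfolding free_act_def lcomb_def s
    using word_act_closed[OF u x] by (subst V.finsum_insert) (auto simp: kvs_simps[OF kvs_V])
  then show ?thesis using word_act_closed[OF u x] by (simp add: word_def kvs_simps[OF kvs_V])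
qed

lemma free_act_gen:
  "i \<in> I \<Longrightarrow> a \<in> carrier (B i) \<Longrightarrow> x \<in> carrier V \<Longrightarrow> free_act (free_gen (i, a)) x = \<rho> i a x"
  using free_act_word[of "[(i, a)]" x] by (simp add: word_singleton word_act_simps coproduct_gens_def)

lemma free_act_zero: "x \<in> carrier V \<Longrightarrow> free_act \<zero>\<^bsub>R\<^esub> x = \<zero>\<^bsub>V\<^esub>"
  by (simp add: free_act_def support_def FA_simps(4) lcomb_def)

lemma free_act_one: "x \<in> carrier V \<Longrightarrow> free_act \<one>\<^bsub>R\<^esub> x = x"
  unfolding FA_simps(6) by (simp add: free_act_word word_act_simps)

lemma word_act_klin: "u \<in> lists X \<Longrightarrow> klin V V (word_act u)"
proof (induction u)
  case Nil
  show ?case by (rule klinI[OF kvs_V kvs_V]) (auto simp: word_act_simps)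
next
  case (Cons p u)
  obtain i a where p: "p = (i, a)" "i \<in> I" "a \<in> carrier (B i)" using Cons.prems by (cases p) (auto simp: coproduct_gens_def)
  have "word_act (p # u) = (\<lambda>x. \<rho> i a (word_act u x))" by (rule ext) (simp add: p word_act_simps)
  then show ?case using klin_comp[OF _ \<rho>_klin[OF p(2,3)]] Cons by simp
qed

lemma free_act_klin: "f \<in> carrier R \<Longrightarrow> klin V V (free_act f)"
proof (induction f rule: FA_induct)
  case zero
  show ?case by (rule klinI[OF kvs_V kvs_V]) (auto simp: free_act_zero kvs_simps[OF kvs_V])
next
  case (add c u f)
  have wR: "(word u :: _ \<Rightarrow> 'k) \<in> carrier R" by (rule word_closed[OF add(1)])
  have eq: "free_act (c \<odot>\<^bsub>R\<^esub> word u \<oplus>\<^bsub>R\<^esub> f) x = c \<odot>\<^bsub>V\<^esub> word_act u x \<oplus>\<^bsub>V\<^esub> free_act f x" if "x \<in> carrier V" for x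
    using free_act_add[OF FA_smult_closed[OF wR] add(2) that] free_act_smult[OF wR that] free_act_word[OF add(1) that] by simp
  note lw = klinD(3-5)[OF word_act_klin[OF add(1)]] and lf = klinD(3-5)[OF add(3)]
  show ?case
  proof (rule klinI[OF kvs_V kvs_V])
    fix x assume x: "x \<in> carrier V"
    show "free_act (c \<odot>\<^bsub>R\<^esub> word u \<oplus>\<^bsub>R\<^esub> f) x \<in> carrier V"
      unfolding eq[OF x] using lw(1)[OF x] lf(1)[OF x] kvs_simps(1)[OF kvs_V] by simp
    fix c'
    show "free_act (c \<odot>\<^bsub>R\<^esub> word u \<oplus>\<^bsub>R\<^esub> f) (c' \<odot>\<^bsub>V\<^esub> x) = c' \<odot>\<^bsub>V\<^esub> free_act (c \<odot>\<^bsub>R\<^esub> word u \<oplus>\<^bsub>R\<^esub> f) x"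
      unfolding eq[OF x] eq[OF kvs_simps(1)[OF kvs_V x]] lw(3)[OF x] lf(3)[OF x]
        kvs_distrib(3)[OF kvs_V kvs_simps(1)[OF kvs_V lw(1)[OF x]] lf(1)[OF x]]
        kvs_distrib(2)[OF kvs_V lw(1)[OF x], symmetric] by (simp add: mult.commute)
  next
    fix x y assume x: "x \<in> carrier V" and y: "y \<in> carrier V"
    show "free_act (c \<odot>\<^bsub>R\<^esub> word u \<oplus>\<^bsub>R\<^esub> f) (x \<oplus>\<^bsub>V\<^esub> y)
      = free_act (c \<odot>\<^bsub>R\<^esub> word u \<oplus>\<^bsub>R\<^esub> f) x \<oplus>\<^bsub>V\<^esub> free_act (c \<odot>\<^bsub>R\<^esub> word u \<oplus>\<^bsub>R\<^esub> f) y"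
      unfolding eq[OF x] eq[OF y] eq[OF kvs_simps(6)[OF kvs_V x y]] lw(2)[OF x y] lf(2)[OF x y]
        kvs_distrib(3)[OF kvs_V lw(1)[OF x] lw(1)[OF y]]
      using lw(1)[OF x] lw(1)[OF y] lf(1)[OF x] lf(1)[OF y] kvs_simps(1)[OF kvs_V] by (simp add: V.a_ac)
  qed
qed

lemma free_act_gen_mult:
  assumes p: "(i, a) \<in> X" and h: "h \<in> carrier R" and x: "x \<in> carrier V"
  shows "free_act (free_gen (i, a) \<otimes>\<^bsub>R\<^esub> h) x = \<rho> i a (free_act h x)"
proof -
  have ia: "i \<in> I" "a \<in> carrier (B i)" using p by (auto simp: coproduct_gens_def)
  have T: "finite (support h)" "support h \<subseteq> lists X" using h by (auto simp: FA_simps(1))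
  have c: "(\<lambda>u. word_act u x) \<in> support h \<rightarrow> carrier V" using word_act_closed[OF _ x] T(2) by blast
  let ?f = "free_gen (i, a) \<otimes>\<^bsub>R\<^esub> h"
  have supp: "support ?f \<subseteq> Cons (i, a) ` support h"
  proof
    fix ys assume "ys \<in> support ?f"
    then have n: "?f ys \<noteq> 0" by (simp add: support_def)
    then obtain zs where "ys = (i, a) # zs" by (cases ys) (auto simp: free_gen_mult split: if_splits)
    then show "ys \<in> Cons (i, a) ` support h" using n by (auto simp: free_gen_mult support_def)
  qed
  have sub: "Cons (i, a) ` support h \<subseteq> lists X"
    by (intro image_subsetI lists.Cons p) (use T(2) in blast)
  have "free_act ?f x = lcomb V (\<lambda>u. word_act u x) ?f (Cons (i, a) ` support h)"
    by (rule free_act_superset[OF finite_imageI[OF T(1)] sub supp x])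
  also have "\<dots> = lcomb V (\<rho> i a \<circ> (\<lambda>u. word_act u x)) h (support h)"
  proof -
    have c': "(\<lambda>u. word_act u x) \<in> Cons (i, a) ` support h \<rightarrow> carrier V"
      using word_act_closed[OF _ x] sub by blast
    have bij: "bij_betw (Cons (i, a)) (support h) (Cons (i, a) ` support h)" by (simp add: bij_betw_def)
    have "(\<lambda>u. word_act u x) \<circ> Cons (i, a) = \<rho> i a \<circ> (\<lambda>u. word_act u x)"
      by (rule ext) (simp add: word_act_simps)
    moreover have "?f \<circ> Cons (i, a) = h" by (rule ext) (simp add: free_gen_mult)
    ultimately show ?thesis using lcomb_reindex[OF kvs_V bij c', of ?f] by simp
  qed
  also have "\<dots> = \<rho> i a (free_act h x)"
    unfolding free_act_def by (rule klin_lcomb[OF \<rho>_klin[OF ia] c, symmetric])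
  finally show ?thesis .
qed

lemma free_act_word_mult:
  "u \<in> lists X \<Longrightarrow> h \<in> carrier R \<Longrightarrow> x \<in> carrier V \<Longrightarrow> free_act (word u \<otimes>\<^bsub>R\<^esub> h) x = word_act u (free_act h x)"
proof (induction u)
  case Nil
  have "word [] \<otimes>\<^bsub>R\<^esub> h = h" using R.l_one[OF Nil(2)] unfolding FA_simps(6) .
  then show ?case by (simp add: word_act_simps)
next
  case (Cons p u)
  obtain i a where p: "p = (i, a)" by (cases p)
  have pX: "(i, a) \<in> X" and u: "u \<in> lists X" using Cons(2) p by auto
  have w: "(word u :: _ \<Rightarrow> 'k) \<in> carrier R" by (rule word_closed[OF u])
  have "word (p # u) \<otimes>\<^bsub>R\<^esub> h = free_gen (i, a) \<otimes>\<^bsub>R\<^esub> (word u \<otimes>\<^bsub>R\<^esub> h)"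
    unfolding word_Cons[where X = X] p by (rule R.m_assoc[OF free_gen_closed[OF pX] w Cons(3)])
  then have "free_act (word (p # u) \<otimes>\<^bsub>R\<^esub> h) x = \<rho> i a (free_act (word u \<otimes>\<^bsub>R\<^esub> h) x)"
    using free_act_gen_mult[OF pX _ Cons(4)] w Cons(3) by simp
  then show ?case using Cons.IH[OF u Cons(3,4)] p by (simp add: word_act_simps)
qed

lemma free_act_mult:
  assumes f: "f \<in> carrier R" and g: "g \<in> carrier R" and x: "x \<in> carrier V"
  shows "free_act (f \<otimes>\<^bsub>R\<^esub> g) x = free_act f (free_act g x)"
  using f
proof (induction f rule: FA_induct)
  case zero
  then show ?case using g x by (simp add: free_act_zero free_act_closed)
next
  case (add c u f)
  have w: "(word u :: _ \<Rightarrow> 'k) \<in> carrier R" by (rule word_closed[OF add(1)])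
  have gx: "free_act g x \<in> carrier V" by (rule free_act_closed[OF g x])
  have wg: "word u \<otimes>\<^bsub>R\<^esub> g \<in> carrier R" using w g by simp
  have "(c \<odot>\<^bsub>R\<^esub> word u \<oplus>\<^bsub>R\<^esub> f) \<otimes>\<^bsub>R\<^esub> g = c \<odot>\<^bsub>R\<^esub> (word u \<otimes>\<^bsub>R\<^esub> g) \<oplus>\<^bsub>R\<^esub> f \<otimes>\<^bsub>R\<^esub> g"
    by (simp add: R.l_distr[OF FA_smult_closed[OF w] add(2) g] FA_smult_mult(1))
  then have "free_act ((c \<odot>\<^bsub>R\<^esub> word u \<oplus>\<^bsub>R\<^esub> f) \<otimes>\<^bsub>R\<^esub> g) x
     = c \<odot>\<^bsub>V\<^esub> word_act u (free_act g x) \<oplus>\<^bsub>V\<^esub> free_act (f \<otimes>\<^bsub>R\<^esub> g) x"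
    using free_act_add[OF FA_smult_closed[OF wg] R.m_closed[OF add(2) g] x] free_act_smult[OF wg x]
      free_act_word_mult[OF add(1) g x] by simp
  then show ?case
    using free_act_add[OF FA_smult_closed[OF w] add(2) gx] free_act_smult[OF w gx] free_act_word[OF add(1) gx] add(3) by simp
qed

definition "act_kernel = {f \<in> carrier R. \<forall>x\<in>carrier V. free_act f x = \<zero>\<^bsub>V\<^esub>}"

text \<open>It is an ideal containing the relations, hence the whole ideal by which the free algebra is divided.\<close>

lemma act_kernel_ideal: "ideal act_kernel R"
proof (rule R.ideal_criterion)
  show "\<zero>\<^bsub>R\<^esub> \<in> act_kernel" by (simp add: act_kernel_def free_act_zero)
  show "x \<oplus>\<^bsub>R\<^esub> y \<in> act_kernel" if "x \<in> act_kernel" "y \<in> act_kernel" for x y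
    using that by (simp add: act_kernel_def free_act_add)
  show "x \<otimes>\<^bsub>R\<^esub> y \<in> act_kernel" if "x \<in> carrier R" "y \<in> act_kernel" for x y
    using that klinD(6)[OF free_act_klin[OF that(1)]] by (simp add: act_kernel_def free_act_mult)
  show "y \<otimes>\<^bsub>R\<^esub> x \<in> act_kernel" if "x \<in> carrier R" "y \<in> act_kernel" for x y
    using that by (simp add: act_kernel_def free_act_mult free_act_closed)
qed (auto simp: act_kernel_def)

lemma free_act_minus:
  assumes "f \<in> carrier R" "g \<in> carrier R" "\<And>x. x \<in> carrier V \<Longrightarrow> free_act f x = free_act g x"
  shows "f \<ominus>\<^bsub>R\<^esub> g \<in> act_kernel"
  unfolding act_kernel_def
proof (intro CollectI conjI ballI)
  show m: "f \<ominus>\<^bsub>R\<^esub> g \<in> carrier R" using assms by simp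
  fix x assume x: "x \<in> carrier V"
  have "f = (f \<ominus>\<^bsub>R\<^esub> g) \<oplus>\<^bsub>R\<^esub> g" using assms(1,2) by (simp add: R.minus_eq R.a_assoc R.l_neg)
  then have "free_act f x = free_act (f \<ominus>\<^bsub>R\<^esub> g) x \<oplus>\<^bsub>V\<^esub> free_act g x"
    using free_act_add[OF m assms(2) x] by simp
  then have "free_act g x = free_act (f \<ominus>\<^bsub>R\<^esub> g) x \<oplus>\<^bsub>V\<^esub> free_act g x" using assms(3)[OF x] by simp
  then show "free_act (f \<ominus>\<^bsub>R\<^esub> g) x = \<zero>\<^bsub>V\<^esub>"
    using free_act_closed[OF assms(2) x] free_act_closed[OF m x]
      V.add.r_cancel_one'[of "free_act g x" "free_act (f \<ominus>\<^bsub>R\<^esub> g) x"] by simp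
qed

lemma J_act_kernel: "J \<subseteq> act_kernel"
  unfolding coproduct_ideal_def
proof (rule R.genideal_minimal[OF act_kernel_ideal])
  show "coproduct_rels I B \<subseteq> act_kernel"
    unfolding coproduct_rels_def Let_def
  proof (intro Un_least subsetI)
    fix z assume "z \<in> {free_gen (i, a \<oplus>\<^bsub>B i\<^esub> b) \<ominus>\<^bsub>R\<^esub> (free_gen (i, a) \<oplus>\<^bsub>R\<^esub> free_gen (i, b)) | i a b.
        i \<in> I \<and> a \<in> carrier (B i) \<and> b \<in> carrier (B i)}"
    then show "z \<in> act_kernel"
      by (auto intro!: free_act_minus gen B_closed simp: free_act_add gen free_act_gen B_closed \<rho>_add)
  next
    fix z assume "z \<in> {free_gen (i, c \<odot>\<^bsub>B i\<^esub> a) \<ominus>\<^bsub>R\<^esub> (c \<odot>\<^bsub>R\<^esub> free_gen (i, a)) | i c a.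
        i \<in> I \<and> a \<in> carrier (B i)}"
    then show "z \<in> act_kernel"
      by (auto intro!: free_act_minus gen B_closed FA_smult_closed simp: free_act_smult gen free_act_gen B_closed \<rho>_smult)
  next
    fix z assume "z \<in> {free_gen (i, a \<otimes>\<^bsub>B i\<^esub> b) \<ominus>\<^bsub>R\<^esub> (free_gen (i, a) \<otimes>\<^bsub>R\<^esub> free_gen (i, b)) | i a b.
        i \<in> I \<and> a \<in> carrier (B i) \<and> b \<in> carrier (B i)}"
    then show "z \<in> act_kernel"
      by (auto intro!: free_act_minus gen B_closed R.m_closed simp: free_act_mult gen free_act_gen B_closed \<rho>_mult klinD(3)[OF \<rho>_klin])
  next
    fix z assume "z \<in> {free_gen (i, \<one>\<^bsub>B i\<^esub>) \<ominus>\<^bsub>R\<^esub> \<one>\<^bsub>R\<^esub> | i. i \<in> I}"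
    then show "z \<in> act_kernel"
      by (auto intro!: free_act_minus gen B_closed simp: free_act_one gen free_act_gen B_closed \<rho>_one)
  qed
qed

text \<open>A coset acts through any of its representatives; by \<open>J_act_kernel\<close> the choice does not matter.\<close>

definition action_module :: "((('i \<times> 'a) list \<Rightarrow> 'k) set, 'v) module" where
  "action_module = \<lparr> carrier = carrier V, monoid.mult = monoid.mult V, one = one V, zero = zero V, add = add V,
     module.smult = (\<lambda>C. free_act (SOME f. f \<in> C)) \<rparr>"

lemma action_module_simps [simp]:
  "carrier action_module = carrier V" "zero action_module = zero V" "add action_module = add V"
  by (simp_all add: action_module_def)

lemma action_module_smult:
  assumes f: "f \<in> carrier R" and x: "x \<in> carrier V"
  shows "cls f \<odot>\<^bsub>action_module\<^esub> x = free_act f x"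
proof -
  have "f \<in> cls f" by (rule J.a_rcos_self[OF f])
  then have "(SOME f'. f' \<in> cls f) \<in> cls f" by (rule someI[of "\<lambda>f'. f' \<in> cls f"])
  then obtain j where j: "j \<in> J" "(SOME f'. f' \<in> cls f) = j \<oplus>\<^bsub>R\<^esub> f" unfolding a_r_coset_def' by blast
  have jR: "j \<in> carrier R" and j0: "free_act j x = \<zero>\<^bsub>V\<^esub>"
    using j(1) J_act_kernel x unfolding act_kernel_def by auto
  show ?thesis
    using free_act_add[OF jR f x] j0 free_act_closed[OF f x] by (simp add: action_module_def j(2))
qed

lemma left_module_action_module: "left_module A action_module"
proof -
  have grp: "abelian_group action_module"
    by (rule abelian_groupI) (simp_all add: V.a_assoc V.a_comm V.a_lcomm V.add.l_inv_ex)
  show ?thesis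
  proof (intro left_module.intro left_module_axioms.intro)
    show "ring A" by (rule A.ring_axioms)
    show "abelian_group action_module" by (rule grp)
  next
    fix C x assume "C \<in> carrier A" and x: "x \<in> carrier action_module"
    then obtain f where "f \<in> carrier R" "C = cls f" unfolding A_carrier by blast
    then show "C \<odot>\<^bsub>action_module\<^esub> x \<in> carrier action_module"
      using x by (simp add: action_module_smult free_act_closed)
  next
    fix C D x assume "C \<in> carrier A" "D \<in> carrier A" and x: "x \<in> carrier action_module"
    then obtain f g where fg: "f \<in> carrier R" "C = cls f" "g \<in> carrier R" "D = cls g" unfolding A_carrier by blast
    show "(C \<oplus>\<^bsub>A\<^esub> D) \<odot>\<^bsub>action_module\<^esub> x = C \<odot>\<^bsub>action_module\<^esub> x \<oplus>\<^bsub>action_module\<^esub> D \<odot>\<^bsub>action_module\<^esub> x"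
      using fg x by (simp flip: cls_hom(1) add: action_module_smult free_act_add)
    show "(C \<otimes>\<^bsub>A\<^esub> D) \<odot>\<^bsub>action_module\<^esub> x = C \<odot>\<^bsub>action_module\<^esub> (D \<odot>\<^bsub>action_module\<^esub> x)"
      using fg x by (simp flip: cls_hom(2) add: action_module_smult free_act_mult free_act_closed)
  next
    fix C x y assume "C \<in> carrier A" and x: "x \<in> carrier action_module" "y \<in> carrier action_module"
    then obtain f where f: "f \<in> carrier R" "C = cls f" unfolding A_carrier by blast
    show "C \<odot>\<^bsub>action_module\<^esub> (x \<oplus>\<^bsub>action_module\<^esub> y) = C \<odot>\<^bsub>action_module\<^esub> x \<oplus>\<^bsub>action_module\<^esub> C \<odot>\<^bsub>action_module\<^esub> y"
      using f x klinD(4)[OF free_act_klin[OF f(1)]] by (simp add: action_module_smult)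
  next
    fix x assume "x \<in> carrier action_module"
    then show "\<one>\<^bsub>A\<^esub> \<odot>\<^bsub>action_module\<^esub> x = x"
      unfolding cls_hom(3)[symmetric] by (simp add: action_module_smult free_act_one)
  qed
qed

lemma action_module_emb:
  "i \<in> I \<Longrightarrow> a \<in> carrier (B i) \<Longrightarrow> x \<in> carrier V \<Longrightarrow> emb i a \<odot>\<^bsub>action_module\<^esub> x = \<rho> i a x"
  unfolding coproduct_inj_def by (simp add: action_module_smult gen free_act_gen)

lemma action_module_scalar:
  "x \<in> carrier V \<Longrightarrow> c \<odot>\<^bsub>underlying_vs A action_module\<^esub> x = c \<odot>\<^bsub>V\<^esub> x"
  using action_module_smult[of "c \<odot>\<^bsub>R\<^esub> \<one>\<^bsub>R\<^esub>" x] free_act_smult[OF R.one_closed, of x c]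
  by (simp add: underlying_vs_smult scalar_cls[unfolded scalar_def] FA_smult_closed free_act_one)

end

section \<open>Modules over the free product\<close>

lemma factor_alg_simps:
  "carrier (factor_alg r w i :: ('k::field, nat \<Rightarrow> 'k mat) module) = (\<Pi>\<^sub>E j\<in>{1..r i}. carrier_mat (w i j) (w i j))"
  "a \<oplus>\<^bsub>factor_alg r w i\<^esub> b = (\<lambda>j\<in>{1..r i}. a j + b j)"
  "a \<otimes>\<^bsub>factor_alg r w i\<^esub> b = (\<lambda>j\<in>{1..r i}. a j * b j)"
  "c \<odot>\<^bsub>factor_alg r w i\<^esub> a = (\<lambda>j\<in>{1..r i}. c \<cdot>\<^sub>m a j)"
  "\<one>\<^bsub>factor_alg r w i\<^esub> = (\<lambda>j\<in>{1..r i}. 1\<^sub>m (w i j))"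
  by (simp_all add: factor_alg_def prod_algebra_def module_mat_def ring_mat_def)

lemma coproduct_data_factor_alg: "coproduct_data {1..m} (factor_alg r w :: nat \<Rightarrow> ('k::field, nat \<Rightarrow> 'k mat) module)"
  by (rule coproduct_data.intro) (auto simp: factor_alg_simps PiE_def Pi_def)

definition block :: "(nat \<Rightarrow> nat) \<Rightarrow> (nat \<Rightarrow> nat \<Rightarrow> nat) \<Rightarrow> nat \<Rightarrow> nat \<Rightarrow> 'k::field mat \<Rightarrow> nat \<Rightarrow> 'k mat" where
  "block r w i j A = (\<lambda>l\<in>{1..r i}. if l = j then A else 0\<^sub>m (w i l) (w i l))"

abbreviation (input) "unit_block r w i j p q \<equiv> block r w i j (mat_unit (w i j) p q)"

lemma elem_emb:
  "matrix_unit_elem m r w i j p q = coproduct_inj {1..m} (factor_alg r w) i (unit_block r w i j p q)"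
  "block_one_elem m r w i j = coproduct_inj {1..m} (factor_alg r w) i (block r w i j (1\<^sub>m (w i j)))"
  by (simp_all add: matrix_unit_elem_def block_one_elem_def block_elem_def block_def)

lemma mat_unit_carrier [simp]: "mat_unit s p q \<in> carrier_mat s s"
  by (simp add: mat_unit_def)

lemma block_closed: "A \<in> carrier_mat (w i j) (w i j) \<Longrightarrow> block r w i j A \<in> carrier (factor_alg r w i)"
  by (auto simp: factor_alg_simps block_def)

lemma block_mult:
  assumes "A \<in> carrier_mat (w i j) (w i j)" "C \<in> carrier_mat (w i j') (w i j')"
  shows "block r w i j A \<otimes>\<^bsub>factor_alg r w i\<^esub> block r w i j' C =
    (if j = j' then block r w i j (A * C) else (0::'k::field) \<odot>\<^bsub>factor_alg r w i\<^esub> block r w i j A)"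
proof (rule ext)
  fix l
  show "(block r w i j A \<otimes>\<^bsub>factor_alg r w i\<^esub> block r w i j' C) l =
    (if j = j' then block r w i j (A * C) else 0 \<odot>\<^bsub>factor_alg r w i\<^esub> block r w i j A) l"
    using assms by (cases "l \<in> {1..r i}"; cases "l = j"; cases "l = j'")
      (auto simp: factor_alg_simps block_def intro!: eq_matI)
qed

lemma mat_unit_mult:
  assumes "q \<in> {1..s}" "p' \<in> {1..s}"
  shows "mat_unit s p q * mat_unit s p' q' = (if q = p' then mat_unit s p q' else (0::'k::field) \<cdot>\<^sub>m mat_unit s p q)"
proof (rule eq_matI)
  fix a b assume ab: "a < dim_row (if q = p' then mat_unit s p q' else (0::'k) \<cdot>\<^sub>m mat_unit s p q)"
    "b < dim_col (if q = p' then mat_unit s p q' else (0::'k) \<cdot>\<^sub>m mat_unit s p q)"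
  then have ab': "a < s" "b < s" by (auto simp: mat_unit_def split: if_splits)
  have "(mat_unit s p q * mat_unit s p' q' :: 'k mat) $$ (a, b)
     = (\<Sum>c<s. (if Suc a = p \<and> Suc c = q then 1 else 0) * (if Suc c = p' \<and> Suc b = q' then 1 else 0))"
    using ab' by (auto simp: mat_unit_def scalar_prod_def atLeast0LessThan intro!: sum.cong)
  also have "\<dots> = (\<Sum>c<s. if c = q - 1 then (if Suc a = p \<and> q = p' \<and> Suc b = q' then 1 else 0) else 0)"
    using assms by (intro sum.cong) auto
  also have "\<dots> = (if Suc a = p \<and> q = p' \<and> Suc b = q' then 1 else 0)"
    using assms by (subst sum.delta) auto
  finally show "(mat_unit s p q * mat_unit s p' q' :: 'k mat) $$ (a, b)
      = (if q = p' then mat_unit s p q' else 0 \<cdot>\<^sub>m mat_unit s p q) $$ (a, b)"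
    using ab' by (auto simp: mat_unit_def)
qed (auto simp: mat_unit_def)

lemma block_smult: "c \<odot>\<^bsub>factor_alg r w i\<^esub> block r w i j A = block r w i j (c \<cdot>\<^sub>m A)"
  by (rule ext) (auto simp: factor_alg_simps block_def intro!: eq_matI)

lemma unit_block_mult:
  assumes "q \<in> {1..w i j}" "p' \<in> {1..w i j'}"
  shows "unit_block r w i j p q \<otimes>\<^bsub>factor_alg r w i\<^esub> unit_block r w i j' p' q' =
    (if j = j' \<and> q = p' then unit_block r w i j p q' else (0::'k::field) \<odot>\<^bsub>factor_alg r w i\<^esub> unit_block r w i j p q)"
  using assms by (cases "j = j'") (auto simp: block_mult mat_unit_mult block_smult)

lemma block_one_mult:
  "block r w i j (1\<^sub>m (w i j)) \<otimes>\<^bsub>factor_alg r w i\<^esub> unit_block r w i j p q = unit_block r w i j p q"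
  by (simp add: block_mult left_mult_one_mat[OF mat_unit_carrier])

definition matrix_positions :: "(nat \<Rightarrow> nat) \<Rightarrow> (nat \<Rightarrow> nat \<Rightarrow> nat) \<Rightarrow> nat \<Rightarrow> (nat \<times> nat \<times> nat) set" where
  "matrix_positions r w i = (SIGMA j:{1..r i}. {1..w i j} \<times> {1..w i j})"

text \<open>A linear function on a factor is determined by its values on the matrix units. The set \<open>T\<close> of positions may be
  restricted to those where \<open>a\<close> does not vanish, so that diagonal elements yield diagonal sums. Matrix units are numbered from
  \<open>1\<close>, entries of matrices from \<open>0\<close>.\<close>

lemma matrix_unit_expansion:
  fixes V :: "('k::field, 'v) module"
  assumes V: "kvs V"
    and g: "\<And>a. a \<in> carrier (factor_alg r w i) \<Longrightarrow> g a \<in> carrier V"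
    "\<And>a b. a \<in> carrier (factor_alg r w i) \<Longrightarrow> b \<in> carrier (factor_alg r w i) \<Longrightarrow> g (a \<oplus>\<^bsub>factor_alg r w i\<^esub> b) = g a \<oplus>\<^bsub>V\<^esub> g b"
    "\<And>c a. a \<in> carrier (factor_alg r w i) \<Longrightarrow> g (c \<odot>\<^bsub>factor_alg r w i\<^esub> a) = c \<odot>\<^bsub>V\<^esub> g a"
    and a: "a \<in> carrier (factor_alg r w i)" and T: "T \<subseteq> matrix_positions r w i"
    and zero: "\<And>j p q. (j, p, q) \<in> matrix_positions r w i - T \<Longrightarrow> a j $$ (p - 1, q - 1) = 0"
  shows "g a = (\<Oplus>\<^bsub>V\<^esub>t\<in>T. (a (fst t) $$ (fst (snd t) - 1, snd (snd t) - 1)) \<odot>\<^bsub>V\<^esub> g (unit_block r w i (fst t) (fst (snd t)) (snd (snd t))))"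
proof -
  interpret V: abelian_group V by (rule kvs_abelian_group[OF V])
  have fin: "finite T" using finite_subset[OF T] by (simp add: matrix_positions_def)
  define part where "part U = (\<lambda>j\<in>{1..r i}. mat (w i j) (w i j) (\<lambda>(p, q). if (j, Suc p, Suc q) \<in> U then a j $$ (p, q) else 0))" for U
  have pc: "part U \<in> carrier (factor_alg r w i)" for U by (simp add: part_def factor_alg_simps)
  have uc: "unit_block r w i j p q \<in> carrier (factor_alg r w i)" for j p q
    by (rule block_closed) simp
  let ?t = "\<lambda>t. (a (fst t) $$ (fst (snd t) - 1, snd (snd t) - 1)) \<odot>\<^bsub>V\<^esub> g (unit_block r w i (fst t) (fst (snd t)) (snd (snd t)))"
  have tc: "?t t \<in> carrier V" for t by (intro kvs_simps(1)[OF V] g(1) uc)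
  have sumU: "g (part U) = (\<Oplus>\<^bsub>V\<^esub>t\<in>U. ?t t)" if "finite U" "U \<subseteq> matrix_positions r w i" for U
    using that
  proof (induction U rule: finite_induct)
    case empty
    have "part {} = 0 \<odot>\<^bsub>factor_alg r w i\<^esub> part {}" by (rule ext) (auto simp: part_def factor_alg_simps intro!: eq_matI)
    then have "g (part {}) = 0 \<odot>\<^bsub>V\<^esub> g (part {})" using g(3)[OF pc[of "{}"], of 0] by simp
    then show ?case using kvs_simps(3)[OF V g(1)[OF pc[of "{}"]]] by simp
  next
    case (insert t U)
    obtain j p q where t: "t = (j, p, q)" "j \<in> {1..r i}" "p \<in> {1..w i j}" "q \<in> {1..w i j}"
      using insert.prems by (cases t) (auto simp: matrix_positions_def)
    let ?c = "a j $$ (p - 1, q - 1)"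
    have "part (insert t U) = (?c \<odot>\<^bsub>factor_alg r w i\<^esub> unit_block r w i j p q) \<oplus>\<^bsub>factor_alg r w i\<^esub> part U"
    proof (rule ext)
      fix l
      show "part (insert t U) l = ((?c \<odot>\<^bsub>factor_alg r w i\<^esub> unit_block r w i j p q) \<oplus>\<^bsub>factor_alg r w i\<^esub> part U) l"
      proof (cases "l \<in> {1..r i}")
        case True
        show ?thesis
        proof (rule eq_matI)
          fix x y assume "x < dim_row (((?c \<odot>\<^bsub>factor_alg r w i\<^esub> unit_block r w i j p q) \<oplus>\<^bsub>factor_alg r w i\<^esub> part U) l)"
            "y < dim_col (((?c \<odot>\<^bsub>factor_alg r w i\<^esub> unit_block r w i j p q) \<oplus>\<^bsub>factor_alg r w i\<^esub> part U) l)"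
          then have xy: "x < w i l" "y < w i l" using True by (simp_all add: part_def factor_alg_simps)
          have "(l, Suc x, Suc y) = t \<Longrightarrow> (l, Suc x, Suc y) \<notin> U" using insert.hyps by auto
          then show "part (insert t U) l $$ (x, y) = ((?c \<odot>\<^bsub>factor_alg r w i\<^esub> unit_block r w i j p q) \<oplus>\<^bsub>factor_alg r w i\<^esub> part U) l $$ (x, y)"
            using xy True by (auto simp: part_def factor_alg_simps block_def mat_unit_def t(1))
        qed (use True in \<open>auto simp: part_def factor_alg_simps block_def mat_unit_def\<close>)
      next
        case False
        then show ?thesis by (simp only: part_def factor_alg_simps restrict_def if_False)
      qed
    qed
    moreover have "?c \<odot>\<^bsub>factor_alg r w i\<^esub> unit_block r w i j p q \<in> carrier (factor_alg r w i)"
      unfolding block_smult by (rule block_closed) simp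
    ultimately have "g (part (insert t U)) = ?c \<odot>\<^bsub>V\<^esub> g (unit_block r w i j p q) \<oplus>\<^bsub>V\<^esub> g (part U)"
      using g(2)[OF _ pc] g(3)[OF uc] by simp
    also have "\<dots> = ?t t \<oplus>\<^bsub>V\<^esub> (\<Oplus>\<^bsub>V\<^esub>t\<in>U. ?t t)" using insert by (simp add: t(1))
    also have "\<dots> = (\<Oplus>\<^bsub>V\<^esub>t\<in>insert t U. ?t t)"
      using insert.hyps tc by (intro V.finsum_insert[symmetric]) auto
    finally show ?case .
  qed
  moreover have "part T = a"
  proof (rule ext)
    fix l
    show "part T l = a l"
    proof (cases "l \<in> {1..r i}")
      case True
      have al: "a l \<in> carrier_mat (w i l) (w i l)" using a True by (auto simp: factor_alg_simps PiE_def Pi_def)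
      show ?thesis
      proof (rule eq_matI)
        fix x y assume "x < dim_row (a l)" "y < dim_col (a l)"
        then have xy: "x < w i l" "y < w i l" using al by auto
        then have "(l, Suc x, Suc y) \<in> matrix_positions r w i" using True by (simp add: matrix_positions_def)
        then show "part T l $$ (x, y) = a l $$ (x, y)"
          using zero[of l "Suc x" "Suc y"] xy True by (auto simp: part_def)
      qed (use al True in \<open>auto simp: part_def\<close>)
    next
      case False
      then show ?thesis using a by (auto simp: part_def factor_alg_simps PiE_def extensional_def)
    qed
  qed
  ultimately show ?thesis using sumU[of T] fin T by simp
qed

locale free_product_module =
  fixes m :: nat and r :: "nat \<Rightarrow> nat" and w :: "nat \<Rightarrow> nat \<Rightarrow> nat"
    and M :: "('k::field free_prod_elem, 'v) module"
  assumes left_M: "left_module (free_prod_alg m r w) M"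
begin

sublocale coproduct_module "{1..m}" "factor_alg r w :: nat \<Rightarrow> ('k, nat \<Rightarrow> 'k mat) module" M
proof (rule coproduct_module.intro)
  show "coproduct_data {1..m} (factor_alg r w :: nat \<Rightarrow> ('k, nat \<Rightarrow> 'k mat) module)"
    by (rule coproduct_data_factor_alg)
  show "coproduct_module_axioms {1..m} (factor_alg r w) M"
    by (rule coproduct_module_axioms.intro) (rule left_M[unfolded free_prod_alg_def])
qed

abbreviation "FP \<equiv> (free_prod_alg m r w :: ('k, 'k free_prod_elem) module)"
abbreviation "V' \<equiv> underlying_vs FP M"

lemma FP: "FP = coproduct_algebra {1..m} (factor_alg r w)"
  by (simp add: free_prod_alg_def)

definition unit_act :: "nat \<Rightarrow> nat \<Rightarrow> nat \<Rightarrow> nat \<Rightarrow> 'v \<Rightarrow> 'v" where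
  "unit_act i j p q x = matrix_unit_elem m r w i j p q \<odot>\<^bsub>M\<^esub> x"

lemma kvs: "kvs V'"
  unfolding FP by (rule kvs_V)

lemma unit_act_emb: "unit_act i j p q x = act i (unit_block r w i j p q) x"
  by (simp add: unit_act_def elem_emb)

lemma unit_block_closed: "unit_block r w i j p q \<in> carrier (factor_alg r w i :: ('k, nat \<Rightarrow> 'k mat) module)"
  by (rule block_closed) simp

lemma unit_act_klin: "i \<in> {1..m} \<Longrightarrow> klin V' V' (unit_act i j p q)"
  unfolding FP unit_act_emb[abs_def] by (rule act_klin[OF emb_closed[OF _ unit_block_closed]])

lemma zero_smult: "y \<in> carrier M \<Longrightarrow> 0 \<odot>\<^bsub>V'\<^esub> y = \<zero>\<^bsub>M\<^esub>"
  using kvs_simps(3)[OF kvs, of y] by simp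

text \<open>The multiplication rule of matrix units; different blocks annihilate each other.\<close>

lemma unit_act_unit_act:
  assumes i: "i \<in> {1..m}" and x: "x \<in> carrier M" and "q \<in> {1..w i j}" "p' \<in> {1..w i j'}"
  shows "unit_act i j p q (unit_act i j' p' q' x) = (if j = j' \<and> q = p' then unit_act i j p q' x else \<zero>\<^bsub>M\<^esub>)"
proof -
  note u = unit_block_closed
  have "unit_act i j p q (unit_act i j' p' q' x)
     = act i (unit_block r w i j p q \<otimes>\<^bsub>factor_alg r w i\<^esub> unit_block r w i j' p' q') x"
    unfolding unit_act_emb by (rule act_hom(2)[OF i u x u, symmetric])
  also have "\<dots> = (if j = j' \<and> q = p' then unit_act i j p q' x else \<zero>\<^bsub>M\<^esub>)"
    unfolding unit_block_mult[where w = w and i = i and j = j and j' = j' and q = q and p' = p', OF assms(3,4)]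
    using act_hom(3)[OF i u x, of 0 j p q] zero_smult[OF act_closed[OF i u x]]
    by (auto simp: unit_act_emb FP)
  finally show ?thesis .
qed

lemma act_expansion:
  fixes a :: "nat \<Rightarrow> 'k mat"
  assumes i: "i \<in> {1..m}" and x: "x \<in> carrier M" and a: "a \<in> carrier (factor_alg r w i)"
    and T: "T \<subseteq> matrix_positions r w i"
    and zero: "\<And>j p q. (j, p, q) \<in> matrix_positions r w i - T \<Longrightarrow> a j $$ (p - 1, q - 1) = 0"
  shows "act i a x = (\<Oplus>\<^bsub>V'\<^esub>t\<in>T. (a (fst t) $$ (fst (snd t) - 1, snd (snd t) - 1)) \<odot>\<^bsub>V'\<^esub> unit_act i (fst t) (fst (snd t)) (snd (snd t)) x)"
  unfolding unit_act_emb
  by (rule matrix_unit_expansion[OF kvs _ _ _ a T zero])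
    (use act_closed[OF i _ x] act_hom(1,3)[OF i _ x] in \<open>simp_all add: FP\<close>)

lemma diagonal_expansion:
  fixes a :: "nat \<Rightarrow> 'k mat"
  assumes i: "i \<in> {1..m}" and x: "x \<in> carrier M" and js: "js \<subseteq> {1..r i}"
    and a: "a \<in> carrier (factor_alg r w i)"
    and one: "\<And>j. j \<in> js \<Longrightarrow> a j = 1\<^sub>m (w i j)" and zero: "\<And>j. j \<in> {1..r i} - js \<Longrightarrow> a j = 0\<^sub>m (w i j) (w i j)"
  shows "act i a x = (\<Oplus>\<^bsub>V'\<^esub>s\<in>(SIGMA j:js. {1..w i j}). unit_act i (fst s) (snd s) (snd s) x)"
proof -
  interpret V: abelian_group V' by (rule kvs_abelian_group[OF kvs])
  let ?D = "\<lambda>(j, p). (j, p, p)"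
  let ?T = "?D ` (SIGMA j:js. {1..w i j})"
  have uc: "unit_act i j p q x \<in> carrier V'" for j p q using klinD(3)[OF unit_act_klin[OF i], of x] x by simp
  have "act i a x = (\<Oplus>\<^bsub>V'\<^esub>t\<in>?T. (a (fst t) $$ (fst (snd t) - 1, snd (snd t) - 1)) \<odot>\<^bsub>V'\<^esub> unit_act i (fst t) (fst (snd t)) (snd (snd t)) x)"
  proof (rule act_expansion[OF i x a])
    show "?T \<subseteq> matrix_positions r w i" using js by (auto simp: matrix_positions_def)
    fix j p q assume jpq: "(j, p, q) \<in> matrix_positions r w i - ?T"
    then have "j \<in> {1..r i}" "p \<in> {1..w i j}" "q \<in> {1..w i j}" by (auto simp: matrix_positions_def)
    moreover from this have "j \<in> js \<Longrightarrow> p \<noteq> q" using jpq by (auto simp: image_iff)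
    ultimately show "a j $$ (p - 1, q - 1) = 0" using one zero by (cases "j \<in> js") auto
  qed
  also have "\<dots> = (\<Oplus>\<^bsub>V'\<^esub>s\<in>(SIGMA j:js. {1..w i j}). (a (fst (?D s)) $$ (fst (snd (?D s)) - 1, snd (snd (?D s)) - 1)) \<odot>\<^bsub>V'\<^esub> unit_act i (fst (?D s)) (fst (snd (?D s))) (snd (snd (?D s))) x)"
    by (rule V.finsum_reindex) (use uc kvs_simps(1)[OF kvs] in \<open>auto simp: inj_on_def\<close>)
  also have "\<dots> = (\<Oplus>\<^bsub>V'\<^esub>s\<in>(SIGMA j:js. {1..w i j}). unit_act i (fst s) (snd s) (snd s) x)"
    using one uc by (intro V.finsum_cong') (auto simp: kvs_simps(2)[OF kvs])
  finally show ?thesis .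
qed

lemma identity_expansion:
  assumes i: "i \<in> {1..m}" and x: "x \<in> carrier M"
  shows "x = (\<Oplus>\<^bsub>V'\<^esub>s\<in>(SIGMA j:{1..r i}. {1..w i j}). unit_act i (fst s) (snd s) (snd s) x)"
proof -
  have "act i \<one>\<^bsub>factor_alg r w i\<^esub> x = (\<Oplus>\<^bsub>V'\<^esub>s\<in>(SIGMA j:{1..r i}. {1..w i j}). unit_act i (fst s) (snd s) (snd s) x)"
    by (rule diagonal_expansion[OF i x subset_refl B_closed(4)[OF i]]) (auto simp: factor_alg_simps)
  then show ?thesis by (simp only: act_hom(4)[OF i B_closed(4)[OF i] x])
qed

lemma block_one_expansion:
  assumes i: "i \<in> {1..m}" and j: "j \<in> {1..r i}" and x: "x \<in> carrier M"
  shows "block_one_elem m r w i j \<odot>\<^bsub>M\<^esub> x = (\<Oplus>\<^bsub>V'\<^esub>p\<in>{1..w i j}. unit_act i j p p x)"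
proof -
  interpret V: abelian_group V' by (rule kvs_abelian_group[OF kvs])
  have uc: "unit_act i j p q x \<in> carrier V'" for j p q using klinD(3)[OF unit_act_klin[OF i], of x] x by simp
  have "block_one_elem m r w i j \<odot>\<^bsub>M\<^esub> x = (\<Oplus>\<^bsub>V'\<^esub>s\<in>(SIGMA j:{j}. {1..w i j}). unit_act i (fst s) (snd s) (snd s) x)"
    unfolding elem_emb by (rule diagonal_expansion[OF i x _ block_closed]) (use j in \<open>auto simp: block_def\<close>)
  also have "(SIGMA j:{j}. {1..w i j}) = Pair j ` {1..w i j}" by auto
  also have "(\<Oplus>\<^bsub>V'\<^esub>s\<in>Pair j ` {1..w i j}. unit_act i (fst s) (snd s) (snd s) x) = (\<Oplus>\<^bsub>V'\<^esub>p\<in>{1..w i j}. unit_act i j p p x)"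
    using uc by (subst V.finsum_reindex) (auto simp: inj_on_def)
  finally show ?thesis .
qed

lemma submodule_unit_act:
  "Module.submodule N FP M \<longleftrightarrow> ksub N V' \<and>
     (\<forall>i\<in>{1..m}. \<forall>j\<in>{1..r i}. \<forall>p\<in>{1..w i j}. \<forall>q\<in>{1..w i j}. \<forall>x\<in>N. unit_act i j p q x \<in> N)"
  unfolding FP submodule_iff
proof (intro conj_cong refl iffI ballI)
  fix i j p q x
  assume "\<forall>i\<in>{1..m}. \<forall>a\<in>carrier (factor_alg r w i). \<forall>x\<in>N. act i a x \<in> N" "i \<in> {1..m}" "x \<in> N"
  then show "unit_act i j p q x \<in> N" unfolding unit_act_emb using unit_block_closed by blast
next
  fix i :: nat and a :: "nat \<Rightarrow> 'k mat" and x
  assume N: "ksub N (underlying_vs (coproduct_algebra {1..m} (factor_alg r w)) M)"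
    and u: "\<forall>i\<in>{1..m}. \<forall>j\<in>{1..r i}. \<forall>p\<in>{1..w i j}. \<forall>q\<in>{1..w i j}. \<forall>x\<in>N. unit_act i j p q x \<in> N"
    and i: "i \<in> {1..m}" and a: "a \<in> carrier (factor_alg r w i)" and x: "x \<in> N"
  have N': "ksub N V'" using N by (simp add: FP)
  have xM: "x \<in> carrier M" using ksubD(2)[OF N'] x by auto
  have "act i a x = (\<Oplus>\<^bsub>V'\<^esub>t\<in>matrix_positions r w i. (a (fst t) $$ (fst (snd t) - 1, snd (snd t) - 1)) \<odot>\<^bsub>V'\<^esub> unit_act i (fst t) (fst (snd t)) (snd (snd t)) x)"
    by (rule act_expansion[OF i xM a]) auto
  also have "\<dots> \<in> N"
  proof (rule finsum_subspace(2)[OF N'], rule Pi_I, rule ksubD(5)[OF N'])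
    fix t assume "t \<in> matrix_positions r w i"
    then have "fst t \<in> {1..r i}" "fst (snd t) \<in> {1..w i (fst t)}" "snd (snd t) \<in> {1..w i (fst t)}"
      by (auto simp: matrix_positions_def)
    then show "unit_act i (fst t) (fst (snd t)) (snd (snd t)) x \<in> N" using u i x by blast
  qed
  finally show "act i a x \<in> N" .
qed

abbreviation "F \<equiv> functor_F m r w M"
abbreviation "corner i j \<equiv> unit_act i j 1 1 ` carrier M"

lemma functor_F_simps:
  "vspace F Sink = V'"
  "vspace F (Src i j) = V'\<lparr>carrier := corner i j\<rparr>"
  "amap F (i, j, k) x = unit_act i j k 1 x"
  by (simp_all add: functor_F_def image_space_def unit_act_def)

lemma full_ksub: "ksub (carrier M) V'"
  by (rule ksubI[OF kvs]) (auto simp: kvs_simps[OF kvs, simplified])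

lemma corner_ksub: "i \<in> {1..m} \<Longrightarrow> ksub (corner i j) V'"
  by (rule ksub_image[OF unit_act_klin full_ksub])

lemma corner_iff:
  assumes i: "i \<in> {1..m}" and w: "w i j \<ge> 1"
  shows "x \<in> corner i j \<longleftrightarrow> x \<in> carrier M \<and> unit_act i j 1 1 x = x"
proof
  assume "x \<in> corner i j"
  then obtain y where y: "y \<in> carrier M" "x = unit_act i j 1 1 y" by blast
  then show "x \<in> carrier M \<and> unit_act i j 1 1 x = x"
    using unit_act_unit_act[OF i y(1), of 1 j 1 j 1 1] w klinD(3)[OF unit_act_klin[OF i], of y] by simp
qed (metis imageI)

lemma unit_act_corner:
  assumes i: "i \<in> {1..m}" and w: "w i j \<ge> 1" and q: "q \<in> {1..w i j}" and x: "x \<in> carrier M"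
  shows "unit_act i j 1 q x \<in> corner i j"
  unfolding corner_iff[of i j, OF i w]
  using unit_act_unit_act[OF i x, of 1 j 1 j 1 q] w klinD(3)[OF unit_act_klin[OF i], of x] x by simp

lemma fd_functor_F:
  assumes fd: "kfd V'"
  shows "fd_quiver_rep (Gam m r w) F"
  unfolding fd_quiver_rep_def
proof (intro conjI ballI)
  fix v assume "v \<in> verts (Gam m r w)"
  then consider "v = Sink" | i j where "v = Src i j" "i \<in> {1..m}" by auto
  then have "kvs (vspace F v) \<and> kfd (vspace F v)"
    using kvs fd ksubD(6)[OF corner_ksub] subspace_fd(1)[OF fd corner_ksub]
    by cases (simp_all add: functor_F_simps)
  then show "kvs (vspace F v)" "kfd (vspace F v)" by auto
next
  fix e assume "e \<in> arcs (Gam m r w)"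
  then obtain i j k where e: "e = (i, j, k)" "i \<in> {1..m}" by auto
  have "klin (V'\<lparr>carrier := corner i j\<rparr>) (V'\<lparr>carrier := carrier M\<rparr>) (unit_act i j k 1)"
    by (rule klin_restrict[OF unit_act_klin[OF e(2)] corner_ksub[OF e(2)] full_ksub])
      (use klinD(3)[OF unit_act_klin[OF e(2)]] klinD(3)[OF unit_act_klin[OF e(2), of j 1 1]] in auto)
  moreover have "V'\<lparr>carrier := carrier M\<rparr> = V'" by (simp add: underlying_vs_def)
  moreover have "amap F (i, j, k) = unit_act i j k 1" by (rule ext) (simp add: functor_F_simps)
  ultimately show "klin (vspace F (tail (Gam m r w) e)) (vspace F (head (Gam m r w) e)) (amap F e)"
    by (simp add: e(1) functor_F_simps)
qed

text \<open>The operator of the matrix unit with indices \<open>1\<close>, \<open>k\<close> in block \<open>j\<close> picks out the summand \<open>(j, k)\<close>.\<close>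

lemma total_component:
  assumes i: "i \<in> {1..m}"
    and S: "S \<subseteq> (SIGMA j:{1..r i}. {1..w i j})"
    and y: "\<And>s. s \<in> S \<Longrightarrow> y s \<in> corner i (fst s)" and jk: "(j, k) \<in> S"
  shows "unit_act i j 1 k (\<Oplus>\<^bsub>V'\<^esub>s\<in>S. unit_act i (fst s) (snd s) 1 (y s)) = y (j, k)"
proof -
  interpret V: abelian_group V' by (rule kvs_abelian_group[OF kvs])
  have yM: "y s \<in> carrier M" if "s \<in> S" for s using y[OF that] ksubD(2)[OF corner_ksub[OF i]] by auto
  have uc: "unit_act i j p q x \<in> carrier V'" if "x \<in> carrier M" for j p q x
    using klinD(3)[OF unit_act_klin[OF i], of x] that by simp
  have fin: "finite S" using finite_subset[OF S] by auto
  have "unit_act i j 1 k (\<Oplus>\<^bsub>V'\<^esub>s\<in>S. unit_act i (fst s) (snd s) 1 (y s))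
     = (\<Oplus>\<^bsub>V'\<^esub>s\<in>S. unit_act i j 1 k (unit_act i (fst s) (snd s) 1 (y s)))"
    by (rule klin_finsum[OF unit_act_klin[OF i]]) (use uc yM in auto)
  also have "\<dots> = (\<Oplus>\<^bsub>V'\<^esub>s\<in>S. if (j, k) = s then y s else \<zero>\<^bsub>V'\<^esub>)"
  proof (rule V.finsum_cong'[OF refl])
    fix s assume s: "s \<in> S"
    obtain j' k' where s': "s = (j', k')" "j' \<in> {1..r i}" "k' \<in> {1..w i j'}" using s S by auto
    have k: "k \<in> {1..w i j}" using jk S by auto
    have "w i j' \<ge> 1" using s'(3) by simp
    then have "unit_act i j' 1 1 (y s) = y s" using y[OF s] corner_iff[OF i] s'(1) by simp
    then show "unit_act i j 1 k (unit_act i (fst s) (snd s) 1 (y s)) = (if (j, k) = s then y s else \<zero>\<^bsub>V'\<^esub>)"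
      using unit_act_unit_act[OF i yM[OF s] k s'(3), of 1 1] s'(1) by auto
  qed (use yM in auto)
  also have "\<dots> = y (j, k)"
    by (rule V.finsum_singleton[OF jk fin]) (use yM in auto)
  finally show ?thesis .
qed

text \<open>The inverse of the total map sends \<open>x\<close> to its components \<open>unit_act i j 1 k x\<close>; these recover \<open>x\<close> because the
  diagonal matrix units add up to the identity.\<close>

lemma balanced_functor_F:
  assumes w: "\<And>i j. i \<in> {1..m} \<Longrightarrow> j \<in> {1..r i} \<Longrightarrow> w i j \<ge> 1"
  shows "balanced_rep m r w F"
  unfolding balanced_rep_def Let_def functor_F_simps
proof
  fix i assume i: "i \<in> {1..m}"
  interpret V: abelian_group V' by (rule kvs_abelian_group[OF kvs])
  let ?S = "SIGMA j:{1..r i}. {1..w i j}"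
  let ?W = "\<Pi>\<^sub>E s\<in>?S. carrier (V'\<lparr>carrier := corner i (fst s)\<rparr>)"
  let ?t = "\<lambda>y. \<Oplus>\<^bsub>V'\<^esub>s\<in>?S. unit_act i (fst s) (snd s) 1 (y s)"
  have uc: "unit_act i j p q x \<in> carrier V'" if "x \<in> carrier M" for j p q x
    using klinD(3)[OF unit_act_klin[OF i], of x] that by simp
  have cM: "x \<in> carrier M" if "x \<in> corner i j" for x j using that ksubD(2)[OF corner_ksub[OF i]] by auto
  have comp: "unit_act i (fst s) 1 (snd s) (?t y) = y s" if y: "y \<in> ?W" and s: "s \<in> ?S" for y s
    using total_component[OF i subset_refl, of y "fst s" "snd s"] y s by (auto simp: PiE_def Pi_def)
  show "bij_betw ?t ?W (carrier V')"
    unfolding bij_betw_def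
  proof
    show "inj_on ?t ?W"
    proof (rule inj_onI)
      fix y y' assume y: "y \<in> ?W" "y' \<in> ?W" and eq: "?t y = ?t y'"
      show "y = y'"
      proof (rule PiE_ext[OF y])
        fix s assume s: "s \<in> ?S"
        show "y s = y' s" using comp[OF y(1) s] comp[OF y(2) s] eq by simp
      qed
    qed
    show "?t ` ?W = carrier V'"
    proof
      show "?t ` ?W \<subseteq> carrier V'"
      proof
        fix x assume "x \<in> ?t ` ?W"
        then obtain y where y: "y \<in> ?W" "x = ?t y" by blast
        have "y s \<in> carrier M" if "s \<in> ?S" for s using PiE_mem[OF y(1) that] cM by simp
        then show "x \<in> carrier V'" unfolding y(2) using uc by (intro V.finsum_closed) auto
      qed
      show "carrier V' \<subseteq> ?t ` ?W"
      proof
        fix x assume "x \<in> carrier V'"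
        then have x: "x \<in> carrier M" by simp
        let ?y = "\<lambda>s\<in>?S. unit_act i (fst s) 1 (snd s) x"
        have yW: "?y \<in> ?W" using unit_act_corner[OF i _ _ x] w[OF i] by auto
        have ty: "?t ?y = (\<Oplus>\<^bsub>V'\<^esub>s\<in>?S. unit_act i (fst s) (snd s) (snd s) x)"
        proof (rule V.finsum_cong'[OF refl])
          fix s assume s: "s \<in> ?S"
          then show "unit_act i (fst s) (snd s) 1 (?y s) = unit_act i (fst s) (snd s) (snd s) x"
            using unit_act_unit_act[OF i x, of 1 "fst s" 1 "fst s" "snd s" "snd s"] w[OF i] by auto
        qed (use uc x in auto)
        show "x \<in> ?t ` ?W"
          by (rule image_eqI[OF _ yW]) (simp only: ty, rule identity_expansion[OF i x])
      qed
    qed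
  qed
qed

text \<open>The image of the central idempotent of a block is the direct sum of as many copies of the corner space as
  the weight says.\<close>

lemma block_one_dim:
  assumes i: "i \<in> {1..m}" and j: "j \<in> {1..r i}" and w: "w i j \<ge> 1" and fd: "kfd V'"
  shows "kdim (image_space FP M (block_one_elem m r w i j)) = w i j * kdim (vspace F (Src i j))"
proof -
  let ?E = "\<lambda>x. block_one_elem m r w i j \<odot>\<^bsub>M\<^esub> x"
  let ?N = "?E ` carrier M"
  interpret V: abelian_group V' by (rule kvs_abelian_group[OF kvs])
  have uc: "unit_act i j p q x \<in> carrier V'" if "x \<in> carrier M" for j p q x
    using klinD(3)[OF unit_act_klin[OF i], of x] that by simp
  have bc: "block r w i j (1\<^sub>m (w i j)) \<in> carrier (factor_alg r w i :: ('k, nat \<Rightarrow> 'k mat) module)"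
    by (rule block_closed) simp
  have Elin: "klin V' V' ?E"
    unfolding FP elem_emb by (rule act_klin[OF emb_closed[OF i bc]])
  have N: "ksub ?N V'" by (rule ksub_image[OF Elin full_ksub])
  have im: "image_space FP M (block_one_elem m r w i j) = V'\<lparr>carrier := ?N\<rparr>"
    by (simp add: image_space_def)
  have Eu: "?E (unit_act i j p q x) = unit_act i j p q x" if x: "x \<in> carrier M" for p q x
    unfolding elem_emb unit_act_emb act_hom(2)[OF i bc x unit_block_closed, symmetric] block_one_mult ..
  have uN: "unit_act i j p q x \<in> ?N" if x: "x \<in> carrier M" for p q x
  proof -
    have "unit_act i j p q x \<in> carrier M" using uc[OF x] by simp
    then have "?E (unit_act i j p q x) \<in> ?N" by (rule imageI)
    then show ?thesis unfolding Eu[OF x] .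
  qed
  let ?C = "V'\<lparr>carrier := corner i j\<rparr>"
  have cM: "x \<in> carrier M" if "x \<in> corner i j" for x using that ksubD(2)[OF corner_ksub[OF i]] by auto
  interpret D: direct_sum_map "{1..w i j}" "\<lambda>_. ?C" "V'\<lparr>carrier := ?N\<rparr>" "\<lambda>k. unit_act i j k 1"
  proof (rule direct_sum_map.intro)
    fix k assume "k \<in> {1..w i j}"
    show "klin ?C (V'\<lparr>carrier := ?N\<rparr>) (unit_act i j k 1)"
      by (rule klin_restrict[OF unit_act_klin[OF i] corner_ksub[OF i] N]) (use uN cM in blast)
    show "kfd ?C" by (rule subspace_fd(1)[OF fd corner_ksub[OF i]])
  qed (simp_all add: ksubD(6)[OF N])
  have tot: "D.total y = (\<Oplus>\<^bsub>V'\<^esub>k\<in>{1..w i j}. unit_act i j k 1 (y k))"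
    if "\<And>k. k \<in> {1..w i j} \<Longrightarrow> y k \<in> corner i j" for y
    unfolding D.total_def by (rule finsum_subspace(1)[OF N]) (use that cM uN in auto)
  have comp: "unit_act i j 1 k (D.total y) = y k"
    if y: "\<And>k. k \<in> {1..w i j} \<Longrightarrow> y k \<in> corner i j" and k: "k \<in> {1..w i j}" for y k
  proof -
    let ?S = "Pair j ` {1..w i j}"
    have "(\<Oplus>\<^bsub>V'\<^esub>s\<in>?S. unit_act i (fst s) (snd s) 1 ((y \<circ> snd) s))
      = (\<Oplus>\<^bsub>V'\<^esub>k\<in>{1..w i j}. unit_act i (fst (j, k)) (snd (j, k)) 1 ((y \<circ> snd) (j, k)))"
      by (rule V.finsum_reindex) (use y cM uc in \<open>auto simp: inj_on_def\<close>)
    then have "D.total y = (\<Oplus>\<^bsub>V'\<^esub>s\<in>?S. unit_act i (fst s) (snd s) 1 ((y \<circ> snd) s))"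
      using tot[of y, OF y] by simp
    moreover have "unit_act i j 1 k (\<Oplus>\<^bsub>V'\<^esub>s\<in>?S. unit_act i (fst s) (snd s) 1 ((y \<circ> snd) s)) = (y \<circ> snd) (j, k)"
    proof (rule total_component[OF i])
      show "?S \<subseteq> (SIGMA j:{1..r i}. {1..w i j})" using j by auto
      show "(y \<circ> snd) s \<in> corner i (fst s)" if "s \<in> ?S" for s using that y by auto
      show "(j, k) \<in> ?S" using k by blast
    qed
    ultimately show ?thesis by simp
  qed
  have "(\<Sum>k\<in>{1..w i j}. kdim ?C) \<le> kdim (V'\<lparr>carrier := ?N\<rparr>)"
  proof (rule D.sum_dim_le(1)[OF _ subspace_fd(1)[OF fd N]])
    fix y assume y: "y \<in> (\<Pi>\<^sub>E k\<in>{1..w i j}. carrier ?C)" and z: "D.total y = \<zero>\<^bsub>V'\<lparr>carrier := ?N\<rparr>\<^esub>"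
    have yc: "\<And>k. k \<in> {1..w i j} \<Longrightarrow> y k \<in> corner i j" using PiE_mem[OF y] by simp
    show "\<forall>k\<in>{1..w i j}. y k = \<zero>\<^bsub>?C\<^esub>"
    proof
      fix k assume k: "k \<in> {1..w i j}"
      have "y k = unit_act i j 1 k \<zero>\<^bsub>V'\<^esub>" using comp[of y, OF yc k] z by simp
      also have "\<dots> = \<zero>\<^bsub>V'\<^esub>" by (rule klinD(6)[OF unit_act_klin[OF i]])
      finally show "y k = \<zero>\<^bsub>?C\<^esub>" by simp
    qed
  qed
  moreover have "kdim (V'\<lparr>carrier := ?N\<rparr>) \<le> (\<Sum>k\<in>{1..w i j}. kdim ?C)"
  proof (rule D.dim_le_sum(2))
    fix x assume "x \<in> carrier (V'\<lparr>carrier := ?N\<rparr>)"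
    then obtain z where z: "z \<in> carrier M" "x = ?E z" by auto
    let ?y = "\<lambda>k\<in>{1..w i j}. unit_act i j 1 k z"
    have yc: "?y k \<in> corner i j" if "k \<in> {1..w i j}" for k
      using unit_act_corner[OF i w that z(1)] that by simp
    have "x = (\<Oplus>\<^bsub>V'\<^esub>p\<in>{1..w i j}. unit_act i j p p z)" unfolding z(2) by (rule block_one_expansion[OF i j z(1)])
    also have "\<dots> = (\<Oplus>\<^bsub>V'\<^esub>p\<in>{1..w i j}. unit_act i j p 1 (?y p))"
    proof (rule V.finsum_cong'[OF refl])
      show "(\<lambda>p. unit_act i j p 1 (?y p)) \<in> {1..w i j} \<rightarrow> carrier V'" using uc z(1) by auto
      fix p assume p: "p \<in> {1..w i j}"
      then show "unit_act i j p p z = unit_act i j p 1 (?y p)"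
        using unit_act_unit_act[OF i z(1), of 1 j 1 j p p] w by simp
    qed
    also have "\<dots> = D.total ?y" using tot[of ?y, OF yc] by simp
    finally show "\<exists>y\<in>(\<Pi>\<^sub>E k\<in>{1..w i j}. carrier ?C). D.total y = x"
      using yc by (intro bexI[of _ ?y]) auto
  qed
  ultimately show ?thesis unfolding im functor_F_simps by simp
qed

end

section \<open>The module of a balanced point\<close>

text \<open>The inverse construction to the functor: through the total map of its cluster, the space at the sink is
  a direct sum of \<open>w i j\<close> copies of the space at \<open>Src i j\<close>, and a matrix acts by mixing the copies.\<close>

locale balanced_point = balanced_representation m r w d "matrix_rep d P"
  for m r w d and P :: "arrow \<Rightarrow> 'k::field mat" +
  assumes P: "P \<in> rep_space (Gam m r w) d"
begin

abbreviation "n \<equiv> d Sink"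
abbreviation "vs k \<equiv> module_vec TYPE('k) k"
abbreviation "ds i s \<equiv> d (Src i (fst s))"

definition tot :: "nat \<Rightarrow> (nat \<times> nat \<Rightarrow> 'k vec) \<Rightarrow> 'k vec" where
  "tot i x = (\<Oplus>\<^bsub>vs n\<^esub>s\<in>cluster_arrows r w i. P (i, fst s, snd s) *\<^sub>v x s)"

lemma point_cluster:
  assumes i: "i \<in> {1..m}"
  shows "direct_sum_map (cluster_arrows r w i) (\<lambda>s. vs (ds i s)) (vs n) (\<lambda>s x. P (i, fst s, snd s) *\<^sub>v x)"
  using cluster[OF i] by (simp add: matrix_rep_def)

lemma tot_total: "i \<in> {1..m} \<Longrightarrow>
  direct_sum_map.total (cluster_arrows r w i) (vs n) (\<lambda>s x. P (i, fst s, snd s) *\<^sub>v x) x = tot i x"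
  unfolding tot_def by (rule direct_sum_map.total_def[OF point_cluster])

context
  fixes i assumes i: "i \<in> {1..m}"
begin

interpretation D: direct_sum_map "cluster_arrows r w i" "\<lambda>s. vs (ds i s)" "vs n" "\<lambda>s x. P (i, fst s, snd s) *\<^sub>v x"
  by (rule point_cluster[OF i])

lemma tot_cong:
  assumes "\<And>s. s \<in> cluster_arrows r w i \<Longrightarrow> x s \<in> carrier_vec (ds i s)"
    "\<And>s. s \<in> cluster_arrows r w i \<Longrightarrow> x s = y s"
  shows "tot i x = tot i y"
  unfolding tot_total[OF i, symmetric] by (rule D.total_cong[unfolded vec_space_simps]) (rule assms, assumption)+

lemma tot_closed:
  "(\<And>s. s \<in> cluster_arrows r w i \<Longrightarrow> x s \<in> carrier_vec (ds i s)) \<Longrightarrow> tot i x \<in> carrier_vec n"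
  unfolding tot_total[OF i, symmetric] by (rule D.total_closed[unfolded vec_space_simps])

lemma tot_add:
  assumes "\<And>s. s \<in> cluster_arrows r w i \<Longrightarrow> x s \<in> carrier_vec (ds i s)"
    "\<And>s. s \<in> cluster_arrows r w i \<Longrightarrow> y s \<in> carrier_vec (ds i s)"
  shows "tot i (\<lambda>s. x s + y s) = tot i x + tot i y"
  unfolding tot_total[OF i, symmetric] by (rule D.total_add[unfolded vec_space_simps]) (rule assms, assumption)+

lemma tot_smult:
  assumes "\<And>s. s \<in> cluster_arrows r w i \<Longrightarrow> x s \<in> carrier_vec (ds i s)"
  shows "tot i (\<lambda>s. c \<cdot>\<^sub>v x s) = c \<cdot>\<^sub>v tot i x"
  unfolding tot_total[OF i, symmetric] by (rule D.total_smult[unfolded vec_space_simps]) (rule assms, assumption)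

lemma tot_single:
  assumes "t \<in> cluster_arrows r w i" "y \<in> carrier_vec (ds i t)"
  shows "tot i (\<lambda>s. if s = t then y else 0\<^sub>v (ds i s)) = P (i, fst t, snd t) *\<^sub>v y"
  unfolding tot_total[OF i, symmetric] by (rule D.total_single[unfolded vec_space_simps]) (rule assms)+

end

lemma projections_exist:
  assumes i: "i \<in> {1..m}"
  shows "\<exists>\<pi>. (\<forall>s\<in>cluster_arrows r w i. klin (vs n) (vs (ds i s)) (\<pi> s)) \<and>
    (\<forall>v\<in>carrier_vec n. tot i (\<lambda>s. \<pi> s v) = v) \<and>
    (\<forall>x. (\<forall>s\<in>cluster_arrows r w i. x s \<in> carrier_vec (ds i s)) \<longrightarrow>
       (\<forall>s\<in>cluster_arrows r w i. \<pi> s (tot i x) = x s))"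
proof -
  interpret D: direct_sum_map "cluster_arrows r w i" "\<lambda>s. vs (ds i s)" "vs n" "\<lambda>s x. P (i, fst s, snd s) *\<^sub>v x"
    by (rule point_cluster[OF i])
  have "bij_betw D.total (\<Pi>\<^sub>E s\<in>cluster_arrows r w i. carrier (vs (ds i s))) (carrier (vs n))"
    using cluster_bij[OF i] by (simp add: matrix_rep_def)
  then obtain \<pi> where \<pi>: "\<And>s. s \<in> cluster_arrows r w i \<Longrightarrow> klin (vs n) (vs (ds i s)) (\<pi> s)"
    "\<And>v. v \<in> carrier (vs n) \<Longrightarrow> D.total (\<lambda>s. \<pi> s v) = v"
    "\<And>x s. (\<And>s. s \<in> cluster_arrows r w i \<Longrightarrow> x s \<in> carrier (vs (ds i s))) \<Longrightarrow> s \<in> cluster_arrows r w i \<Longrightarrow> \<pi> s (D.total x) = x s"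
    by (rule D.components) blast
  note \<pi> = \<pi>[unfolded tot_total[OF i] vec_space_simps]
  show ?thesis
  proof (intro exI[of _ \<pi>] conjI ballI allI impI \<pi>(1,2))
    fix x :: "nat \<times> nat \<Rightarrow> 'k vec" and s
    assume x: "\<forall>s\<in>cluster_arrows r w i. x s \<in> carrier_vec (ds i s)" and s: "s \<in> cluster_arrows r w i"
    show "\<pi> s (tot i x) = x s" by (rule \<pi>(3)[OF bspec[OF x] s])
  qed
qed

definition proj :: "nat \<Rightarrow> nat \<times> nat \<Rightarrow> 'k vec \<Rightarrow> 'k vec" where
  "proj i = (SOME \<pi>. (\<forall>s\<in>cluster_arrows r w i. klin (vs n) (vs (ds i s)) (\<pi> s)) \<and>
    (\<forall>v\<in>carrier_vec n. tot i (\<lambda>s. \<pi> s v) = v) \<and>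
    (\<forall>x. (\<forall>s\<in>cluster_arrows r w i. x s \<in> carrier_vec (ds i s)) \<longrightarrow>
       (\<forall>s\<in>cluster_arrows r w i. \<pi> s (tot i x) = x s)))"

lemma proj:
  assumes i: "i \<in> {1..m}"
  shows "s \<in> cluster_arrows r w i \<Longrightarrow> klin (vs n) (vs (ds i s)) (proj i s)"
    "v \<in> carrier_vec n \<Longrightarrow> tot i (\<lambda>s. proj i s v) = v"
    "(\<And>s. s \<in> cluster_arrows r w i \<Longrightarrow> x s \<in> carrier_vec (ds i s)) \<Longrightarrow> s \<in> cluster_arrows r w i \<Longrightarrow>
      proj i s (tot i x) = x s"
  using someI_ex[OF projections_exist[OF i]] unfolding proj_def[symmetric] by blast+

lemma proj_closed: "i \<in> {1..m} \<Longrightarrow> s \<in> cluster_arrows r w i \<Longrightarrow> v \<in> carrier_vec n \<Longrightarrow> proj i s v \<in> carrier_vec (ds i s)"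
  using klinD(3)[OF proj(1)] by simp

text \<open>The components of the image of \<open>v\<close> under \<open>a\<close>.\<close>

definition mix :: "nat \<Rightarrow> (nat \<Rightarrow> 'k mat) \<Rightarrow> 'k vec \<Rightarrow> nat \<times> nat \<Rightarrow> 'k vec" where
  "mix i a v s = vec (ds i s)
     (\<lambda>t. \<Sum>q\<in>{1..w i (fst s)}. a (fst s) $$ (snd s - 1, q - 1) * proj i (fst s, q) v $ t)"

definition point_act :: "nat \<Rightarrow> (nat \<Rightarrow> 'k mat) \<Rightarrow> 'k vec \<Rightarrow> 'k vec" where
  "point_act i a v = tot i (mix i a v)"

lemma mix_closed: "mix i a v s \<in> carrier_vec (ds i s)" by (simp add: mix_def)

lemma point_act_closed: "i \<in> {1..m} \<Longrightarrow> point_act i a v \<in> carrier_vec n"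
  unfolding point_act_def by (rule tot_closed[OF _ mix_closed])

lemma proj_point_act: "i \<in> {1..m} \<Longrightarrow> s \<in> cluster_arrows r w i \<Longrightarrow> proj i s (point_act i a v) = mix i a v s"
  unfolding point_act_def by (rule proj(3)[OF _ mix_closed])

abbreviation "B \<equiv> (factor_alg r w :: nat \<Rightarrow> ('k, nat \<Rightarrow> 'k mat) module)"

lemma B_mem: "a \<in> carrier (B i) \<Longrightarrow> j \<in> {1..r i} \<Longrightarrow> a j \<in> carrier_mat (w i j) (w i j)"
  by (auto simp: factor_alg_simps)

lemma arrowE:
  assumes "s \<in> cluster_arrows r w i"
  obtains j p where "s = (j, p)" "j \<in> {1..r i}" "p \<in> {1..w i j}"
  using assms by auto

lemma mix_index:
  "t < d (Src i j) \<Longrightarrow> mix i a v (j, p) $ t = (\<Sum>q\<in>{1..w i j}. a j $$ (p - 1, q - 1) * proj i (j, q) v $ t)"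
  by (simp add: mix_def)

lemma mix_add_index: "t < d (Src i j) \<Longrightarrow> (x + mix i a v (j, p)) $ t = x $ t + mix i a v (j, p) $ t"
  by (simp add: mix_def)

lemma mix_smult_index: "t < d (Src i j) \<Longrightarrow> (c \<cdot>\<^sub>v mix i a v (j, p)) $ t = c * mix i a v (j, p) $ t"
  by (simp add: mix_def)

lemma mix_add:
  assumes i: "i \<in> {1..m}" and s: "s \<in> cluster_arrows r w i" and v: "v \<in> carrier_vec n"
    and a: "a \<in> carrier (B i)" and b: "b \<in> carrier (B i)"
  shows "mix i (a \<oplus>\<^bsub>B i\<^esub> b) v s = mix i a v s + mix i b v s"
proof (rule eq_vecI)
  obtain j p where jp: "s = (j, p)" "j \<in> {1..r i}" "p \<in> {1..w i j}" using s by (rule arrowE)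
  fix t assume "t < dim_vec (mix i a v s + mix i b v s)"
  then have t: "t < d (Src i j)" using mix_closed[of i b v s] jp by simp
  have "(a \<oplus>\<^bsub>B i\<^esub> b) j $$ (p - 1, q - 1) = a j $$ (p - 1, q - 1) + b j $$ (p - 1, q - 1)" if "q \<in> {1..w i j}" for q
  proof -
    have lt: "p - 1 < w i j" "q - 1 < w i j" using jp(3) that by auto
    have "(a \<oplus>\<^bsub>B i\<^esub> b) j = a j + b j" using jp(2) by (simp add: factor_alg_simps)
    then show ?thesis using B_mem[OF b jp(2)] lt by simp
  qed
  then have "mix i (a \<oplus>\<^bsub>B i\<^esub> b) v (j, p) $ t
      = (\<Sum>q\<in>{1..w i j}. a j $$ (p - 1, q - 1) * proj i (j, q) v $ t + b j $$ (p - 1, q - 1) * proj i (j, q) v $ t)"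
    unfolding mix_index[OF t] by (intro sum.cong refl) (simp only: distrib_right)
  then show "mix i (a \<oplus>\<^bsub>B i\<^esub> b) v s $ t = (mix i a v s + mix i b v s) $ t"
    by (simp only: jp(1) mix_add_index[OF t] mix_index[OF t] sum.distrib)
qed (simp add: mix_def)

lemma mix_smult:
  assumes i: "i \<in> {1..m}" and s: "s \<in> cluster_arrows r w i" and a: "a \<in> carrier (B i)"
  shows "mix i (c \<odot>\<^bsub>B i\<^esub> a) v s = c \<cdot>\<^sub>v mix i a v s"
proof (rule eq_vecI)
  obtain j p where jp: "s = (j, p)" "j \<in> {1..r i}" "p \<in> {1..w i j}" using s by (rule arrowE)
  fix t assume "t < dim_vec (c \<cdot>\<^sub>v mix i a v s)"
  then have t: "t < d (Src i j)" using mix_closed[of i a v s] jp by simp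
  have "(c \<odot>\<^bsub>B i\<^esub> a) j $$ (p - 1, q - 1) = c * a j $$ (p - 1, q - 1)" if "q \<in> {1..w i j}" for q
  proof -
    have lt: "p - 1 < w i j" "q - 1 < w i j" using jp(3) that by auto
    have "(c \<odot>\<^bsub>B i\<^esub> a) j = c \<cdot>\<^sub>m a j" using jp(2) by (simp add: factor_alg_simps)
    then show ?thesis using B_mem[OF a jp(2)] lt by simp
  qed
  then have "mix i (c \<odot>\<^bsub>B i\<^esub> a) v (j, p) $ t = (\<Sum>q\<in>{1..w i j}. c * (a j $$ (p - 1, q - 1) * proj i (j, q) v $ t))"
    unfolding mix_index[OF t] by (intro sum.cong refl) (simp only: mult.assoc)
  then show "mix i (c \<odot>\<^bsub>B i\<^esub> a) v s $ t = (c \<cdot>\<^sub>v mix i a v s) $ t"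
    by (simp only: jp(1) mix_smult_index[OF t] mix_index[OF t] sum_distrib_left)
qed (simp add: mix_def)

lemma mix_vec_add:
  assumes i: "i \<in> {1..m}" and s: "s \<in> cluster_arrows r w i" and v: "v \<in> carrier_vec n" "u \<in> carrier_vec n"
  shows "mix i a (v + u) s = mix i a v s + mix i a u s"
proof (rule eq_vecI)
  obtain j p where jp: "s = (j, p)" "j \<in> {1..r i}" "p \<in> {1..w i j}" using s by (rule arrowE)
  fix t assume "t < dim_vec (mix i a v s + mix i a u s)"
  then have t: "t < d (Src i j)" using mix_closed[of i a u s] jp by simp
  have "proj i (j, q) (v + u) $ t = proj i (j, q) v $ t + proj i (j, q) u $ t" if q: "q \<in> {1..w i j}" for q
  proof -
    have jq: "(j, q) \<in> cluster_arrows r w i" using jp q by simp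
    have "proj i (j, q) (v + u) = proj i (j, q) v + proj i (j, q) u"
      using klinD(4)[OF proj(1)[OF i jq], of v u] v by simp
    then show ?thesis using proj_closed[OF i jq v(2)] t by simp
  qed
  then have "mix i a (v + u) (j, p) $ t
      = (\<Sum>q\<in>{1..w i j}. a j $$ (p - 1, q - 1) * proj i (j, q) v $ t + a j $$ (p - 1, q - 1) * proj i (j, q) u $ t)"
    unfolding mix_index[OF t] by (intro sum.cong refl) (simp only: distrib_left)
  then show "mix i a (v + u) s $ t = (mix i a v s + mix i a u s) $ t"
    by (simp only: jp(1) mix_add_index[OF t] mix_index[OF t] sum.distrib)
qed (simp add: mix_def)

lemma mix_vec_smult:
  assumes i: "i \<in> {1..m}" and s: "s \<in> cluster_arrows r w i" and v: "v \<in> carrier_vec n"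
  shows "mix i a (c \<cdot>\<^sub>v v) s = c \<cdot>\<^sub>v mix i a v s"
proof (rule eq_vecI)
  obtain j p where jp: "s = (j, p)" "j \<in> {1..r i}" "p \<in> {1..w i j}" using s by (rule arrowE)
  fix t assume "t < dim_vec (c \<cdot>\<^sub>v mix i a v s)"
  then have t: "t < d (Src i j)" using mix_closed[of i a v s] jp by simp
  have "proj i (j, q) (c \<cdot>\<^sub>v v) $ t = c * proj i (j, q) v $ t" if q: "q \<in> {1..w i j}" for q
  proof -
    have jq: "(j, q) \<in> cluster_arrows r w i" using jp q by simp
    have "proj i (j, q) (c \<cdot>\<^sub>v v) = c \<cdot>\<^sub>v proj i (j, q) v"
      using klinD(5)[OF proj(1)[OF i jq], of v c] v by simp
    then show ?thesis using proj_closed[OF i jq v] t by simp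
  qed
  then have "mix i a (c \<cdot>\<^sub>v v) (j, p) $ t = (\<Sum>q\<in>{1..w i j}. c * (a j $$ (p - 1, q - 1) * proj i (j, q) v $ t))"
    unfolding mix_index[OF t] by (intro sum.cong refl) (simp only: mult.left_commute)
  then show "mix i a (c \<cdot>\<^sub>v v) s $ t = (c \<cdot>\<^sub>v mix i a v s) $ t"
    by (simp only: jp(1) mix_smult_index[OF t] mix_index[OF t] sum_distrib_left)
qed (simp add: mix_def)

lemma mix_one:
  assumes i: "i \<in> {1..m}" and s: "s \<in> cluster_arrows r w i" and v: "v \<in> carrier_vec n"
  shows "mix i \<one>\<^bsub>B i\<^esub> v s = proj i s v"
proof (rule eq_vecI)
  obtain j p where jp: "s = (j, p)" "j \<in> {1..r i}" "p \<in> {1..w i j}" using s by (rule arrowE)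
  note pc = proj_closed[OF i s v]
  show "dim_vec (mix i \<one>\<^bsub>B i\<^esub> v s) = dim_vec (proj i s v)" using pc by (simp add: mix_def)
  fix t assume "t < dim_vec (proj i s v)"
  then have t: "t < d (Src i j)" using pc jp by simp
  have "mix i \<one>\<^bsub>B i\<^esub> v s $ t = (\<Sum>q\<in>{1..w i j}. \<one>\<^bsub>B i\<^esub> j $$ (p - 1, q - 1) * proj i (j, q) v $ t)"
    unfolding jp(1) by (rule mix_index[OF t])
  also have "\<dots> = (\<Sum>q\<in>{1..w i j}. if p = q then proj i (j, q) v $ t else 0)"
  proof (rule sum.cong[OF refl])
    fix q assume q: "q \<in> {1..w i j}"
    have lt: "p - 1 < w i j" "q - 1 < w i j" using jp(3) q by auto
    have "\<one>\<^bsub>B i\<^esub> j = 1\<^sub>m (w i j)" using jp(2) by (simp add: factor_alg_simps)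
    moreover have "p - 1 = q - 1 \<longleftrightarrow> p = q" using jp(3) q by auto
    ultimately show "\<one>\<^bsub>B i\<^esub> j $$ (p - 1, q - 1) * proj i (j, q) v $ t = (if p = q then proj i (j, q) v $ t else 0)"
      using lt by simp
  qed
  also have "\<dots> = proj i s v $ t" using jp by (subst sum.delta') auto
  finally show "mix i \<one>\<^bsub>B i\<^esub> v s $ t = proj i s v $ t" .
qed

lemma mix_mult:
  assumes i: "i \<in> {1..m}" and s: "s \<in> cluster_arrows r w i" and v: "v \<in> carrier_vec n"
    and a: "a \<in> carrier (B i)" and b: "b \<in> carrier (B i)"
  shows "mix i (a \<otimes>\<^bsub>B i\<^esub> b) v s = mix i a (point_act i b v) s"
proof (rule eq_vecI)
  obtain j p where jp: "s = (j, p)" "j \<in> {1..r i}" "p \<in> {1..w i j}" using s by (rule arrowE)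
  show "dim_vec (mix i (a \<otimes>\<^bsub>B i\<^esub> b) v s) = dim_vec (mix i a (point_act i b v) s)" by (simp add: mix_def)
  fix t assume "t < dim_vec (mix i a (point_act i b v) s)"
  then have t: "t < d (Src i j)" using mix_closed[of i a "point_act i b v" s] jp by simp
  let ?y = "\<lambda>q. proj i (j, q) v $ t"
  have ab: "(a \<otimes>\<^bsub>B i\<^esub> b) j $$ (p - 1, q - 1) = (\<Sum>l\<in>{1..w i j}. a j $$ (p - 1, l - 1) * b j $$ (l - 1, q - 1))"
    if q: "q \<in> {1..w i j}" for q
  proof -
    have lt: "p - 1 < w i j" "q - 1 < w i j" using jp(3) q by auto
    have "(a \<otimes>\<^bsub>B i\<^esub> b) j = a j * b j" using jp(2) by (simp add: factor_alg_simps)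
    then have "(a \<otimes>\<^bsub>B i\<^esub> b) j $$ (p - 1, q - 1) = (\<Sum>l<w i j. a j $$ (p - 1, l) * b j $$ (l, q - 1))"
      using B_mem[OF a jp(2)] B_mem[OF b jp(2)] lt by (simp add: scalar_prod_def atLeast0LessThan)
    also have "\<dots> = (\<Sum>l\<in>{1..w i j}. a j $$ (p - 1, l - 1) * b j $$ (l - 1, q - 1))"
      by (rule sum.reindex_bij_witness[of _ "\<lambda>l. l - 1" Suc]) auto
    finally show ?thesis .
  qed
  have "mix i (a \<otimes>\<^bsub>B i\<^esub> b) v s $ t = (\<Sum>q\<in>{1..w i j}. (a \<otimes>\<^bsub>B i\<^esub> b) j $$ (p - 1, q - 1) * ?y q)"
    unfolding jp(1) by (rule mix_index[OF t])
  also have "\<dots> = (\<Sum>q\<in>{1..w i j}. \<Sum>l\<in>{1..w i j}. a j $$ (p - 1, l - 1) * (b j $$ (l - 1, q - 1) * ?y q))"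
    by (intro sum.cong refl) (simp only: ab sum_distrib_right mult.assoc)
  also have "\<dots> = (\<Sum>l\<in>{1..w i j}. a j $$ (p - 1, l - 1) * (\<Sum>q\<in>{1..w i j}. b j $$ (l - 1, q - 1) * ?y q))"
    by (subst sum.swap) (simp only: sum_distrib_left)
  also have "\<dots> = (\<Sum>l\<in>{1..w i j}. a j $$ (p - 1, l - 1) * proj i (j, l) (point_act i b v) $ t)"
  proof (rule sum.cong[OF refl])
    fix l assume l: "l \<in> {1..w i j}"
    then have jl: "(j, l) \<in> cluster_arrows r w i" using jp by simp
    show "a j $$ (p - 1, l - 1) * (\<Sum>q\<in>{1..w i j}. b j $$ (l - 1, q - 1) * ?y q)
      = a j $$ (p - 1, l - 1) * proj i (j, l) (point_act i b v) $ t"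
      unfolding proj_point_act[OF i jl] mix_index[OF t] ..
  qed
  also have "\<dots> = mix i a (point_act i b v) s $ t" unfolding jp(1) by (rule mix_index[OF t, symmetric])
  finally show "mix i (a \<otimes>\<^bsub>B i\<^esub> b) v s $ t = mix i a (point_act i b v) s $ t" .
qed

sublocale act: coproduct_action "{1..m}" B "vs n" point_act
proof (rule coproduct_action.intro[OF coproduct_data_factor_alg], rule coproduct_action_axioms.intro)
  show "kvs (vs n)" by (rule kvs_module_vec)
  fix i :: nat assume i: "i \<in> {1..m}"
  fix a assume a: "a \<in> carrier (B i)"
  note tc = tot_cong[OF i mix_closed]
  show "klin (vs n) (vs n) (point_act i a)"
  proof (rule klinI[OF kvs_module_vec kvs_module_vec], unfold vec_space_simps)
    fix v :: "'k vec" assume v: "v \<in> carrier_vec n"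
    show "point_act i a v \<in> carrier_vec n" by (rule point_act_closed[OF i])
    fix u :: "'k vec" assume u: "u \<in> carrier_vec n"
    show "point_act i a (v + u) = point_act i a v + point_act i a u"
      unfolding point_act_def tot_add[OF i mix_closed mix_closed, symmetric]
      by (rule tc) (rule mix_vec_add[OF i _ v u])
  next
    fix c and v :: "'k vec" assume v: "v \<in> carrier_vec n"
    show "point_act i a (c \<cdot>\<^sub>v v) = c \<cdot>\<^sub>v point_act i a v"
      unfolding point_act_def tot_smult[OF i mix_closed, symmetric]
      by (rule tc) (rule mix_vec_smult[OF i _ v])
  qed
  fix v assume "v \<in> carrier (vs n)"
  then have v: "v \<in> carrier_vec n" by simp
  show "point_act i (c \<odot>\<^bsub>B i\<^esub> a) v = c \<odot>\<^bsub>vs n\<^esub> point_act i a v" for c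
    unfolding point_act_def vec_space_simps tot_smult[OF i mix_closed, symmetric]
    by (rule tc) (rule mix_smult[OF i _ a])
  fix b assume b: "b \<in> carrier (B i)"
  show "point_act i (a \<oplus>\<^bsub>B i\<^esub> b) v = point_act i a v \<oplus>\<^bsub>vs n\<^esub> point_act i b v"
    unfolding point_act_def vec_space_simps tot_add[OF i mix_closed mix_closed, symmetric]
    by (rule tc) (rule mix_add[OF i _ v a b])
  show "point_act i (a \<otimes>\<^bsub>B i\<^esub> b) v = point_act i a (point_act i b v)"
    unfolding point_act_def[of i "a \<otimes>\<^bsub>B i\<^esub> b"] point_act_def[of i a]
    by (rule tc) (rule mix_mult[OF i _ v a b])
next
  fix i v assume i: "i \<in> {1..m}" and "v \<in> carrier (vs n)"
  then have v: "v \<in> carrier_vec n" by simp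
  have "point_act i \<one>\<^bsub>B i\<^esub> v = tot i (\<lambda>s. proj i s v)"
    unfolding point_act_def by (rule tot_cong[OF i mix_closed]) (rule mix_one[OF i _ v])
  then show "point_act i \<one>\<^bsub>B i\<^esub> v = v" using proj(2)[OF i v] by simp
qed

definition point_module :: "('k free_prod_elem, 'k vec) module" where
  "point_module = act.action_module"

lemma left_module_point: "left_module (free_prod_alg m r w) point_module"
  unfolding point_module_def free_prod_alg_def by (rule act.left_module_action_module)

sublocale pm: free_product_module m r w point_module
  by (rule free_product_module.intro[OF left_module_point])

lemma carrier_point_module [simp]: "carrier point_module = carrier_vec n"
  by (simp add: point_module_def)

lemma point_module_id: "klin pm.V' (vs n) (\<lambda>x. x)"
proof (rule klinI[OF pm.kvs kvs_module_vec])
  fix c x assume "x \<in> carrier pm.V'"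
  then show "c \<odot>\<^bsub>pm.V'\<^esub> x = c \<odot>\<^bsub>vs n\<^esub> x"
    using act.action_module_scalar[of x c] by (simp add: point_module_def free_prod_alg_def)
qed (simp_all add: point_module_def)

lemma fd_point_module: "fd_left_module (free_prod_alg m r w) point_module"
proof -
  have "klin (vs n) pm.V' (inv_into (carrier pm.V') (\<lambda>x. x))"
    by (rule klin_inv[OF point_module_id]) (simp add: bij_betw_def)
  moreover have "bij_betw (inv_into (carrier pm.V') (\<lambda>x. x)) (carrier (vs n)) (carrier pm.V')"
    by (rule bij_betw_inv_into) (simp add: bij_betw_def)
  ultimately have "kfd pm.V'" using klin_bij_dim(1) module_vec_dim(1) by blast
  then show ?thesis unfolding fd_left_module_def using left_module_point by blast
qed

lemma point_unit_act:
  assumes i: "i \<in> {1..m}" and j: "j \<in> {1..r i}" and p: "p \<in> {1..w i j}" and q: "q \<in> {1..w i j}"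
    and v: "v \<in> carrier_vec n"
  shows "pm.unit_act i j p q v = P (i, j, p) *\<^sub>v proj i (j, q) v"
proof -
  have jp: "(j, p) \<in> cluster_arrows r w i" and jq: "(j, q) \<in> cluster_arrows r w i" using j p q by auto
  let ?e = "unit_block r w i j p q"
  note pc = proj_closed[OF i jq v]
  have ec: "?e \<in> carrier (B i)" by (rule pm.unit_block_closed)
  have "pm.unit_act i j p q v = point_act i ?e v"
    unfolding pm.unit_act_emb unfolding point_module_def
    by (rule act.action_module_emb[OF i ec]) (simp add: v)
  also have "\<dots> = tot i (\<lambda>s. if s = (j, p) then proj i (j, q) v else 0\<^sub>v (ds i s))"
    unfolding point_act_def
  proof (rule tot_cong[OF i mix_closed])
    fix s assume s: "s \<in> cluster_arrows r w i"
    then obtain j' p' where jp': "s = (j', p')" "j' \<in> {1..r i}" "p' \<in> {1..w i j'}" by (rule arrowE)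
    show "mix i ?e v s = (if s = (j, p) then proj i (j, q) v else 0\<^sub>v (ds i s))"
    proof (rule eq_vecI)
      show "dim_vec (mix i ?e v s) = dim_vec (if s = (j, p) then proj i (j, q) v else 0\<^sub>v (ds i s))"
        using pc by (simp add: mix_def)
      fix t assume "t < dim_vec (if s = (j, p) then proj i (j, q) v else 0\<^sub>v (ds i s))"
      then have t: "t < d (Src i j')" using pc jp'(1) by (auto split: if_splits)
      have "mix i ?e v s $ t = (\<Sum>l\<in>{1..w i j'}. ?e j' $$ (p' - 1, l - 1) * proj i (j', l) v $ t)"
        unfolding jp'(1) by (rule mix_index[OF t])
      also have "\<dots> = (\<Sum>l\<in>{1..w i j'}. if q = l then (if s = (j, p) then proj i (j', l) v $ t else 0) else 0)"
      proof (rule sum.cong[OF refl])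
        fix l assume l: "l \<in> {1..w i j'}"
        have lt: "p' - 1 < w i j'" "l - 1 < w i j'" "Suc (p' - 1) = p'" "Suc (l - 1) = l" using jp'(3) l by auto
        have ej: "?e j' = (if j' = j then mat_unit (w i j) p q else 0\<^sub>m (w i j') (w i j'))"
          using jp'(2) by (simp add: block_def)
        have "?e j' $$ (p' - 1, l - 1) = (if j' = j \<and> p' = p \<and> l = q then 1 else 0)"
          unfolding ej using lt by (auto simp: mat_unit_def)
        then show "?e j' $$ (p' - 1, l - 1) * proj i (j', l) v $ t
            = (if q = l then (if s = (j, p) then proj i (j', l) v $ t else 0) else 0)"
          using jp'(1) by auto
      qed
      also have "\<dots> = (if q \<in> {1..w i j'} then (if s = (j, p) then proj i (j', q) v $ t else 0) else 0)"
        by (rule sum.delta') simp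
      also have "\<dots> = (if s = (j, p) then proj i (j, q) v else 0\<^sub>v (ds i s)) $ t"
        using t jp'(1) q by auto
      finally show "mix i ?e v s $ t = (if s = (j, p) then proj i (j, q) v else 0\<^sub>v (ds i s)) $ t" .
    qed
  qed
  also have "\<dots> = P (i, fst (j, p), snd (j, p)) *\<^sub>v proj i (j, q) v"
    by (rule tot_single[OF i jp]) (use pc in simp)
  finally show ?thesis by simp
qed

lemma proj_arrow:
  assumes i: "i \<in> {1..m}" and s: "s \<in> cluster_arrows r w i" and y: "y \<in> carrier_vec (ds i s)"
  shows "proj i s (P (i, fst s, snd s) *\<^sub>v y) = y"
proof -
  have "proj i s (tot i (\<lambda>t. if t = s then y else 0\<^sub>v (ds i t))) = (if s = s then y else 0\<^sub>v (ds i s))"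
    by (rule proj(3)[OF i _ s]) (use y in auto)
  then show ?thesis by (simp only: tot_single[OF i s y] if_True refl)
qed

lemma arrow_closed:
  assumes "i \<in> {1..m}" "s \<in> cluster_arrows r w i" "y \<in> carrier_vec (ds i s)"
  shows "P (i, fst s, snd s) *\<^sub>v y \<in> carrier_vec n"
  using klinD(3)[OF direct_sum_map.lin[OF point_cluster[OF assms(1)] assms(2)], of y] assms(3) by simp

text \<open>At a source the isomorphism is the projection to the first copy; the corresponding arrow is its inverse.\<close>

lemma functor_F_point_module: "rep_iso Q (functor_F m r w point_module) (matrix_rep d P)"
  unfolding rep_iso_def
proof (rule exI, intro conjI ballI)
  let ?\<phi> = "\<lambda>v. case v of Sink \<Rightarrow> (\<lambda>x. x) | Src i j \<Rightarrow> proj i (j, 1)"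
  fix v assume v: "v \<in> verts Q"
  have "klin (vspace pm.F v) (vspace (matrix_rep d P) v) (?\<phi> v) \<and>
    bij_betw (?\<phi> v) (carrier (vspace pm.F v)) (carrier (vspace (matrix_rep d P) v))"
  proof (cases v)
    case Sink
    then show ?thesis using point_module_id by (simp add: pm.functor_F_simps bij_betw_def)
  next
    case (Src i j)
    then have ij: "i \<in> {1..m}" "j \<in> {1..r i}" using v by auto
    have one: "1 \<in> {1..w i j}" using weights[OF ij] by simp
    then have s: "(j, 1) \<in> cluster_arrows r w i" using ij by simp
    let ?C = "pm.corner i j"
    have unit: "pm.unit_act i j 1 1 x = P (i, j, 1) *\<^sub>v proj i (j, 1) x" if "x \<in> carrier_vec n" for x
      by (rule point_unit_act[OF ij one one that])
    have C: "ksub ?C pm.V'" by (rule pm.corner_ksub[OF ij(1)])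
    have Cn: "?C \<subseteq> carrier_vec n" using ksubD(2)[OF C] by simp
    have full: "ksub (carrier_vec (d (Src i j))) (vs (d (Src i j)))"
      by (rule ksubI[OF kvs_module_vec]) auto
    have pl: "klin pm.V' (vs (d (Src i j))) (\<lambda>x. proj i (j, 1) x)"
      using klin_comp[OF point_module_id proj(1)[OF ij(1) s]] by simp
    have eqV: "vs (d (Src i j))\<lparr>carrier := carrier_vec (d (Src i j))\<rparr> = vs (d (Src i j))" by (simp add: module_vec_def)
    have sub: "proj i (j, 1) ` ?C \<subseteq> carrier_vec (d (Src i j))"
      using proj_closed[OF ij(1) s] Cn by auto
    have lin: "klin (pm.V'\<lparr>carrier := ?C\<rparr>) (vs (d (Src i j))) (proj i (j, 1))"
      using klin_restrict[OF pl C full sub] unfolding eqV .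
    have "bij_betw (proj i (j, 1)) ?C (carrier_vec (d (Src i j)))"
    proof (rule bij_betw_byWitness[where f' = "\<lambda>y. P (i, j, 1) *\<^sub>v y"])
      show "\<forall>x\<in>?C. P (i, j, 1) *\<^sub>v proj i (j, 1) x = x"
      proof
        fix x assume x: "x \<in> ?C"
        then have "pm.unit_act i j 1 1 x = x" using pm.corner_iff[OF ij(1) weights[OF ij]] by blast
        then show "P (i, j, 1) *\<^sub>v proj i (j, 1) x = x" using unit[of x] x Cn by auto
      qed
      show "\<forall>y\<in>carrier_vec (d (Src i j)). proj i (j, 1) (P (i, j, 1) *\<^sub>v y) = y"
        using proj_arrow[OF ij(1) s] by simp
      show "(\<lambda>y. P (i, j, 1) *\<^sub>v y) ` carrier_vec (d (Src i j)) \<subseteq> ?C"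
      proof
        fix x assume "x \<in> (\<lambda>y. P (i, j, 1) *\<^sub>v y) ` carrier_vec (d (Src i j))"
        then obtain y where y: "y \<in> carrier_vec (d (Src i j))" "x = P (i, j, 1) *\<^sub>v y" by blast
        have xc: "x \<in> carrier_vec n" using arrow_closed[OF ij(1) s, of y] y by simp
        have "pm.unit_act i j 1 1 x = x" unfolding unit[OF xc] using proj_arrow[OF ij(1) s, of y] y by simp
        then show "x \<in> ?C" using pm.corner_iff[OF ij(1) weights[OF ij]] xc by simp
      qed
    qed (rule sub)
    then show ?thesis using Src lin by (simp add: pm.functor_F_simps)
  qed
  then show "klin (vspace pm.F v) (vspace (matrix_rep d P) v) (?\<phi> v)"
    "bij_betw (?\<phi> v) (carrier (vspace pm.F v)) (carrier (vspace (matrix_rep d P) v))" by auto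
next
  fix e x assume e: "e \<in> arcs Q" and x: "x \<in> carrier (vspace pm.F (tail Q e))"
  obtain i j k where ijk: "e = (i, j, k)" "i \<in> {1..m}" "j \<in> {1..r i}" "k \<in> {1..w i j}" using e by auto
  have one: "1 \<in> {1..w i j}" using ijk(4) by simp
  have "x \<in> pm.corner i j" using x ijk(1) by (simp add: pm.functor_F_simps)
  then have xc: "x \<in> carrier_vec n" using ksubD(2)[OF pm.corner_ksub[OF ijk(2)]] by auto
  show "(case head Q e of Sink \<Rightarrow> (\<lambda>x. x) | Src i j \<Rightarrow> proj i (j, 1)) (amap pm.F e x)
    = amap (matrix_rep d P) e ((case tail Q e of Sink \<Rightarrow> (\<lambda>x. x) | Src i j \<Rightarrow> proj i (j, 1)) x)"
    using point_unit_act[OF ijk(2,3,4) one xc] ijk(1) by (simp add: pm.functor_F_simps)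
qed

end

context free_product_module
begin

text \<open>A submodule \<open>N\<close> and its corners form a subrepresentation. Each element of \<open>N\<close> is the sum of the images of its components
  in the corners, so \<open>\<theta> \<ge> 0\<close>.\<close>

lemma stable_simple:
  assumes w: "\<And>i j. i \<in> {1..m} \<Longrightarrow> j \<in> {1..r i} \<Longrightarrow> w i j \<ge> 1"
    and fd: "kfd V'" and st: "stable_rep (Gam m r w) (theta m w) F" and nz: "carrier M \<noteq> {\<zero>\<^bsub>M\<^esub>}"
  shows "simple_left_module FP M"
  unfolding simple_left_module_def
proof (intro conjI left_M nz allI impI)
  fix N assume "Module.submodule N FP M"
  then have N: "ksub N V'" and uN: "\<And>i j p q x. i \<in> {1..m} \<Longrightarrow> j \<in> {1..r i} \<Longrightarrow> p \<in> {1..w i j} \<Longrightarrow> q \<in> {1..w i j} \<Longrightarrow>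
      x \<in> N \<Longrightarrow> unit_act i j p q x \<in> N"
    unfolding submodule_unit_act by blast+
  have NM: "N \<subseteq> carrier M" using ksubD(2)[OF N] by simp
  define W where "W v = (case v of Sink \<Rightarrow> N | Src i j \<Rightarrow> unit_act i j 1 1 ` N)" for v
  have WS: "W Sink = N" and Wij: "W (Src i j) = unit_act i j 1 1 ` N" for i j by (simp_all add: W_def)
  have cN: "unit_act i j 1 1 ` N \<subseteq> N" if ij: "i \<in> {1..m}" "j \<in> {1..r i}" for i j
    using uN[OF ij, of 1 1] w[OF ij] by auto
  have sub: "ksub (unit_act i j 1 1 ` N) (V'\<lparr>carrier := corner i j\<rparr>)" if i: "i \<in> {1..m}" for i j
  proof (rule ksubI)
    have K: "ksub (unit_act i j 1 1 ` N) V'" by (rule ksub_image[OF unit_act_klin[OF i] N])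
    show "kvs (V'\<lparr>carrier := corner i j\<rparr>)" by (rule ksubD(6)[OF corner_ksub[OF i]])
    show "unit_act i j 1 1 ` N \<subseteq> carrier (V'\<lparr>carrier := corner i j\<rparr>)" using NM by auto
    show "\<zero>\<^bsub>V'\<lparr>carrier := corner i j\<rparr>\<^esub> \<in> unit_act i j 1 1 ` N" using ksubD(3)[OF K] by simp
    show "x \<oplus>\<^bsub>V'\<lparr>carrier := corner i j\<rparr>\<^esub> y \<in> unit_act i j 1 1 ` N"
      if "x \<in> unit_act i j 1 1 ` N" "y \<in> unit_act i j 1 1 ` N" for x y using ksubD(4)[OF K that] by simp
    show "c \<odot>\<^bsub>V'\<lparr>carrier := corner i j\<rparr>\<^esub> x \<in> unit_act i j 1 1 ` N"
      if "x \<in> unit_act i j 1 1 ` N" for c x using ksubD(5)[OF K that] by simp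
  qed
  have subrep: "is_subrep (Gam m r w) F W"
    unfolding is_subrep_def
  proof (intro conjI ballI)
    fix v assume "v \<in> verts (Gam m r w)"
    then show "ksub (W v) (vspace F v)"
      using N sub by (cases v) (auto simp: WS Wij functor_F_simps)
  next
    fix e assume "e \<in> arcs (Gam m r w)"
    then obtain i j k where e: "e = (i, j, k)" "i \<in> {1..m}" "j \<in> {1..r i}" "k \<in> {1..w i j}" by auto
    have "unit_act i j k 1 ` (unit_act i j 1 1 ` N) \<subseteq> N"
      using uN[OF e(2,3,4), of 1] cN[OF e(2,3)] w[OF e(2,3)] by auto
    moreover have "amap F (i, j, k) = unit_act i j k 1" by (rule ext) (simp add: functor_F_simps)
    ultimately show "amap F e ` W (tail (Gam m r w) e) \<subseteq> W (head (Gam m r w) e)"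
      by (simp add: e(1) WS Wij)
  qed
  let ?c = "\<lambda>i j. V'\<lparr>carrier := unit_act i j 1 1 ` N\<rparr>"
  have ge: "kdim (V'\<lparr>carrier := N\<rparr>) \<le> (\<Sum>j\<in>{1..r i}. w i j * kdim (?c i j))" if i: "i \<in> {1..m}" for i
  proof -
    let ?S = "cluster_arrows r w i"
    interpret V: abelian_group V' by (rule kvs_abelian_group[OF kvs])
    interpret D: direct_sum_map ?S "\<lambda>s. ?c i (fst s)" "V'\<lparr>carrier := N\<rparr>" "\<lambda>s. unit_act i (fst s) (snd s) 1"
    proof (rule direct_sum_map.intro)
      show "kvs (V'\<lparr>carrier := N\<rparr>)" by (rule ksubD(6)[OF N])
      fix s assume "s \<in> ?S"
      then obtain j k where s: "s = (j, k)" "j \<in> {1..r i}" "k \<in> {1..w i j}" by auto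
      have K: "ksub (unit_act i j 1 1 ` N) V'" by (rule ksub_image[OF unit_act_klin[OF i] N])
      show "kfd (?c i (fst s))" using subspace_fd(1)[OF fd K] s by simp
      have "unit_act i j k 1 ` (unit_act i j 1 1 ` N) \<subseteq> N"
        using uN[OF i s(2,3), of 1] cN[OF i s(2)] w[OF i s(2)] by auto
      from klin_restrict[OF unit_act_klin[OF i] K N this]
      show "klin (?c i (fst s)) (V'\<lparr>carrier := N\<rparr>) (unit_act i (fst s) (snd s) 1)" using s by simp
    qed auto
    have "kdim (V'\<lparr>carrier := N\<rparr>) \<le> (\<Sum>s\<in>?S. kdim (?c i (fst s)))"
    proof (rule D.dim_le_sum(2))
      fix x assume "x \<in> carrier (V'\<lparr>carrier := N\<rparr>)"
      then have xN: "x \<in> N" and x: "x \<in> carrier M" using NM by auto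
      let ?y = "\<lambda>s\<in>?S. unit_act i (fst s) 1 (snd s) x"
      have uM: "unit_act i j p q x \<in> carrier V'" for j p q using klinD(3)[OF unit_act_klin[OF i], of x] x by simp
      have y: "?y s \<in> unit_act i (fst s) 1 1 ` N" if s: "s \<in> ?S" for s
      proof -
        obtain j k where jk: "s = (j, k)" "j \<in> {1..r i}" "k \<in> {1..w i j}" using s by auto
        have one: "1 \<in> {1..w i j}" using w[OF i jk(2)] by simp
        have e: "unit_act i j 1 k x = unit_act i j 1 1 (unit_act i j 1 k x)"
          using unit_act_unit_act[OF i x one one, of 1 k] by simp
        have "unit_act i j 1 k x \<in> unit_act i j 1 1 ` N"
        proof (rule rev_image_eqI)
          show "unit_act i j 1 k x \<in> N" by (rule uN[OF i jk(2) one jk(3) xN])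
        qed (rule e)
        then show ?thesis using s jk(1) by simp
      qed
      have "D.total ?y = (\<Oplus>\<^bsub>V'\<^esub>s\<in>?S. unit_act i (fst s) (snd s) 1 (?y s))"
      proof -
        have "(\<lambda>s. unit_act i (fst s) (snd s) 1 (?y s)) \<in> ?S \<rightarrow> carrier (V'\<lparr>carrier := N\<rparr>)"
          by (rule D.total_mem) (use y in simp)
        then show ?thesis unfolding D.total_def by (intro finsum_subspace(1)[OF N]) simp
      qed
      also have "\<dots> = (\<Oplus>\<^bsub>V'\<^esub>s\<in>?S. unit_act i (fst s) (snd s) (snd s) x)"
      proof (rule V.finsum_cong'[OF refl])
        show "(\<lambda>s. unit_act i (fst s) (snd s) (snd s) x) \<in> ?S \<rightarrow> carrier V'" using uM by blast
        fix s assume s: "s \<in> ?S"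
        then obtain j k where jk: "s = (j, k)" "j \<in> {1..r i}" "k \<in> {1..w i j}" by auto
        have one: "1 \<in> {1..w i j}" using w[OF i jk(2)] by simp
        show "unit_act i (fst s) (snd s) 1 (?y s) = unit_act i (fst s) (snd s) (snd s) x"
          using unit_act_unit_act[OF i x one one, of k k] s jk(1) by simp
      qed
      also have "\<dots> = x" by (rule identity_expansion[OF i x, symmetric])
      finally have "D.total ?y = x" .
      moreover have "?y \<in> (\<Pi>\<^sub>E s\<in>?S. carrier (?c i (fst s)))"
        by (rule restrict_PiE_iff[THEN iffD2]) (use y in simp)
      ultimately show "\<exists>y\<in>(\<Pi>\<^sub>E s\<in>?S. carrier (?c i (fst s))). D.total y = x" by (rule bexI)
    qed
    then show ?thesis unfolding sum_cluster_arrows[of "\<lambda>j. kdim (?c i j)"] .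
  qed
  show "N = {\<zero>\<^bsub>M\<^esub>} \<or> N = carrier M"
  proof (rule disjCI)
    assume "N \<noteq> carrier M"
    show "N = {\<zero>\<^bsub>M\<^esub>}"
    proof (rule ccontr)
      assume N0: "N \<noteq> {\<zero>\<^bsub>M\<^esub>}"
      have "int m * int (kdim (V'\<lparr>carrier := N\<rparr>)) = (\<Sum>i\<in>{1..m}. int (kdim (V'\<lparr>carrier := N\<rparr>)))" by simp
      also have "\<dots> \<le> (\<Sum>i\<in>{1..m}. int (\<Sum>j\<in>{1..r i}. w i j * kdim (?c i j)))"
        by (rule sum_mono) (simp only: of_nat_le_iff ge)
      finally have "pairing (Gam m r w) (theta m w) (dim_vec_rep (restrict_rep F W)) \<ge> 0"
        unfolding pairing_Gam dim_vec_rep_def restrict_rep_simps WS Wij functor_F_simps by simp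
      from stable_repD(3)[OF st subrep, of Sink, OF _ _ this, of Sink] N0
      have "N = carrier M" by (simp add: WS functor_F_simps)
      then show False using \<open>N \<noteq> carrier M\<close> by simp
    qed
  qed
qed

text \<open>For a subrepresentation with balanced dimension vector the total maps are surjective, so an element of the space
  at the sink has its components in the spaces at the sources. Therefore the space at the sink is a submodule.\<close>

lemma simple_stable:
  assumes w: "\<And>i j. i \<in> {1..m} \<Longrightarrow> j \<in> {1..r i} \<Longrightarrow> w i j \<ge> 1"
    and fd: "kfd V'" and simple: "simple_left_module FP M"
    and dims: "has_dim_vec (Gam m r w) F d" and bal: "balanced m r w d" and pos: "d Sink > 0"
  shows "stable_rep (Gam m r w) (theta m w) F"
proof -
  interpret R: balanced_representation m r w d F
    by (rule balanced_representation.intro[OF w fd_functor_F[OF fd] dims bal pos balanced_functor_F[OF w]])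
  show ?thesis
  proof (rule R.stable_of_balanced_subreps)
    fix W assume W: "is_subrep R.Q F W" and balW: "balanced m r w (R.sub_dim W)"
    have WS: "ksub (W Sink) V'" using is_subrepD(1)[OF W, of Sink] by (simp add: functor_F_simps)
    have "Module.submodule (W Sink) FP M"
      unfolding submodule_unit_act
    proof (intro conjI ballI WS)
      fix i j p q x
      assume i: "i \<in> {1..m}" and j: "j \<in> {1..r i}" and p: "p \<in> {1..w i j}" and q: "q \<in> {1..w i j}" and x: "x \<in> W Sink"
      have eq: "(\<Sum>j\<in>{1..r i}. w i j * R.sub_dim W (Src i j)) = R.sub_dim W Sink"
        using balW i unfolding balanced_def by blast
      obtain y where y: "\<And>s. s \<in> cluster_arrows r w i \<Longrightarrow> y s \<in> W (Src i (fst s))"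
        and xy: "x = (\<Oplus>\<^bsub>vspace F Sink\<^esub>s\<in>cluster_arrows r w i. amap F (i, fst s, snd s) (y s))"
        using R.sub_cluster_le(2)[OF W i eq x] by blast
      have Wc: "W (Src i l) \<subseteq> corner i l" if l: "l \<in> {1..r i}" for l
        using ksubD(2)[OF is_subrepD(1)[OF W], of "Src i l"] i l by (simp add: functor_F_simps)
      have yc: "y s \<in> corner i (fst s)" if s: "s \<in> cluster_arrows r w i" for s
        using Wc[of "fst s"] y[OF s] s by auto
      have jq: "(j, q) \<in> cluster_arrows r w i" using j q by simp
      have "unit_act i j 1 q x = y (j, q)"
        unfolding xy functor_F_simps by (rule total_component[OF i subset_refl yc jq])
      then have yW: "unit_act i j 1 q x \<in> W (Src i j)" using y[OF jq] by simp
      have xM: "x \<in> carrier M" using ksubD(2)[OF WS] x by auto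
      have one: "1 \<in> {1..w i j}" using w[OF i j] by simp
      have "unit_act i j p q x = unit_act i j p 1 (unit_act i j 1 q x)"
        using unit_act_unit_act[OF i xM one one, of p q] by simp
      also have "\<dots> \<in> W Sink"
        using is_subrepD(2)[OF W, of "(i, j, p)" "unit_act i j 1 q x"] i j p yW by (simp add: functor_F_simps)
      finally show "unit_act i j p q x \<in> W Sink" .
    qed
    then show "W Sink = {\<zero>\<^bsub>vspace F Sink\<^esub>} \<or> W Sink = carrier (vspace F Sink)"
      using simple unfolding simple_left_module_def by (simp add: functor_F_simps)
  qed
qed

end

section \<open>Generic points of the balanced locus\<close>

lemma pf_det:
  assumes "\<And>p c. p < n \<Longrightarrow> c < n \<Longrightarrow> (\<lambda>x. Z x p c) \<in> polynomial_functions E"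
  shows "(\<lambda>x. det (mat n n (\<lambda>(p, c). Z x p c))) \<in> polynomial_functions E"
proof -
  have "(\<lambda>x. \<Sum>p\<in>{p. p permutes {0..<n}}. signof p * (\<Prod>i\<in>{0..<n}. Z x i (p i))) \<in> polynomial_functions E"
  proof (rule pf_sum, rule pf_mult[OF pf_const], rule pf_prod)
    fix p i assume p: "p \<in> {p. p permutes {0..<n}}" and i: "i \<in> {0..<n}"
    then have "p i \<in> {0..<n}" using permutes_in_image[of p "{0..<n}" i] by blast
    then show "(\<lambda>x. Z x i (p i)) \<in> polynomial_functions E" using assms i by simp
  qed
  moreover have "(\<lambda>x. det (mat n n (\<lambda>(p, c). Z x p c)))
      = (\<lambda>x. \<Sum>p\<in>{p. p permutes {0..<n}}. signof p * (\<Prod>i\<in>{0..<n}. Z x i (p i)))"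
  proof
    fix x
    have entries: "(\<Prod>i\<in>{0..<n}. mat n n (\<lambda>(p, c). Z x p c) $$ (i, p i)) = (\<Prod>i\<in>{0..<n}. Z x i (p i))"
      if "p permutes {0..<n}" for p
    proof (rule prod.cong[OF refl])
      fix i assume i: "i \<in> {0..<n}"
      then have "p i \<in> {0..<n}" using permutes_in_image[OF that, of i] by blast
      then show "mat n n (\<lambda>(p, c). Z x p c) $$ (i, p i) = Z x i (p i)" using i by simp
    qed
    have "det (mat n n (\<lambda>(p, c). Z x p c))
      = (\<Sum>p\<in>{p. p permutes {0..<n}}. signof p * (\<Prod>i\<in>{0..<n}. mat n n (\<lambda>(p, c). Z x p c) $$ (i, p i)))"
      by (rule det_def') simp
    also have "\<dots> = (\<Sum>p\<in>{p. p permutes {0..<n}}. signof p * (\<Prod>i\<in>{0..<n}. Z x i (p i)))"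
      by (rule sum.cong[OF refl]) (simp only: mem_Collect_eq entries)
    finally show "det (mat n n (\<lambda>(p, c). Z x p c)) = (\<Sum>p\<in>{p. p permutes {0..<n}}. signof p * (\<Prod>i\<in>{0..<n}. Z x i (p i)))" .
  qed
  ultimately show ?thesis by simp
qed

context balanced_vector
begin

abbreviation "Q \<equiv> Gam m r w"

text \<open>The columns of all matrices of a cluster, taken together: \<open>((j, k), q)\<close> stands for the column \<open>q\<close> of the arrow
  \<open>(i, j, k)\<close>. For balanced \<open>d\<close> there are \<open>d Sink\<close> of them, so they form a square matrix.\<close>

definition columns :: "nat \<Rightarrow> ((nat \<times> nat) \<times> nat) set" where
  "columns i = (SIGMA s:cluster_arrows r w i. {..<d (Src i (fst s))})"

lemma card_columns: "i \<in> {1..m} \<Longrightarrow> finite (columns i) \<and> card (columns i) = d Sink"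
  using sum_cluster_arrows[of "\<lambda>j. d (Src i j)" r i w] bal
  unfolding columns_def balanced_def by (subst card_SigmaI) auto

definition column :: "nat \<Rightarrow> nat \<Rightarrow> (nat \<times> nat) \<times> nat" where
  "column i = (SOME h. bij_betw h {0..<d Sink} (columns i))"

lemma column: "i \<in> {1..m} \<Longrightarrow> bij_betw (column i) {0..<d Sink} (columns i)"
  unfolding column_def
  using someI_ex[OF ex_bij_betw_nat_finite, of "columns i"] card_columns[of i] by simp

definition column_entry :: "nat \<Rightarrow> nat \<Rightarrow> nat \<Rightarrow> arrow \<times> nat \<times> nat" where
  "column_entry i p c = ((i, fst (fst (column i c)), snd (fst (column i c))), p, snd (column i c))"

lemma column_entry:
  assumes i: "i \<in> {1..m}" and "p < d Sink" "c < d Sink"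
  shows "column_entry i p c \<in> entries Q d"
proof -
  have "column i c \<in> columns i" using bij_betwE[OF column[OF i]] assms by simp
  then show ?thesis using assms unfolding column_entry_def entries_def columns_def by auto
qed

definition total_matrix :: "nat \<Rightarrow> (arrow \<times> nat \<times> nat \<Rightarrow> 'k::field) \<Rightarrow> 'k mat" where
  "total_matrix i x = mat (d Sink) (d Sink) (\<lambda>(p, c). x (column_entry i p c))"

lemma pf_det_total: "i \<in> {1..m} \<Longrightarrow> (\<lambda>x. det (total_matrix i x)) \<in> polynomial_functions (entries Q d)"
  unfolding total_matrix_def by (rule pf_det[OF pf_coord]) (rule column_entry)

text \<open>Different clusters involve different entries, so all these matrices can be made the identity at once.\<close>

lemma det_total_nonzero: "\<exists>x. \<forall>i\<in>{1..m}. det (total_matrix i x) \<noteq> (0::'k::field)"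
proof -
  define x :: "arrow \<times> nat \<times> nat \<Rightarrow> 'k" where
    "x = (\<lambda>((i, j, k), p, q). if column i p = ((j, k), q) then 1 else 0)"
  have "total_matrix i x = 1\<^sub>m (d Sink)" if i: "i \<in> {1..m}" for i
  proof (rule eq_matI)
    fix p c assume pc: "p < dim_row (1\<^sub>m (d Sink) :: 'k mat)" "c < dim_col (1\<^sub>m (d Sink) :: 'k mat)"
    have "column i p = column i c \<longleftrightarrow> p = c"
      using inj_onD[OF bij_betw_imp_inj_on[OF column[OF i]], of p c] pc by auto
    then show "total_matrix i x $$ (p, c) = 1\<^sub>m (d Sink) $$ (p, c)"
      using pc by (simp add: total_matrix_def x_def column_entry_def)
  qed (simp_all add: total_matrix_def)
  then show ?thesis by (intro exI[of _ x]) simp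
qed

lemma balanced_locusI:
  assumes P: "(P :: arrow \<Rightarrow> 'k::field mat) \<in> rep_space Q d"
    and det: "\<And>i. i \<in> {1..m} \<Longrightarrow> det (total_matrix i (entry P)) \<noteq> 0"
  shows "P \<in> balanced_locus m r w d"
  unfolding balanced_locus_def balanced_rep_def Let_def matrix_rep_simps
proof (intro CollectI conjI ballI P)
  fix i assume i: "i \<in> {1..m}"
  let ?S = "cluster_arrows r w i" and ?V = "module_vec TYPE('k) (d Sink)"
  let ?W = "\<lambda>s. module_vec TYPE('k) (d (Src i (fst s)))"
  let ?Z = "total_matrix i (entry P)"
  have Pc: "P (i, fst s, snd s) \<in> carrier_mat (d Sink) (d (Src i (fst s)))" if "s \<in> ?S" for s
    using PiE_mem[OF P[unfolded rep_space_def], of "(i, fst s, snd s)"] that i by auto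
  interpret D: direct_sum_map ?S ?W ?V "\<lambda>s x. P (i, fst s, snd s) *\<^sub>v x"
  proof (rule direct_sum_map.intro)
    show "finite ?S" by auto
    show "kvs ?V" by (rule kvs_module_vec)
    fix s assume s: "s \<in> ?S"
    show "klin (?W s) ?V (\<lambda>x. P (i, fst s, snd s) *\<^sub>v x)" by (rule mult_mat_vec_klin[OF Pc[OF s]])
    show "kfd (?W s)" by (rule module_vec_dim(1))
  qed
  define coord :: "(nat \<times> nat \<Rightarrow> 'k vec) \<Rightarrow> 'k vec" where
    "coord x = vec (d Sink) (\<lambda>c. x (fst (column i c)) $ snd (column i c))" for x
  have Zc: "?Z \<in> carrier_mat (d Sink) (d Sink)" by (simp add: total_matrix_def)
  have tot: "D.total x = ?Z *\<^sub>v coord x" if x: "\<And>s. s \<in> ?S \<Longrightarrow> x s \<in> carrier_vec (d (Src i (fst s)))" for x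
  proof (rule eq_vecI)
    have tc: "D.total x \<in> carrier_vec (d Sink)" using D.total_closed[of x] x by simp
    then show "dim_vec (D.total x) = dim_vec (?Z *\<^sub>v coord x)" using Zc by simp
    fix p assume "p < dim_vec (?Z *\<^sub>v coord x)"
    then have p: "p < d Sink" using Zc by simp
    have mem: "(\<lambda>s. P (i, fst s, snd s) *\<^sub>v x s) \<in> ?S \<rightarrow> carrier_vec (d Sink)"
      using mult_mat_vec_carrier[OF Pc x] by auto
    have "D.total x $ p = (\<Sum>s\<in>?S. (P (i, fst s, snd s) *\<^sub>v x s) $ p)"
      unfolding D.total_def by (rule finsum_vec_index[OF mem p])
    also have "\<dots> = (\<Sum>s\<in>?S. \<Sum>q<d (Src i (fst s)). P (i, fst s, snd s) $$ (p, q) * x s $ q)"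
    proof (rule sum.cong[OF refl])
      fix s assume s: "s \<in> ?S"
      show "(P (i, fst s, snd s) *\<^sub>v x s) $ p = (\<Sum>q<d (Src i (fst s)). P (i, fst s, snd s) $$ (p, q) * x s $ q)"
        using Pc[OF s] x[OF s] p by (simp add: scalar_prod_def atLeast0LessThan)
    qed
    also have "\<dots> = (\<Sum>t\<in>columns i. P (i, fst (fst t), snd (fst t)) $$ (p, snd t) * x (fst t) $ snd t)"
      unfolding columns_def by (subst sum.Sigma) (auto simp: case_prod_beta)
    also have "\<dots> = (\<Sum>c\<in>{0..<d Sink}. entry P (column_entry i p c) * coord x $ c)"
      by (subst sum.reindex_bij_betw[OF column[OF i], symmetric]) (simp add: column_entry_def entry_def coord_def)
    also have "\<dots> = (?Z *\<^sub>v coord x) $ p"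
      using p by (simp add: total_matrix_def scalar_prod_def coord_def)
    finally show "D.total x $ p = (?Z *\<^sub>v coord x) $ p" .
  qed
  have "bij_betw D.total (\<Pi>\<^sub>E s\<in>?S. carrier (?W s)) (carrier ?V)"
  proof (rule D.total_bij[OF _ module_vec_dim(1)])
    fix x assume x: "x \<in> (\<Pi>\<^sub>E s\<in>?S. carrier (?W s))" and z: "D.total x = \<zero>\<^bsub>?V\<^esub>"
    have xc: "x s \<in> carrier_vec (d (Src i (fst s)))" if "s \<in> ?S" for s using PiE_mem[OF x that] by simp
    have Z0: "?Z *\<^sub>v coord x = 0\<^sub>v (d Sink)" using z by (simp only: tot[of x, OF xc] vec_space_simps)
    have c0: "coord x = 0\<^sub>v (d Sink)"
    proof (rule ccontr)
      assume ne: "coord x \<noteq> 0\<^sub>v (d Sink)"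
      have "coord x \<in> carrier_vec (d Sink)" by (simp add: coord_def)
      then have "det ?Z = 0"
        unfolding det_0_iff_vec_prod_zero_field[OF Zc] using Z0 ne by (intro exI[of _ "coord x"] conjI)
      then show False using det[OF i] by simp
    qed
    show "\<forall>s\<in>?S. x s = \<zero>\<^bsub>?W s\<^esub>"
    proof
      fix s assume s: "s \<in> ?S"
      have "x s = 0\<^sub>v (d (Src i (fst s)))"
      proof (rule eq_vecI)
        show "dim_vec (x s) = dim_vec (0\<^sub>v (d (Src i (fst s))))" using xc[OF s] by simp
        fix q assume "q < dim_vec (0\<^sub>v (d (Src i (fst s))) :: 'k vec)"
        then have q: "q < d (Src i (fst s))" by simp
        then have "(s, q) \<in> columns i" using s by (simp add: columns_def)
        then have "(s, q) \<in> column i ` {0..<d Sink}" by (simp only: bij_betw_imp_surj_on[OF column[OF i]])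
        then obtain c where c: "c < d Sink" "column i c = (s, q)" by auto
        have "coord x $ c = 0" using c0 c(1) by simp
        then show "x s $ q = 0\<^sub>v (d (Src i (fst s))) $ q" using c q by (simp add: coord_def)
      qed
      then show "x s = \<zero>\<^bsub>?W s\<^esub>" by simp
    qed
  next
    show "(\<Sum>s\<in>?S. kdim (?W s)) = kdim ?V"
      using sum_cluster_arrows[of "\<lambda>j. d (Src i j)" r i w] bal i by (simp add: module_vec_dim(2) balanced_def)
  qed
  moreover have "D.total = (\<lambda>x. \<Oplus>\<^bsub>?V\<^esub>s\<in>?S. P (i, fst s, snd s) *\<^sub>v x s)"
    by (rule ext) (rule D.total_def)
  ultimately show "bij_betw (\<lambda>x. \<Oplus>\<^bsub>?V\<^esub>s\<in>?S. P (i, fst s, snd s) *\<^sub>v x s)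
      (\<Pi>\<^sub>E s\<in>?S. carrier (?W s)) (carrier ?V)"
    by simp
qed

lemma sum_arcs: "(\<Sum>e\<in>arcs Q. g e) = (\<Sum>i\<in>{1..m}. \<Sum>j\<in>{1..r i}. \<Sum>k\<in>{1..w i j}. g (i, j, k))"
  for g :: "arrow \<Rightarrow> nat"
proof -
  have "arcs Q = (SIGMA i:{1..m}. cluster_arrows r w i)" by auto
  then have "(\<Sum>e\<in>arcs Q. g e) = (\<Sum>i\<in>{1..m}. \<Sum>t\<in>cluster_arrows r w i. g (i, t))"
    by (subst sum.Sigma) auto
  also have "\<dots> = (\<Sum>i\<in>{1..m}. \<Sum>j\<in>{1..r i}. \<Sum>k\<in>{1..w i j}. g (i, j, k))"
    by (intro sum.cong refl) (subst sum.Sigma, auto)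
  finally show ?thesis .
qed

lemma sum_verts: "(\<Sum>v\<in>verts Q. g v) = g Sink + (\<Sum>i\<in>{1..m}. \<Sum>j\<in>{1..r i}. g (Src i j))"
  for g :: "vertex \<Rightarrow> nat"
proof -
  have "(\<Sum>v\<in>verts Q. g v) = g Sink + (\<Sum>v\<in>(\<lambda>(i, j). Src i j) ` (SIGMA i:{1..m}. {1..r i}). g v)"
    unfolding verts_Gam_image by (subst sum.insert) auto
  also have "(\<Sum>v\<in>(\<lambda>(i, j). Src i j) ` (SIGMA i:{1..m}. {1..r i}). g v)
     = (\<Sum>(i, j)\<in>(SIGMA i:{1..m}. {1..r i}). g (Src i j))"
    by (subst sum.reindex) (auto simp: inj_on_def intro!: sum.cong)
  finally show ?thesis by (simp add: sum.Sigma)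
qed

text \<open>The right-hand side is \<open>m n' n''\<close> and the left-hand side is \<open>n' n''\<close> plus the form of the decomposition, so
  this is \<open>form_less\<close>.\<close>

lemma codimension_positive:
  assumes m: "m \<ge> 1" and c: "condition_a m r w d \<or> condition_b m r w d \<or> condition_c m r w d"
    and d': "balanced m r w d'" "0 < d' Sink" "d' Sink < d Sink" "\<And>v. v \<in> verts Q \<Longrightarrow> d' v \<le> d v"
  shows "(\<Sum>v\<in>verts Q. d' v * (d v - d' v)) < (\<Sum>e\<in>arcs Q. d' (tail Q e) * (d (head Q e) - d' (head Q e)))"
proof -
  let ?d'' = "\<lambda>v. d v - d' v"
  have d'': "balanced m r w ?d''"
    unfolding balanced_def
  proof
    fix i assume i: "i \<in> {1..m}"
    have "(\<Sum>j\<in>{1..r i}. w i j * ?d'' (Src i j)) = (\<Sum>j\<in>{1..r i}. w i j * d (Src i j) - w i j * d' (Src i j))"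
      by (simp add: diff_mult_distrib2)
    also have "\<dots> = (\<Sum>j\<in>{1..r i}. w i j * d (Src i j)) - (\<Sum>j\<in>{1..r i}. w i j * d' (Src i j))"
      by (rule sum_subtractf_nat) (use d'(4) i in auto)
    finally show "(\<Sum>j\<in>{1..r i}. w i j * ?d'' (Src i j)) = ?d'' Sink"
      using bal d'(1) i by (simp add: balanced_def)
  qed
  interpret B: balanced_decomposition m r w d d' ?d''
    by (rule balanced_decomposition.intro[OF weights d'(1) d'']) (use d' in auto)
  define a b f where "a = d' Sink" and "b = ?d'' Sink" and "f = B.form"
  have "real f < (real m - 1) * (real a * real b)"
    using B.form_less[OF m c] unfolding a_def b_def f_def .
  then have "real (a * b + f) < real (m * (a * b))" by (simp add: algebra_simps)
  then have "a * b + f < m * (a * b)" by (simp only: of_nat_less_iff)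
  then have "d' Sink * ?d'' Sink + B.form < m * (d' Sink * ?d'' Sink)" unfolding a_def b_def f_def .
  also have "m * (d' Sink * ?d'' Sink) = (\<Sum>i\<in>{1..m}. d' Sink * ?d'' Sink)" by simp
  also have "\<dots> = (\<Sum>i\<in>{1..m}. (\<Sum>j\<in>{1..r i}. w i j * d' (Src i j)) * ?d'' Sink)"
    using d'(1) by (intro sum.cong) (auto simp: balanced_def)
  also have "\<dots> = (\<Sum>e\<in>arcs Q. d' (tail Q e) * ?d'' (head Q e))"
    unfolding sum_arcs by (simp add: sum_distrib_right mult.assoc)
  finally show ?thesis unfolding sum_verts .
qed

text \<open>Choices of a chart at every vertex whose dimension vector would contradict stability.\<close>

definition subspace_dims :: "(vertex \<Rightarrow> nat set) set" where
  "subspace_dims = {S \<in> (\<Pi>\<^sub>E v\<in>verts Q. Pow {..<d v}). balanced m r w (\<lambda>v. card (S v)) \<and>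
     0 < card (S Sink) \<and> card (S Sink) < d Sink}"

lemma generic_polynomial:
  assumes inf: "infinite (UNIV :: 'k::field set)" and m: "m \<ge> 1"
    and c: "condition_a m r w d \<or> condition_b m r w d \<or> condition_c m r w d"
  shows "\<exists>G\<in>polynomial_functions (entries Q d). (\<exists>x. G x \<noteq> (0::'k)) \<and>
     (\<forall>P\<in>rep_space Q d. G (entry P) \<noteq> 0 \<longrightarrow> (\<forall>W. is_subrep Q (matrix_rep d P) W \<longrightarrow>
        balanced m r w (\<lambda>v. kdim (module_vec TYPE('k) (d v)\<lparr>carrier := W v\<rparr>)) \<longrightarrow>
        W Sink = {0\<^sub>v (d Sink)} \<or> W Sink = carrier_vec (d Sink)))"
proof -
  have arcsQ: "tail Q e \<in> verts Q \<and> head Q e \<in> verts Q" if "e \<in> arcs Q" for e using that by auto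
  have finV: "finite (verts Q)" and finA: "finite (arcs Q)" using finite_Gam by auto
  have "finite (\<Pi>\<^sub>E v\<in>verts Q. Pow {..<d v})" by (rule finite_PiE[OF finV]) simp
  then have finS: "finite subspace_dims" unfolding subspace_dims_def by simp
  let ?deg = "\<lambda>S G. \<forall>P W b. P \<in> rep_space Q d \<longrightarrow> is_subrep Q (matrix_rep d P) W \<longrightarrow>
        (\<forall>v\<in>verts Q. in_chart (d v) (S v) (W v) (b v)) \<longrightarrow> G (entry P) = (0::'k)"
  have "\<forall>S\<in>subspace_dims. \<exists>G. G \<in> polynomial_functions (entries Q d) \<and> (\<exists>x. G x \<noteq> 0) \<and> ?deg S G"
  proof
    fix S assume S: "S \<in> subspace_dims"
    then have Sv: "S v \<subseteq> {..<d v}" if "v \<in> verts Q" for v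
      using that unfolding subspace_dims_def by (auto simp: PiE_def Pi_def)
    have le: "card (S v) \<le> d v" if "v \<in> verts Q" for v using card_mono[OF _ Sv[OF that]] by simp
    have codim: "(\<Sum>v\<in>verts Q. card (S v) * (d v - card (S v)))
       < (\<Sum>e\<in>arcs Q. card (S (tail Q e)) * (d (head Q e) - card (S (head Q e))))"
      by (rule codimension_positive[OF m c, of "\<lambda>v. card (S v)"]) (use S le in \<open>auto simp: subspace_dims_def\<close>)
    have "\<exists>G\<in>polynomial_functions (entries Q d). (\<exists>x. G x \<noteq> 0) \<and> ?deg S G"
      by (rule subrep_locus_degenerate[OF inf arcsQ finV finA Sv codim])
    then show "\<exists>G. G \<in> polynomial_functions (entries Q d) \<and> (\<exists>x. G x \<noteq> 0) \<and> ?deg S G"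
      unfolding Bex_def .
  qed
  then have "\<exists>G. \<forall>S\<in>subspace_dims. G S \<in> polynomial_functions (entries Q d) \<and> (\<exists>x. G S x \<noteq> 0) \<and> ?deg S (G S)"
    by (rule bchoice)
  then obtain G where G0: "\<forall>S\<in>subspace_dims. G S \<in> polynomial_functions (entries Q d) \<and> (\<exists>x. G S x \<noteq> 0) \<and> ?deg S (G S)"
    by (rule exE)
  have G: "G S \<in> polynomial_functions (entries Q d)" "\<exists>x. G S x \<noteq> 0" "?deg S (G S)" if "S \<in> subspace_dims" for S
    using bspec[OF G0 that] by simp_all
  let ?G = "\<lambda>x. \<Prod>S\<in>subspace_dims. G S x"
  show ?thesis
  proof (rule bexI[of _ ?G], intro conjI ballI impI allI)
    show "?G \<in> polynomial_functions (entries Q d)" by (rule pf_prod[OF G(1)])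
    show "\<exists>x. ?G x \<noteq> 0" by (rule pf_prod_nonzero[OF inf finS G(1,2)])
    fix P W assume P: "P \<in> rep_space Q d" and nz: "?G (entry P) \<noteq> 0" and W: "is_subrep Q (matrix_rep d P) W"
      and balW: "balanced m r w (\<lambda>v. kdim (module_vec TYPE('k) (d v)\<lparr>carrier := W v\<rparr>))"
    show "W Sink = {0\<^sub>v (d Sink)} \<or> W Sink = carrier_vec (d Sink)"
    proof (rule ccontr)
      assume pr: "\<not> ?thesis"
      have Wv: "ksub (W v) (module_vec TYPE('k) (d v))" if "v \<in> verts Q" for v
        using is_subrepD(1)[OF W that] by simp
      have "\<forall>v\<in>verts Q. \<exists>S b. S \<subseteq> {..<d v} \<and> card S = kdim (module_vec TYPE('k) (d v)\<lparr>carrier := W v\<rparr>)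
          \<and> in_chart (d v) S (W v) b" using subspace_in_chart[OF Wv] by blast
      then obtain S b where S: "\<And>v. v \<in> verts Q \<Longrightarrow> S v \<subseteq> {..<d v}"
        "\<And>v. v \<in> verts Q \<Longrightarrow> card (S v) = kdim (module_vec TYPE('k) (d v)\<lparr>carrier := W v\<rparr>)"
        "\<And>v. v \<in> verts Q \<Longrightarrow> in_chart (d v) (S v) (W v) (b v)" by metis
      let ?S = "restrict S (verts Q)"
      have sink: "Sink \<in> verts Q" by simp
      have fdS: "kfd (module_vec TYPE('k) (d Sink)\<lparr>carrier := W Sink\<rparr>)"
        by (rule subspace_fd(1)[OF module_vec_dim(1) Wv[OF sink]])
      have "card (S Sink) \<noteq> 0"
        using kdim_zeroD[OF ksubD(6)[OF Wv[OF sink]] fdS] S(2)[OF sink] pr by auto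
      moreover have "card (S Sink) \<noteq> d Sink"
        using subspace_fd(3)[OF module_vec_dim(1) Wv[OF sink]] S(2)[OF sink] pr by (auto simp: module_vec_dim(2))
      moreover have "card (S Sink) \<le> d Sink" using card_mono[OF _ S(1)[OF sink]] by simp
      moreover have "balanced m r w (\<lambda>v. card (?S v))"
        unfolding balanced_def
      proof
        fix i assume i: "i \<in> {1..m}"
        have "(\<Sum>j\<in>{1..r i}. w i j * card (?S (Src i j)))
          = (\<Sum>j\<in>{1..r i}. w i j * kdim (module_vec TYPE('k) (d (Src i j))\<lparr>carrier := W (Src i j)\<rparr>))"
          by (rule sum.cong) (use i S(2) in auto)
        then show "(\<Sum>j\<in>{1..r i}. w i j * card (?S (Src i j))) = card (?S Sink)"
          using balW i S(2)[OF sink] by (simp add: balanced_def)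
      qed
      ultimately have mem: "?S \<in> subspace_dims" unfolding subspace_dims_def using S(1) by auto
      have "\<forall>v\<in>verts Q. in_chart (d v) (?S v) (W v) (b v)" using S(3) by simp
      then have "G ?S (entry P) = 0" using G(3)[OF mem] P W by blast
      then show False using nz mem finS by auto
    qed
  qed
qed

end

section \<open>Density of the simple modules\<close>

text \<open>Over a finite field the product of all linear polynomials plus \<open>1\<close> has no root.\<close>

lemma infinite_alg_closed_field: "infinite (UNIV :: 'k::alg_closed_field set)"
proof
  assume fin: "finite (UNIV :: 'k set)"
  let ?p = "(\<Prod>a\<in>UNIV. [:- a, 1:]) + 1 :: 'k poly"
  have dp: "degree (\<Prod>a\<in>(UNIV :: 'k set). [:- a, 1:]) = card (UNIV :: 'k set)"
    by (subst degree_prod_eq_sum_degree) auto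
  have "card (UNIV :: 'k set) > 0" using fin by (simp add: card_gt_0_iff)
  then have "degree ?p > 0" using dp by (subst degree_add_eq_left) auto
  then obtain x where "poly ?p x = 0" using alg_closed_imp_poly_has_root by blast
  moreover have "poly (\<Prod>a\<in>UNIV. [:- a, 1:]) x = 0"
    using fin by (auto simp: poly_prod prod_zero_iff)
  ultimately show False by simp
qed

lemma topspace_zariski: "rep_space Q d \<subseteq> topspace (zariski Q d :: ('e \<Rightarrow> 'k::field mat) topology)"
proof -
  have "rep_space Q d = rep_space Q d - (zero_locus Q d {\<lambda>P. 1} :: ('e \<Rightarrow> 'k mat) set)"
    by (auto simp: zero_locus_def)
  moreover have "{\<lambda>P. 1} \<subseteq> (poly_funs Q d :: (('e \<Rightarrow> 'k mat) \<Rightarrow> 'k) set)" using poly_funs.const by blast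
  ultimately have "openin (zariski Q d) (rep_space Q d :: ('e \<Rightarrow> 'k mat) set)"
    unfolding openin_zariski by blast
  then show ?thesis by (rule openin_subset)
qed

context balanced_vector
begin

lemma arcs_verts: "e \<in> arcs Q \<Longrightarrow> tail Q e \<in> verts Q \<and> head Q e \<in> verts Q"
  by auto

lemma balanced_point:
  assumes P: "(P :: arrow \<Rightarrow> 'k::field mat) \<in> balanced_locus m r w d"
  shows "balanced_point m r w d P"
proof -
  have P': "P \<in> rep_space Q d" and b: "balanced_rep m r w (matrix_rep d P)"
    using P unfolding balanced_locus_def by auto
  have "balanced_representation m r w d (matrix_rep d P)"
    by (rule balanced_representation.intro[OF weights fd_matrix_rep[OF P'] bal pos b])
  then show ?thesis by (rule balanced_point.intro) (rule balanced_point_axioms.intro[OF P'])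
qed

lemma stable_imp_simple_locus:
  assumes P: "(P :: arrow \<Rightarrow> 'k::field mat) \<in> balanced_locus m r w d"
    and st: "stable_rep Q (theta m w) (matrix_rep d P)"
  shows "P \<in> simple_locus m r w d"
proof -
  interpret bp: balanced_point m r w d P by (rule balanced_point[OF P])
  have fd: "kfd bp.pm.V'" using bp.fd_point_module unfolding fd_left_module_def by blast
  have fdF: "fd_quiver_rep Q bp.pm.F" by (rule bp.pm.fd_functor_F[OF fd])
  have iso: "rep_iso Q (matrix_rep d P) bp.pm.F"
    by (rule rep_iso_sym[OF arcs_verts fdF bp.functor_F_point_module])
  have stF: "stable_rep Q (theta m w) bp.pm.F"
    by (rule stable_rep_iso[OF arcs_verts fd_matrix_rep(1)[OF bp.P] iso st])
  have "carrier (module_vec TYPE('k) (d Sink)) \<noteq> {\<zero>\<^bsub>module_vec TYPE('k) (d Sink)\<^esub>}"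
  proof
    assume "carrier (module_vec TYPE('k) (d Sink)) = {\<zero>\<^bsub>module_vec TYPE('k) (d Sink)\<^esub>}"
    from kdim_zero(2)[OF kvs_module_vec this] show False using pos by (simp only: module_vec_dim(2))
  qed
  then have "carrier bp.point_module \<noteq> {\<zero>\<^bsub>bp.point_module\<^esub>}" by (simp add: bp.point_module_def)
  from bp.pm.stable_simple[OF weights fd stF this]
  have "simple_left_module (free_prod_alg m r w) bp.point_module" .
  then show ?thesis
    unfolding simple_locus_def using P bp.fd_point_module bp.functor_F_point_module by blast
qed

lemma stable_of_generic:
  assumes P: "(P :: arrow \<Rightarrow> 'k::field mat) \<in> balanced_locus m r w d"
    and no: "\<And>W. is_subrep Q (matrix_rep d P) W \<Longrightarrow>
        balanced m r w (\<lambda>v. kdim (module_vec TYPE('k) (d v)\<lparr>carrier := W v\<rparr>)) \<Longrightarrow>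
        W Sink = {0\<^sub>v (d Sink)} \<or> W Sink = carrier_vec (d Sink)"
  shows "stable_rep Q (theta m w) (matrix_rep d P)"
proof -
  interpret bp: balanced_point m r w d P by (rule balanced_point[OF P])
  show ?thesis
  proof (rule bp.stable_of_balanced_subreps)
    fix W assume "is_subrep Q (matrix_rep d P) W" "balanced m r w (bp.sub_dim W)"
    then show "W Sink = {\<zero>\<^bsub>vspace (matrix_rep d P) Sink\<^esub>} \<or> W Sink = carrier (vspace (matrix_rep d P) Sink)"
      using no unfolding matrix_rep_simps vec_space_simps by blast
  qed
qed

definition total_det :: "(arrow \<times> nat \<times> nat \<Rightarrow> 'k::field) \<Rightarrow> 'k" where
  "total_det x = (\<Prod>i\<in>{1..m}. det (total_matrix i x))"

lemma pf_total_det: "(total_det :: _ \<Rightarrow> 'k::field) \<in> polynomial_functions (entries Q d)"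
proof -
  have "(\<lambda>x. \<Prod>i\<in>{1..m}. det (total_matrix i x :: 'k mat)) \<in> polynomial_functions (entries Q d)"
    by (rule pf_prod[OF pf_det_total])
  then show ?thesis unfolding total_det_def[abs_def] .
qed

lemma total_det_nonzero: "\<exists>x. total_det x \<noteq> (0 :: 'k::field)"
proof -
  obtain x :: "arrow \<times> nat \<times> nat \<Rightarrow> 'k" where "\<forall>i\<in>{1..m}. det (total_matrix i x) \<noteq> 0"
    using det_total_nonzero by blast
  then have "total_det x \<noteq> 0" unfolding total_det_def by simp
  then show ?thesis by blast
qed

lemma total_det_balanced:
  fixes P :: "arrow \<Rightarrow> 'k::field mat"
  assumes "P \<in> rep_space Q d" "total_det (entry P) \<noteq> 0"
  shows "P \<in> balanced_locus m r w d"
  by (rule balanced_locusI[OF assms(1)]) (use assms(2) in \<open>auto simp: total_det_def\<close>)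

text \<open>The balanced locus contains the nonvanishing set of the nonzero polynomial \<open>total_det\<close>.\<close>

lemma nonzero_balanced_point:
  assumes inf: "infinite (UNIV :: 'k::field set)"
    and f: "f \<in> polynomial_functions (entries Q d)" "f x \<noteq> (0::'k)"
  shows "\<exists>P\<in>balanced_locus m r w d. f (entry P) \<noteq> 0"
proof -
  obtain y :: "arrow \<times> nat \<times> nat \<Rightarrow> 'k" where y: "total_det y \<noteq> 0" using total_det_nonzero by blast
  obtain z where z: "f z \<noteq> 0" "total_det z \<noteq> 0"
    using pf_common_nonzero[OF inf f pf_total_det y] by blast
  let ?P = "rep_of_entries Q d z"
  have e: "g (entry ?P) = g z" if "g \<in> polynomial_functions (entries Q d)" for g :: "(arrow \<times> nat \<times> nat \<Rightarrow> 'k) \<Rightarrow> 'k"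
    by (rule pf_cong[OF that]) (rule rep_of_entries(2))
  have "total_det (entry ?P) \<noteq> 0" unfolding e[OF pf_total_det] by (rule z(2))
  then have "?P \<in> balanced_locus m r w d" by (rule total_det_balanced[OF rep_of_entries(1)])
  moreover have "f (entry ?P) \<noteq> 0" unfolding e[OF f(1)] by (rule z(1))
  ultimately show ?thesis by blast
qed

lemma generic_simple:
  assumes m: "m \<ge> 1" and inf: "infinite (UNIV :: 'k::field set)"
    and c: "condition_a m r w d \<or> condition_b m r w d \<or> condition_c m r w d"
  shows "\<exists>G\<in>polynomial_functions (entries Q d). (\<exists>x. G x \<noteq> (0::'k)) \<and>
     (\<forall>P\<in>balanced_locus m r w d. G (entry P) \<noteq> 0 \<longrightarrow> stable_rep Q (theta m w) (matrix_rep d P))"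
proof -
  obtain G :: "(arrow \<times> nat \<times> nat \<Rightarrow> 'k) \<Rightarrow> 'k" where G: "G \<in> polynomial_functions (entries Q d)" "\<exists>x. G x \<noteq> 0"
    and gen: "\<forall>P\<in>rep_space Q d. G (entry P) \<noteq> 0 \<longrightarrow> (\<forall>W. is_subrep Q (matrix_rep d P) W \<longrightarrow>
        balanced m r w (\<lambda>v. kdim (module_vec TYPE('k) (d v)\<lparr>carrier := W v\<rparr>)) \<longrightarrow>
        W Sink = {0\<^sub>v (d Sink)} \<or> W Sink = carrier_vec (d Sink))"
    using generic_polynomial[OF inf m c] by (elim bexE conjE)
  show ?thesis
  proof (rule bexI[OF _ G(1)], intro conjI G(2) ballI impI)
    fix P assume P: "P \<in> balanced_locus m r w d" and nz: "G (entry P) \<noteq> 0"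
    then have "P \<in> rep_space Q d" by (simp add: balanced_locus_def)
    from mp[OF bspec[OF gen this] nz] show "stable_rep Q (theta m w) (matrix_rep d P)"
      by (intro stable_of_generic[OF P]) blast
  qed
qed

lemma theta_stableI:
  assumes m: "m \<ge> 1" and inf: "infinite (UNIV :: 'k::field set)"
    and c: "condition_a m r w d \<or> condition_b m r w d \<or> condition_c m r w d"
  shows "theta_stable TYPE('k) m r w d"
proof -
  obtain G :: "(arrow \<times> nat \<times> nat \<Rightarrow> 'k) \<Rightarrow> 'k" and x where G: "G \<in> polynomial_functions (entries Q d)" "G x \<noteq> 0"
    "\<And>P. P \<in> balanced_locus m r w d \<Longrightarrow> G (entry P) \<noteq> 0 \<Longrightarrow> stable_rep Q (theta m w) (matrix_rep d P)"
    using generic_simple[OF m inf c] by blast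
  obtain P where P: "P \<in> balanced_locus m r w d" "G (entry P) \<noteq> 0"
    using nonzero_balanced_point[OF inf G(1,2)] by blast
  have P': "P \<in> rep_space Q d" using P(1) by (simp add: balanced_locus_def)
  show ?thesis
    unfolding stable_dim_vec_def using fd_matrix_rep[OF P'] G(3)[OF P] by blast
qed

text \<open>A nonempty open subset of the balanced locus contains a point where some polynomial \<open>F\<close> does not vanish; then
  \<open>F\<close> and the generic polynomial \<open>G\<close> have a common nonzero value at a balanced point.\<close>

lemma simple_locus_dense:
  assumes m: "m \<ge> 1" and inf: "infinite (UNIV :: 'k::field set)"
    and c: "condition_a m r w d \<or> condition_b m r w d \<or> condition_c m r w d"
  shows "\<exists>U :: (arrow \<Rightarrow> 'k mat) set. U \<subseteq> simple_locus m r w d \<and>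
     openin (subtopology (zariski Q d) (balanced_locus m r w d)) U \<and>
     subtopology (zariski Q d) (balanced_locus m r w d) closure_of U = balanced_locus m r w d"
proof -
  let ?C = "balanced_locus m r w d :: (arrow \<Rightarrow> 'k mat) set"
  let ?T = "subtopology (zariski Q d) ?C"
  obtain G :: "(arrow \<times> nat \<times> nat \<Rightarrow> 'k) \<Rightarrow> 'k" and x where G: "G \<in> polynomial_functions (entries Q d)" "G x \<noteq> 0"
    "\<And>P. P \<in> ?C \<Longrightarrow> G (entry P) \<noteq> 0 \<Longrightarrow> stable_rep Q (theta m w) (matrix_rep d P)"
    using generic_simple[OF m inf c] by blast
  have CR: "?C \<subseteq> rep_space Q d" by (auto simp: balanced_locus_def)
  define U where "U = {P \<in> ?C. G (entry P) \<noteq> 0}"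
  have top: "topspace ?T = ?C"
    using CR topspace_zariski[of Q d] by (auto simp: topspace_subtopology)
  show ?thesis
  proof (intro exI[of _ U] conjI)
    show "U \<subseteq> simple_locus m r w d"
      unfolding U_def using stable_imp_simple_locus[OF _ G(3)] by blast
    have "openin (zariski Q d) (rep_space Q d - zero_locus Q d {\<lambda>P. G (entry P)})"
      unfolding openin_zariski using polynomial_functions_poly_funs[OF G(1)] by blast
    moreover have "U = (rep_space Q d - zero_locus Q d {\<lambda>P. G (entry P)}) \<inter> ?C"
      using CR by (auto simp: U_def zero_locus_def)
    ultimately show "openin ?T U" unfolding openin_subtopology by blast
    have "U \<inter> V \<noteq> {}" if V: "openin ?T V" "V \<noteq> {}" for V
    proof -
      obtain S where S: "S \<subseteq> poly_funs Q d" and VS: "V = (rep_space Q d - zero_locus Q d S) \<inter> ?C"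
        using V(1) unfolding openin_subtopology openin_zariski by blast
      obtain P0 where P0: "P0 \<in> V" using V(2) by blast
      then obtain f where f: "f \<in> S" "f P0 \<noteq> 0" unfolding VS zero_locus_def by blast
      obtain F where F: "F \<in> polynomial_functions (entries Q d)" "\<And>P. f P = F (entry P)"
        using poly_funs_polynomial_functions[of f Q d] S f(1) by blast
      have F0: "F (entry P0) \<noteq> 0" using f(2) F(2) by simp
      obtain z where z: "F z \<noteq> 0" "G z \<noteq> 0" using pf_common_nonzero[OF inf F(1) F0 G(1,2)] by blast
      have "(\<lambda>x. F x * G x) \<in> polynomial_functions (entries Q d)" by (rule pf_mult[OF F(1) G(1)])
      moreover have "F z * G z \<noteq> 0" using z by simp
      ultimately obtain P where P: "P \<in> ?C" "F (entry P) * G (entry P) \<noteq> 0"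
        using nonzero_balanced_point[OF inf, of "\<lambda>x. F x * G x" z] by blast
      have nz: "f P \<noteq> 0" "G (entry P) \<noteq> 0" using P(2) F(2) by auto
      have "P \<in> U" using P(1) nz(2) by (simp add: U_def)
      moreover have "P \<in> V" unfolding VS using P(1) CR nz(1) f(1) by (auto simp: zero_locus_def)
      ultimately show ?thesis by blast
    qed
    then have "?T closure_of U = topspace ?T" unfolding dense_intersects_open by blast
    then show "?T closure_of U = ?C" unfolding top .
  qed
qed

end

lemma has_dim_vec_functor_F_iff:
  fixes M :: "('k::field free_prod_elem, 'x) module"
  assumes weights: "\<And>i j. \<lbrakk>i \<in> {1..m}; j \<in> {1..r i}\<rbrakk> \<Longrightarrow> w i j \<ge> 1"
    and fdM: "fd_left_module (free_prod_alg m r w) M"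
    and dim: "kdim (underlying_vs (free_prod_alg m r w) M) = d Sink"
  shows "has_dim_vec (Gam m r w) (functor_F m r w M) d \<longleftrightarrow>
    (\<forall>i\<in>{1..m}. \<forall>j\<in>{1..r i}. (of_nat (d (Src i j)) :: rat) =
       of_nat (kdim (image_space (free_prod_alg m r w) M (block_one_elem m r w i j))) / of_nat (w i j))"
proof -
  interpret free_product_module m r w M
    by (rule free_product_module.intro) (rule conjunct1[OF fdM[unfolded fd_left_module_def]])
  have fd: "kfd V'" by (rule conjunct2[OF fdM[unfolded fd_left_module_def]])
  have "(of_nat (d (Src i j)) :: rat) = of_nat (kdim (image_space FP M (block_one_elem m r w i j))) / of_nat (w i j)
      \<longleftrightarrow> kdim (vspace F (Src i j)) = d (Src i j)" if ij: "i \<in> {1..m}" "j \<in> {1..r i}" for i j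
    unfolding block_one_dim[OF ij weights[OF ij] fd] using weights[OF ij] by auto
  moreover have "has_dim_vec (Gam m r w) F d \<longleftrightarrow>
      kdim (vspace F Sink) = d Sink \<and> (\<forall>i\<in>{1..m}. \<forall>j\<in>{1..r i}. kdim (vspace F (Src i j)) = d (Src i j))"
    unfolding has_dim_vec_def dim_vec_rep_def by auto
  moreover have "kdim (vspace F Sink) = d Sink" using dim by (simp add: functor_F_simps)
  ultimately show ?thesis by simp
qed

theorem theorem5p1:
  fixes m n :: nat and r :: "nat \<Rightarrow> nat" and w :: "nat \<Rightarrow> nat \<Rightarrow> nat" and d :: "vertex \<Rightarrow> nat"
  assumes "m \<ge> 1"
    and weights: "\<And>i j. \<lbrakk>i \<in> {1..m}; j \<in> {1..r i}\<rbrakk> \<Longrightarrow> w i j \<ge> 1"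
    and not_one_dim: "\<And>i. i \<in> {1..m} \<Longrightarrow>
      vectorspace.dim class_ring
        (factor_alg r w i :: ('k::alg_closed_field, nat \<Rightarrow> 'k mat) module) \<noteq> 1"
    and "n > 0" and "balanced m r w d" and "d Sink = n"
  shows
    \<comment> \<open>\<open>functor_F m r w M\<close> has dimension vector \<open>d\<close> iff \<open>d\<close> is given by the ranks of the central idempotents\<close>
    "(\<forall>M :: ('k free_prod_elem, 'x) module.
        fd_left_module (free_prod_alg m r w) M \<and>
        vectorspace.dim class_ring (underlying_vs (free_prod_alg m r w) M) = n \<longrightarrow>
        (has_dim_vec (Gam m r w) (functor_F m r w M) d \<longleftrightarrow>
         (\<forall>i\<in>{1..m}. \<forall>j\<in>{1..r i}. (of_nat (d (Src i j)) :: rat) =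
            of_nat (vectorspace.dim class_ring
              (image_space (free_prod_alg m r w) M (block_one_elem m r w i j))) /
            of_nat (w i j))))
     \<and>
     (theta_stable TYPE('k) m r w d \<longleftrightarrow>
        condition_a m r w d \<or> condition_b m r w d \<or> condition_c m r w d)
     \<and>
     (\<forall>M :: ('k free_prod_elem, 'x) module.
        fd_left_module (free_prod_alg m r w) M \<and>
        vectorspace.dim class_ring (underlying_vs (free_prod_alg m r w) M) = n \<and>
        has_dim_vec (Gam m r w) (functor_F m r w M) d \<and>
        simple_left_module (free_prod_alg m r w) M \<longrightarrow>
        theta_stable TYPE('k) m r w d \<and>
        (condition_a m r w d \<or> condition_b m r w d \<or> condition_c m r w d))
     \<and>
     (theta_stable TYPE('k) m r w d \<longrightarrow>
        (\<exists>U :: (arrow \<Rightarrow> 'k mat) set.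
           U \<subseteq> simple_locus m r w d \<and>
           openin (subtopology (zariski (Gam m r w) d) (balanced_locus m r w d)) U \<and>
           subtopology (zariski (Gam m r w) d) (balanced_locus m r w d) closure_of U
             = balanced_locus m r w d))"
proof -
  note m = \<open>m \<ge> 1\<close> and bal = \<open>balanced m r w d\<close>
  have pos: "d Sink > 0" using \<open>n > 0\<close> \<open>d Sink = n\<close> by simp
  interpret balanced_vector m r w d by (rule balanced_vector.intro[OF weights bal pos])
  note inf = infinite_alg_closed_field[where 'k = 'k]
  let ?cond = "condition_a m r w d \<or> condition_b m r w d \<or> condition_c m r w d"
  have iff: "theta_stable TYPE('k) m r w d \<longleftrightarrow> ?cond"
  proof
    assume "theta_stable TYPE('k) m r w d"
    then obtain X :: "(vertex, arrow, 'k, 'k vec) quiver_rep" where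
      X: "fd_quiver_rep (Gam m r w) X" "has_dim_vec (Gam m r w) X d" "stable_rep (Gam m r w) (theta m w) X"
      unfolding stable_dim_vec_def by (elim exE conjE)
    show ?cond by (rule stable_conditions[OF m weights bal pos X])
  qed (rule theta_stableI[OF m inf])
  have simple: "?cond" if M: "fd_left_module (free_prod_alg m r w) M" "has_dim_vec (Gam m r w) (functor_F m r w M) d"
      "simple_left_module (free_prod_alg m r w) M" for M :: "('k free_prod_elem, 'x) module"
  proof -
    interpret fm: free_product_module m r w M
      by (rule free_product_module.intro) (rule conjunct1[OF M(1)[unfolded fd_left_module_def]])
    have fd: "kfd fm.V'" by (rule conjunct2[OF M(1)[unfolded fd_left_module_def]])
    show ?thesis
      by (rule stable_conditions[OF m weights bal pos fm.fd_functor_F[OF fd] M(2)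
            fm.simple_stable[OF weights fd M(3,2) bal pos]])
  qed
  show ?thesis
  proof (intro conjI allI impI iff)
    fix M :: "('k free_prod_elem, 'x) module"
    assume "fd_left_module (free_prod_alg m r w) M \<and> kdim (underlying_vs (free_prod_alg m r w) M) = n"
    then show "has_dim_vec (Gam m r w) (functor_F m r w M) d \<longleftrightarrow>
      (\<forall>i\<in>{1..m}. \<forall>j\<in>{1..r i}. (of_nat (d (Src i j)) :: rat) =
       of_nat (kdim (image_space (free_prod_alg m r w) M (block_one_elem m r w i j))) / of_nat (w i j))"
      using \<open>d Sink = n\<close> by (intro has_dim_vec_functor_F_iff[OF weights]) auto
  next
    fix M :: "('k free_prod_elem, 'x) module"
    assume M: "fd_left_module (free_prod_alg m r w) M \<and> kdim (underlying_vs (free_prod_alg m r w) M) = n \<and>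
      has_dim_vec (Gam m r w) (functor_F m r w M) d \<and> simple_left_module (free_prod_alg m r w) M"
    show c: "?cond" using simple M by blast
    show "theta_stable TYPE('k) m r w d" by (rule iffD2[OF iff c])
  next
    assume "theta_stable TYPE('k) m r w d"
    from iffD1[OF iff this] show "\<exists>U :: (arrow \<Rightarrow> 'k mat) set. U \<subseteq> simple_locus m r w d \<and>
       openin (subtopology (zariski (Gam m r w) d) (balanced_locus m r w d)) U \<and>
       subtopology (zariski (Gam m r w) d) (balanced_locus m r w d) closure_of U = balanced_locus m r w d"
      by (rule simple_locus_dense[OF m inf])
  qed
qed

end
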